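(* Let $1\le p_0<q_0\le\infty$ and $k\in\mathbb{N}$. Suppose that $T$ is a sublinear operator bounded on $L^{p_0}$ and that $\{\mathcal{A}_r\}_{r>0}$ is a family of operators acting from $L^\infty_c$ into $L^{p_0}$. Assume that, for a constant $C$ and non-negative numbers $\alpha_j$, $j\ge1$, $$\Big(\frac1{|B|}\int_B|T(I-\mathcal{A}_{r(B)})f|^{p_0}\Big)^{1/p_0}\le C\sum_{j=1}^\infty\alpha_j\Big(\frac1{|2^{j+1}B|}\int_{2^{j+1}B}|f|^{p_0}\Big)^{1/p_0}$$ and $$\Big(\frac1{|B|}\int_B|T\mathcal{A}_{r(B)}f|^{q_0}\Big)^{1/q_0}\le\sum_{j=1}^\infty\alpha_j\Big(\frac1{|2^{j+1}B|}\int_{2^{j+1}B}|Tf|^{p_0}\Big)^{1/p_0}$$ for all $f\in L^\infty_c$ and all balls $B$, where $r(B)$ denotes the radius of $B$. Let $p_0<p<q_0$ and $w\in A_{p/p_0}\cap RH_{(q_0/p)'}$. If $\sum_j\alpha_j\,j^k<\infty$, then there is a constant $C$ such that for all $f\in L^\infty_c$ and all $b\in\mathrm{BMO}$, $$\|T_b^kf\|_{L^p(w)}\le C\,\|b\|_{\mathrm{BMO}}^k\,\|f\|_{L^p(w)}.$$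
   Context: The setting is $\mathbb{R}^n$ with Lebesgue measure. $\mathbb{N}$ includes $0$. $L^\infty_c$ is the space of bounded functions with compact support. $T$ is sublinear if $|T(f+g)|\le|Tf|+|Tg|$ and $|T(\lambda f)|=|\lambda||Tf|$. $\lambda B$ is the ball concentric with $B$ with radius $\lambda r(B)$. $\mathrm{BMO}$ consists of $b$ with $\|b\|_{\mathrm{BMO}}=\sup_B\frac1{|B|}\int_B|b-b_B|<\infty$, $b_B$ being the average of $b$ on the ball $B$. The $k$-th order commutator is $T_b^kf(x)=T\big((b(x)-b)^kf\big)(x)$ for $f\in L^\infty_c$, $x\in\mathbb{R}^n$ (so $T_b^0=T$; for linear $T$, $T_b^1f=b\,Tf-T(bf)$ and $T_b^k=[b,T_b^{k-1}]$). If $q_0=\infty$, the $L^{q_0}$-average is the essential supremum over $B$. Weights: a weight $w$ is a non-negative locally integrable function, $L^p(w)=L^p(w\,dx)$. For $1<t<\infty$: $w\in A_t$ if $\big(\frac1{|B|}\int_Bw\big)\big(\frac1{|B|}\int_Bw^{1-t'}\big)^{t-1}\le C$ for all balls $B$; $w\in RH_t$ if $\big(\frac1{|B|}\int_Bw^t\big)^{1/t}\le C\frac1{|B|}\int_Bw$ for all balls $B$; $RH_1$ is the class of all weights. Primes denote conjugate exponents, with $(q_0/p)'=1$ if $q_0=\infty$. *)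

theory Defs
  imports "HOL-Probability.Essential_Supremum"
begin

text \<open>
  Scalars are a type of sort \<open>{real_normed_field, euclidean_space}\<close>, so that the real and the
  complex case are both covered. Operators act on functions, not on equivalence classes.
\<close>

text \<open>Real powers on \<open>[0,\<infinity>]\<close>; the library's \<open>powr\<close> has \<open>0 powr a = 0\<close> for negative \<open>a\<close> too,
  where the value \<open>\<infinity>\<close> is needed for the dual weight in the Muckenhoupt condition.\<close>

definition epowr :: "ennreal \<Rightarrow> real \<Rightarrow> ennreal" where
  "epowr x a =
    (if a = 0 then 1
     else if x = 0 then (if a < 0 then \<infinity> else 0)
     else if x = \<infinity> then (if a < 0 then 0 else \<infinity>)
     else ennreal (enn2real x powr a))"

definition eLp_norm :: "'a measure \<Rightarrow> ennreal \<Rightarrow> ('a \<Rightarrow> 'b::real_normed_vector) \<Rightarrow> ennreal" where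
  "eLp_norm M q f =
    (if q = \<infinity> then esssup M (\<lambda>x. ennreal (norm (f x)))
     else epowr (\<integral>\<^sup>+x. epowr (ennreal (norm (f x))) (enn2real q) \<partial>M) (1 / enn2real q))"

definition Lp_space :: "real \<Rightarrow> ('a::euclidean_space \<Rightarrow> 'b::real_normed_vector) set" where
  "Lp_space p = {f \<in> borel_measurable lebesgue. eLp_norm lebesgue (ennreal p) f < \<infinity>}"

definition Linf_c :: "('a::euclidean_space \<Rightarrow> 'b::real_normed_vector) set" where
  "Linf_c = {f \<in> borel_measurable lebesgue.
     bounded (range f) \<and> (\<exists>K. compact K \<and> (\<forall>x. x \<notin> K \<longrightarrow> f x = 0))}"

definition locally_integrable :: "('a::euclidean_space \<Rightarrow> 'b::{banach, second_countable_topology}) \<Rightarrow> bool" where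
  "locally_integrable f \<longleftrightarrow> (\<forall>K. compact K \<longrightarrow> set_integrable lebesgue K f)"

text \<open>Normalized Lebesgue measure on a ball: integrals against it are averages over the ball, and
  \<open>eLp_norm (ball_measure x r) q f\<close> is the \<open>L\<^sup>q\<close>-average of \<open>f\<close> on the ball (the
  essential supremum over the ball if \<open>q = \<infinity>\<close>).\<close>

abbreviation ball_measure :: "'a::euclidean_space \<Rightarrow> real \<Rightarrow> 'a measure" where
  "ball_measure x r \<equiv> uniform_measure lebesgue (ball x r)"

definition weight :: "('a::euclidean_space \<Rightarrow> real) \<Rightarrow> bool" where
  "weight w \<longleftrightarrow> (\<forall>x. 0 \<le> w x) \<and> locally_integrable w"

definition weighted_measure :: "('a::euclidean_space \<Rightarrow> real) \<Rightarrow> 'a measure" where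
  "weighted_measure w = density lebesgue (\<lambda>x. ennreal (w x))"

definition conj_exponent :: "real \<Rightarrow> real" where
  "conj_exponent t = t / (t - 1)"

text \<open>With the library convention \<open>0 * \<infinity> = 0\<close>, a weight in this class is positive
  almost everywhere unless it vanishes almost everywhere.\<close>

definition muckenhoupt :: "real \<Rightarrow> ('a::euclidean_space \<Rightarrow> real) \<Rightarrow> bool" where
  "muckenhoupt t w \<longleftrightarrow> weight w \<and>
    (\<exists>C::real. \<forall>x. \<forall>r>0.
       (\<integral>\<^sup>+y. ennreal (w y) \<partial>ball_measure x r) *
       epowr (\<integral>\<^sup>+y. epowr (ennreal (w y)) (1 - conj_exponent t) \<partial>ball_measure x r) (t - 1)
       \<le> ennreal C)"

definition reverse_hoelder :: "real \<Rightarrow> ('a::euclidean_space \<Rightarrow> real) \<Rightarrow> bool" where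
  "reverse_hoelder t w \<longleftrightarrow> weight w \<and>
    (t = 1 \<or>
     (\<exists>C::real. \<forall>x. \<forall>r>0.
       epowr (\<integral>\<^sup>+y. epowr (ennreal (w y)) t \<partial>ball_measure x r) (1 / t)
       \<le> ennreal C * (\<integral>\<^sup>+y. ennreal (w y) \<partial>ball_measure x r)))"

text \<open>The exponent \<open>(q\<^sub>0/p)'\<close>, with value \<open>1\<close> if \<open>q\<^sub>0 = \<infinity>\<close>.\<close>

definition conj_quotient :: "ennreal \<Rightarrow> real \<Rightarrow> real" where
  "conj_quotient q0 p = (if q0 = \<infinity> then 1 else conj_exponent (enn2real q0 / p))"

definition ball_average :: "('a::euclidean_space \<Rightarrow> 'b::{banach, second_countable_topology}) \<Rightarrow> 'a \<Rightarrow> real \<Rightarrow> 'b" where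
  "ball_average b x r = (LINT y|ball_measure x r. b y)"

definition mean_oscillation :: "('a::euclidean_space \<Rightarrow> 'b::{banach, second_countable_topology}) \<Rightarrow> 'a \<Rightarrow> real \<Rightarrow> real" where
  "mean_oscillation b x r = (LINT y|ball_measure x r. norm (b y - ball_average b x r))"

definition BMO :: "('a::euclidean_space \<Rightarrow> 'b::{banach, second_countable_topology}) set" where
  "BMO = {b. locally_integrable b \<and>
     bdd_above ((\<lambda>(x, r). mean_oscillation b x r) ` (UNIV \<times> {0<..}))}"

definition BMO_norm :: "('a::euclidean_space \<Rightarrow> 'b::{banach, second_countable_topology}) \<Rightarrow> real" where
  "BMO_norm b = (SUP (x, r)\<in>UNIV \<times> {0<..}. mean_oscillation b x r)"

text \<open>The exceptional null set does not depend on the functions involved: the commutator evaluates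
  \<open>T\<close> at each point \<open>x\<close> on a function that itself depends on \<open>x\<close>, so a null set
  depending on the functions would leave its values arbitrary.\<close>

definition sublinear_op_on ::
  "('a::euclidean_space \<Rightarrow> 'b::real_normed_field) set \<Rightarrow> (('a \<Rightarrow> 'b) \<Rightarrow> ('a \<Rightarrow> 'b)) \<Rightarrow> bool" where
  "sublinear_op_on S T \<longleftrightarrow>
    (AE x in lebesgue.
      (\<forall>f\<in>S. \<forall>g\<in>S. norm (T (\<lambda>y. f y + g y) x) \<le> norm (T f x) + norm (T g x)) \<and>
      (\<forall>f\<in>S. \<forall>c. norm (T (\<lambda>y. c * f y) x) = norm c * norm (T f x)))"

definition bounded_on_Lp ::
  "real \<Rightarrow> (('a::euclidean_space \<Rightarrow> 'b::real_normed_vector) \<Rightarrow> ('a \<Rightarrow> 'b)) \<Rightarrow> bool" where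
  "bounded_on_Lp p T \<longleftrightarrow>
    (\<forall>f\<in>Lp_space p. T f \<in> Lp_space p) \<and>
    (\<exists>K::real. \<forall>f\<in>Lp_space p.
       eLp_norm lebesgue (ennreal p) (T f) \<le> ennreal K * eLp_norm lebesgue (ennreal p) f)"

definition commutator ::
  "(('a \<Rightarrow> 'b::comm_ring_1) \<Rightarrow> ('a \<Rightarrow> 'b)) \<Rightarrow> nat \<Rightarrow> ('a \<Rightarrow> 'b) \<Rightarrow> ('a \<Rightarrow> 'b) \<Rightarrow> ('a \<Rightarrow> 'b)" where
  "commutator T k b f = (\<lambda>x. T (\<lambda>y. (b x - b y) ^ k * f y) x)"

end

theory Submission
  imports Defs "HOL-Probability.Probability_Measure"
begin

text \<open>
  Put \<open>F = |T\<^sub>b\<^sup>k f|\<^bsup>p0\<^esup>\<close>. On a ball \<open>B\<close> expand \<open>(b(x) - b(y))\<^sup>k\<close> around the average \<open>b\<^sub>B\<close>: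
  the terms of order below \<open>k\<close> are controlled by lower-order commutators, and the remaining one is \<open>T\<close>
  applied to \<open>h = (b\<^sub>B - b)\<^sup>k f\<close>, split as \<open>T(I - A\<^sub>r)h + T A\<^sub>r h\<close>. The two hypotheses and the
  John--Nirenberg inequality, which costs a factor \<open>j\<^sup>k\<close> on \<open>2\<^sup>j B\<close>, bound \<open>F \<le> U + V\<close>
  on \<open>B\<close> with the average of \<open>U\<close> at most \<open>G\<close> and the \<open>q\<^sub>0/p\<^sub>0\<close>-average of \<open>V\<close> at most \<open>MF + G\<close>,
  where \<open>M\<close> is the maximal function and \<open>G\<close> is built from \<open>f\<close> and commutators of lower order. A
  good-\<open>\<lambda>\<close> argument then gives \<open>\<parallel>MF\<parallel> \<le> C \<parallel>G\<parallel>\<close> in \<open>L\<^bsup>p/p0\<^esup>(w)\<close>, and induction on \<open>k\<close> concludes.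
  The weight enters through \<open>w\<^sup>u \<in> A\<^sub>s\<close> with \<open>u = (q\<^sub>0/p)'\<close> and \<open>s = u(p/p\<^sub>0 - 1) + 1\<close>. Unbounded \<open>b\<close>
  and \<open>w\<close> are reached by truncation and Fatou's lemma. For \<open>q\<^sub>0 = \<infinity>\<close> the exponent may
  be replaced by a large finite one, because \<open>w \<in> A\<^sub>\<infinity>\<close>.
\<close>

section \<open>Powers of extended non-negative reals\<close>

text \<open>All exponents meet in the condition \<open>t < q0 / p0 * \<theta>\<close> of the
  good-lambda step, where t = p/p0 and a set filling a share e of a ball has at most C e^\<theta> of
  its w-mass. For finite q0, Hoelder's inequality with the reverse Hoelder exponent u gives only
  \<theta> = 1 - 1/u = p/q0, that is, equality. The self-improving reverse Hoelder inequality of w^u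
  supplies the strict inequality that makes the error absorbable. T is evaluated at x on a function
  that depends on x. Pointwise arguments are therefore made at points x where |T g(x)| is a seminorm
  in g, and even the measurability of the commutator has to be proved. Powers of b - b_B cost a
  little integrability. Hence G is built from M(H^\<kappa>)^(1/\<kappa>) with \<kappa> > 1, which is
  bounded on L^t(w) because the A_t condition is open in t. Absorption is legitimate only for finite
  quantities, so it is done for bounded b and for weights bounded above and below. The constants are
  fixed before these objects and are independent of their bounds; this is what lets them survive the
  limits.\<close>

lemma epowr_ennreal: "0 < a \<Longrightarrow> 0 \<le> x \<Longrightarrow> epowr (ennreal x) a = ennreal (x powr a)"
  by (auto simp: epowr_def)

lemma epowr_ennreal_pos: "0 < x \<Longrightarrow> epowr (ennreal x) a = ennreal (x powr a)"
  by (auto simp: epowr_def)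

lemma epowr_zero_left [simp]: "0 < a \<Longrightarrow> epowr 0 a = 0"
  and epowr_top_left [simp]: "0 < a \<Longrightarrow> epowr top a = top"
  and epowr_zero_right [simp]: "epowr x 0 = 1"
  and epowr_one_left [simp]: "epowr 1 a = 1"
  by (auto simp: epowr_def)

lemma epowr_one_right [simp]: "epowr x 1 = x"
  by (cases x) (auto simp: epowr_def)

lemma epowr_mono: "0 \<le> a \<Longrightarrow> x \<le> y \<Longrightarrow> epowr x a \<le> epowr y a"
  by (cases "a = 0"; cases x; cases y) (auto simp: epowr_ennreal powr_mono2 top_unique ennreal_leI epowr_def)

lemma epowr_mult: "0 \<le> a \<Longrightarrow> epowr (x * y) a = epowr x a * epowr y a"
proof (cases "a = 0")
  case False
  moreover assume "0 \<le> a"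
  ultimately have "0 < a" by simp
  then show ?thesis
    by (cases x; cases y)
      (auto simp: epowr_ennreal ennreal_mult[symmetric] powr_mult ennreal_top_mult ennreal_mult_top)
qed simp

lemma epowr_epowr: "0 < a \<Longrightarrow> 0 < b \<Longrightarrow> epowr (epowr x a) b = epowr x (a * b)"
  by (cases x) (auto simp: epowr_def powr_powr mult_less_0_iff)

lemma epowr_add: "0 \<le> a \<Longrightarrow> 0 \<le> b \<Longrightarrow> epowr x (a + b) = epowr x a * epowr x b"
  by (cases x) (auto simp: epowr_def powr_add ennreal_mult[symmetric] ennreal_top_mult ennreal_mult_top)

lemma epowr_eq_0_iff [simp]: "0 < a \<Longrightarrow> epowr x a = 0 \<longleftrightarrow> x = 0"
  by (cases x) (auto simp: epowr_def)

lemma epowr_eq_top_iff [simp]: "0 < a \<Longrightarrow> epowr x a = top \<longleftrightarrow> x = top"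
  by (cases x) (auto simp: epowr_def)

lemma epowr_less_top: "0 < a \<Longrightarrow> x < top \<Longrightarrow> epowr x a < top"
  by (simp add: less_top[symmetric])

lemma epowr_inv: "0 < a \<Longrightarrow> epowr (epowr x a) (1/a) = x"
  and epowr_inv': "0 < a \<Longrightarrow> epowr (epowr x (1/a)) a = x"
  by (simp_all add: epowr_epowr)

lemma epowr_le_iff:
  assumes "0 < a" shows "epowr x a \<le> epowr y a \<longleftrightarrow> x \<le> y"
proof
  assume "epowr x a \<le> epowr y a"
  then have "epowr (epowr x a) (1/a) \<le> epowr (epowr y a) (1/a)"
    using assms by (rule_tac epowr_mono) auto
  then show "x \<le> y" by (simp only: epowr_inv[OF assms])
qed (use assms in \<open>auto intro: epowr_mono\<close>)

lemma epowr_less_iff: "0 < a \<Longrightarrow> epowr x a < epowr y a \<longleftrightarrow> x < y"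
  by (simp add: epowr_le_iff less_le_not_le)

lemma le_epowrI: "0 < a \<Longrightarrow> epowr x a \<le> y \<Longrightarrow> x \<le> epowr y (1/a)"
  using epowr_mono[of "1/a" "epowr x a" y] by (simp add: epowr_inv)

lemma epowr_leI: "0 < a \<Longrightarrow> x \<le> epowr y (1/a) \<Longrightarrow> epowr x a \<le> y"
  using epowr_mono[of a x "epowr y (1/a)"] by (simp add: epowr_inv')

lemma epowr_measurable [measurable]:
  assumes [measurable]: "f \<in> borel_measurable M"
  shows "(\<lambda>x. epowr (f x) a) \<in> borel_measurable M"
  unfolding epowr_def by measurable

lemma epowr_sup_le: "0 \<le> a \<Longrightarrow> epowr (max x y) a \<le> epowr x a + epowr y a"
  by (simp add: max_def add_increasing add_increasing2)

lemma epowr_add_le: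
  assumes "0 \<le> a" shows "epowr (x + y) a \<le> ennreal (2 powr a) * (epowr x a + epowr y a)"
proof -
  have "x + y \<le> 2 * max x y"
    unfolding mult_2 by (intro add_mono) auto
  then have "epowr (x + y) a \<le> epowr (2 * max x y) a" by (rule epowr_mono[OF assms])
  also have "\<dots> = ennreal (2 powr a) * epowr (max x y) a"
    using epowr_ennreal_pos[of 2 a] by (simp add: epowr_mult assms)
  also have "\<dots> \<le> ennreal (2 powr a) * (epowr x a + epowr y a)"
    by (intro mult_left_mono epowr_sup_le assms) auto
  finally show ?thesis .
qed

text \<open>The sum is at most \<open>card I\<close> times its largest term. The argument does not
  rest on convexity and so covers exponents below 1 as well.\<close>

lemma epowr_sum_le:
  assumes "0 \<le> a" "finite I" "I \<noteq> {}"
  shows "epowr (\<Sum>i\<in>I. x i) a \<le> ennreal (real (card I) powr a) * (\<Sum>i\<in>I. epowr (x i) a)"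
proof -
  obtain j where j: "j \<in> I" "\<And>i. i \<in> I \<Longrightarrow> x i \<le> x j"
    using Max_in[of "x ` I"] Max_ge[of "x ` I"] assms(2,3) by fastforce
  have c: "card I > 0" using assms by (simp add: card_gt_0_iff)
  have "(\<Sum>i\<in>I. x i) \<le> of_nat (card I) * x j" by (rule sum_bounded_above) (rule j)
  then have "epowr (\<Sum>i\<in>I. x i) a \<le> epowr (ennreal (card I) * x j) a"
    by (intro epowr_mono assms) (simp add: ennreal_of_nat_eq_real_of_nat)
  also have "\<dots> = ennreal (real (card I) powr a) * epowr (x j) a"
    using c by (simp add: epowr_mult assms epowr_ennreal_pos)
  also have "\<dots> \<le> ennreal (real (card I) powr a) * (\<Sum>i\<in>I. epowr (x i) a)"
    by (intro mult_left_mono member_le_sum j assms) auto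
  finally show ?thesis .
qed

section \<open>The inequalities of Young, Hoelder and Jensen\<close>

lemma weighted_am_gm_ennreal:
  assumes "0 < \<theta>" "\<theta> < 1"
  shows "epowr x \<theta> * epowr y (1 - \<theta>) \<le> ennreal \<theta> * x + ennreal (1 - \<theta>) * y"
proof (cases "x = 0 \<or> y = 0 \<or> x = top \<or> y = top")
  case True
  then show ?thesis using assms by (auto simp: ennreal_mult_top)
next
  case False
  then obtain u v where uv: "x = ennreal u" "y = ennreal v" "0 < u" "0 < v"
    by (cases x; cases y) auto
  have "u powr \<theta> * v powr (1 - \<theta>) \<le> \<theta> * u + (1 - \<theta>) * v"
    using Youngs_inequality_0[of \<theta> "1 - \<theta>" u v] assms uv by auto
  then show ?thesis using uv assms
    by (simp add: epowr_ennreal_pos ennreal_mult[symmetric] ennreal_plus[symmetric] ennreal_leI del: ennreal_plus)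
qed

text \<open>The exponents \<open>1/\<theta>\<close> and \<open>1/(1 - \<theta>)\<close> are conjugate.\<close>

lemma hoelder_nn_integral:
  assumes [measurable]: "f \<in> borel_measurable M" "g \<in> borel_measurable M"
    and \<theta>: "0 < \<theta>" "\<theta> < 1"
  shows "(\<integral>\<^sup>+x. epowr (f x) \<theta> * epowr (g x) (1 - \<theta>) \<partial>M)
    \<le> epowr (\<integral>\<^sup>+x. f x \<partial>M) \<theta> * epowr (\<integral>\<^sup>+x. g x \<partial>M) (1 - \<theta>)"
proof -
  let ?A = "\<integral>\<^sup>+x. f x \<partial>M" and ?B = "\<integral>\<^sup>+x. g x \<partial>M"
  consider "?A = 0 \<or> ?B = 0" | "?A \<noteq> 0" "?B \<noteq> 0" "?A = top \<or> ?B = top"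
    | a b where "?A = ennreal a" "?B = ennreal b" "0 < a" "0 < b"
    by (cases "?A"; cases "?B") (auto simp: less_eq_real_def)
  then show ?thesis
  proof cases
    case 1
    \<comment> \<open>The right-hand side is 0 here even if the other integral is infinite, so the
      integrand itself must vanish almost everywhere.\<close>
    then have "AE x in M. f x = 0 \<or> g x = 0"
      by (auto simp: nn_integral_0_iff_AE)
    then have "(\<integral>\<^sup>+x. epowr (f x) \<theta> * epowr (g x) (1 - \<theta>) \<partial>M) = 0"
      using \<theta> by (subst nn_integral_0_iff_AE) auto
    then show ?thesis by simp
  next
    case 2
    then show ?thesis using \<theta> by (auto simp: ennreal_mult_top ennreal_top_mult)
  next
    case 3
    \<comment> \<open>Young's inequality is applied to f/a and g/b, which have integral 1;
      \<open>?c\<close> undoes this normalisation.\<close>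
    let ?c = "ennreal (a powr \<theta> * b powr (1 - \<theta>))"
    have *: "epowr (f x) \<theta> * epowr (g x) (1 - \<theta>) \<le>
       ?c * (ennreal (\<theta> / a) * f x + ennreal ((1 - \<theta>) / b) * g x)" for x
    proof -
      define u v where "u = ennreal (1/a) * f x" and "v = ennreal (1/b) * g x"
      have "f x = ennreal a * u" "g x = ennreal b * v"
        using 3 by (simp_all add: u_def v_def mult.assoc[symmetric] ennreal_mult[symmetric])
      then have "epowr (f x) \<theta> * epowr (g x) (1 - \<theta>) = ?c * (epowr u \<theta> * epowr v (1 - \<theta>))"
        using \<theta> 3 by (simp add: epowr_mult epowr_ennreal_pos ennreal_mult ac_simps)
      also have "\<dots> = ?c * (epowr (ennreal (1/a) * f x) \<theta> * epowr (ennreal (1/b) * g x) (1 - \<theta>))"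
        by (simp add: u_def v_def)
      also have "\<dots> \<le> ?c * (ennreal \<theta> * (ennreal (1/a) * f x) + ennreal (1 - \<theta>) * (ennreal (1/b) * g x))"
        by (intro mult_left_mono weighted_am_gm_ennreal \<theta>) auto
      also have "\<dots> = ?c * (ennreal (\<theta> / a) * f x + ennreal ((1 - \<theta>) / b) * g x)"
        using \<theta> 3 by (simp add: mult.assoc[symmetric] ennreal_mult[symmetric])
      finally show ?thesis .
    qed
    have "(\<integral>\<^sup>+x. epowr (f x) \<theta> * epowr (g x) (1 - \<theta>) \<partial>M)
      \<le> (\<integral>\<^sup>+x. ?c * (ennreal (\<theta> / a) * f x + ennreal ((1 - \<theta>) / b) * g x) \<partial>M)"
      by (intro nn_integral_mono *)
    also have "\<dots> = ?c * (ennreal (\<theta> / a) * ?A + ennreal ((1 - \<theta>) / b) * ?B)"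
      by (simp add: nn_integral_cmult nn_integral_add)
    also have "ennreal (\<theta> / a) * ?A + ennreal ((1 - \<theta>) / b) * ?B = ennreal \<theta> + ennreal (1 - \<theta>)"
      unfolding 3(1,2) using 3(3,4) \<theta> by (simp add: ennreal_mult[symmetric])
    also have "\<dots> = 1" using \<theta> by (simp add: ennreal_plus[symmetric] del: ennreal_plus)
    also have "?c * 1 = epowr ?A \<theta> * epowr ?B (1 - \<theta>)"
      unfolding 3(1,2) using 3(3,4) by (simp add: epowr_ennreal_pos ennreal_mult)
    finally show ?thesis .
  qed
qed

text \<open>Hoelder's inequality against the constant 1, whose integral is 1 on a probability
  space.\<close>

lemma (in prob_space) nn_integral_le_epowr:
  assumes [measurable]: "f \<in> borel_measurable M" and a: "1 \<le> a"
  shows "(\<integral>\<^sup>+x. f x \<partial>M) \<le> epowr (\<integral>\<^sup>+x. epowr (f x) a \<partial>M) (1/a)"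
proof (cases "a = 1")
  case False
  with a have a: "1 < a" by simp
  have "(\<integral>\<^sup>+x. f x \<partial>M) = (\<integral>\<^sup>+x. epowr (epowr (f x) a) (1/a) * epowr 1 (1 - 1/a) \<partial>M)"
    using a by (intro nn_integral_cong) (simp add: epowr_inv)
  also have "\<dots> \<le> epowr (\<integral>\<^sup>+x. epowr (f x) a \<partial>M) (1/a) * epowr (\<integral>\<^sup>+x. 1 \<partial>M) (1 - 1/a)"
    using a by (intro hoelder_nn_integral) auto
  finally show ?thesis by (simp add: emeasure_space_1)
qed simp

section \<open>The layer-cake formula\<close>

lemma nn_integral_powr_Ioo:
  assumes "0 < a"
  shows "(\<integral>\<^sup>+l. ennreal (a * l powr (a - 1)) * indicator {0<..<R} l \<partial>lborel) = ennreal (if 0 < R then R powr a else 0)"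
proof (cases "0 < R")
  case True
  have "((\<lambda>l. a * l powr (a - 1)) has_integral (a * (R powr (a - 1 + 1) / (a - 1 + 1)))) {0..R}"
    using True assms by (intro has_integral_mult_right has_integral_powr_from_0) auto
  then have h: "((\<lambda>l. a * l powr (a - 1)) has_integral (R powr a)) {0<..<R}"
    using assms by (simp add: has_integral_Icc_iff_Ioo)
  have "(\<integral>\<^sup>+l. ennreal (a * l powr (a - 1)) * indicator {0<..<R} l \<partial>lborel)
     = (\<integral>\<^sup>+l. ennreal ((a * l powr (a - 1)) * indicator {0<..<R} l) \<partial>lborel)"
    by (intro nn_integral_cong) (auto split: split_indicator)
  also have "\<dots> = ennreal (R powr a)"
  proof (intro nn_integral_has_integral_lborel)
    have "(\<lambda>l. (a * l powr (a - 1)) * indicator {0<..<R} l) = (\<lambda>l. if l \<in> {0<..<R} then a * l powr (a - 1) else 0)"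
      by auto
    then show "((\<lambda>l. (a * l powr (a - 1)) * indicator {0<..<R} l) has_integral R powr a) UNIV"
      using h by (simp only: has_integral_restrict_UNIV)
  qed (use assms in auto)
  finally show ?thesis using True by simp
qed simp

text \<open>\<open>ennreal l\<close> is 0 for negative l, so the set of l with
  \<open>ennreal l < y\<close> contains the negative half-line as soon as y > 0; the factor
  \<open>indicator {0<..}\<close> removes it. For infinite y, the integrals over bounded intervals
  already reach every real number.\<close>

lemma nn_integral_powr_layer:
  assumes a: "0 < a"
  shows "(\<integral>\<^sup>+l. ennreal (a * l powr (a - 1)) * indicator {0<..} l * indicator {l. ennreal l < y} l \<partial>lborel) = epowr y a"
proof (cases y)
  case (real r)
  then have "(\<integral>\<^sup>+l. ennreal (a * l powr (a - 1)) * indicator {0<..} l * indicator {l. ennreal l < y} l \<partial>lborel)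
     = (\<integral>\<^sup>+l. ennreal (a * l powr (a - 1)) * indicator {0<..<r} l \<partial>lborel)"
    by (intro nn_integral_cong) (auto split: split_indicator simp: ennreal_less_iff)
  then show ?thesis using real a by (auto simp: nn_integral_powr_Ioo epowr_ennreal not_less)
next
  case top
  have le: "ennreal r \<le> (\<integral>\<^sup>+l. ennreal (a * l powr (a - 1)) * indicator {0<..} l * indicator {l. ennreal l < y} l \<partial>lborel)"
    (is "_ \<le> ?I") if "0 < r" for r
  proof -
    have "ennreal r = (\<integral>\<^sup>+l. ennreal (a * l powr (a - 1)) * indicator {0<..<r powr (1/a)} l \<partial>lborel)"
      using a that by (simp add: nn_integral_powr_Ioo powr_powr)
    also have "\<dots> \<le> ?I"
      using top by (intro nn_integral_mono) (auto split: split_indicator)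
    finally show ?thesis .
  qed
  have "?I = top"
  proof (rule ccontr)
    assume "?I \<noteq> top"
    then obtain u where "?I = ennreal u" "0 \<le> u" by (cases ?I) auto
    with le[of "u + 1"] show False by (simp add: ennreal_le_iff)
  qed
  then show ?thesis using top a by (simp add: top_unique)
qed

text \<open>Tonelli's theorem on the region 0 < l < g(x). The factor h allows weights and
  restrictions to a ball without a change of the underlying measure.\<close>

lemma layer_cake:
  assumes [measurable]: "g \<in> borel_measurable M" "h \<in> borel_measurable M" and "sigma_finite_measure M" and a: "0 < a"
  shows "(\<integral>\<^sup>+x. h x * epowr (g x) a \<partial>M) =
    (\<integral>\<^sup>+l. ennreal (a * l powr (a - 1)) * indicator {0<..} l * (\<integral>\<^sup>+x. h x * indicator {x. ennreal l < g x} x \<partial>M) \<partial>lborel)"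
proof -
  interpret sigma_finite_measure M by fact
  interpret pair_sigma_finite M "lborel :: real measure" ..
  have "(\<integral>\<^sup>+x. h x * epowr (g x) a \<partial>M) = (\<integral>\<^sup>+x. (\<integral>\<^sup>+l. h x * (ennreal (a * l powr (a - 1)) * indicator {0<..} l * indicator {l. ennreal l < g x} l) \<partial>lborel) \<partial>M)"
    by (intro nn_integral_cong, subst nn_integral_cmult) (simp_all add: nn_integral_powr_layer a)
  also have "\<dots> = (\<integral>\<^sup>+l. (\<integral>\<^sup>+x. h x * (ennreal (a * l powr (a - 1)) * indicator {0<..} l * indicator {l. ennreal l < g x} l) \<partial>M) \<partial>lborel)"
    by (subst Fubini') (simp_all add: indicator_def)
  also have "\<dots> = (\<integral>\<^sup>+l. ennreal (a * l powr (a - 1)) * indicator {0<..} l * (\<integral>\<^sup>+x. h x * indicator {x. ennreal l < g x} x \<partial>M) \<partial>lborel)"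
    by (intro nn_integral_cong, subst nn_integral_cmult[symmetric]) (auto intro!: nn_integral_cong simp: indicator_def mult.commute)
  finally show ?thesis .
qed

section \<open>The Hardy--Littlewood maximal function\<close>

declare emeasure_completion [simp del]

section \<open>Volumes of balls and averages over balls\<close>

lemma emeasure_ball_pos: "0 < r \<Longrightarrow> 0 < emeasure lebesgue (ball (c::'a::euclidean_space) r)"
  using content_ball_pos[of r c] by (simp add: measure_def enn2real_positive_iff emeasure_completion)

lemma emeasure_ball_finite: "emeasure lebesgue (ball (c::'a::euclidean_space) r) < \<infinity>"
  using emeasure_lborel_ball_finite[of c r] by (simp add: emeasure_completion)

lemma emeasure_ball_neq [simp]:
  "emeasure lebesgue (ball (c::'a::euclidean_space) r) \<noteq> top"
  "0 < r \<Longrightarrow> emeasure lebesgue (ball c r) \<noteq> 0"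
  using emeasure_ball_finite[of c r] emeasure_ball_pos[of r c] by auto

lemma emeasure_ball_scale:
  fixes c c' :: "'a::euclidean_space"
  assumes "0 \<le> s" "0 \<le> r"
  shows "emeasure lebesgue (ball c (s * r)) = ennreal (s ^ DIM('a)) * emeasure lebesgue (ball c' r)"
proof -
  have "emeasure lebesgue (ball c (s * r)) = ennreal ((s * r) ^ DIM('a)) * emeasure lebesgue (ball (0::'a) 1)"
    using assms by (intro emeasure_lebesgue_ball_conv_unit_ball) auto
  moreover have "emeasure lebesgue (ball c' r) = ennreal (r ^ DIM('a)) * emeasure lebesgue (ball (0::'a) 1)"
    using assms by (intro emeasure_lebesgue_ball_conv_unit_ball) auto
  ultimately show ?thesis using assms by (simp add: power_mult_distrib ennreal_mult mult.assoc)
qed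

lemma sets_ball_measure [measurable_cong, simp]: "sets (ball_measure c r) = sets lebesgue"
  by (simp add: sets_uniform_measure)

lemma ball_measurable [measurable]: "ball (c::'a::euclidean_space) r \<in> sets lebesgue"
  by (intro lmeasurable_ball fmeasurableD)

lemma prob_space_ball_measure: "0 < r \<Longrightarrow> prob_space (ball_measure (c::'a::euclidean_space) r)"
  by (intro prob_space_uniform_measure) auto

lemma nn_integral_ball_measure:
  assumes [measurable]: "g \<in> borel_measurable lebesgue"
  shows "(\<integral>\<^sup>+y. g y \<partial>ball_measure (c::'a::euclidean_space) r)
    = (\<integral>\<^sup>+y. g y * indicator (ball c r) y \<partial>lebesgue) / emeasure lebesgue (ball c r)"
  by (intro nn_integral_uniform_measure) auto

lemma emeasure_ball_measure:
  assumes [measurable]: "E \<in> sets lebesgue"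
  shows "emeasure (ball_measure (c::'a::euclidean_space) r) E = emeasure lebesgue (ball c r \<inter> E) / emeasure lebesgue (ball c r)"
  by (intro emeasure_uniform_measure) auto

lemma ball_measure_mult:
  assumes [measurable]: "g \<in> borel_measurable lebesgue" and "0 < r"
  shows "(\<integral>\<^sup>+y. g y \<partial>ball_measure (c::'a::euclidean_space) r) * emeasure lebesgue (ball c r)
    = (\<integral>\<^sup>+y. g y * indicator (ball c r) y \<partial>lebesgue)"
  using assms(2) emeasure_ball_finite[of c r]
  by (simp add: nn_integral_ball_measure ennreal_divide_times ennreal_times_divide[symmetric] less_top)

lemma ball_measure_less_iff:
  assumes [measurable]: "g \<in> borel_measurable lebesgue" and "0 < r"
  shows "a < (\<integral>\<^sup>+y. g y \<partial>ball_measure (c::'a::euclidean_space) r) \<longleftrightarrow>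
     a * emeasure lebesgue (ball c r) < (\<integral>\<^sup>+y. g y * indicator (ball c r) y \<partial>lebesgue)"
proof -
  have "x < y \<longleftrightarrow> x * v < y * v" if "v \<noteq> 0" "v \<noteq> top" for x y v :: ennreal
    using that by (cases v; cases x; cases y)
      (auto simp: ennreal_mult[symmetric] ennreal_less_iff ennreal_top_mult mult_less_cancel_right)
  from this[of "emeasure lebesgue (ball c r)"] show ?thesis
    using assms(2) by (subst ball_measure_mult[symmetric]) auto
qed

lemma ball_measure_le_iff:
  assumes "g \<in> borel_measurable lebesgue" and "0 < r"
  shows "(\<integral>\<^sup>+y. g y \<partial>ball_measure (c::'a::euclidean_space) r) \<le> a \<longleftrightarrow>
     (\<integral>\<^sup>+y. g y * indicator (ball c r) y \<partial>lebesgue) \<le> a * emeasure lebesgue (ball c r)"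
  using ball_measure_less_iff[OF assms] by (simp add: not_less[symmetric])

lemma ball_measure_mono_ball:
  assumes [measurable]: "g \<in> borel_measurable lebesgue" and "0 < r" "0 < s" "ball c r \<subseteq> ball c' (s * r)"
  shows "(\<integral>\<^sup>+y. g y \<partial>ball_measure (c::'a::euclidean_space) r)
    \<le> ennreal (s ^ DIM('a)) * (\<integral>\<^sup>+y. g y \<partial>ball_measure c' (s * r))"
proof (subst ball_measure_le_iff)
  have "(\<integral>\<^sup>+y. g y * indicator (ball c r) y \<partial>lebesgue) \<le> (\<integral>\<^sup>+y. g y * indicator (ball c' (s * r)) y \<partial>lebesgue)"
    using assms(4) by (intro nn_integral_mono) (auto split: split_indicator)
  also have "\<dots> = (\<integral>\<^sup>+y. g y \<partial>ball_measure c' (s * r)) * (ennreal (s ^ DIM('a)) * emeasure lebesgue (ball c r))"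
    using assms by (subst ball_measure_mult[symmetric]) (simp_all add: emeasure_ball_scale[of s r c' c])
  finally show "(\<integral>\<^sup>+y. g y * indicator (ball c r) y \<partial>lebesgue) \<le>
    ennreal (s ^ DIM('a)) * (\<integral>\<^sup>+y. g y \<partial>ball_measure c' (s * r)) * emeasure lebesgue (ball c r)"
    by (simp add: ac_simps)
qed (use assms in auto)

text \<open>Subadditivity over a countable index set without an enumeration, the form in which
  Vitali's theorems deliver their balls. The sum is an integral over \<open>count_space\<close>, so
  it can be interchanged with the integral of the indicators.\<close>

lemma emeasure_UN_le_count_space:
  assumes "countable I" "\<And>i. i \<in> I \<Longrightarrow> X i \<in> sets M"
  shows "emeasure M (\<Union>i\<in>I. X i) \<le> (\<integral>\<^sup>+i. emeasure M (X i) \<partial>count_space I)"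
proof -
  have m: "(\<Union>i\<in>I. X i) \<in> sets M" using assms by auto
  have "emeasure M (\<Union>i\<in>I. X i) = (\<integral>\<^sup>+x. indicator (\<Union>i\<in>I. X i) x \<partial>M)" using m by simp
  also have "\<dots> \<le> (\<integral>\<^sup>+x. (\<integral>\<^sup>+i. indicator (X i) x \<partial>count_space I) \<partial>M)"
  proof (intro nn_integral_mono)
    fix x
    show "indicator (\<Union>i\<in>I. X i) x \<le> (\<integral>\<^sup>+i. indicator (X i) x \<partial>count_space I)"
    proof (cases "x \<in> (\<Union>i\<in>I. X i)")
      case True
      then obtain i where "i \<in> I" "x \<in> X i" by auto
      then have "1 \<le> (\<integral>\<^sup>+i. indicator (X i) x \<partial>count_space I)"
        using nn_integral_ge_point[of i I "\<lambda>i. indicator (X i) x"] by simp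
      with True show ?thesis by (simp add: indicator_def of_bool_def)
    qed simp
  qed
  also have "\<dots> = (\<integral>\<^sup>+i. (\<integral>\<^sup>+x. indicator (X i) x \<partial>M) \<partial>count_space I)"
    using assms by (intro nn_integral_count_space_nn_integral[of I "\<lambda>i. indicator (X i)"]) auto
  also have "\<dots> = (\<integral>\<^sup>+i. emeasure M (X i) \<partial>count_space I)"
    using assms by (intro nn_integral_cong) auto
  finally show ?thesis .
qed

text \<open>Lower semicontinuity in the centre. By continuity from below a slightly smaller
  concentric ball already exceeds a, and it stays inside the ball of radius r when the centre moves
  a little. The set of points with small averages at every radius is therefore closed, hence
  measurable although uncountably many radii are involved.\<close>

lemma open_less_emeasure_ball:
  fixes M :: "'a::euclidean_space measure"
  assumes M: "sets M = sets lebesgue"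
  shows "open {x. a < emeasure M (ball x r)}"
proof (subst open_contains_ball, safe)
  fix x assume a: "a < emeasure M (ball x r)"
  have "(\<Union>n. ball x (r - 1 / Suc n)) = ball x r"
  proof safe
    fix y assume "y \<in> ball x r"
    then obtain n where "1 / Suc n < r - dist x y"
      using nat_approx_posE[of "r - dist x y"] by auto
    then show "y \<in> (\<Union>n. ball x (r - 1 / Suc n))" by (intro UN_I[of n]) auto
  next
    fix y n assume "y \<in> ball x (r - 1 / Suc n)"
    moreover have "0 < 1 / real (Suc n)" by simp
    ultimately show "y \<in> ball x r" unfolding mem_ball by linarith
  qed
  moreover have "incseq (\<lambda>n. ball x (r - 1 / Suc n))"
    unfolding incseq_def by (intro allI impI subset_ball diff_left_mono divide_left_mono) auto
  moreover have "range (\<lambda>n. ball x (r - 1 / Suc n)) \<subseteq> sets M" by (auto simp: M)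
  ultimately have "(SUP n. emeasure M (ball x (r - 1 / Suc n))) = emeasure M (ball x r)"
    using SUP_emeasure_incseq[of "\<lambda>n. ball x (r - 1 / Suc n)" M] by simp
  with a have "a < (SUP n. emeasure M (ball x (r - 1 / Suc n)))" by simp
  then obtain n where n: "a < emeasure M (ball x (r - 1 / Suc n))"
    unfolding less_SUP_iff by blast
  have "ball x (1 / Suc n) \<subseteq> {x. a < emeasure M (ball x r)}"
  proof
    fix y assume y: "y \<in> ball x (1 / Suc n)"
    have "emeasure M (ball x (r - 1 / Suc n)) \<le> emeasure M (ball y r)"
    proof (intro emeasure_mono subsetI)
      fix z assume "z \<in> ball x (r - 1 / Suc n)"
      with y dist_triangle[of y z x] show "z \<in> ball y r" by (simp add: dist_commute)
    qed (simp add: M)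
    with n show "y \<in> {x. a < emeasure M (ball x r)}" by simp
  qed
  then show "\<exists>e>0. ball x e \<subseteq> {x. a < emeasure M (ball x r)}"
    by (intro exI[of _ "1 / Suc n"]) auto
qed

text \<open>A weak form of Lebesgue's differentiation theorem. If \<open>\<mu> \<le> g\<close> on a set where all
  averages are at most \<open>\<lambda> < \<mu>\<close>, then Vitali's theorem inside an open superset of almost the
  same measure shows that the set is null.\<close>

lemma AE_le_of_averages_le:
  fixes g :: "'a::euclidean_space \<Rightarrow> ennreal" and l :: real
  assumes [measurable]: "g \<in> borel_measurable lebesgue" and l: "0 \<le> l"
  shows "AE x in lebesgue. (\<forall>r>0. (\<integral>\<^sup>+y. g y * indicator (ball x r) y \<partial>lebesgue)
    \<le> ennreal l * emeasure lebesgue (ball x r)) \<longrightarrow> g x \<le> ennreal l"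
proof -
  define N where "N = density lebesgue g"
  have N: "sets N = sets lebesgue" "\<And>A. A \<in> sets lebesgue \<Longrightarrow> emeasure N A = (\<integral>\<^sup>+y. g y * indicator A y \<partial>lebesgue)"
    by (simp_all add: N_def emeasure_density)
  \<comment> \<open>By translation invariance the threshold can be stated with the ball around 0. It
    then does not depend on x, and each set that is removed is open.\<close>
  define S where "S = (\<Inter>r\<in>{0<..}. - {x. ennreal l * emeasure lebesgue (ball (0::'a) r) < emeasure N (ball x r)})"
  have "closed S" unfolding S_def
    by (intro closed_INT ballI closed_Compl open_less_emeasure_ball N)
  then have [measurable]: "S \<in> sets lebesgue" by (simp add: borel_closed sets_completionI_sets)
  have vol: "emeasure lebesgue (ball (0::'a) r) = emeasure lebesgue (ball x r)" if "0 < r" for x :: 'a and r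
    using emeasure_ball_scale[of 1 r 0 x] that by simp
  have S: "emeasure N (ball x r) \<le> ennreal l * emeasure lebesgue (ball x r)" if "x \<in> S" "0 < r" for x r
    using that by (auto simp: S_def not_less vol[OF \<open>0 < r\<close>, of x, symmetric])
  \<comment> \<open>Intersecting with \<open>ball 0 R\<close> makes the measure v finite, so that m
    v \<le> l v with l < m forces v = 0.\<close>
  have null: "emeasure lebesgue (S \<inter> {x. ennreal m \<le> g x} \<inter> ball 0 R) = 0" if m: "l < m" for m R
  proof -
    define E where "E = S \<inter> {x. ennreal m \<le> g x} \<inter> ball 0 R"
    have [measurable]: "E \<in> sets lebesgue" unfolding E_def by measurable
    have "emeasure lebesgue E \<le> emeasure lebesgue (ball (0::'a) R)"
      by (intro emeasure_mono) (auto simp: E_def)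
    then obtain v where v: "emeasure lebesgue E = ennreal v" "0 \<le> v"
      by (cases "emeasure lebesgue E") (auto simp: top_unique)
    have "m * v \<le> l * (v + e)" if e: "0 < e" for e
    proof -
      obtain U where U: "open U" "E \<subseteq> U" "U - E \<in> lmeasurable" "emeasure lebesgue (U - E) < ennreal e"
        using sets_lebesgue_outer_open[OF \<open>E \<in> sets lebesgue\<close> e] by blast
      have [measurable]: "U \<in> sets lebesgue" using U(1) by simp
      have Uv: "emeasure lebesgue U \<le> ennreal (v + e)"
      proof -
        have "emeasure lebesgue U = emeasure lebesgue (E \<union> (U - E))" using U(2) by (simp add: Un_absorb1)
        also have "\<dots> \<le> emeasure lebesgue E + emeasure lebesgue (U - E)"
          by (intro emeasure_subadditive) auto
        also have "\<dots> \<le> ennreal v + ennreal e" using U(4) v by (intro add_mono) auto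
        finally show ?thesis using v e by simp
      qed
      define K where "K = {(x, r). x \<in> E \<and> 0 < r \<and> ball x r \<subseteq> U}"
      obtain C where C: "countable C" "C \<subseteq> K"
        "pairwise (\<lambda>i j. disjnt (ball (fst i) (snd i)) (ball (fst j) (snd j))) C"
        "negligible (E - (\<Union>i\<in>C. ball (fst i) (snd i)))"
      proof (rule Vitali_covering_theorem_balls[of E K fst snd])
        fix x d assume "x \<in> E" "0 < (d::real)"
        moreover obtain r where "0 < r" "ball x r \<subseteq> U"
          using U(1,2) \<open>x \<in> E\<close> by (meson open_contains_ball subsetD)
        ultimately show "\<exists>i. i \<in> K \<and> x \<in> ball (fst i) (snd i) \<and> snd i < d"
          by (intro exI[of _ "(x, min r (d/2))"]) (auto simp: K_def)
      qed
      let ?V = "\<Union>i\<in>C. ball (fst i) (snd i)"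
      have [measurable]: "?V \<in> sets lebesgue" by (intro sets.countable_UN'' C) auto
      have VU: "?V \<subseteq> U"
      proof (rule UN_least)
        fix i assume "i \<in> C"
        then have "i \<in> K" using C(2) by blast
        then show "ball (fst i) (snd i) \<subseteq> U" by (simp add: K_def case_prod_beta)
      qed
      have disj: "disjoint_family_on (\<lambda>i. ball (fst i) (snd i)) C"
        using C(3) by (auto simp: disjoint_family_on_def pairwise_def disjnt_def)
      have "E - ?V \<in> null_sets lebesgue" using C(4) by (simp add: negligible_iff_null_sets)
      then have EV: "AE x in lebesgue. x \<in> E \<longrightarrow> x \<in> ?V"
        using AE_not_in by fastforce
      \<comment> \<open>The chain is m |E| \<le> N(V) \<le> l |V| \<le> l |U|: Vitali's balls are
        disjoint, are centred in S, lie in U and cover almost all of E.\<close>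
      have "ennreal m * ennreal v = (\<integral>\<^sup>+x. ennreal m * indicator E x \<partial>lebesgue)"
        using v by (simp add: nn_integral_cmult_indicator)
      also have "\<dots> \<le> (\<integral>\<^sup>+x. g x * indicator ?V x \<partial>lebesgue)"
        using EV by (intro nn_integral_mono_AE) (auto elim!: eventually_mono simp: E_def split: split_indicator)
      also have "\<dots> = emeasure N ?V" by (simp add: N)
      also have "\<dots> = (\<integral>\<^sup>+i. emeasure N (ball (fst i) (snd i)) \<partial>count_space C)"
        using C disj by (intro emeasure_UN_countable) (auto simp: N)
      also have "\<dots> \<le> (\<integral>\<^sup>+i. ennreal l * emeasure lebesgue (ball (fst i) (snd i)) \<partial>count_space C)"
        using C(2) by (intro nn_integral_mono S) (auto simp: K_def E_def)
      also have "\<dots> = ennreal l * emeasure lebesgue ?V"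
        using C disj by (subst emeasure_UN_countable) (auto simp: nn_integral_cmult)
      also have "\<dots> \<le> ennreal l * ennreal (v + e)"
        using Uv VU emeasure_mono[of ?V U lebesgue] by (intro mult_left_mono) auto
      finally show ?thesis using v l e m
        by (simp add: ennreal_mult[symmetric] ennreal_le_iff del: ennreal_plus)
    qed
    then have "m * v \<le> l * v + e" if "0 < e" for e
    proof -
      \<comment> \<open>Dividing by l + 1 instead of l includes the case l = 0.\<close>
      have "m * v \<le> l * (v + e / (l + 1))" using \<open>0 < e\<close> l by (intro \<open>\<And>e. 0 < e \<Longrightarrow> m * v \<le> l * (v + e)\<close>) auto
      also have "\<dots> = l * v + l / (l + 1) * e" by (simp add: distrib_left)
      also have "l / (l + 1) * e \<le> 1 * e" using that l by (intro mult_right_mono) auto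
      finally show ?thesis by simp
    qed
    then have "m * v \<le> l * v" by (rule field_le_epsilon)
    then have "v = 0" using m v(2) by (auto simp: mult_le_cancel_right)
    then show ?thesis using v by (simp add: E_def)
  qed
  have "AE x in lebesgue. \<forall>k n. x \<notin> S \<inter> {x. ennreal (l + 1 / Suc n) \<le> g x} \<inter> ball 0 (real k)"
    unfolding AE_all_countable
  proof (intro allI AE_not_in)
    fix k n
    have "S \<inter> {x. ennreal (l + 1 / Suc n) \<le> g x} \<inter> ball 0 (real k) \<in> sets lebesgue" by measurable
    then show "S \<inter> {x. ennreal (l + 1 / Suc n) \<le> g x} \<inter> ball 0 (real k) \<in> null_sets lebesgue"
      by (intro null_setsI null) auto
  qed
  then show ?thesis
  proof eventually_elim
    case (elim x)
    show ?case
    proof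
      assume *: "\<forall>r>0. (\<integral>\<^sup>+y. g y * indicator (ball x r) y \<partial>lebesgue) \<le> ennreal l * emeasure lebesgue (ball x r)"
      then have "x \<in> S" by (auto simp: S_def N not_less vol[of _ x])
      obtain k where k: "norm x < real k" using reals_Archimedean2 by blast
      have "g x \<le> ennreal l + ennreal e" if e: "0 < e" for e
      proof -
        obtain n where n: "1 / Suc n < e" using nat_approx_posE[OF e] by auto
        have "g x \<le> ennreal (l + 1 / Suc n)" using elim[rule_format, of n k] \<open>x \<in> S\<close> k by simp
        also have "\<dots> \<le> ennreal (l + e)" using n by (intro ennreal_leI) auto
        finally show ?thesis using l e by simp
      qed
      then show "g x \<le> ennreal l" by (rule ennreal_le_epsilon)
    qed
  qed
qed

section \<open>The uncentred maximal function and coverings\<close>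

text \<open>The supremum runs over all balls containing x, not only those centred at x. Superlevel
  sets are then unions of open balls, so measurability is immediate, and the average over a ball is
  a lower bound at every one of its points.\<close>

definition hl_max :: "('a::euclidean_space \<Rightarrow> ennreal) \<Rightarrow> 'a \<Rightarrow> ennreal" where
  "hl_max g x = (SUP (c, r)\<in>{(c, r). 0 < r \<and> x \<in> ball c r}. \<integral>\<^sup>+y. g y \<partial>ball_measure c r)"

lemma hl_max_ge: "0 < r \<Longrightarrow> x \<in> ball c r \<Longrightarrow> (\<integral>\<^sup>+y. g y \<partial>ball_measure c r) \<le> hl_max g x"
  unfolding hl_max_def by (rule SUP_upper2[of "(c, r)"]) auto

lemma less_hl_max_iff:
  "a < hl_max g x \<longleftrightarrow> (\<exists>c r. 0 < r \<and> x \<in> ball c r \<and> a < (\<integral>\<^sup>+y. g y \<partial>ball_measure c r))"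
  unfolding hl_max_def less_SUP_iff by auto

lemma hl_max_le_iff:
  "hl_max g x \<le> a \<longleftrightarrow> (\<forall>c r. 0 < r \<longrightarrow> x \<in> ball c r \<longrightarrow> (\<integral>\<^sup>+y. g y \<partial>ball_measure c r) \<le> a)"
  using less_hl_max_iff[of a g x] by (simp add: not_less[symmetric]) blast

lemma less_hl_max_eq_UN:
  "{x. a < hl_max g x} = (\<Union>(c, r)\<in>{(c, r). 0 < r \<and> a < (\<integral>\<^sup>+y. g y \<partial>ball_measure c r)}. ball c r)"
  by (fastforce simp: less_hl_max_iff)

lemma open_less_hl_max: "open {x. a < hl_max g x}"
  unfolding less_hl_max_eq_UN by auto

lemma hl_max_measurable [measurable]: "hl_max g \<in> borel_measurable lebesgue"
proof (rule borel_measurableI_greater)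
  fix a :: ennreal
  have "{x. a < hl_max g x} \<in> sets lebesgue"
    by (intro sets_completionI_sets) (simp add: open_less_hl_max)
  then show "{x \<in> space lebesgue. a < hl_max g x} \<in> sets lebesgue" by simp
qed

text \<open>A rational level strictly between the maximal function and g at x would contradict the
  statement about averages below a level. Countably many levels leave one common null set.\<close>

lemma AE_le_hl_max:
  assumes [measurable]: "g \<in> borel_measurable lebesgue"
  shows "AE x in lebesgue. g x \<le> hl_max g x"
proof -
  have "AE x in lebesgue. \<forall>q. 0 \<le> q \<longrightarrow> (\<forall>r>0. (\<integral>\<^sup>+y. g y * indicator (ball x r) y \<partial>lebesgue)
    \<le> ennreal (real_of_rat q) * emeasure lebesgue (ball x r)) \<longrightarrow> g x \<le> ennreal (real_of_rat q)"
    unfolding AE_all_countable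
  proof
    fix q :: rat
    show "AE x in lebesgue. 0 \<le> q \<longrightarrow> (\<forall>r>0. (\<integral>\<^sup>+y. g y * indicator (ball x r) y \<partial>lebesgue)
    \<le> ennreal (real_of_rat q) * emeasure lebesgue (ball x r)) \<longrightarrow> g x \<le> ennreal (real_of_rat q)"
      using AE_le_of_averages_le[of g "real_of_rat q"] by (cases "0 \<le> q") auto
  qed
  then show ?thesis
  proof eventually_elim
    case (elim x)
    show ?case
    proof (rule ccontr)
      assume "\<not> g x \<le> hl_max g x"
      then obtain q where q: "hl_max g x < ennreal (real_of_rat q)" "ennreal (real_of_rat q) < g x"
        using ennreal_rat_dense[of "hl_max g x" "g x"] by (auto simp: not_le)
      have "0 \<le> q" using q(1) by (cases "0 \<le> q") (auto simp: ennreal_neg)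
      moreover have "(\<integral>\<^sup>+y. g y * indicator (ball x r) y \<partial>lebesgue) \<le> ennreal (real_of_rat q) * emeasure lebesgue (ball x r)" if "0 < r" for r
        using hl_max_ge[of r x x g] that q(1) by (subst ball_measure_le_iff[symmetric]) auto
      ultimately show False using elim q(2) by (auto simp: not_le[symmetric])
    qed
  qed
qed

text \<open>Disjoint balls carry the measure M, and doubling of N pays for their 5-fold
  enlargements. The same argument serves Lebesgue measure and w dx in the role of N.\<close>

lemma vitali_weak_type:
  fixes N M :: "'a::euclidean_space measure"
  assumes N: "sets N = sets lebesgue" and M: "sets M = sets lebesgue"
    and D: "\<And>c r. 0 < r \<Longrightarrow> emeasure N (ball c (5 * r)) \<le> D * emeasure N (ball c r)"
    and K: "\<And>c r. (c, r) \<in> K \<Longrightarrow> 0 < r \<and> a * emeasure N (ball c r) \<le> emeasure M (ball c r)"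
  shows "a * emeasure N (\<Union>(c, r)\<in>K. ball c r) \<le> D * emeasure M UNIV"
proof -
  \<comment> \<open>Vitali's covering lemma needs bounded radii. The full union is recovered by
    continuity from below.\<close>
  define U where "U n = (\<Union>(c, r)\<in>{(c, r)\<in>K. r \<le> real n}. ball c r)" for n :: nat
  have U_open: "open (U n)" for n unfolding U_def by auto
  have bound: "a * emeasure N (U n) \<le> D * emeasure M UNIV" for n
  proof -
    obtain C where C: "countable C" "C \<subseteq> {(c, r)\<in>K. r \<le> real n}"
      "pairwise (\<lambda>i j. disjnt (ball (fst i) (snd i)) (ball (fst j) (snd j))) C"
      "U n \<subseteq> (\<Union>i\<in>C. ball (fst i) (5 * snd i))"
      proof (rule Vitali_covering_lemma_balls[where S = "U n" and K = "{(c, r)\<in>K. r \<le> real n}" and a = fst and r = snd and B = "real n"])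
      show "U n \<subseteq> (\<Union>i\<in>{(c, r)\<in>K. r \<le> real n}. ball (fst i) (snd i))"
        by (auto simp: U_def case_prod_beta)
      show "0 < snd i \<and> snd i \<le> real n" if "i \<in> {(c, r)\<in>K. r \<le> real n}" for i
        using that K[of "fst i" "snd i"] by (auto simp: case_prod_beta)
    qed
    have CK: "0 < snd i" "a * emeasure N (ball (fst i) (snd i)) \<le> emeasure M (ball (fst i) (snd i))" if "i \<in> C" for i
      using K[of "fst i" "snd i"] subsetD[OF C(2) that] by (auto simp: case_prod_beta)
    have disj: "disjoint_family_on (\<lambda>i. ball (fst i) (snd i)) C"
      using C(3) by (auto simp: disjoint_family_on_def pairwise_def disjnt_def)
    have "a * emeasure N (U n) \<le> a * (\<integral>\<^sup>+i. emeasure N (ball (fst i) (5 * snd i)) \<partial>count_space C)"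
      using C(1,4) by (intro mult_left_mono order_trans[OF emeasure_mono emeasure_UN_le_count_space]) (auto simp: N)
    also have "\<dots> \<le> a * (\<integral>\<^sup>+i. D * emeasure N (ball (fst i) (snd i)) \<partial>count_space C)"
      using CK by (intro mult_left_mono nn_integral_mono D) auto
    also have "\<dots> = D * (\<integral>\<^sup>+i. a * emeasure N (ball (fst i) (snd i)) \<partial>count_space C)"
      by (simp add: nn_integral_cmult ac_simps)
    also have "\<dots> \<le> D * (\<integral>\<^sup>+i. emeasure M (ball (fst i) (snd i)) \<partial>count_space C)"
      using CK by (intro mult_left_mono nn_integral_mono) auto
    also have "\<dots> = D * emeasure M (\<Union>i\<in>C. ball (fst i) (snd i))"
      using C(1) disj by (subst emeasure_UN_countable) (auto simp: M)
    also have "\<dots> \<le> D * emeasure M UNIV"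
      using sets_eq_imp_space_eq[OF M] by (intro mult_left_mono emeasure_mono) (auto simp: M)
    finally show ?thesis .
  qed
  have "(\<Union>n. U n) = (\<Union>(c, r)\<in>K. ball c r)"
  proof (intro equalityI subsetI)
    fix x assume "x \<in> (\<Union>(c, r)\<in>K. ball c r)"
    then obtain c r where cr: "(c, r) \<in> K" "x \<in> ball c r" by auto
    obtain n where "r \<le> real n" using real_arch_simple by blast
    with cr show "x \<in> (\<Union>n. U n)" unfolding U_def by blast
  qed (fastforce simp: U_def)
  moreover have "incseq U" unfolding U_def incseq_def by force
  moreover have "range U \<subseteq> sets N" using U_open by (auto simp: N intro!: sets_completionI_sets)
  ultimately have "emeasure N (\<Union>(c, r)\<in>K. ball c r) = (SUP n. emeasure N (U n))"
    using SUP_emeasure_incseq[of U N] by simp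
  then show ?thesis using bound by (auto simp: SUP_mult_left_ennreal intro!: SUP_least)
qed

section \<open>The John--Nirenberg inequality\<close>

text \<open>A Calderon--Zygmund decomposition with balls in place of dyadic cubes: the radius of a ball in
  \<open>C\<close> is at least half of the largest radius \<open>r < R\<close> for which the average around
  the same centre exceeds \<open>l\<close>.\<close>

lemma local_calderon_zygmund:
  fixes g :: "'a::euclidean_space \<Rightarrow> ennreal"
  assumes [measurable]: "g \<in> borel_measurable lebesgue" and R: "0 < R" and l: "0 < l"
    and avg: "ennreal (10 ^ DIM('a)) * (\<integral>\<^sup>+y. g y \<partial>ball_measure x0 (2 * R)) \<le> ennreal l"
  obtains C :: "('a \<times> real) set" where "countable C"
    "\<And>i. i \<in> C \<Longrightarrow> 0 < snd i" "\<And>i. i \<in> C \<Longrightarrow> ball (fst i) (5 * snd i) \<subseteq> ball x0 (2 * R)"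
    "disjoint_family_on (\<lambda>i. ball (fst i) (snd i)) C"
    "\<And>i. i \<in> C \<Longrightarrow> ennreal l \<le> (\<integral>\<^sup>+y. g y \<partial>ball_measure (fst i) (snd i))"
    "\<And>i. i \<in> C \<Longrightarrow> (\<integral>\<^sup>+y. g y \<partial>ball_measure (fst i) (5 * snd i)) \<le> ennreal l"
    "AE x in lebesgue. x \<in> ball x0 R \<longrightarrow> x \<notin> (\<Union>i\<in>C. ball (fst i) (5 * snd i)) \<longrightarrow> g x \<le> ennreal l"
proof -
  define A where "A x r = (\<integral>\<^sup>+y. g y \<partial>ball_measure x r)" for x r
  \<comment> \<open>For a radius between R/5 and R the ball lies in \<open>ball x0 (2 * R)\<close>
    and fills at least the share 10^(-n) of it. This is the origin of the factor in
    \<open>avg\<close>.\<close>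
  have small: "A x r \<le> ennreal l" if "x \<in> ball x0 R" "R / 5 \<le> r" "r \<le> R" for x r
  proof -
    have "A x r \<le> ennreal ((2 * R / r) ^ DIM('a)) * A x0 (2 * R / r * r)"
      unfolding A_def
    proof (rule ball_measure_mono_ball)
      show "ball x r \<subseteq> ball x0 (2 * R / r * r)"
      proof
        fix y assume "y \<in> ball x r"
        then show "y \<in> ball x0 (2 * R / r * r)"
          using that R dist_triangle[of x0 y x] by (simp add: dist_commute)
      qed
    qed (use that R in auto)
    also have "\<dots> \<le> ennreal (10 ^ DIM('a)) * A x0 (2 * R)"
      using that R by (intro mult_mono ennreal_leI power_mono) (auto simp: field_simps)
    finally show ?thesis using avg by (simp add: A_def)
  qed
  define K where "K = {(x, r). x \<in> ball x0 R \<and> 0 < r \<and> 5 * r < R \<and> ennreal l < A x r \<and> A x (5 * r) \<le> ennreal l}"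
  have exK: "\<exists>r. (x, r) \<in> K" if x: "x \<in> ball x0 R" and r: "0 < r" "r < R" "ennreal l < A x r" for x r
  proof -
    define Q where "Q = {r. 0 < r \<and> r < R \<and> ennreal l < A x r}"
    have Q: "Q \<noteq> {}" "bdd_above Q" using r by (auto simp: Q_def intro!: bdd_aboveI[of _ R])
    have "0 < Sup Q" using r Q(2) by (intro less_le_trans[OF r(1) cSup_upper]) (auto simp: Q_def)
    then have "Sup Q / 2 < Sup Q" by simp
    then obtain s where s: "s \<in> Q" "Sup Q / 2 < s" using less_cSup_iff[OF Q] by blast
    \<comment> \<open>Otherwise s would lie between R/5 and R, where \<open>small\<close>
      contradicts l < A x s.\<close>
    have "5 * s < R" using s(1) small[OF x, of s] by (auto simp: Q_def not_le[symmetric])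
    moreover have "5 * s \<notin> Q"
    proof
      assume "5 * s \<in> Q"
      then have "5 * s \<le> Sup Q" using Q(2) by (rule cSup_upper)
      with s(2) \<open>0 < Sup Q\<close> show False by simp
    qed
    ultimately have "(x, s) \<in> K" using s(1) x by (auto simp: K_def Q_def not_less)
    then show ?thesis by blast
  qed
  obtain C where C: "countable C" "C \<subseteq> K"
    "pairwise (\<lambda>i j. disjnt (ball (fst i) (snd i)) (ball (fst j) (snd j))) C"
    "(\<Union>i\<in>K. ball (fst i) (snd i)) \<subseteq> (\<Union>i\<in>C. ball (fst i) (5 * snd i))"
  proof (rule Vitali_covering_lemma_balls[where S = "\<Union>i\<in>K. ball (fst i) (snd i)" and K = K and a = fst and r = snd and B = R])
    show "0 < snd i \<and> snd i \<le> R" if "i \<in> K" for i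
      using that by (auto simp: K_def)
  qed auto
  have CK: "fst i \<in> ball x0 R" "0 < snd i" "5 * snd i < R" "ennreal l < A (fst i) (snd i)" "A (fst i) (5 * snd i) \<le> ennreal l" if "i \<in> C" for i
    using subsetD[OF C(2) that] by (auto simp: K_def case_prod_beta)
  show thesis
  proof (rule that[of C])
    show "ball (fst i) (5 * snd i) \<subseteq> ball x0 (2 * R)" if "i \<in> C" for i
    proof
      fix y assume "y \<in> ball (fst i) (5 * snd i)"
      then show "y \<in> ball x0 (2 * R)"
        using CK[OF that] dist_triangle[of x0 y "fst i"] by (simp add: dist_commute)
    qed
    show "disjoint_family_on (\<lambda>i. ball (fst i) (snd i)) C"
      using C(3) by (auto simp: disjoint_family_on_def pairwise_def disjnt_def)
    \<comment> \<open>The differentiation lemma asks for all radii, whereas the stopping argument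
      controls only r < R. Cutting g off outside \<open>ball x0 (2 * R)\<close> bounds the averages
      over larger balls by the total mass, again at the cost of 10^n.\<close>
    let ?g = "\<lambda>x. g x * indicator (ball x0 (2 * R)) x"
    have "AE x in lebesgue. (\<forall>r>0. (\<integral>\<^sup>+y. ?g y * indicator (ball x r) y \<partial>lebesgue)
       \<le> ennreal l * emeasure lebesgue (ball x r)) \<longrightarrow> ?g x \<le> ennreal l"
      using l by (intro AE_le_of_averages_le) auto
    then show "AE x in lebesgue. x \<in> ball x0 R \<longrightarrow> x \<notin> (\<Union>i\<in>C. ball (fst i) (5 * snd i)) \<longrightarrow> g x \<le> ennreal l"
    proof eventually_elim
      case (elim x)
      show ?case
      proof (intro impI)
        assume x: "x \<in> ball x0 R" and nx: "x \<notin> (\<Union>i\<in>C. ball (fst i) (5 * snd i))"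
        have le: "A x r \<le> ennreal l" if r: "0 < r" "r < R" for r
        proof (rule ccontr)
          assume "\<not> A x r \<le> ennreal l"
          then obtain s where s: "(x, s) \<in> K" using exK[OF x r] by (auto simp: not_le)
          then have "x \<in> ball (fst (x, s)) (snd (x, s))" by (auto simp: K_def)
          with s have "x \<in> (\<Union>i\<in>K. ball (fst i) (snd i))" by blast
          with C(4) nx show False by blast
        qed
        have "(\<integral>\<^sup>+y. ?g y * indicator (ball x r) y \<partial>lebesgue) \<le> ennreal l * emeasure lebesgue (ball x r)" if r: "0 < r" for r
        proof (cases "r < R")
          case True
          have "(\<integral>\<^sup>+y. ?g y * indicator (ball x r) y \<partial>lebesgue) \<le> (\<integral>\<^sup>+y. g y * indicator (ball x r) y \<partial>lebesgue)"
            by (intro nn_integral_mono) (auto split: split_indicator)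
          also have "\<dots> \<le> ennreal l * emeasure lebesgue (ball x r)"
            using le[OF r True] r unfolding A_def by (subst (asm) ball_measure_le_iff) auto
          finally show ?thesis .
        next
          case False
          have "(\<integral>\<^sup>+y. ?g y * indicator (ball x r) y \<partial>lebesgue) \<le> (\<integral>\<^sup>+y. g y * indicator (ball x0 (2 * R)) y \<partial>lebesgue)"
            by (intro nn_integral_mono) (auto split: split_indicator)
          also have "\<dots> = A x0 (2 * R) * emeasure lebesgue (ball x0 (2 * R))"
            using R by (simp add: A_def ball_measure_mult)
          also have "emeasure lebesgue (ball x0 (2 * R)) \<le> ennreal (10 ^ DIM('a)) * emeasure lebesgue (ball x r)"
          proof -
            have "emeasure lebesgue (ball x0 (2 * R)) = ennreal (2 ^ DIM('a)) * emeasure lebesgue (ball x R)"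
              using R emeasure_ball_scale[of 2 R x0 x] by simp
            also have "\<dots> \<le> ennreal (10 ^ DIM('a)) * emeasure lebesgue (ball x r)"
              using False by (intro mult_mono emeasure_mono ennreal_leI power_mono) auto
            finally show ?thesis .
          qed
          also have "A x0 (2 * R) * (ennreal (10 ^ DIM('a)) * emeasure lebesgue (ball x r)) \<le> ennreal l * emeasure lebesgue (ball x r)"
            using mult_right_mono[OF avg, of "emeasure lebesgue (ball x r)"] by (simp add: A_def ac_simps)
          finally show ?thesis by (simp add: mult_left_mono)
        qed
        with elim have "?g x \<le> ennreal l" by blast
        moreover have "x \<in> ball x0 (2 * R)" using x R by simp
        ultimately show "g x \<le> ennreal l" by simp
      qed
    qed
  qed (use C CK in \<open>auto simp: A_def less_imp_le\<close>)
qed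

text \<open>The triangle inequality through b(y), averaged over y: two centres are close if b is on
  average close to both on one common ball.\<close>

lemma (in prob_space) norm_diff_le_nn_integral:
  fixes b :: "'a \<Rightarrow> 'b::{real_normed_vector, second_countable_topology}"
  assumes [measurable]: "b \<in> borel_measurable M"
  shows "ennreal (norm (u - v)) \<le> (\<integral>\<^sup>+y. ennreal (norm (b y - u)) \<partial>M) + (\<integral>\<^sup>+y. ennreal (norm (b y - v)) \<partial>M)"
proof -
  have "ennreal (norm (u - v)) = (\<integral>\<^sup>+y. ennreal (norm (u - v)) \<partial>M)" by (simp add: emeasure_space_1)
  also have "\<dots> \<le> (\<integral>\<^sup>+y. ennreal (norm (b y - u)) + ennreal (norm (b y - v)) \<partial>M)"
  proof (intro nn_integral_mono)
    fix y
    have "norm (u - v) \<le> norm (b y - u) + norm (b y - v)"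
      using norm_triangle_ineq4[of "b y - v" "b y - u"] by simp
    then show "ennreal (norm (u - v)) \<le> ennreal (norm (b y - u)) + ennreal (norm (b y - v))"
      by (simp add: ennreal_plus[symmetric] ennreal_leI del: ennreal_plus)
  qed
  also have "\<dots> = (\<integral>\<^sup>+y. ennreal (norm (b y - u)) \<partial>M) + (\<integral>\<^sup>+y. ennreal (norm (b y - v)) \<partial>M)"
    by (intro nn_integral_add) auto
  finally show ?thesis .
qed

lemma (in prob_space) nn_integral_epowr_shift:
  fixes b :: "'a \<Rightarrow> 'b::{real_normed_vector, second_countable_topology}"
  assumes [measurable]: "b \<in> borel_measurable M" and q: "0 < q"
  shows "(\<integral>\<^sup>+y. epowr (ennreal (norm (b y - v))) q \<partial>M)
    \<le> ennreal (2 powr q) * ((\<integral>\<^sup>+y. epowr (ennreal (norm (b y - u))) q \<partial>M) + epowr (ennreal (norm (u - v))) q)"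
proof -
  have "(\<integral>\<^sup>+y. epowr (ennreal (norm (b y - v))) q \<partial>M)
    \<le> (\<integral>\<^sup>+y. ennreal (2 powr q) * (epowr (ennreal (norm (b y - u))) q + epowr (ennreal (norm (u - v))) q) \<partial>M)"
  proof (intro nn_integral_mono)
    fix y
    have "norm (b y - v) \<le> norm (b y - u) + norm (u - v)"
      using norm_triangle_ineq[of "b y - u" "u - v"] by simp
    then have "ennreal (norm (b y - v)) \<le> ennreal (norm (b y - u)) + ennreal (norm (u - v))"
      by (simp add: ennreal_plus[symmetric] ennreal_leI del: ennreal_plus)
    then have "epowr (ennreal (norm (b y - v))) q \<le> epowr (ennreal (norm (b y - u)) + ennreal (norm (u - v))) q"
      using q by (intro epowr_mono) auto
    also have "\<dots> \<le> ennreal (2 powr q) * (epowr (ennreal (norm (b y - u))) q + epowr (ennreal (norm (u - v))) q)"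
      using q by (intro epowr_add_le) auto
    finally show "epowr (ennreal (norm (b y - v))) q \<le> \<dots>" .
  qed
  also have "\<dots> = ennreal (2 powr q) * ((\<integral>\<^sup>+y. epowr (ennreal (norm (b y - u))) q \<partial>M) + epowr (ennreal (norm (u - v))) q)"
    by (simp add: nn_integral_cmult nn_integral_add emeasure_space_1)
  finally show ?thesis .
qed

text \<open>Finiteness of X is the point: X = top satisfies the first assumption for every A. Each
  appeal to this lemma is preceded by a qualitative bound that makes X finite.\<close>

lemma ennreal_absorb_half:
  assumes "X \<le> A + ennreal (1/2) * X" "X < top"
  shows "X \<le> 2 * A"
proof (cases A)
  case (real a)
  obtain x where x: "X = ennreal x" "0 \<le> x" using assms(2) by (cases X) auto
  have "ennreal (1/2) * ennreal x = ennreal (1/2 * x)" by (subst ennreal_mult[symmetric]) (auto simp: x)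
  then have "ennreal x \<le> ennreal (a + 1/2 * x)" using assms(1) real x by simp
  then have "x \<le> a + 1/2 * x" using real x by (subst (asm) ennreal_le_iff) auto
  then have "ennreal x \<le> ennreal (2 * a)" by (intro ennreal_leI) simp
  then show ?thesis using x real by (simp add: ennreal_mult)
qed (auto simp: ennreal_mult_top)

text \<open>L is the stopping level in units of \<beta>, chosen so that 2^q * 2^q * 10^n / L = 1/2.
  The three summands come from the points below the level L \<beta>, from recentring on the stopping
  balls by at most (1 + L) \<beta>, and from recentring from the doubled ball to the ball itself.
  The outer factor 2 is due to the absorption.\<close>

definition john_nirenberg_const :: "nat \<Rightarrow> real \<Rightarrow> real" where
  "john_nirenberg_const n q = (let L = 2 * 4 powr q * 10 ^ n in
     2 * (2 powr q * L powr q + (1 + L) powr q / 2 + 2 powr q * (1 + 2 ^ n) powr q))"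

text \<open>The bound \<open>N\<close> only makes the supremum over all balls of the left-hand side finite. The
  Calderon--Zygmund balls estimate this supremum by a constant plus half of itself.\<close>

lemma john_nirenberg_bounded:
  fixes b :: "'a::euclidean_space \<Rightarrow> 'b::euclidean_space" and a :: "'a \<Rightarrow> real \<Rightarrow> 'b"
  assumes b[measurable]: "b \<in> borel_measurable lebesgue" and q: "0 < q" and \<beta>: "0 < \<beta>"
    and osc: "\<And>c r. 0 < r \<Longrightarrow> (\<integral>\<^sup>+y. ennreal (norm (b y - a c r)) \<partial>ball_measure c r) \<le> ennreal \<beta>"
    and bN: "\<And>y. norm (b y) \<le> N" and aN: "\<And>c r. norm (a c r) \<le> N" and r: "0 < r"
  shows "(\<integral>\<^sup>+y. epowr (ennreal (norm (b y - a c r))) q \<partial>ball_measure c r)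
    \<le> ennreal (john_nirenberg_const DIM('a) q * \<beta> powr q)"
proof -
  define n where "n = DIM('a)"
  define L where "L = 2 * 4 powr q * 10 ^ n"
  have p4: "1 \<le> 4 powr q" using q by (intro ge_one_powr_ge_zero) auto
  have L: "10 ^ n \<le> L" "0 < L" using p4 by (auto simp: L_def)
  define l where "l = L * \<beta>"
  have l: "0 < l" using L \<beta> by (simp add: l_def)
  define I where "I v c r = (\<integral>\<^sup>+y. epowr (ennreal (norm (b y - v))) q \<partial>ball_measure c r)" for v c r
  define S where "S = (SUP (c, r)\<in>UNIV \<times> {0<..}. I (a c r) c r)"
  have IS: "I (a c r) c r \<le> S" if "0 < r" for c r
    unfolding S_def using that by (intro SUP_upper2[of "(c, r)"]) auto
  have "S \<le> epowr (ennreal (2 * N)) q"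
    unfolding S_def
  proof (rule SUP_least, clarsimp)
    fix c :: 'a and r :: real assume r: "0 < r"
    interpret prob_space "ball_measure c r" using r by (rule prob_space_ball_measure)
    have "I (a c r) c r \<le> (\<integral>\<^sup>+y. epowr (ennreal (2 * N)) q \<partial>ball_measure c r)"
      unfolding I_def
    proof (intro nn_integral_mono epowr_mono ennreal_leI)
      fix y show "norm (b y - a c r) \<le> 2 * N" using norm_triangle_ineq4[of "b y" "a c r"] bN[of y] aN[of c r] by simp
    qed (use q in auto)
    then show "I (a c r) c r \<le> epowr (ennreal (2 * N)) q"
      by (simp only: nn_integral_const emeasure_space_1 mult_1_right)
  qed
  also have "\<dots> < top" using q by (intro epowr_less_top) auto
  finally have "S < top" .
  have main: "I (a c r) c r \<le> ennreal (\<beta> powr q * (2 powr q * L powr q + (1 + L) powr q / 2 + 2 powr q * (1 + 2 ^ n) powr q)) + ennreal (1/2) * S"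
    if r: "0 < r" for c r
  proof -
    define v where "v = a c (2 * r)"
    define g where "g y = ennreal (norm (b y - v))" for y
    have [measurable]: "g \<in> borel_measurable lebesgue" unfolding g_def by measurable
    have g2: "(\<integral>\<^sup>+y. g y \<partial>ball_measure c (2 * r)) \<le> ennreal \<beta>"
      using osc[of "2 * r" c] r by (simp add: g_def v_def)
    obtain C where C: "countable C"
      "\<And>i. i \<in> C \<Longrightarrow> 0 < snd i" "\<And>i. i \<in> C \<Longrightarrow> ball (fst i) (5 * snd i) \<subseteq> ball c (2 * r)"
      "disjoint_family_on (\<lambda>i. ball (fst i) (snd i)) C"
      "\<And>i. i \<in> C \<Longrightarrow> ennreal l \<le> (\<integral>\<^sup>+y. g y \<partial>ball_measure (fst i) (snd i))"
      "\<And>i. i \<in> C \<Longrightarrow> (\<integral>\<^sup>+y. g y \<partial>ball_measure (fst i) (5 * snd i)) \<le> ennreal l"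
      "AE x in lebesgue. x \<in> ball c r \<longrightarrow> x \<notin> (\<Union>i\<in>C. ball (fst i) (5 * snd i)) \<longrightarrow> g x \<le> ennreal l"
    proof (rule local_calderon_zygmund[of g r l c])
      have "ennreal (10 ^ DIM('a)) * (\<integral>\<^sup>+y. g y \<partial>ball_measure c (2 * r)) \<le> ennreal (10 ^ DIM('a)) * ennreal \<beta>"
        by (intro mult_left_mono g2) auto
      also have "\<dots> \<le> ennreal l" using L \<beta> by (auto simp: ennreal_mult[symmetric] l_def n_def intro!: ennreal_leI mult_right_mono)
      finally show "ennreal (10 ^ DIM('a)) * (\<integral>\<^sup>+y. g y \<partial>ball_measure c (2 * r)) \<le> ennreal l" .
    qed (use r l in auto)
    let ?V = "\<Union>i\<in>C. ball (fst i) (5 * snd i)"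
    have [measurable]: "?V \<in> sets lebesgue" by (intro sets.countable_UN'' C) auto
    \<comment> \<open>This bounds the q-average of |b - v| on every enlarged stopping ball. There b
      is within \<beta> of its own centre and within l of v on average, so the two centres differ by
      at most \<beta> + l.\<close>
    define X where "X = ennreal (2 powr q) * (S + epowr (ennreal (\<beta> + l)) q)"
    have ball_i: "(\<integral>\<^sup>+y. epowr (g y) q * indicator (ball (fst i) (5 * snd i)) y \<partial>lebesgue)
       \<le> X * ennreal (5 ^ n) * emeasure lebesgue (ball (fst i) (snd i))" if i: "i \<in> C" for i
    proof -
      let ?r = "5 * snd i" and ?c = "fst i"
      have r5: "0 < ?r" using C(2)[OF i] by simp
      interpret prob_space "ball_measure ?c ?r" using r5 by (rule prob_space_ball_measure)
      have "ennreal (norm (a ?c ?r - v)) \<le> ennreal \<beta> + ennreal l"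
        by (rule order_trans[OF norm_diff_le_nn_integral[of b]]) (use osc[OF r5] C(6)[OF i] in \<open>auto simp: g_def intro!: add_mono\<close>)
      then have "epowr (ennreal (norm (a ?c ?r - v))) q \<le> epowr (ennreal (\<beta> + l)) q"
        using q \<beta> l by (intro epowr_mono) auto
      moreover have "(\<integral>\<^sup>+y. epowr (g y) q \<partial>ball_measure ?c ?r) \<le> ennreal (2 powr q) * (I (a ?c ?r) ?c ?r + epowr (ennreal (norm (a ?c ?r - v))) q)"
        unfolding g_def I_def using q by (intro nn_integral_epowr_shift) auto
      ultimately have "(\<integral>\<^sup>+y. epowr (g y) q \<partial>ball_measure ?c ?r) \<le> X"
        unfolding X_def by (elim order_trans) (intro mult_left_mono add_mono IS[OF r5], auto)
      then have "(\<integral>\<^sup>+y. epowr (g y) q * indicator (ball ?c ?r) y \<partial>lebesgue) \<le> X * emeasure lebesgue (ball ?c ?r)"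
        using r5 by (subst (asm) ball_measure_le_iff) auto
      then show ?thesis using C(2)[OF i] emeasure_ball_scale[of 5 "snd i" ?c ?c] by (simp add: n_def mult.assoc)
    qed
    \<comment> \<open>On the disjoint balls before enlargement g averages at least l, so l times
      their total volume is at most the integral of g over the doubled ball.\<close>
    have sumC: "ennreal l * (\<integral>\<^sup>+i. emeasure lebesgue (ball (fst i) (snd i)) \<partial>count_space C) \<le> ennreal (\<beta> * 2 ^ n) * emeasure lebesgue (ball c r)"
    proof -
      have "ennreal l * (\<integral>\<^sup>+i. emeasure lebesgue (ball (fst i) (snd i)) \<partial>count_space C)
        = (\<integral>\<^sup>+i. ennreal l * emeasure lebesgue (ball (fst i) (snd i)) \<partial>count_space C)" by (simp add: nn_integral_cmult)
      also have "\<dots> \<le> (\<integral>\<^sup>+i. emeasure (density lebesgue g) (ball (fst i) (snd i)) \<partial>count_space C)"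
      proof (intro nn_integral_mono)
        fix i assume "i \<in> space (count_space C)"
        then have i: "i \<in> C" by simp
        show "ennreal l * emeasure lebesgue (ball (fst i) (snd i)) \<le> emeasure (density lebesgue g) (ball (fst i) (snd i))"
          using mult_right_mono[OF C(5)[OF i], of "emeasure lebesgue (ball (fst i) (snd i))"] C(2)[OF i]
          by (simp add: ball_measure_mult emeasure_density)
      qed
      also have "\<dots> = emeasure (density lebesgue g) (\<Union>i\<in>C. ball (fst i) (snd i))"
        using C(1,4) by (subst emeasure_UN_countable) auto
      also have "\<dots> \<le> emeasure (density lebesgue g) (ball c (2 * r))"
      proof (intro emeasure_mono UN_least)
        fix i assume i: "i \<in> C"
        have "ball (fst i) (snd i) \<subseteq> ball (fst i) (5 * snd i)" using C(2)[OF i] by (intro subset_ball) auto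
        with C(3)[OF i] show "ball (fst i) (snd i) \<subseteq> ball c (2 * r)" by blast
      qed auto
      also have "\<dots> = (\<integral>\<^sup>+y. g y \<partial>ball_measure c (2 * r)) * emeasure lebesgue (ball c (2 * r))"
        using r by (simp add: ball_measure_mult emeasure_density)
      also have "\<dots> \<le> ennreal \<beta> * emeasure lebesgue (ball c (2 * r))"
        by (intro mult_right_mono g2) auto
      also have "\<dots> = ennreal (\<beta> * 2 ^ n) * emeasure lebesgue (ball c r)"
        using r \<beta> emeasure_ball_scale[of 2 r c c] by (simp add: n_def ennreal_mult mult.assoc)
      finally show ?thesis .
    qed
    have vol: "(\<integral>\<^sup>+i. emeasure lebesgue (ball (fst i) (snd i)) \<partial>count_space C) \<le> ennreal (2 ^ n / L) * emeasure lebesgue (ball c r)"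
    proof -
      have "(\<integral>\<^sup>+i. emeasure lebesgue (ball (fst i) (snd i)) \<partial>count_space C)
         = ennreal (1 / l) * (ennreal l * (\<integral>\<^sup>+i. emeasure lebesgue (ball (fst i) (snd i)) \<partial>count_space C))"
        using l by (simp add: mult.assoc[symmetric] ennreal_mult[symmetric])
      also have "\<dots> \<le> ennreal (1 / l) * (ennreal (\<beta> * 2 ^ n) * emeasure lebesgue (ball c r))"
        by (intro mult_left_mono sumC) auto
      also have "\<dots> = ennreal (2 ^ n / L) * emeasure lebesgue (ball c r)"
        using l \<beta> L by (simp add: mult.assoc[symmetric] ennreal_mult[symmetric] l_def)
      finally show ?thesis .
    qed
    have "(\<integral>\<^sup>+y. epowr (g y) q * indicator (ball c r) y \<partial>lebesgue)
       \<le> (\<integral>\<^sup>+y. epowr (ennreal l) q * indicator (ball c r) y + epowr (g y) q * indicator ?V y \<partial>lebesgue)"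
      using C(7) by (intro nn_integral_mono_AE) (auto elim!: eventually_mono simp: q less_imp_le epowr_mono split: split_indicator)
    also have "\<dots> = epowr (ennreal l) q * emeasure lebesgue (ball c r) + emeasure (density lebesgue (\<lambda>y. epowr (g y) q)) ?V"
      by (simp add: nn_integral_add nn_integral_cmult_indicator emeasure_density)
    also have "emeasure (density lebesgue (\<lambda>y. epowr (g y) q)) ?V
       \<le> (\<integral>\<^sup>+i. emeasure (density lebesgue (\<lambda>y. epowr (g y) q)) (ball (fst i) (5 * snd i)) \<partial>count_space C)"
      using C(1) by (intro emeasure_UN_le_count_space) auto
    also have "\<dots> \<le> (\<integral>\<^sup>+i. X * ennreal (5 ^ n) * emeasure lebesgue (ball (fst i) (snd i)) \<partial>count_space C)"
      using ball_i by (intro nn_integral_mono) (auto simp: emeasure_density)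
    also have "\<dots> = X * ennreal (5 ^ n) * (\<integral>\<^sup>+i. emeasure lebesgue (ball (fst i) (snd i)) \<partial>count_space C)"
      by (simp add: nn_integral_cmult)
    also have "\<dots> \<le> X * ennreal (5 ^ n) * (ennreal (2 ^ n / L) * emeasure lebesgue (ball c r))"
      by (intro mult_left_mono vol) auto
    also have "ennreal (5 ^ n) * ennreal (2 ^ n / L) = ennreal (10 ^ n / L)"
      using L by (simp add: ennreal_mult[symmetric] power_mult_distrib[symmetric])
    then have "X * ennreal (5 ^ n) * (ennreal (2 ^ n / L) * emeasure lebesgue (ball c r)) = X * ennreal (10 ^ n / L) * emeasure lebesgue (ball c r)"
      by (metis mult.assoc)
    finally have "(\<integral>\<^sup>+y. epowr (g y) q \<partial>ball_measure c r) \<le> epowr (ennreal l) q + X * ennreal (10 ^ n / L)"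
      using r by (subst ball_measure_le_iff) (auto simp: distrib_right add_left_mono)
    then have gq: "I v c r \<le> epowr (ennreal l) q + X * ennreal (10 ^ n / L)" by (simp add: I_def g_def)
    interpret prob_space "ball_measure c r" using r by (rule prob_space_ball_measure)
    have "ennreal (norm (v - a c r)) \<le> (\<integral>\<^sup>+y. g y \<partial>ball_measure c r) + ennreal \<beta>"
      by (rule order_trans[OF norm_diff_le_nn_integral[of b]]) (use osc[OF r] in \<open>auto simp: g_def intro!: add_mono\<close>)
    also have "(\<integral>\<^sup>+y. g y \<partial>ball_measure c r) \<le> ennreal (2 ^ n) * (\<integral>\<^sup>+y. g y \<partial>ball_measure c (2 * r))"
      unfolding n_def using r by (intro ball_measure_mono_ball) (auto intro!: subset_ball)
    also have "\<dots> \<le> ennreal (2 ^ n) * ennreal \<beta>" by (intro mult_left_mono g2) auto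
    also have "ennreal (2 ^ n) * ennreal \<beta> + ennreal \<beta> = ennreal ((1 + 2 ^ n) * \<beta>)"
      using \<beta> by (simp add: ennreal_mult[symmetric] ennreal_plus[symmetric] distrib_right add.commute del: ennreal_plus)
    finally have "ennreal (norm (v - a c r)) \<le> ennreal ((1 + 2 ^ n) * \<beta>)"
      by (simp add: add_right_mono)
    then have vq: "epowr (ennreal (norm (v - a c r))) q \<le> epowr (ennreal ((1 + 2 ^ n) * \<beta>)) q"
      using q by (intro epowr_mono) auto
    have "I (a c r) c r \<le> ennreal (2 powr q) * (I v c r + epowr (ennreal (norm (v - a c r))) q)"
      unfolding I_def using q by (intro nn_integral_epowr_shift) auto
    also have "\<dots> \<le> ennreal (2 powr q) * (epowr (ennreal l) q + X * ennreal (10 ^ n / L) + epowr (ennreal ((1 + 2 ^ n) * \<beta>)) q)"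
      by (intro mult_left_mono add_mono gq vq) auto
    also have "\<dots> = ennreal (2 powr q) * (epowr (ennreal l) q + epowr (ennreal ((1 + 2 ^ n) * \<beta>)) q) + ennreal (2 powr q * 2 powr q * (10 ^ n / L)) * (S + epowr (ennreal (\<beta> + l)) q)"
    proof -
      have "P * (A + P * Y * k + B) = P * (A + B) + P * P * k * Y" for P A B Y k :: ennreal
        by (simp add: distrib_left ac_simps)
      moreover have "ennreal (2 powr q * 2 powr q * (10 ^ n / L)) = ennreal (2 powr q) * ennreal (2 powr q) * ennreal (10 ^ n / L)"
        using L by (subst ennreal_mult, simp, simp, subst ennreal_mult) auto
      ultimately show ?thesis unfolding X_def by (simp only:)
    qed
    also have "2 powr q * 2 powr q * (10 ^ n / L) = 1 / 2"
      by (simp add: L_def powr_mult[symmetric])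
    also have "ennreal (2 powr q) * (epowr (ennreal l) q + epowr (ennreal ((1 + 2 ^ n) * \<beta>)) q) + ennreal (1/2) * (S + epowr (ennreal (\<beta> + l)) q)
      = ennreal (\<beta> powr q * (2 powr q * L powr q + (1 + L) powr q / 2 + 2 powr q * (1 + 2 ^ n) powr q)) + ennreal (1/2) * S"
    proof -
      have "\<beta> + l = (1 + L) * \<beta>" by (simp add: l_def distrib_right)
      then have e1: "epowr (ennreal (\<beta> + l)) q = ennreal ((1 + L) powr q * \<beta> powr q)"
        using q L \<beta> by (simp add: epowr_ennreal powr_mult)
      have e2: "epowr (ennreal l) q = ennreal (L powr q * \<beta> powr q)" "epowr (ennreal ((1 + 2 ^ n) * \<beta>)) q = ennreal ((1 + 2 ^ n) powr q * \<beta> powr q)"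
        using q L \<beta> by (simp_all add: l_def epowr_ennreal powr_mult)
      have gen: "ennreal P * (ennreal u + ennreal v) + ennreal h * (S + ennreal t) = ennreal (P * u + P * v + h * t) + ennreal h * S"
        if "0 \<le> P" "0 \<le> u" "0 \<le> v" "0 \<le> h" "0 \<le> t" for P u v h t
        using that by (simp add: distrib_left ennreal_mult ac_simps)
      have "ennreal (2 powr q) * (epowr (ennreal l) q + epowr (ennreal ((1 + 2 ^ n) * \<beta>)) q) + ennreal (1/2) * (S + epowr (ennreal (\<beta> + l)) q)
        = ennreal (2 powr q * (L powr q * \<beta> powr q) + 2 powr q * ((1 + 2 ^ n) powr q * \<beta> powr q) + 1/2 * ((1 + L) powr q * \<beta> powr q)) + ennreal (1/2) * S"
        unfolding e1 e2 by (rule gen) (use L in auto)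
      also have "2 powr q * (L powr q * \<beta> powr q) + 2 powr q * ((1 + 2 ^ n) powr q * \<beta> powr q) + 1/2 * ((1 + L) powr q * \<beta> powr q)
        = \<beta> powr q * (2 powr q * L powr q + (1 + L) powr q / 2 + 2 powr q * (1 + 2 ^ n) powr q)"
        by (simp add: algebra_simps)
      finally show ?thesis .
    qed
    finally show ?thesis .
  qed
  have "S \<le> ennreal (\<beta> powr q * (2 powr q * L powr q + (1 + L) powr q / 2 + 2 powr q * (1 + 2 ^ n) powr q)) + ennreal (1/2) * S"
    using main by (subst S_def) (auto intro!: SUP_least)
  then have "S \<le> 2 * ennreal (\<beta> powr q * (2 powr q * L powr q + (1 + L) powr q / 2 + 2 powr q * (1 + 2 ^ n) powr q))"
    using \<open>S < top\<close> by (rule ennreal_absorb_half)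
  also have "\<dots> = ennreal (john_nirenberg_const DIM('a) q * \<beta> powr q)"
  proof -
    have jn: "john_nirenberg_const DIM('a) q = 2 * (2 powr q * L powr q + (1 + L) powr q / 2 + 2 powr q * (1 + 2 ^ n) powr q)"
      unfolding john_nirenberg_const_def Let_def L_def n_def by (rule refl)
    show ?thesis unfolding jn
      by (subst ennreal_numeral[symmetric], subst ennreal_mult[symmetric]) (auto simp: ac_simps)
  qed
  finally show ?thesis using IS[OF r, of c] by (simp add: I_def)
qed

section \<open>Muckenhoupt weights\<close>

lemma ennreal_mult_le_cancel_right:
  "v \<noteq> 0 \<Longrightarrow> v \<noteq> top \<Longrightarrow> x * v \<le> y * v \<longleftrightarrow> x \<le> (y::ennreal)"
  by (cases v; cases x; cases y)
    (auto simp: ennreal_mult[symmetric] ennreal_le_iff ennreal_top_mult top_unique mult_le_cancel_right)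

lemma lebesgue_superlevel:
  fixes f :: "'a::euclidean_space \<Rightarrow> 'b::{second_countable_topology, linorder_topology}"
  assumes [measurable]: "f \<in> borel_measurable lebesgue"
  shows "{y. u < f y} \<in> sets lebesgue"
proof -
  have "{y \<in> space lebesgue. u < f y} \<in> sets lebesgue" by measurable
  then show ?thesis by simp
qed

lemma layer_cake_measurable:
  assumes [measurable]: "g \<in> borel_measurable M" "h \<in> borel_measurable M" and "sigma_finite_measure M"
  shows "(\<lambda>l. \<integral>\<^sup>+x. h x * indicator {x. ennreal l < g x} x \<partial>M) \<in> borel_measurable lborel"
proof -
  interpret sigma_finite_measure M by fact
  show ?thesis by (intro borel_measurable_nn_integral) (simp add: indicator_def)
qed

lemma sigma_finite_lebesgue: "sigma_finite_measure (lebesgue :: 'a::euclidean_space measure)"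
proof
  have "(\<Union>n. ball (0::'a) (real n)) = UNIV"
    using reals_Archimedean2 by (auto simp: mem_ball)
  then show "\<exists>A. countable A \<and> A \<subseteq> sets lebesgue \<and> \<Union> A = space (lebesgue :: 'a measure) \<and> (\<forall>a\<in>A. emeasure lebesgue a \<noteq> \<infinity>)"
    by (intro exI[of _ "range (\<lambda>n. ball 0 (real n))"]) auto
qed

text \<open>The bounds \<open>m\<close> and \<open>N\<close> enter no estimate; they make averages of powers of \<open>W\<close> finite,
  so that such averages can be absorbed.\<close>

definition ap_bound :: "real \<Rightarrow> real \<Rightarrow> ('a::euclidean_space \<Rightarrow> real) \<Rightarrow> bool" where
  "ap_bound t K W \<longleftrightarrow> W \<in> borel_measurable lebesgue \<and> (\<exists>m>0. \<exists>N. \<forall>x. m \<le> W x \<and> W x \<le> N) \<and>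
    (\<forall>c r. 0 < r \<longrightarrow> (\<integral>\<^sup>+y. ennreal (W y) \<partial>ball_measure c r) *
       epowr (\<integral>\<^sup>+y. ennreal (W y powr (- 1 / (t - 1))) \<partial>ball_measure c r) (t - 1) \<le> ennreal K)"

lemma ap_boundD:
  assumes "ap_bound t K W"
  shows "W \<in> borel_measurable lebesgue"
    and "0 < W x"
    and "0 < r \<Longrightarrow> (\<integral>\<^sup>+y. ennreal (W y) \<partial>ball_measure c r) *
       epowr (\<integral>\<^sup>+y. ennreal (W y powr (- 1 / (t - 1))) \<partial>ball_measure c r) (t - 1) \<le> ennreal K"
  using assms by (auto simp: ap_bound_def intro: less_le_trans)

lemma ap_bound_obtain:
  assumes "ap_bound t K W"
  obtains m N where "0 < m" "\<And>x. m \<le> W x" "\<And>x. W x \<le> N"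
  using assms unfolding ap_bound_def by blast

lemma (in prob_space) nn_integral_bounds:
  assumes "\<And>x. m \<le> f x" "\<And>x. f x \<le> N"
  shows "m \<le> (\<integral>\<^sup>+x. f x \<partial>M)" "(\<integral>\<^sup>+x. f x \<partial>M) \<le> N"
proof -
  have "(\<integral>\<^sup>+x. m \<partial>M) \<le> (\<integral>\<^sup>+x. f x \<partial>M)" "(\<integral>\<^sup>+x. f x \<partial>M) \<le> (\<integral>\<^sup>+x. N \<partial>M)"
    by (intro nn_integral_mono assms)+
  then show "m \<le> (\<integral>\<^sup>+x. f x \<partial>M)" "(\<integral>\<^sup>+x. f x \<partial>M) \<le> N"
    by (simp_all only: nn_integral_const emeasure_space_1 mult_1_right)
qed

lemma ap_bound_avg:
  assumes "ap_bound t K W" "0 < r"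
  obtains A where "(\<integral>\<^sup>+y. ennreal (W y) \<partial>ball_measure (c::'a::euclidean_space) r) = ennreal A" "0 < A"
proof -
  obtain m N where mN: "0 < m" "\<And>x. m \<le> W x" "\<And>x. W x \<le> N" using ap_bound_obtain[OF assms(1)] by blast
  interpret prob_space "ball_measure c r" using assms(2) by (rule prob_space_ball_measure)
  have "ennreal m \<le> (\<integral>\<^sup>+y. ennreal (W y) \<partial>ball_measure c r)" "(\<integral>\<^sup>+y. ennreal (W y) \<partial>ball_measure c r) \<le> ennreal N"
    using mN by (auto intro!: nn_integral_bounds ennreal_leI)
  then show thesis using mN(1) that
    by (cases "\<integral>\<^sup>+y. ennreal (W y) \<partial>ball_measure c r") (auto simp: top_unique ennreal_le_iff2 less_le_trans)
qed

text \<open>Hoelder's inequality with exponents t and t' for 1_E = (W 1_E)^(1/t) W^(-1/t) on E,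
  where W^(-1/t) is the power 1 - 1/t of the dual weight. Consequently a set that fills a fixed
  share of a ball carries a fixed share of its W-mass.\<close>

lemma ap_bound_measure:
  assumes W: "ap_bound t K W" and t: "1 < t" and r: "0 < r" and [measurable]: "E \<in> sets lebesgue"
  shows "epowr (emeasure (ball_measure (c::'a::euclidean_space) r) E) t * (\<integral>\<^sup>+y. ennreal (W y) \<partial>ball_measure c r)
    \<le> ennreal K * (\<integral>\<^sup>+y. ennreal (W y) * indicator E y \<partial>ball_measure c r)"
proof -
  have [measurable]: "W \<in> borel_measurable lebesgue" by (rule ap_boundD[OF W])
  let ?P = "ball_measure c r"
  define s where "s y = ennreal (W y powr (- 1 / (t - 1)))" for y
  have "emeasure ?P E = (\<integral>\<^sup>+y. epowr (ennreal (W y) * indicator E y) (1/t) * epowr (s y) (1 - 1/t) \<partial>?P)"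
  proof (subst nn_integral_indicator[symmetric], simp, intro nn_integral_cong)
    fix y
    have "epowr (ennreal (W y)) (1/t) * epowr (s y) (1 - 1/t) = ennreal (W y powr (1/t) * W y powr (- 1 / (t - 1) * (1 - 1/t)))"
      using ap_boundD(2)[OF W, of y] t by (simp add: s_def epowr_ennreal_pos powr_powr ennreal_mult)
    also have "W y powr (1/t) * W y powr (- 1 / (t - 1) * (1 - 1/t)) = 1"
    proof -
      have "1/t + - 1 / (t - 1) * (1 - 1/t) = 0" using t by (simp add: field_simps)
      then show ?thesis using ap_boundD(2)[OF W, of y] by (simp only: powr_add[symmetric]) simp
    qed
    finally show "indicator E y = epowr (ennreal (W y) * indicator E y) (1/t) * epowr (s y) (1 - 1/t)"
      using t by (auto split: split_indicator)
  qed
  also have "\<dots> \<le> epowr (\<integral>\<^sup>+y. ennreal (W y) * indicator E y \<partial>?P) (1/t) * epowr (\<integral>\<^sup>+y. s y \<partial>?P) (1 - 1/t)"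
    unfolding s_def using t by (intro hoelder_nn_integral) auto
  finally have "epowr (emeasure ?P E) t \<le> epowr (epowr (\<integral>\<^sup>+y. ennreal (W y) * indicator E y \<partial>?P) (1/t) * epowr (\<integral>\<^sup>+y. s y \<partial>?P) (1 - 1/t)) t"
    using t by (intro epowr_mono) auto
  also have "\<dots> = (\<integral>\<^sup>+y. ennreal (W y) * indicator E y \<partial>?P) * epowr (\<integral>\<^sup>+y. s y \<partial>?P) (t - 1)"
  proof -
    have "(1 - 1/t) * t = t - 1" using t by (simp add: field_simps)
    then show ?thesis using t by (simp add: epowr_mult epowr_epowr)
  qed
  finally have "epowr (emeasure ?P E) t * (\<integral>\<^sup>+y. ennreal (W y) \<partial>?P)
     \<le> (\<integral>\<^sup>+y. ennreal (W y) * indicator E y \<partial>?P) * epowr (\<integral>\<^sup>+y. s y \<partial>?P) (t - 1) * (\<integral>\<^sup>+y. ennreal (W y) \<partial>?P)"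
    by (intro mult_right_mono) auto
  also have "\<dots> = (\<integral>\<^sup>+y. ennreal (W y) * indicator E y \<partial>?P) * ((\<integral>\<^sup>+y. ennreal (W y) \<partial>?P) * epowr (\<integral>\<^sup>+y. s y \<partial>?P) (t - 1))"
    by (simp add: ac_simps)
  also have "\<dots> \<le> (\<integral>\<^sup>+y. ennreal (W y) * indicator E y \<partial>?P) * ennreal K"
    unfolding s_def by (intro mult_left_mono ap_boundD(3)[OF W r]) auto
  finally show ?thesis by (simp add: ac_simps)
qed

text \<open>The preceding comparison with E the smaller ball, which fills the share s^(-n) of the
  larger one.\<close>

lemma ap_bound_doubling:
  fixes W :: "'a::euclidean_space \<Rightarrow> real"
  assumes W: "ap_bound t K W" and t: "1 < t" and r: "0 < r" and s: "1 \<le> s" and K: "0 \<le> K"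
  shows "(\<integral>\<^sup>+y. ennreal (W y) \<partial>ball_measure c (s * r)) \<le> ennreal (K * (s ^ DIM('a)) powr t) * (\<integral>\<^sup>+y. ennreal (W y) \<partial>ball_measure c r)"
    and "(\<integral>\<^sup>+y. ennreal (W y) * indicator (ball c (s * r)) y \<partial>lebesgue)
      \<le> ennreal (K * (s ^ DIM('a)) powr t) * (\<integral>\<^sup>+y. ennreal (W y) * indicator (ball c r) y \<partial>lebesgue)"
proof -
  have [measurable]: "W \<in> borel_measurable lebesgue" by (rule ap_boundD[OF W])
  define d where "d = s ^ DIM('a)"
  have d: "1 \<le> d" using s by (simp add: d_def)
  have sr: "0 < s * r" "ball c r \<subseteq> ball c (s * r)" using r s by (auto intro!: subset_ball)
  have v: "emeasure lebesgue (ball c (s * r)) = ennreal d * emeasure lebesgue (ball c r)"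
    using r s emeasure_ball_scale[of s r c c] by (simp add: d_def)
  have "emeasure (ball_measure c (s * r)) (ball c r) = ennreal (1 / d)"
  proof -
    have "emeasure (ball_measure c (s * r)) (ball c r) = emeasure lebesgue (ball c r) / (ennreal d * emeasure lebesgue (ball c r))"
      using sr(2) by (simp add: emeasure_ball_measure v Int_absorb1)
    also have "\<dots> = (1 * emeasure lebesgue (ball c r)) / (ennreal d * emeasure lebesgue (ball c r))" by simp
    also have "\<dots> = 1 / ennreal d" using r by (intro divide_mult_eq) auto
    also have "\<dots> = ennreal (1 / d)" using d divide_ennreal[of 1 d] by simp
    finally show ?thesis .
  qed
  then have "epowr (ennreal (1 / d)) t * (\<integral>\<^sup>+y. ennreal (W y) \<partial>ball_measure c (s * r))
    \<le> ennreal K * (\<integral>\<^sup>+y. ennreal (W y) * indicator (ball c r) y \<partial>ball_measure c (s * r))"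
    using ap_bound_measure[OF W t sr(1), of "ball c r" c] by simp
  then have "ennreal (d powr t) * (epowr (ennreal (1 / d)) t * (\<integral>\<^sup>+y. ennreal (W y) \<partial>ball_measure c (s * r)))
    \<le> ennreal (d powr t) * (ennreal K * (\<integral>\<^sup>+y. ennreal (W y) * indicator (ball c r) y \<partial>ball_measure c (s * r)))"
    by (intro mult_left_mono) auto
  moreover have "ennreal (d powr t) * epowr (ennreal (1 / d)) t = 1"
    using d by (simp add: epowr_ennreal_pos ennreal_mult[symmetric] powr_mult[symmetric])
  ultimately have *: "(\<integral>\<^sup>+y. ennreal (W y) \<partial>ball_measure c (s * r))
    \<le> ennreal (K * d powr t) * (\<integral>\<^sup>+y. ennreal (W y) * indicator (ball c r) y \<partial>ball_measure c (s * r))"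
    using K by (simp add: mult.assoc[symmetric] ennreal_mult[symmetric] mult.commute[of K])
  have ind: "(\<integral>\<^sup>+y. ennreal (W y) * indicator (ball c r) y \<partial>ball_measure c (s * r)) * emeasure lebesgue (ball c (s * r))
     = (\<integral>\<^sup>+y. ennreal (W y) * indicator (ball c r) y \<partial>lebesgue)"
    using sr by (subst ball_measure_mult) (auto intro!: nn_integral_cong split: split_indicator)
  have "(\<integral>\<^sup>+y. ennreal (W y) * indicator (ball c (s * r)) y \<partial>lebesgue) = (\<integral>\<^sup>+y. ennreal (W y) \<partial>ball_measure c (s * r)) * emeasure lebesgue (ball c (s * r))"
    using sr by (simp add: ball_measure_mult)
  also have "\<dots> \<le> ennreal (K * d powr t) * (\<integral>\<^sup>+y. ennreal (W y) * indicator (ball c r) y \<partial>ball_measure c (s * r)) * emeasure lebesgue (ball c (s * r))"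
    by (intro mult_right_mono *) auto
  also have "\<dots> = ennreal (K * d powr t) * (\<integral>\<^sup>+y. ennreal (W y) * indicator (ball c r) y \<partial>lebesgue)"
    by (simp only: mult.assoc ind)
  finally show "(\<integral>\<^sup>+y. ennreal (W y) * indicator (ball c (s * r)) y \<partial>lebesgue)
      \<le> ennreal (K * (s ^ DIM('a)) powr t) * (\<integral>\<^sup>+y. ennreal (W y) * indicator (ball c r) y \<partial>lebesgue)"
    by (simp add: d_def)
  have "(\<integral>\<^sup>+y. ennreal (W y) * indicator (ball c r) y \<partial>ball_measure c (s * r)) \<le> (\<integral>\<^sup>+y. ennreal (W y) \<partial>ball_measure c r)"
  proof (subst ball_measure_le_iff)
    have "(\<integral>\<^sup>+y. ennreal (W y) * indicator (ball c r) y * indicator (ball c (s * r)) y \<partial>lebesgue)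
      = (\<integral>\<^sup>+y. ennreal (W y) \<partial>ball_measure c r) * emeasure lebesgue (ball c r)"
      using r sr by (subst ball_measure_mult) (auto intro!: nn_integral_cong split: split_indicator)
    also have "\<dots> \<le> (\<integral>\<^sup>+y. ennreal (W y) \<partial>ball_measure c r) * emeasure lebesgue (ball c (s * r))"
      using sr(2) by (intro mult_left_mono emeasure_mono) auto
    finally show "(\<integral>\<^sup>+y. ennreal (W y) * indicator (ball c r) y * indicator (ball c (s * r)) y \<partial>lebesgue) \<le> \<dots>" .
  qed (use sr in auto)
  then show "(\<integral>\<^sup>+y. ennreal (W y) \<partial>ball_measure c (s * r)) \<le> ennreal (K * (s ^ DIM('a)) powr t) * (\<integral>\<^sup>+y. ennreal (W y) \<partial>ball_measure c r)"
    unfolding d_def[symmetric] by (intro order_trans[OF *] mult_left_mono) auto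
qed

section \<open>The reverse Hoelder inequality\<close>

text \<open>The part of the ball where W \<le> 2^(-t) l / K contributes at most 2^(-t) / K times the
  average of W. By \<open>ap_bound_measure\<close> the t-th power of its share is at most 2^(-t), so
  it fills at most half of the ball.\<close>

lemma ap_bound_level:
  fixes W :: "'a::euclidean_space \<Rightarrow> real"
  assumes W: "ap_bound t K W" and t: "1 < t" and r: "0 < r" and K: "1 \<le> K" and l: "0 < l"
    and le: "ennreal l \<le> (\<integral>\<^sup>+y. ennreal (W y) \<partial>ball_measure c r)"
  shows "emeasure lebesgue (ball c r) \<le> 2 * emeasure lebesgue (ball c r \<inter> {y. 2 powr (- t) / K * l < W y})"
proof -
  have [measurable]: "W \<in> borel_measurable lebesgue" by (rule ap_boundD[OF W])
  let ?P = "ball_measure c r"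
  interpret prob_space ?P using r by (rule prob_space_ball_measure)
  define \<beta> where "\<beta> = 2 powr (- t) / K"
  have \<beta>: "0 < \<beta>" using K by (simp add: \<beta>_def)
  define E where "E = {y. W y \<le> \<beta> * l}"
  have [measurable]: "{y. \<beta> * l < W y} \<in> sets lebesgue" by (intro lebesgue_superlevel) measurable
  have "{y \<in> space lebesgue. W y \<le> \<beta> * l} \<in> sets lebesgue" by measurable
  then have [measurable]: "E \<in> sets lebesgue" by (simp add: E_def)
  obtain A where A: "(\<integral>\<^sup>+y. ennreal (W y) \<partial>?P) = ennreal A" "0 < A" by (rule ap_bound_avg[OF W r])
  have lA: "l \<le> A" using le A l by (simp add: ennreal_le_iff)
  have "(\<integral>\<^sup>+y. ennreal (W y) * indicator E y \<partial>?P) \<le> (\<integral>\<^sup>+y. ennreal (\<beta> * l) \<partial>?P)"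
    by (intro nn_integral_mono) (auto simp: E_def ennreal_leI split: split_indicator)
  also have "\<dots> = ennreal (\<beta> * l)" by (simp only: nn_integral_const emeasure_space_1 mult_1_right)
  finally have wE: "(\<integral>\<^sup>+y. ennreal (W y) * indicator E y \<partial>?P) \<le> ennreal (\<beta> * l)" .
  have "epowr (emeasure ?P E) t * ennreal A \<le> ennreal K * (\<integral>\<^sup>+y. ennreal (W y) * indicator E y \<partial>?P)"
    using ap_bound_measure[OF W t r, of E c] unfolding A by simp
  also have "\<dots> \<le> ennreal K * ennreal (\<beta> * l)" by (intro mult_left_mono wE) auto
  also have "\<dots> = ennreal (2 powr (- t) * l)" using K \<beta> l by (simp add: ennreal_mult[symmetric] \<beta>_def)
  also have "\<dots> \<le> ennreal (2 powr (- t) * A)" using lA by (intro ennreal_leI mult_left_mono) auto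
  also have "\<dots> = ennreal (2 powr (- t)) * ennreal A" using A by (simp add: ennreal_mult)
  finally have "epowr (emeasure ?P E) t \<le> ennreal (2 powr (- t))"
    using A(2) by (subst (asm) ennreal_mult_le_cancel_right) auto
  also have "\<dots> = epowr (ennreal (1/2)) t"
  proof -
    have "(1/2) powr t = 2 powr (- t)" by (simp add: powr_minus_divide powr_divide)
    then show ?thesis by (subst epowr_ennreal_pos) (simp, simp only:)
  qed
  finally have "emeasure ?P E \<le> ennreal (1/2)" using t epowr_le_iff[of t "emeasure ?P E" "ennreal (1/2)"] by simp
  then have pE: "prob E \<le> 1/2" unfolding emeasure_eq_measure by (subst (asm) ennreal_le_iff) auto
  have "prob (space ?P - E) = 1 - prob E" by (rule prob_compl) simp
  then have "1/2 \<le> prob (space ?P - E)" using pE by simp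
  then have "ennreal (1/2) \<le> emeasure ?P (space ?P - E)" unfolding emeasure_eq_measure by (rule ennreal_leI)
  also have "space ?P - E = {y. \<beta> * l < W y}" by (auto simp: E_def)
  finally have "ennreal (1/2) * emeasure lebesgue (ball c r) \<le> emeasure ?P {y. \<beta> * l < W y} * emeasure lebesgue (ball c r)"
    by (intro mult_right_mono) auto
  also have "emeasure ?P {y. \<beta> * l < W y} * emeasure lebesgue (ball c r) = emeasure lebesgue (ball c r \<inter> {y. \<beta> * l < W y})"
    using r emeasure_ball_finite[of c r]
    by (subst emeasure_ball_measure) (auto simp: ennreal_divide_times ennreal_times_divide[symmetric] less_top)
  finally have "2 * (ennreal (1/2) * emeasure lebesgue (ball c r)) \<le> 2 * emeasure lebesgue (ball c r \<inter> {y. \<beta> * l < W y})"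
    by (intro mult_left_mono) auto
  moreover have "2 * (ennreal (1/2) * x) = x" for x
  proof -
    have "2 * ennreal (1/2) = ennreal (2 * (1/2))" by (subst ennreal_mult) auto
    then show ?thesis by (simp add: mult.assoc[symmetric])
  qed
  ultimately show ?thesis by (simp only: \<beta>_def)
qed

text \<open>Each stopping ball has W-average at least l, and its enlargement at most l; half of the
  ball lies in a slightly lower superlevel set. The W-mass above l is thereby bounded by l times a
  Lebesgue measure, the input of Gehring's argument.\<close>

lemma ap_bound_superlevel:
  fixes W :: "'a::euclidean_space \<Rightarrow> real"
  assumes W: "ap_bound t K W" and t: "1 < t" and R: "0 < R" and K: "1 \<le> K" and l: "0 < l"
    and le: "ennreal (10 ^ DIM('a)) * (\<integral>\<^sup>+y. ennreal (W y) \<partial>ball_measure c (2 * R)) \<le> ennreal l"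
  shows "(\<integral>\<^sup>+y. ennreal (W y) * indicator (ball c R) y * indicator {y. ennreal l < ennreal (W y)} y \<partial>lebesgue)
    \<le> ennreal (2 * 5 ^ DIM('a)) * ennreal l * emeasure lebesgue (ball c (2 * R) \<inter> {y. 2 powr (- t) / K * l < W y})"
proof -
  have [measurable]: "W \<in> borel_measurable lebesgue" by (rule ap_boundD[OF W])
  define n where "n = DIM('a)"
  define H where "H = {y. 2 powr (- t) / K * l < W y}"
  have [measurable]: "H \<in> sets lebesgue" unfolding H_def by (intro lebesgue_superlevel) measurable
  obtain C where C: "countable C"
    "\<And>i. i \<in> C \<Longrightarrow> 0 < snd i" "\<And>i. i \<in> C \<Longrightarrow> ball (fst i) (5 * snd i) \<subseteq> ball c (2 * R)"
    "disjoint_family_on (\<lambda>i. ball (fst i) (snd i)) C"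
    "\<And>i. i \<in> C \<Longrightarrow> ennreal l \<le> (\<integral>\<^sup>+y. ennreal (W y) \<partial>ball_measure (fst i) (snd i))"
    "\<And>i. i \<in> C \<Longrightarrow> (\<integral>\<^sup>+y. ennreal (W y) \<partial>ball_measure (fst i) (5 * snd i)) \<le> ennreal l"
    "AE x in lebesgue. x \<in> ball c R \<longrightarrow> x \<notin> (\<Union>i\<in>C. ball (fst i) (5 * snd i)) \<longrightarrow> ennreal (W x) \<le> ennreal l"
  proof (rule local_calderon_zygmund[of "\<lambda>y. ennreal (W y)" R l c])
    show "(\<lambda>y. ennreal (W y)) \<in> borel_measurable lebesgue" by measurable
  qed (use R l le in auto)
  let ?V = "\<Union>i\<in>C. ball (fst i) (5 * snd i)"
  let ?D = "density lebesgue (\<lambda>y. ennreal (W y))"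
  have [measurable]: "?V \<in> sets lebesgue" by (intro sets.countable_UN'' C) auto
  have "(\<integral>\<^sup>+y. ennreal (W y) * indicator (ball c R) y * indicator {y. ennreal l < ennreal (W y)} y \<partial>lebesgue)
    \<le> (\<integral>\<^sup>+y. ennreal (W y) * indicator ?V y \<partial>lebesgue)"
    using C(7) by (intro nn_integral_mono_AE) (auto elim!: eventually_mono split: split_indicator)
  also have "\<dots> = emeasure ?D ?V" by (simp add: emeasure_density)
  also have "\<dots> \<le> (\<integral>\<^sup>+i. emeasure ?D (ball (fst i) (5 * snd i)) \<partial>count_space C)"
    using C(1) by (intro emeasure_UN_le_count_space) auto
  also have "\<dots> \<le> (\<integral>\<^sup>+i. ennreal (2 * 5 ^ n) * ennreal l * emeasure lebesgue (ball (fst i) (snd i) \<inter> H) \<partial>count_space C)"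
  proof (intro nn_integral_mono)
    fix i assume "i \<in> space (count_space C)"
    then have i: "i \<in> C" by simp
    have "emeasure ?D (ball (fst i) (5 * snd i)) = (\<integral>\<^sup>+y. ennreal (W y) \<partial>ball_measure (fst i) (5 * snd i)) * emeasure lebesgue (ball (fst i) (5 * snd i))"
      using C(2)[OF i] by (simp add: ball_measure_mult emeasure_density)
    also have "\<dots> \<le> ennreal l * (ennreal (5 ^ n) * emeasure lebesgue (ball (fst i) (snd i)))"
      using C(2)[OF i] emeasure_ball_scale[of 5 "snd i" "fst i" "fst i"]
      by (intro mult_mono C(6)[OF i]) (auto simp: n_def)
    also have "\<dots> \<le> ennreal l * (ennreal (5 ^ n) * (2 * emeasure lebesgue (ball (fst i) (snd i) \<inter> H)))"
      unfolding H_def by (intro mult_left_mono ap_bound_level[OF W t C(2)[OF i] K l C(5)[OF i]]) auto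
    also have "\<dots> = ennreal (2 * 5 ^ n) * ennreal l * emeasure lebesgue (ball (fst i) (snd i) \<inter> H)"
      by (simp add: ennreal_mult ac_simps)
    finally show "emeasure ?D (ball (fst i) (5 * snd i)) \<le> \<dots>" .
  qed
  also have "\<dots> = ennreal (2 * 5 ^ n) * ennreal l * (\<integral>\<^sup>+i. emeasure lebesgue (ball (fst i) (snd i) \<inter> H) \<partial>count_space C)"
    by (simp add: nn_integral_cmult)
  also have "(\<integral>\<^sup>+i. emeasure lebesgue (ball (fst i) (snd i) \<inter> H) \<partial>count_space C) = emeasure lebesgue (\<Union>i\<in>C. ball (fst i) (snd i) \<inter> H)"
  proof (intro emeasure_UN_countable[symmetric])
    show "disjoint_family_on (\<lambda>i. ball (fst i) (snd i) \<inter> H) C"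
      using C(4) unfolding disjoint_family_on_def by blast
  qed (use C(1) in auto)
  also have "\<dots> \<le> emeasure lebesgue (ball c (2 * R) \<inter> H)"
  proof (intro emeasure_mono UN_least)
    fix i assume i: "i \<in> C"
    have "ball (fst i) (snd i) \<subseteq> ball (fst i) (5 * snd i)" using C(2)[OF i] by (intro subset_ball) auto
    with C(3)[OF i] show "ball (fst i) (snd i) \<inter> H \<subseteq> ball c (2 * R) \<inter> H" by blast
  qed auto
  finally show ?thesis by (simp add: H_def n_def mult_left_mono)
qed

text \<open>The superlevel estimate is integrated against e s^(e-1) ds. Levels below l are estimated
  trivially and give l^e times the average of W. The higher ones return the average of W^(1+e) over
  the doubled ball with a factor e in front, which is what makes that term small.\<close>

lemma ap_bound_gehring_step:
  fixes W :: "'a::euclidean_space \<Rightarrow> real"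
  assumes W: "ap_bound t K W" and t: "1 < t" and R: "0 < R" and K: "1 \<le> K" and e: "0 < e"
    and l: "0 < l" "ennreal (10 ^ DIM('a)) * (\<integral>\<^sup>+y. ennreal (W y) \<partial>ball_measure c (2 * R)) \<le> ennreal l"
  shows "(\<integral>\<^sup>+y. epowr (ennreal (W y)) (1 + e) \<partial>ball_measure c R)
    \<le> ennreal (l powr e) * (\<integral>\<^sup>+y. ennreal (W y) \<partial>ball_measure c R)
      + ennreal (2 * 10 ^ DIM('a) * e * (K * 2 powr t) powr (1 + e)) * (\<integral>\<^sup>+y. epowr (ennreal (W y)) (1 + e) \<partial>ball_measure c (2 * R))"
proof -
  have [measurable]: "W \<in> borel_measurable lebesgue" by (rule ap_boundD[OF W])
  have Wpos: "0 < W y" for y by (rule ap_boundD(2)[OF W])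
  define n where "n = DIM('a)"
  define \<beta> where "\<beta> = 2 powr (- t) / K"
  have \<beta>: "0 < \<beta>" using K by (simp add: \<beta>_def)
  let ?X = "\<integral>\<^sup>+y. ennreal (W y) * indicator (ball c R) y \<partial>lebesgue"
  let ?Y = "\<lambda>s. \<integral>\<^sup>+y. indicator (ball c (2 * R)) y * indicator {y. ennreal s < ennreal (W y / \<beta>)} y \<partial>lebesgue"
  have lev: "(\<integral>\<^sup>+y. ennreal (W y) * indicator (ball c R) y * indicator {y. ennreal s < ennreal (W y)} y \<partial>lebesgue)
    \<le> (if s < l then ?X else 0) + ennreal (2 * 5 ^ n) * (ennreal s * ?Y s)" if s: "0 < s" for s
  proof (cases "s < l")
    case True
    then show ?thesis by (auto intro!: add_increasing2 nn_integral_mono split: split_indicator)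
  next
    case False
    have "emeasure lebesgue (ball c (2 * R) \<inter> {y. \<beta> * s < W y}) = ?Y s"
    proof -
      have [measurable]: "{y. \<beta> * s < W y} \<in> sets lebesgue" by (intro lebesgue_superlevel) measurable
      have "?Y s = (\<integral>\<^sup>+y. indicator (ball c (2 * R) \<inter> {y. \<beta> * s < W y}) y \<partial>lebesgue)"
        using s \<beta> by (intro nn_integral_cong) (auto simp: ennreal_less_iff field_simps split: split_indicator)
      then show ?thesis by simp
    qed
    moreover have "ennreal (10 ^ DIM('a)) * (\<integral>\<^sup>+y. ennreal (W y) \<partial>ball_measure c (2 * R)) \<le> ennreal s"
      using False by (intro order_trans[OF l(2)] ennreal_leI) simp
    ultimately show ?thesis using ap_bound_superlevel[OF W t R K s, of c] False
      by (simp only: \<beta>_def[symmetric] n_def[symmetric] mult.assoc if_False add_0_left)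
  qed
  have "(\<integral>\<^sup>+y. epowr (ennreal (W y)) (1 + e) * indicator (ball c R) y \<partial>lebesgue)
     = (\<integral>\<^sup>+y. (ennreal (W y) * indicator (ball c R) y) * epowr (ennreal (W y)) e \<partial>lebesgue)"
    using e by (intro nn_integral_cong) (simp add: epowr_add ac_simps)
  also have "\<dots> = (\<integral>\<^sup>+s. ennreal (e * s powr (e - 1)) * indicator {0<..} s *
     (\<integral>\<^sup>+y. ennreal (W y) * indicator (ball c R) y * indicator {y. ennreal s < ennreal (W y)} y \<partial>lebesgue) \<partial>lborel)"
    using e by (intro layer_cake sigma_finite_lebesgue) auto
  also have "\<dots> \<le> (\<integral>\<^sup>+s. ?X * (ennreal (e * s powr (e - 1)) * indicator {0<..<l} s)
      + ennreal (2 * 5 ^ n * e / (1 + e)) * (ennreal ((1 + e) * s powr (1 + e - 1)) * indicator {0<..} s * ?Y s) \<partial>lborel)"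
  proof (intro nn_integral_mono)
    fix s :: real
    show "ennreal (e * s powr (e - 1)) * indicator {0<..} s *
     (\<integral>\<^sup>+y. ennreal (W y) * indicator (ball c R) y * indicator {y. ennreal s < ennreal (W y)} y \<partial>lebesgue)
      \<le> ?X * (ennreal (e * s powr (e - 1)) * indicator {0<..<l} s)
      + ennreal (2 * 5 ^ n * e / (1 + e)) * (ennreal ((1 + e) * s powr (1 + e - 1)) * indicator {0<..} s * ?Y s)"
    proof (cases "0 < s")
      case True
      have s1: "ennreal (2 * 5 ^ n * e / (1 + e)) * ennreal ((1 + e) * s powr (1 + e - 1)) = ennreal (e * s powr (e - 1)) * (ennreal (2 * 5 ^ n) * ennreal s)"
      proof -
        have "s powr e = s powr (e - 1) * s" using True by (simp add: powr_mult_base mult.commute)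
        then have eq: "2 * 5 ^ n * e / (1 + e) * ((1 + e) * s powr (1 + e - 1)) = e * s powr (e - 1) * (2 * 5 ^ n * s)"
          using e by simp
        have gen: "ennreal x * ennreal y = ennreal z * (ennreal u * ennreal v)"
          if "x * y = z * (u * v)" "0 \<le> x" "0 \<le> y" "0 \<le> z" "0 \<le> u" "0 \<le> v" for x y z u v
          using that by (simp add: ennreal_mult[symmetric])
        show ?thesis by (rule gen) (use e True eq in auto)
      qed
      have "ennreal (e * s powr (e - 1)) *
       (\<integral>\<^sup>+y. ennreal (W y) * indicator (ball c R) y * indicator {y. ennreal s < ennreal (W y)} y \<partial>lebesgue)
        \<le> ennreal (e * s powr (e - 1)) * ((if s < l then ?X else 0) + ennreal (2 * 5 ^ n) * (ennreal s * ?Y s))"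
        by (intro mult_left_mono lev True) auto
      also have "\<dots> = ?X * (ennreal (e * s powr (e - 1)) * indicator {0<..<l} s) + (ennreal (e * s powr (e - 1)) * (ennreal (2 * 5 ^ n) * ennreal s)) * ?Y s"
        using True by (simp add: distrib_left ac_simps)
      finally show ?thesis unfolding s1[symmetric] using True by (simp add: mult.assoc)
    qed simp
  qed
  also have "\<dots> = ?X * (\<integral>\<^sup>+s. ennreal (e * s powr (e - 1)) * indicator {0<..<l} s \<partial>lborel)
     + ennreal (2 * 5 ^ n * e / (1 + e)) * (\<integral>\<^sup>+s. ennreal ((1 + e) * s powr (1 + e - 1)) * indicator {0<..} s * ?Y s \<partial>lborel)"
  proof -
    have [measurable]: "(\<lambda>s. ?Y s) \<in> borel_measurable lborel"
      by (intro layer_cake_measurable sigma_finite_lebesgue) auto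
    show ?thesis by (simp add: nn_integral_add nn_integral_cmult)
  qed
  also have "(\<integral>\<^sup>+s. ennreal (e * s powr (e - 1)) * indicator {0<..<l} s \<partial>lborel) = ennreal (l powr e)"
    using e l by (simp add: nn_integral_powr_Ioo)
  also have "(\<integral>\<^sup>+s. ennreal ((1 + e) * s powr (1 + e - 1)) * indicator {0<..} s * ?Y s \<partial>lborel)
     = (\<integral>\<^sup>+y. indicator (ball c (2 * R)) y * epowr (ennreal (W y / \<beta>)) (1 + e) \<partial>lebesgue)"
    using e by (intro layer_cake[symmetric] sigma_finite_lebesgue) auto
  also have "\<dots> = (\<integral>\<^sup>+y. ennreal ((1/\<beta>) powr (1 + e)) * (epowr (ennreal (W y)) (1 + e) * indicator (ball c (2 * R)) y) \<partial>lebesgue)"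
    using \<beta> Wpos e by (intro nn_integral_cong) (auto simp: epowr_ennreal_pos ennreal_mult[symmetric] powr_mult[symmetric] split: split_indicator)
  also have "\<dots> = ennreal ((1/\<beta>) powr (1 + e)) * (\<integral>\<^sup>+y. epowr (ennreal (W y)) (1 + e) * indicator (ball c (2 * R)) y \<partial>lebesgue)"
    by (simp add: nn_integral_cmult)
  also have "\<dots> = ennreal ((1/\<beta>) powr (1 + e)) * ((\<integral>\<^sup>+y. epowr (ennreal (W y)) (1 + e) \<partial>ball_measure c (2 * R)) * (ennreal (2 ^ n) * emeasure lebesgue (ball c R)))"
    using R emeasure_ball_scale[of 2 R c c] by (subst ball_measure_mult[symmetric]) (auto simp: n_def)
  also have "?X = (\<integral>\<^sup>+y. ennreal (W y) \<partial>ball_measure c R) * emeasure lebesgue (ball c R)"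
    using R by (simp add: ball_measure_mult)
  finally have "(\<integral>\<^sup>+y. epowr (ennreal (W y)) (1 + e) \<partial>ball_measure c R)
    \<le> ennreal (l powr e) * (\<integral>\<^sup>+y. ennreal (W y) \<partial>ball_measure c R)
      + ennreal (2 * 5 ^ n * e / (1 + e)) * ennreal ((1/\<beta>) powr (1 + e)) * ennreal (2 ^ n) * (\<integral>\<^sup>+y. epowr (ennreal (W y)) (1 + e) \<partial>ball_measure c (2 * R))"
    using R by (subst ball_measure_le_iff) (auto simp: distrib_left distrib_right ac_simps)
  also have "ennreal (2 * 5 ^ n * e / (1 + e)) * ennreal ((1/\<beta>) powr (1 + e)) * ennreal (2 ^ n) = ennreal (2 * 10 ^ n * e / (1 + e) * (1/\<beta>) powr (1 + e))"
  proof -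
    have "(10::real) ^ n = 5 ^ n * 2 ^ n" by (simp add: power_mult_distrib[symmetric])
    then show ?thesis using e by (simp add: ennreal_mult[symmetric] field_simps)
  qed
  also have "1/\<beta> = K * 2 powr t" using K by (simp add: \<beta>_def powr_minus field_simps)
  also have "ennreal (2 * 10 ^ n * e / (1 + e) * (K * 2 powr t) powr (1 + e)) \<le> ennreal (2 * 10 ^ n * e * (K * 2 powr t) powr (1 + e))"
    using e by (intro ennreal_leI mult_right_mono) (auto simp: field_simps)
  finally show ?thesis by (simp add: n_def add_left_mono mult_right_mono)
qed

text \<open>The supremum over all balls of the normalised averages of W^(1+e) is at most a constant
  plus half of itself. The exponent and the constant are chosen before W and depend on t, K and the
  dimension alone.\<close>

lemma ap_bound_reverse_hoelder:
  assumes t: "1 < t" and K: "1 \<le> K"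
  shows "\<exists>e>0. \<exists>C\<ge>0. \<forall>W :: 'a::euclidean_space \<Rightarrow> real. ap_bound t K W \<longrightarrow> (\<forall>c r. 0 < r \<longrightarrow>
    (\<integral>\<^sup>+y. epowr (ennreal (W y)) (1 + e) \<partial>ball_measure c r) \<le> ennreal C * epowr (\<integral>\<^sup>+y. ennreal (W y) \<partial>ball_measure c r) (1 + e))"
proof -
  define n where "n = DIM('a)"
  define D where "D = K * (2 ^ n) powr t"
  have D: "1 \<le> D"
  proof -
    have "1 \<le> ((2::real) ^ n) powr t" using t by (intro ge_one_powr_ge_zero) auto
    then show ?thesis using K mult_mono[of 1 K 1 "(2 ^ n) powr t"] by (simp add: D_def)
  qed
  define \<kappa> where "\<kappa> = K * 2 powr t"
  have \<kappa>: "1 \<le> \<kappa>"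
  proof -
    have "1 \<le> (2::real) powr t" using t by (intro ge_one_powr_ge_zero) auto
    then show ?thesis using K mult_mono[of 1 K 1 "2 powr t"] by (simp add: \<kappa>_def)
  qed
  \<comment> \<open>The coefficient \<kappa> of the step and the doubling constant D both enter with
    the power 1 + e \<le> 2, hence the squares. Absorption then asks for e * P \<le> 1/2.\<close>
  define P where "P = 2 * 10 ^ n * \<kappa> ^ 2 * D ^ 2"
  have P: "0 < P" using \<kappa> D by (simp add: P_def)
  define e where "e = min 1 (1 / (2 * P))"
  have e: "0 < e" "e \<le> 1" "e * P \<le> 1 / 2"
    using P by (auto simp: e_def min_def field_simps)
  \<comment> \<open>For a ball with W-average a, doubling makes Q a at least 10^n times the average
    over the doubled ball, as the step requires of its level.\<close>
  define Q where "Q = 10 ^ n * D"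
  have Q: "1 \<le> Q" using D mult_mono[of 1 "10 ^ n" 1 D] by (simp add: Q_def)
  have "(\<integral>\<^sup>+y. epowr (ennreal (W y)) (1 + e) \<partial>ball_measure c r) \<le> ennreal (2 * Q) * epowr (\<integral>\<^sup>+y. ennreal (W y) \<partial>ball_measure c r) (1 + e)"
    if W: "ap_bound t K W" and r: "0 < r" for W :: "'a \<Rightarrow> real" and c r
  proof -
    have [measurable]: "W \<in> borel_measurable lebesgue" by (rule ap_boundD[OF W])
    obtain m N where m: "0 < m" "\<And>x. m \<le> W x" "\<And>x. W x \<le> N"
      using ap_bound_obtain[OF W] by blast
    have N: "0 < N" using m(1) m(2)[of 0] m(3)[of 0] by simp
    define A where "A c r = (\<integral>\<^sup>+y. ennreal (W y) \<partial>ball_measure c r)" for c r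
    define B where "B c r = (\<integral>\<^sup>+y. epowr (ennreal (W y)) (1 + e) \<partial>ball_measure c r)" for c r
    define S where "S = (SUP (c, r)\<in>UNIV \<times> {0<..}. B c r / epowr (A c r) (1 + e))"
    have Apos: "A c r \<noteq> 0" "A c r \<noteq> top" if r0: "0 < r" for c r
    proof -
      obtain a where "A c r = ennreal a" "0 < a" unfolding A_def by (rule ap_bound_avg[OF W r0])
      then show "A c r \<noteq> 0" "A c r \<noteq> top" by auto
    qed
    have quot: "B c r / epowr (A c r) (1 + e) \<le> X \<longleftrightarrow> B c r \<le> X * epowr (A c r) (1 + e)" if "0 < r" for c r X
    proof -
      have "(B c r / epowr (A c r) (1 + e)) * epowr (A c r) (1 + e) = B c r"
        using Apos[OF that, of c] e by (simp add: ennreal_divide_times ennreal_times_divide[symmetric] less_top[symmetric])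
      then show ?thesis
        using Apos[OF that, of c] e ennreal_mult_le_cancel_right[of "epowr (A c r) (1 + e)" "B c r / epowr (A c r) (1 + e)" X] by auto
    qed
    have BS: "B c r \<le> S * epowr (A c r) (1 + e)" if "0 < r" for c r
      unfolding quot[OF that, symmetric] S_def using that by (intro SUP_upper2[of "(c, r)"]) auto
    \<comment> \<open>A crude bound from m \<le> W \<le> N, which makes S finite.\<close>
    have "S \<le> ennreal ((N / m) powr (1 + e))"
      unfolding S_def
    proof (rule SUP_least, clarsimp simp: quot)
      fix c :: 'a and r :: real assume r: "0 < r"
      interpret prob_space "ball_measure c r" using r by (rule prob_space_ball_measure)
      have "B c r \<le> epowr (ennreal N) (1 + e)"
        unfolding B_def using m e by (intro nn_integral_bounds(2)[of 0] epowr_mono ennreal_leI) auto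
      also have "\<dots> = ennreal ((N / m) powr (1 + e)) * epowr (ennreal m) (1 + e)"
        using m N by (simp add: epowr_ennreal_pos ennreal_mult[symmetric] powr_divide)
      also have "\<dots> \<le> ennreal ((N / m) powr (1 + e)) * epowr (A c r) (1 + e)"
        unfolding A_def using m e by (intro mult_left_mono epowr_mono nn_integral_bounds(1)[where N = "ennreal N"]) (auto intro: ennreal_leI)
      finally show "B c r \<le> \<dots>" .
    qed
    then have "S < top" by (auto intro: le_less_trans)
    have "S \<le> ennreal Q + ennreal (1/2) * S"
    proof (subst (1) S_def, rule SUP_least, clarsimp simp: quot)
      fix c :: 'a and r :: real assume r: "0 < r"
      obtain a where a: "A c r = ennreal a" "0 < a" unfolding A_def by (rule ap_bound_avg[OF W r])
      have dbl: "A c (2 * r) \<le> ennreal D * A c r"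
        using ap_bound_doubling(1)[OF W t r, of 2 c] K by (simp add: A_def D_def n_def)
      have l: "0 < Q * a" using Q a by simp
      have "ennreal (10 ^ DIM('a)) * A c (2 * r) \<le> ennreal (10 ^ n) * (ennreal D * A c r)"
        unfolding n_def[symmetric] by (intro mult_left_mono dbl) auto
      also have "\<dots> = ennreal (Q * a)" using a D by (simp add: Q_def ennreal_mult[symmetric] mult.assoc)
      finally have step: "B c r \<le> ennreal ((Q * a) powr e) * A c r + ennreal (2 * 10 ^ n * e * \<kappa> powr (1 + e)) * B c (2 * r)"
        using ap_bound_gehring_step[OF W t r K e(1) l] by (simp add: A_def B_def n_def \<kappa>_def)
      have aa: "epowr (A c r) (1 + e) = ennreal (a powr (1 + e))" using a by (simp add: epowr_ennreal_pos)
      have "ennreal ((Q * a) powr e) * A c r = ennreal ((Q * a) powr e * a)"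
        using a by (simp add: ennreal_mult)
      also have "\<dots> \<le> ennreal (Q * a powr (1 + e))"
      proof (intro ennreal_leI)
        have "Q powr e \<le> Q powr 1" using Q e by (intro powr_mono) auto
        then have "Q powr e * (a powr e * a) \<le> Q * (a powr e * a)" using Q a by (intro mult_right_mono) auto
        moreover have "a powr (1 + e) = a powr e * a" using a by (simp add: powr_add)
        ultimately show "(Q * a) powr e * a \<le> Q * a powr (1 + e)"
          using Q a by (simp add: powr_mult mult.assoc)
      qed
      finally have t1: "ennreal ((Q * a) powr e) * A c r \<le> ennreal Q * ennreal (a powr (1 + e))"
        using Q by (simp add: ennreal_mult)
      have "B c (2 * r) \<le> S * epowr (A c (2 * r)) (1 + e)" using r by (intro BS) auto
      also have "\<dots> \<le> S * epowr (ennreal D * A c r) (1 + e)"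
        using e by (intro mult_left_mono epowr_mono dbl) auto
      also have "\<dots> = S * ennreal (D powr (1 + e)) * ennreal (a powr (1 + e))"
        using D e by (simp add: epowr_mult aa epowr_ennreal_pos mult.assoc)
      finally have "ennreal (2 * 10 ^ n * e * \<kappa> powr (1 + e)) * B c (2 * r)
        \<le> ennreal (2 * 10 ^ n * e * \<kappa> powr (1 + e)) * (S * ennreal (D powr (1 + e)) * ennreal (a powr (1 + e)))"
        by (intro mult_left_mono) auto
      also have "\<dots> = ennreal (2 * 10 ^ n * e * \<kappa> powr (1 + e) * D powr (1 + e)) * (S * ennreal (a powr (1 + e)))"
        using e by (simp add: ennreal_mult ac_simps)
      also have "\<dots> \<le> ennreal (1/2) * (S * ennreal (a powr (1 + e)))"
      proof (intro mult_right_mono ennreal_leI)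
        have "\<kappa> powr (1 + e) \<le> \<kappa> ^ 2" "D powr (1 + e) \<le> D ^ 2"
          using \<kappa> D e powr_mono[of "1 + e" 2 \<kappa>] powr_mono[of "1 + e" 2 D] by auto
        then have "\<kappa> powr (1 + e) * D powr (1 + e) \<le> \<kappa> ^ 2 * D ^ 2"
          using \<kappa> D by (intro mult_mono) auto
        then have "2 * 10 ^ n * e * (\<kappa> powr (1 + e) * D powr (1 + e)) \<le> 2 * 10 ^ n * e * (\<kappa> ^ 2 * D ^ 2)"
          using e by (intro mult_left_mono) auto
        also have "\<dots> = e * P" by (simp add: P_def)
        finally show "2 * 10 ^ n * e * \<kappa> powr (1 + e) * D powr (1 + e) \<le> 1 / 2"
          using e(3) by (simp add: mult.assoc)
      qed auto
      finally have "ennreal (2 * 10 ^ n * e * \<kappa> powr (1 + e)) * B c (2 * r) \<le> ennreal (1/2) * (S * ennreal (a powr (1 + e)))" .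
      with step t1 have "B c r \<le> ennreal Q * ennreal (a powr (1 + e)) + ennreal (1/2) * (S * ennreal (a powr (1 + e)))"
        by (meson add_mono order_trans)
      then have "B c r \<le> (ennreal Q + ennreal (1/2) * S) * epowr (A c r) (1 + e)"
        unfolding aa distrib_right mult.assoc .
      then show "B c r \<le> (ennreal Q + inverse 2 * S) * epowr (A c r) (1 + e)" by simp
    qed
    then have "S \<le> 2 * ennreal Q" using \<open>S < top\<close> by (rule ennreal_absorb_half)
    then have "S \<le> ennreal (2 * Q)" using Q by (simp add: ennreal_mult)
    then have "S * epowr (A c r) (1 + e) \<le> ennreal (2 * Q) * epowr (A c r) (1 + e)" by (rule mult_right_mono) simp
    with BS[OF r, of c] show ?thesis by (simp add: A_def B_def)
  qed
  then show ?thesis using e(1) Q by (intro exI[of _ e] conjI exI[of _ "2 * Q"]) auto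
qed

section \<open>Roots of weights and small sets\<close>

text \<open>For s = u(t-1) + 1 the dual weight of W in A_s is the same function as the dual weight
  of w = W^(1/u) in A_t. The root of order u of the A_s bound thus reads (avg W)^(1/u) (avg of the
  dual weight)^(t-1) \<le> K^(1/u). Jensen's inequality gives A_t for w; multiplying by 1 \<le> (avg
  w) (avg of the dual weight)^(t-1) gives the reverse Hoelder inequality of exponent u.\<close>

lemma ap_bound_root:
  fixes W :: "'a::euclidean_space \<Rightarrow> real"
  assumes W: "ap_bound (u * (t - 1) + 1) K W" and t: "1 < t" and u: "1 \<le> u" and K: "0 \<le> K"
  shows "ap_bound t (K powr (1/u)) (\<lambda>x. W x powr (1/u))"
    and "0 < r \<Longrightarrow> epowr (\<integral>\<^sup>+y. ennreal (W y) \<partial>ball_measure c r) (1/u) \<le> ennreal (K powr (1/u)) * (\<integral>\<^sup>+y. ennreal (W y powr (1/u)) \<partial>ball_measure c r)"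
proof -
  let ?w = "\<lambda>x. W x powr (1/u)"
  have [measurable]: "W \<in> borel_measurable lebesgue" by (rule ap_boundD[OF W])
  have Wpos: "0 < W y" for y by (rule ap_boundD(2)[OF W])
  define s where "s y = ennreal (?w y powr (- 1 / (t - 1)))" for y
  have [measurable]: "s \<in> borel_measurable lebesgue" unfolding s_def by measurable
  have seq: "ennreal (W y powr (- 1 / (u * (t - 1) + 1 - 1))) = s y" for y
  proof -
    have "1 / u * (- 1 / (t - 1)) = - 1 / (u * (t - 1) + 1 - 1)" using u t by simp
    then show ?thesis by (simp only: s_def powr_powr)
  qed
  have main: "epowr (\<integral>\<^sup>+y. ennreal (W y) \<partial>ball_measure c r) (1/u) * epowr (\<integral>\<^sup>+y. s y \<partial>ball_measure c r) (t - 1) \<le> ennreal (K powr (1/u))"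
    if r: "0 < r" for c r
  proof -
    have "(\<integral>\<^sup>+y. ennreal (W y) \<partial>ball_measure c r) * epowr (\<integral>\<^sup>+y. s y \<partial>ball_measure c r) (u * (t - 1)) \<le> ennreal K"
      using ap_boundD(3)[OF W r, of c] by (simp only: seq) simp
    then have "epowr ((\<integral>\<^sup>+y. ennreal (W y) \<partial>ball_measure c r) * epowr (\<integral>\<^sup>+y. s y \<partial>ball_measure c r) (u * (t - 1))) (1/u) \<le> epowr (ennreal K) (1/u)"
      by (rule epowr_mono[rotated]) (use u in simp)
    then show ?thesis using u t K by (simp add: epowr_mult epowr_epowr epowr_ennreal)
  qed
  have Ww: "ennreal (W y) = epowr (ennreal (?w y)) u" for y
    using Wpos[of y] u by (simp add: epowr_ennreal_pos powr_powr)
  show "ap_bound t (K powr (1/u)) ?w"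
    unfolding ap_bound_def
  proof (intro conjI allI impI)
    obtain m N where m: "0 < m" "\<And>x. m \<le> W x" "\<And>x. W x \<le> N"
      using ap_bound_obtain[OF W] by blast
    show "\<exists>m>0. \<exists>N. \<forall>x. m \<le> ?w x \<and> ?w x \<le> N"
      using m u Wpos by (intro exI[of _ "m powr (1/u)"] conjI exI[of _ "N powr (1/u)"] allI powr_mono2) (auto simp: less_imp_le)
    fix c :: 'a and r :: real assume r: "0 < r"
    interpret prob_space "ball_measure c r" using r by (rule prob_space_ball_measure)
    have "(\<integral>\<^sup>+y. ennreal (?w y) \<partial>ball_measure c r) \<le> epowr (\<integral>\<^sup>+y. ennreal (W y) \<partial>ball_measure c r) (1/u)"
      unfolding Ww using u by (intro nn_integral_le_epowr) auto
    then have "(\<integral>\<^sup>+y. ennreal (?w y) \<partial>ball_measure c r) * epowr (\<integral>\<^sup>+y. s y \<partial>ball_measure c r) (t - 1)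
      \<le> epowr (\<integral>\<^sup>+y. ennreal (W y) \<partial>ball_measure c r) (1/u) * epowr (\<integral>\<^sup>+y. s y \<partial>ball_measure c r) (t - 1)"
      by (rule mult_right_mono) simp
    also note main[OF r]
    finally show "(\<integral>\<^sup>+y. ennreal (?w y) \<partial>ball_measure c r) * epowr (\<integral>\<^sup>+y. ennreal (?w y powr (- 1 / (t - 1))) \<partial>ball_measure c r) (t - 1) \<le> ennreal (K powr (1/u))"
      by (simp only: s_def)
  qed measurable
  assume r: "0 < r"
  interpret prob_space "ball_measure c r" using r by (rule prob_space_ball_measure)
  let ?A = "\<integral>\<^sup>+y. ennreal (W y) \<partial>ball_measure c r" and ?S = "\<integral>\<^sup>+y. s y \<partial>ball_measure c r" and ?a = "\<integral>\<^sup>+y. ennreal (?w y) \<partial>ball_measure c r"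
  have one: "epowr (ennreal (?w y)) (1/t) * epowr (s y) (1 - 1/t) = 1" for y
  proof -
    have "1 / u * (1/t) + 1 / u * (- 1 / (t - 1)) * (1 - 1/t) = 0" using u t by (simp add: field_simps)
    moreover have "epowr (ennreal (?w y)) (1/t) * epowr (s y) (1 - 1/t) = ennreal (W y powr (1 / u * (1/t) + 1 / u * (- 1 / (t - 1)) * (1 - 1/t)))"
      using Wpos[of y] unfolding s_def by (simp add: epowr_ennreal_pos powr_powr ennreal_mult[symmetric] powr_add[symmetric])
    ultimately show ?thesis using Wpos[of y] by (simp only: powr_zero_eq_one) simp
  qed
  have "1 = (\<integral>\<^sup>+y. epowr (ennreal (?w y)) (1/t) * epowr (s y) (1 - 1/t) \<partial>ball_measure c r)"
    unfolding one by (simp only: nn_integral_const emeasure_space_1 mult_1_right)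
  also have "\<dots> \<le> epowr ?a (1/t) * epowr ?S (1 - 1/t)"
    using t by (intro hoelder_nn_integral) auto
  finally have "epowr 1 t \<le> epowr (epowr ?a (1/t) * epowr ?S (1 - 1/t)) t"
    using t by (intro epowr_mono) auto
  also have "\<dots> = ?a * epowr ?S (t - 1)"
  proof -
    have "(1 - 1/t) * t = t - 1" using t by (simp add: field_simps)
    then show ?thesis using t by (simp add: epowr_mult epowr_epowr)
  qed
  finally have "epowr ?A (1/u) * 1 \<le> epowr ?A (1/u) * (?a * epowr ?S (t - 1))"
    by (intro mult_left_mono) auto
  also have "\<dots> = (epowr ?A (1/u) * epowr ?S (t - 1)) * ?a" by (simp only: ac_simps)
  also have "\<dots> \<le> ennreal (K powr (1/u)) * ?a" by (intro mult_right_mono main r) auto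
  finally show "epowr ?A (1/u) \<le> ennreal (K powr (1/u)) * ?a" by simp
qed

text \<open>A reverse Hoelder inequality for W with exponent 1 + e is one for w = W^(1/u) with
  exponent v = u(1 + e) > u. Hoelder's inequality on E then gives the power \<theta> = 1 - 1/v,
  strictly above 1 - 1/u.\<close>

lemma ap_bound_small_sets:
  assumes t: "1 < t" and K: "1 \<le> K" and u: "1 \<le> u"
  shows "\<exists>\<theta> > 1 - 1/u. \<theta> < 1 \<and> (\<exists>C\<ge>0. \<forall>W :: 'a::euclidean_space \<Rightarrow> real. ap_bound (u * (t - 1) + 1) K W \<longrightarrow> (\<forall>c r E. 0 < r \<longrightarrow> E \<in> sets lebesgue \<longrightarrow>
    (\<integral>\<^sup>+y. ennreal (W y powr (1/u)) * indicator E y \<partial>ball_measure c r)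
      \<le> ennreal C * epowr (emeasure (ball_measure c r) E) \<theta> * (\<integral>\<^sup>+y. ennreal (W y powr (1/u)) \<partial>ball_measure c r)))"
proof -
  have "1 < u * (t - 1) + 1" using t u by simp
  from ap_bound_reverse_hoelder[OF this K, where 'a = 'a] obtain e C where e: "0 < e" and C: "0 \<le> C" and
    RH: "\<And>W :: 'a \<Rightarrow> real. \<And>c r. ap_bound (u * (t - 1) + 1) K W \<Longrightarrow> 0 < r \<Longrightarrow>
      (\<integral>\<^sup>+y. epowr (ennreal (W y)) (1 + e) \<partial>ball_measure c r) \<le> ennreal C * epowr (\<integral>\<^sup>+y. ennreal (W y) \<partial>ball_measure c r) (1 + e)"
    by blast
  define v where "v = u * (1 + e)"
  have v: "1 < v" using u mult_pos_pos[of u e] e unfolding v_def distrib_left by linarith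
  have uv: "u < v" using u e unfolding v_def by simp
  define \<theta> where "\<theta> = 1 - 1 / v"
  have \<theta>: "1 - 1/u < \<theta>" "\<theta> < 1" using u v uv by (auto simp: \<theta>_def frac_less2)
  have "(\<integral>\<^sup>+y. ennreal (W y powr (1/u)) * indicator E y \<partial>ball_measure c r)
      \<le> ennreal (C powr (1/v) * K powr (1/u)) * epowr (emeasure (ball_measure c r) E) \<theta> * (\<integral>\<^sup>+y. ennreal (W y powr (1/u)) \<partial>ball_measure c r)"
    if W: "ap_bound (u * (t - 1) + 1) K W" and r: "0 < r" and [measurable]: "E \<in> sets lebesgue" for W :: "'a \<Rightarrow> real" and c r E
  proof -
    have [measurable]: "W \<in> borel_measurable lebesgue" by (rule ap_boundD[OF W])
    have Wpos: "0 < W y" for y by (rule ap_boundD(2)[OF W])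
    let ?P = "ball_measure c r"
    have eq: "ennreal (W y powr (1/u)) * indicator E y = epowr (epowr (ennreal (W y)) (1 + e)) (1/v) * epowr (indicator E y) (1 - 1/v)" for y
    proof -
      have "(1 + e) * (1 / v) = 1 / u" using u e by (simp add: v_def)
      then show ?thesis using Wpos[of y] e v
        by (simp add: epowr_ennreal_pos powr_powr split: split_indicator)
    qed
    have "(\<integral>\<^sup>+y. ennreal (W y powr (1/u)) * indicator E y \<partial>?P)
      \<le> epowr (\<integral>\<^sup>+y. epowr (ennreal (W y)) (1 + e) \<partial>?P) (1/v) * epowr (\<integral>\<^sup>+y. indicator E y \<partial>?P) (1 - 1/v)"
      unfolding eq using v by (intro hoelder_nn_integral) auto
    also have "(\<integral>\<^sup>+y. indicator E y \<partial>?P) = emeasure ?P E" by (intro nn_integral_indicator) simp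
    also have "epowr (\<integral>\<^sup>+y. epowr (ennreal (W y)) (1 + e) \<partial>?P) (1/v) \<le> epowr (ennreal C * epowr (\<integral>\<^sup>+y. ennreal (W y) \<partial>?P) (1 + e)) (1/v)"
      using v by (intro epowr_mono RH W r) auto
    also have "\<dots> = ennreal (C powr (1/v)) * epowr (\<integral>\<^sup>+y. ennreal (W y) \<partial>?P) (1/u)"
    proof -
      have "(1 + e) * (1 / v) = 1 / u" using u e by (simp add: v_def)
      then show ?thesis using v e C by (simp add: epowr_mult epowr_epowr epowr_ennreal)
    qed
    also have "\<dots> \<le> ennreal (C powr (1/v)) * (ennreal (K powr (1/u)) * (\<integral>\<^sup>+y. ennreal (W y powr (1/u)) \<partial>?P))"
      using K by (intro mult_left_mono ap_bound_root(2)[OF W t u _ r]) auto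
    finally show ?thesis by (simp add: \<theta>_def ennreal_mult ac_simps mult_left_mono mult_right_mono)
  qed
  then show ?thesis using \<theta> C K by (intro exI[of _ \<theta>] conjI exI[of _ "C powr (1/v) * K powr (1/u)"]) auto
qed

section \<open>Bounds for the maximal function\<close>

lemma hl_max_jensen:
  assumes [measurable]: "g \<in> borel_measurable lebesgue" and k: "1 \<le> k"
  shows "epowr (hl_max g x) k \<le> hl_max (\<lambda>y. epowr (g y) k) x"
proof -
  have "hl_max g x \<le> epowr (hl_max (\<lambda>y. epowr (g y) k) x) (1/k)"
    unfolding hl_max_le_iff
  proof (intro allI impI)
    fix c r assume r: "0 < r" and x: "x \<in> ball c r"
    interpret prob_space "ball_measure c r" using r by (rule prob_space_ball_measure)
    have "(\<integral>\<^sup>+y. g y \<partial>ball_measure c r) \<le> epowr (\<integral>\<^sup>+y. epowr (g y) k \<partial>ball_measure c r) (1/k)"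
      using k by (intro nn_integral_le_epowr) auto
    also have "\<dots> \<le> epowr (hl_max (\<lambda>y. epowr (g y) k) x) (1/k)"
      using k by (intro epowr_mono hl_max_ge r x) auto
    finally show "(\<integral>\<^sup>+y. g y \<partial>ball_measure c r) \<le> \<dots>" .
  qed
  then show ?thesis using k by (intro epowr_leI) auto
qed

lemma hl_max_weak_type:
  fixes g :: "'a::euclidean_space \<Rightarrow> ennreal"
  assumes [measurable]: "g \<in> borel_measurable lebesgue"
  shows "ennreal l * emeasure lebesgue {x. ennreal l < hl_max g x} \<le> ennreal (5 ^ DIM('a)) * (\<integral>\<^sup>+y. g y \<partial>lebesgue)"
proof -
  have "ennreal l * emeasure lebesgue (\<Union>(c, r)\<in>{(c, r). 0 < r \<and> ennreal l < (\<integral>\<^sup>+y. g y \<partial>ball_measure c r)}. ball c r)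
     \<le> ennreal (5 ^ DIM('a)) * emeasure (density lebesgue g) UNIV"
  proof (rule vitali_weak_type)
    fix c :: 'a and r :: real
    assume "0 < r"
    then show "emeasure lebesgue (ball c (5 * r)) \<le> ennreal (5 ^ DIM('a)) * emeasure lebesgue (ball c r)"
      using emeasure_ball_scale[of 5 r c c] by simp
  next
    fix c :: 'a and r :: real
    assume "(c, r) \<in> {(c, r). 0 < r \<and> ennreal l < (\<integral>\<^sup>+y. g y \<partial>ball_measure c r)}"
    then have *: "0 < r \<and> ennreal l < (\<integral>\<^sup>+y. g y \<partial>ball_measure c r)" by simp
    then show "0 < r \<and> ennreal l * emeasure lebesgue (ball c r) \<le> emeasure (density lebesgue g) (ball c r)"
      using ball_measure_less_iff[of g r "ennreal l" c] by (simp add: emeasure_density less_imp_le)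
  qed simp_all
  then show ?thesis unfolding less_hl_max_eq_UN by (simp add: emeasure_density)
qed

text \<open>The exponent s < t is determined by (1 + e)(s - 1) = t - 1. The reverse Hoelder
  inequality of the dual weight turns the A_t bound into an A_s bound, here in the form (avg g)^s
  avg(w) \<le> C avg(w g^s). The covering argument makes it a weak type (s,s) estimate.\<close>

lemma ap_bound_weak_type:
  fixes w :: "'a::euclidean_space \<Rightarrow> real"
  assumes w: "ap_bound t K w" and t: "1 < t" and K: "1 \<le> K" and e: "0 < e" and C: "0 \<le> C" and s: "s = 1 + (t - 1) / (1 + e)"
    and RH: "\<And>c r. 0 < r \<Longrightarrow> (\<integral>\<^sup>+y. epowr (ennreal (w y powr (- 1 / (t - 1)))) (1 + e) \<partial>ball_measure c r)
      \<le> ennreal C * epowr (\<integral>\<^sup>+y. ennreal (w y powr (- 1 / (t - 1))) \<partial>ball_measure c r) (1 + e)"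
    and [measurable]: "g \<in> borel_measurable lebesgue" and l: "0 < l"
  shows "epowr (ennreal l) s * (\<integral>\<^sup>+x. ennreal (w x) * indicator {x. ennreal l < hl_max g x} x \<partial>lebesgue)
    \<le> ennreal (K * (5 ^ DIM('a)) powr t * (C powr (s - 1) * K)) * (\<integral>\<^sup>+x. ennreal (w x) * epowr (g x) s \<partial>lebesgue)"
proof -
  have [measurable]: "w \<in> borel_measurable lebesgue" by (rule ap_boundD[OF w])
  have wpos: "0 < w y" for y by (rule ap_boundD(2)[OF w])
  have s1: "1 < s" using t e by (simp add: s)
  define \<sigma> where "\<sigma> y = ennreal (w y powr (- 1 / (t - 1)))" for y
  have [measurable]: "\<sigma> \<in> borel_measurable lebesgue" unfolding \<sigma>_def by measurable
  let ?C = "C powr (s - 1) * K"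
  have ball: "epowr (\<integral>\<^sup>+y. g y \<partial>ball_measure c r) s * (\<integral>\<^sup>+y. ennreal (w y) \<partial>ball_measure c r)
    \<le> ennreal ?C * (\<integral>\<^sup>+y. ennreal (w y) * epowr (g y) s \<partial>ball_measure c r)" if r: "0 < r" for c r
  proof -
    let ?P = "ball_measure c r"
    have eq: "g y = epowr (ennreal (w y) * epowr (g y) s) (1/s) * epowr (epowr (\<sigma> y) (1 + e)) (1 - 1/s)" for y
    proof -
      have "1 / s + - 1 / (t - 1) * (1 + e) * (1 - 1 / s) = 0"
      proof -
        have "1 - 1 / s = (s - 1) / s" using s1 by (simp add: field_simps)
        also have "s - 1 = (t - 1) / (1 + e)" by (simp add: s)
        finally have *: "1 - 1 / s = (t - 1) / (1 + e) / s" .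
        have "- 1 / x * y * (x / y / s) = - (1 / s)" if "x \<noteq> 0" "y \<noteq> 0" for x y
          using that by simp
        from this[of "t - 1" "1 + e"] show ?thesis unfolding * using t e by simp
      qed
      moreover have "epowr (ennreal (w y)) (1/s) * epowr (epowr (\<sigma> y) (1 + e)) (1 - 1/s) = ennreal (w y powr (1 / s + - 1 / (t - 1) * (1 + e) * (1 - 1 / s)))"
        unfolding \<sigma>_def using wpos[of y] by (simp add: epowr_ennreal_pos powr_powr ennreal_mult[symmetric] powr_add[symmetric])
      ultimately have 1: "epowr (ennreal (w y)) (1/s) * epowr (epowr (\<sigma> y) (1 + e)) (1 - 1/s) = 1"
        using wpos[of y] by (simp only: powr_zero_eq_one) simp
      have "epowr (ennreal (w y) * epowr (g y) s) (1/s) * epowr (epowr (\<sigma> y) (1 + e)) (1 - 1/s)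
        = g y * (epowr (ennreal (w y)) (1/s) * epowr (epowr (\<sigma> y) (1 + e)) (1 - 1/s))"
        using s1 by (simp add: epowr_mult epowr_inv ac_simps)
      then show ?thesis by (simp only: 1 mult_1_right)
    qed
    have "(\<integral>\<^sup>+y. g y \<partial>?P) = (\<integral>\<^sup>+y. epowr (ennreal (w y) * epowr (g y) s) (1/s) * epowr (epowr (\<sigma> y) (1 + e)) (1 - 1/s) \<partial>?P)"
      by (intro nn_integral_cong eq)
    also have "\<dots> \<le> epowr (\<integral>\<^sup>+y. ennreal (w y) * epowr (g y) s \<partial>?P) (1/s) * epowr (\<integral>\<^sup>+y. epowr (\<sigma> y) (1 + e) \<partial>?P) (1 - 1/s)"
      using s1 by (intro hoelder_nn_integral) auto
    finally have "epowr (\<integral>\<^sup>+y. g y \<partial>?P) s \<le> epowr \<dots> s"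
      using s1 by (intro epowr_mono) auto
    also have "\<dots> = (\<integral>\<^sup>+y. ennreal (w y) * epowr (g y) s \<partial>?P) * epowr (\<integral>\<^sup>+y. epowr (\<sigma> y) (1 + e) \<partial>?P) (s - 1)"
    proof -
      have "(1 - 1/s) * s = s - 1" using s1 by (simp add: field_simps)
      then show ?thesis using s1 by (simp add: epowr_mult epowr_epowr)
    qed
    also have "epowr (\<integral>\<^sup>+y. epowr (\<sigma> y) (1 + e) \<partial>?P) (s - 1) \<le> epowr (ennreal C * epowr (\<integral>\<^sup>+y. \<sigma> y \<partial>?P) (1 + e)) (s - 1)"
      unfolding \<sigma>_def using s1 by (intro epowr_mono RH r) auto
    also have "\<dots> = ennreal (C powr (s - 1)) * epowr (\<integral>\<^sup>+y. \<sigma> y \<partial>?P) (t - 1)"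
    proof -
      have "(1 + e) * (s - 1) = t - 1" using e by (simp add: s)
      then show ?thesis using s1 e C by (simp add: epowr_mult epowr_epowr epowr_ennreal)
    qed
    finally have "epowr (\<integral>\<^sup>+y. g y \<partial>?P) s \<le> (\<integral>\<^sup>+y. ennreal (w y) * epowr (g y) s \<partial>?P) * (ennreal (C powr (s - 1)) * epowr (\<integral>\<^sup>+y. \<sigma> y \<partial>?P) (t - 1))"
      by (simp add: mult_left_mono)
    then have "epowr (\<integral>\<^sup>+y. g y \<partial>?P) s * (\<integral>\<^sup>+y. ennreal (w y) \<partial>?P)
      \<le> (\<integral>\<^sup>+y. ennreal (w y) * epowr (g y) s \<partial>?P) * (ennreal (C powr (s - 1)) * epowr (\<integral>\<^sup>+y. \<sigma> y \<partial>?P) (t - 1)) * (\<integral>\<^sup>+y. ennreal (w y) \<partial>?P)"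
      by (rule mult_right_mono) simp
    also have "\<dots> = (\<integral>\<^sup>+y. ennreal (w y) * epowr (g y) s \<partial>?P) * ennreal (C powr (s - 1)) * ((\<integral>\<^sup>+y. ennreal (w y) \<partial>?P) * epowr (\<integral>\<^sup>+y. \<sigma> y \<partial>?P) (t - 1))"
      by (simp only: ac_simps)
    also have "\<dots> \<le> (\<integral>\<^sup>+y. ennreal (w y) * epowr (g y) s \<partial>?P) * ennreal (C powr (s - 1)) * ennreal K"
      unfolding \<sigma>_def by (intro mult_left_mono ap_boundD(3)[OF w r]) auto
    also have "\<dots> = ennreal ?C * (\<integral>\<^sup>+y. ennreal (w y) * epowr (g y) s \<partial>?P)"
      using K by (simp add: ennreal_mult ac_simps)
    finally show ?thesis .
  qed
  let ?N = "density lebesgue (\<lambda>x. ennreal (w x))" and ?M = "density lebesgue (\<lambda>x. ennreal ?C * (ennreal (w x) * epowr (g x) s))"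
  have "epowr (ennreal l) s * emeasure ?N (\<Union>(c, r)\<in>{(c, r). 0 < r \<and> ennreal l < (\<integral>\<^sup>+y. g y \<partial>ball_measure c r)}. ball c r)
    \<le> ennreal (K * (5 ^ DIM('a)) powr t) * emeasure ?M UNIV"
  proof (rule vitali_weak_type)
    fix c :: 'a and r :: real
    assume "0 < r"
    then show "emeasure ?N (ball c (5 * r)) \<le> ennreal (K * (5 ^ DIM('a)) powr t) * emeasure ?N (ball c r)"
      using ap_bound_doubling(2)[OF w t, of r 5 c] K by (simp add: emeasure_density)
  next
    fix c :: 'a and r :: real
    assume "(c, r) \<in> {(c, r). 0 < r \<and> ennreal l < (\<integral>\<^sup>+y. g y \<partial>ball_measure c r)}"
    then have *: "0 < r \<and> ennreal l < (\<integral>\<^sup>+y. g y \<partial>ball_measure c r)" by simp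
    then have r: "0 < r" by simp
    have "epowr (ennreal l) s * emeasure ?N (ball c r) = epowr (ennreal l) s * ((\<integral>\<^sup>+y. ennreal (w y) \<partial>ball_measure c r) * emeasure lebesgue (ball c r))"
      using r by (simp add: emeasure_density ball_measure_mult)
    also have "\<dots> \<le> (epowr (\<integral>\<^sup>+y. g y \<partial>ball_measure c r) s * (\<integral>\<^sup>+y. ennreal (w y) \<partial>ball_measure c r)) * emeasure lebesgue (ball c r)"
      unfolding mult.assoc[symmetric] using * s1 by (intro mult_right_mono epowr_mono) (auto intro: less_imp_le)
    also have "\<dots> \<le> (ennreal ?C * (\<integral>\<^sup>+y. ennreal (w y) * epowr (g y) s \<partial>ball_measure c r)) * emeasure lebesgue (ball c r)"
      by (intro mult_right_mono ball r) auto
    also have "\<dots> = ennreal ?C * (\<integral>\<^sup>+y. ennreal (w y) * epowr (g y) s * indicator (ball c r) y \<partial>lebesgue)"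
      using r by (simp add: ball_measure_mult mult.assoc)
    also have "\<dots> = emeasure ?M (ball c r)"
      by (simp add: emeasure_density nn_integral_cmult[symmetric] mult.assoc)
    finally show "0 < r \<and> epowr (ennreal l) s * emeasure ?N (ball c r) \<le> emeasure ?M (ball c r)" using r by simp
  qed simp_all
  moreover have "emeasure ?N {x. ennreal l < hl_max g x} = (\<integral>\<^sup>+x. ennreal (w x) * indicator {x. ennreal l < hl_max g x} x \<partial>lebesgue)"
    by (intro emeasure_density lebesgue_superlevel) auto
  moreover have "emeasure ?M UNIV = ennreal ?C * (\<integral>\<^sup>+x. ennreal (w x) * epowr (g x) s \<partial>lebesgue)"
    by (simp add: emeasure_density nn_integral_cmult)
  ultimately show ?thesis unfolding less_hl_max_eq_UN using K by (simp add: ennreal_mult mult.assoc)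
qed

text \<open>Dualising twice returns w, and the A_t bound raised to the power 1/(t-1) is the bound
  for the conjugate exponent.\<close>

lemma ap_bound_dual:
  fixes w :: "'a::euclidean_space \<Rightarrow> real"
  assumes w: "ap_bound t K w" and t: "1 < t" and K: "0 \<le> K"
  shows "ap_bound (t / (t - 1)) (K powr (1 / (t - 1))) (\<lambda>x. w x powr (- 1 / (t - 1)))"
  unfolding ap_bound_def
proof (intro conjI allI impI)
  have [measurable]: "w \<in> borel_measurable lebesgue" by (rule ap_boundD[OF w])
  show "(\<lambda>x. w x powr (- 1 / (t - 1))) \<in> borel_measurable lebesgue" by measurable
  have wpos: "0 < w y" for y by (rule ap_boundD(2)[OF w])
  obtain m N where m: "0 < m" "\<And>x. m \<le> w x" "\<And>x. w x \<le> N"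
    using ap_bound_obtain[OF w] by blast
  have "N powr (- 1 / (t - 1)) \<le> w x powr (- 1 / (t - 1)) \<and> w x powr (- 1 / (t - 1)) \<le> m powr (- 1 / (t - 1))" for x
    using m t wpos[of x] by (intro conjI powr_mono2') auto
  moreover have "0 < N" using m(3)[of 0] wpos[of 0] by simp
  ultimately show "\<exists>m>0. \<exists>N. \<forall>x. m \<le> w x powr (- 1 / (t - 1)) \<and> w x powr (- 1 / (t - 1)) \<le> N"
    by (intro exI[of _ "N powr (- 1 / (t - 1))"] conjI exI[of _ "m powr (- 1 / (t - 1))"]) auto
  fix c :: 'a and r :: real assume r: "0 < r"
  let ?S = "\<integral>\<^sup>+y. ennreal (w y powr (- 1 / (t - 1))) \<partial>ball_measure c r" and ?A = "\<integral>\<^sup>+y. ennreal (w y) \<partial>ball_measure c r"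
  have e1: "t / (t - 1) - 1 = 1 / (t - 1)" using t by (simp add: field_simps)
  have inv2: "- 1 / x * (- 1 / (1 / x)) = 1" if "x \<noteq> 0" for x :: real using that by simp
  have e3: "- 1 / (t - 1) * (- 1 / (1 / (t - 1))) = 1" by (rule inv2) (use t in simp)
  have e2: "(w y powr (- 1 / (t - 1))) powr (- 1 / (t / (t - 1) - 1)) = w y" for y
    unfolding e1 powr_powr e3 using wpos[of y] by simp
  have "epowr (?A * epowr ?S (t - 1)) (1 / (t - 1)) \<le> epowr (ennreal K) (1 / (t - 1))"
    using t by (intro epowr_mono ap_boundD(3)[OF w r]) auto
  then have "?S * epowr ?A (1 / (t - 1)) \<le> ennreal (K powr (1 / (t - 1)))"
    using t K by (simp add: epowr_mult epowr_inv epowr_ennreal mult.commute)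
  then show "?S * epowr (\<integral>\<^sup>+y. ennreal ((w y powr (- 1 / (t - 1))) powr (- 1 / (t / (t - 1) - 1))) \<partial>ball_measure c r) (t / (t - 1) - 1)
    \<le> ennreal (K powr (1 / (t - 1)))"
    by (simp only: e2) (simp only: e1)
qed

text \<open>The part of g with 2 g \<le> l adds at most l/2 to any average.\<close>

lemma hl_max_split:
  fixes g :: "'a::euclidean_space \<Rightarrow> ennreal"
  assumes [measurable]: "g \<in> borel_measurable lebesgue" and l: "0 < l" and x: "ennreal l < hl_max g x"
  shows "ennreal (l / 2) < hl_max (\<lambda>y. g y * indicator {y. ennreal l < 2 * g y} y) x"
proof -
  let ?g = "\<lambda>y. g y * indicator {y. ennreal l < 2 * g y} y"
  have [measurable]: "{y. ennreal l < 2 * g y} \<in> sets lebesgue" by (intro lebesgue_superlevel) measurable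
  obtain c r where r: "0 < r" "x \<in> ball c r" "ennreal l < (\<integral>\<^sup>+y. g y \<partial>ball_measure c r)"
    using x unfolding less_hl_max_iff by blast
  interpret prob_space "ball_measure c r" using r(1) by (rule prob_space_ball_measure)
  have two: "2 * ennreal (l / 2) = ennreal l"
  proof -
    have "ennreal (2 * (l / 2)) = ennreal 2 * ennreal (l / 2)" using l by (intro ennreal_mult) auto
    then show ?thesis by simp
  qed
  have "(\<integral>\<^sup>+y. g y \<partial>ball_measure c r) \<le> (\<integral>\<^sup>+y. ?g y + ennreal (l / 2) \<partial>ball_measure c r)"
  proof (intro nn_integral_mono)
    fix y
    show "g y \<le> ?g y + ennreal (l / 2)"
    proof (cases "ennreal l < 2 * g y")
      case False
      then have "2 * g y \<le> 2 * ennreal (l / 2)" by (simp add: two not_less)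
      then have "g y * 2 \<le> ennreal (l / 2) * 2" by (simp only: mult.commute)
      then have "g y \<le> ennreal (l / 2)" by (subst (asm) ennreal_mult_le_cancel_right) auto
      then show ?thesis using False by simp
    qed simp
  qed
  also have "\<dots> = (\<integral>\<^sup>+y. ?g y \<partial>ball_measure c r) + ennreal (l / 2)"
    by (subst nn_integral_add) (auto simp only: nn_integral_const emeasure_space_1 mult_1_right, simp_all)
  finally have "ennreal l < (\<integral>\<^sup>+y. ?g y \<partial>ball_measure c r) + ennreal (l / 2)" using r(3) by (rule less_le_trans[rotated])
  moreover have "ennreal l = ennreal (l / 2) + ennreal (l / 2)"
    using l by (subst ennreal_plus[symmetric]) auto
  ultimately have "ennreal (l / 2) < (\<integral>\<^sup>+y. ?g y \<partial>ball_measure c r)"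
    by (metis add_right_mono not_le)
  then show ?thesis unfolding less_hl_max_iff using r by blast
qed

text \<open>Marcinkiewicz interpolation between weak type (s,s) and the trivial bound on
  L^\<infinity>, the latter in the form of \<open>hl_max_split\<close>.\<close>

lemma hl_max_strong_type:
  fixes g :: "'a::euclidean_space \<Rightarrow> ennreal"
  assumes s: "0 < s" "s < a" and C: "0 \<le> C"
    and [measurable]: "w \<in> borel_measurable lebesgue" "g \<in> borel_measurable lebesgue"
    and weak: "\<And>g l. g \<in> borel_measurable lebesgue \<Longrightarrow> 0 < l \<Longrightarrow>
      epowr (ennreal l) s * (\<integral>\<^sup>+x. w x * indicator {x. ennreal l < hl_max g x} x \<partial>lebesgue)
        \<le> ennreal C * (\<integral>\<^sup>+x. w x * epowr (g x) s \<partial>lebesgue)"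
  shows "(\<integral>\<^sup>+x. w x * epowr (hl_max g x) a \<partial>lebesgue)
    \<le> ennreal (a / (a - s) * 2 powr a * C) * (\<integral>\<^sup>+x. w x * epowr (g x) a \<partial>lebesgue)"
proof -
  let ?J = "\<lambda>l. \<integral>\<^sup>+x. w x * epowr (g x) s * indicator {x. ennreal l < 2 * g x} x \<partial>lebesgue"
  have lev: "(\<integral>\<^sup>+x. w x * indicator {x. ennreal l < hl_max g x} x \<partial>lebesgue) \<le> ennreal ((2 / l) powr s * C) * ?J l"
    if l: "0 < l" for l
  proof -
    let ?h = "\<lambda>y. g y * indicator {y. ennreal l < 2 * g y} y"
    have [measurable]: "{y. ennreal l < 2 * g y} \<in> sets lebesgue" by (intro lebesgue_superlevel) measurable
    have "(\<integral>\<^sup>+x. w x * indicator {x. ennreal l < hl_max g x} x \<partial>lebesgue)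
      \<le> (\<integral>\<^sup>+x. w x * indicator {x. ennreal (l / 2) < hl_max ?h x} x \<partial>lebesgue)"
      using hl_max_split[of g l] l by (intro nn_integral_mono) (auto split: split_indicator)
    also have "\<dots> = ennreal ((2 / l) powr s) * (epowr (ennreal (l / 2)) s * (\<integral>\<^sup>+x. w x * indicator {x. ennreal (l / 2) < hl_max ?h x} x \<partial>lebesgue))"
    proof -
      have "(2 / l) powr s * (l / 2) powr s = 1" using l by (simp add: powr_mult[symmetric])
      then have "ennreal ((2 / l) powr s) * epowr (ennreal (l / 2)) s = 1"
        using l by (subst epowr_ennreal_pos) (auto simp: ennreal_mult[symmetric] simp del: times_divide_eq_right)
      then show ?thesis by (simp only: mult.assoc[symmetric]) simp
    qed
    also have "\<dots> \<le> ennreal ((2 / l) powr s) * (ennreal C * (\<integral>\<^sup>+x. w x * epowr (?h x) s \<partial>lebesgue))"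
      using l by (intro mult_left_mono weak) auto
    also have "(\<integral>\<^sup>+x. w x * epowr (?h x) s \<partial>lebesgue) = ?J l"
      using s by (intro nn_integral_cong) (auto split: split_indicator)
    finally show ?thesis using C by (simp add: ennreal_mult mult.assoc)
  qed
  have "(\<integral>\<^sup>+x. w x * epowr (hl_max g x) a \<partial>lebesgue) = (\<integral>\<^sup>+l. ennreal (a * l powr (a - 1)) * indicator {0<..} l * (\<integral>\<^sup>+x. w x * indicator {x. ennreal l < hl_max g x} x \<partial>lebesgue) \<partial>lborel)"
    using s by (intro layer_cake sigma_finite_lebesgue) auto
  also have "\<dots> \<le> (\<integral>\<^sup>+l. ennreal (a / (a - s) * 2 powr s * C) * (ennreal ((a - s) * l powr (a - s - 1)) * indicator {0<..} l * ?J l) \<partial>lborel)"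
  proof (intro nn_integral_mono)
    fix l :: real
    show "ennreal (a * l powr (a - 1)) * indicator {0<..} l * (\<integral>\<^sup>+x. w x * indicator {x. ennreal l < hl_max g x} x \<partial>lebesgue)
      \<le> ennreal (a / (a - s) * 2 powr s * C) * (ennreal ((a - s) * l powr (a - s - 1)) * indicator {0<..} l * ?J l)"
    proof (cases "0 < l")
      case True
      have "ennreal (a * l powr (a - 1)) * (\<integral>\<^sup>+x. w x * indicator {x. ennreal l < hl_max g x} x \<partial>lebesgue)
        \<le> ennreal (a * l powr (a - 1)) * (ennreal ((2 / l) powr s * C) * ?J l)"
        by (intro mult_left_mono lev True) auto
      also have "\<dots> = ennreal (a / (a - s) * 2 powr s * C) * ennreal ((a - s) * l powr (a - s - 1)) * ?J l"
      proof -
        have "l powr (a - 1) * (2 / l) powr s = 2 powr s * l powr (a - s - 1)"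
          using True powr_diff[of l "a - 1" s] by (simp add: powr_divide algebra_simps)
        then have "a * (l powr (a - 1) * (2 / l) powr s) * C = a * (2 powr s * l powr (a - s - 1)) * C" by simp
        then have eq: "a * l powr (a - 1) * ((2 / l) powr s * C) = a / (a - s) * 2 powr s * C * ((a - s) * l powr (a - s - 1))"
          using s by (simp add: mult.assoc mult.commute mult.left_commute)
        have gen: "ennreal x * (ennreal y * j) = ennreal z * ennreal v * j" if "x * y = z * v" "0 \<le> x" "0 \<le> y" "0 \<le> z" "0 \<le> v" for x y z v j
          using that by (simp add: ennreal_mult[symmetric] mult.assoc[symmetric])
        show ?thesis by (rule gen[OF eq]) (use s C in auto)
      qed
      finally show ?thesis using True by (simp add: mult.assoc)
    qed simp
  qed
  also have "\<dots> = ennreal (a / (a - s) * 2 powr s * C) * (\<integral>\<^sup>+l. ennreal ((a - s) * l powr (a - s - 1)) * indicator {0<..} l * ?J l \<partial>lborel)"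
  proof -
    have [measurable]: "?J \<in> borel_measurable lborel" by (intro layer_cake_measurable sigma_finite_lebesgue) auto
    show ?thesis by (intro nn_integral_cmult) measurable
  qed
  also have "(\<integral>\<^sup>+l. ennreal ((a - s) * l powr (a - s - 1)) * indicator {0<..} l * ?J l \<partial>lborel)
     = (\<integral>\<^sup>+x. w x * epowr (g x) s * epowr (2 * g x) (a - s) \<partial>lebesgue)"
    using s by (intro layer_cake[symmetric] sigma_finite_lebesgue) auto
  also have "\<dots> = (\<integral>\<^sup>+x. ennreal (2 powr (a - s)) * (w x * epowr (g x) a) \<partial>lebesgue)"
  proof (intro nn_integral_cong)
    fix x
    have "epowr (g x) a = epowr (g x) s * epowr (g x) (a - s)"
      using epowr_add[of s "a - s" "g x"] s by simp
    moreover have "epowr 2 (a - s) = ennreal (2 powr (a - s))" using epowr_ennreal_pos[of 2 "a - s"] by simp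
    ultimately show "w x * epowr (g x) s * epowr (2 * g x) (a - s) = ennreal (2 powr (a - s)) * (w x * epowr (g x) a)"
      using s by (simp add: epowr_mult ac_simps)
  qed
  also have "\<dots> = ennreal (2 powr (a - s)) * (\<integral>\<^sup>+x. w x * epowr (g x) a \<partial>lebesgue)"
    by (intro nn_integral_cmult) measurable
  also have "ennreal (a / (a - s) * 2 powr s * C) * (ennreal (2 powr (a - s)) * (\<integral>\<^sup>+x. w x * epowr (g x) a \<partial>lebesgue))
     = ennreal (a / (a - s) * 2 powr s * C * 2 powr (a - s)) * (\<integral>\<^sup>+x. w x * epowr (g x) a \<partial>lebesgue)"
    using s C by (subst (2) ennreal_mult) (auto simp: mult.assoc)
  also have "a / (a - s) * 2 powr s * C * 2 powr (a - s) = a / (a - s) * 2 powr a * C"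
    using powr_add[of 2 s "a - s"] by simp
  finally show ?thesis .
qed

text \<open>The weak type bound holds at some s below t, so interpolation reaches the midpoint a of
  s and t, and k = t/a exceeds 1. Applying the bound on L^a(w) to g^k gives the claim. The margin k
  > 1 later pays for powers of the oscillation of b.\<close>

lemma ap_bound_hl_max:
  assumes t: "1 < t" and K: "1 \<le> K"
  shows "\<exists>k>1. \<exists>C\<ge>0. \<forall>(w :: 'a::euclidean_space \<Rightarrow> real) g. ap_bound t K w \<longrightarrow> g \<in> borel_measurable lebesgue \<longrightarrow>
    (\<integral>\<^sup>+x. ennreal (w x) * epowr (hl_max (\<lambda>y. epowr (g y) k) x) (t / k) \<partial>lebesgue)
      \<le> ennreal C * (\<integral>\<^sup>+x. ennreal (w x) * epowr (g x) t \<partial>lebesgue)"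
proof -
  define K' where "K' = K powr (1 / (t - 1))"
  have K': "1 \<le> K'" using t K by (auto simp: K'_def intro!: ge_one_powr_ge_zero)
  have t': "1 < t / (t - 1)" using t by simp
  from ap_bound_reverse_hoelder[OF t' K', where 'a = 'a] obtain e C where e: "0 < e" and C: "0 \<le> C" and
    RH: "\<And>W :: 'a \<Rightarrow> real. \<And>c r. ap_bound (t / (t - 1)) K' W \<Longrightarrow> 0 < r \<Longrightarrow>
      (\<integral>\<^sup>+y. epowr (ennreal (W y)) (1 + e) \<partial>ball_measure c r) \<le> ennreal C * epowr (\<integral>\<^sup>+y. ennreal (W y) \<partial>ball_measure c r) (1 + e)"
    by blast
  define s where "s = 1 + (t - 1) / (1 + e)"
  have s: "1 < s" "s < t"
  proof -
    have "(t - 1) / (1 + e) < (t - 1) / 1" using t e by (intro divide_strict_left_mono) auto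
    then show "1 < s" "s < t" using t e by (auto simp: s_def)
  qed
  define a where "a = (s + t) / 2"
  have a: "s < a" "a < t" using s by (auto simp: a_def)
  define k where "k = t / a"
  have k: "1 < k" "t / k = a" using a s by (auto simp: k_def)
  define D where "D = K * (5 ^ DIM('a)) powr t * (C powr (s - 1) * K)"
  have D: "0 \<le> D" using K by (simp add: D_def)
  have "(\<integral>\<^sup>+x. ennreal (w x) * epowr (hl_max (\<lambda>y. epowr (g y) k) x) (t / k) \<partial>lebesgue)
      \<le> ennreal (a / (a - s) * 2 powr a * D) * (\<integral>\<^sup>+x. ennreal (w x) * epowr (g x) t \<partial>lebesgue)"
    if w: "ap_bound t K w" and g[measurable]: "g \<in> borel_measurable lebesgue" for w :: "'a \<Rightarrow> real" and g
  proof -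
    have [measurable]: "w \<in> borel_measurable lebesgue" by (rule ap_boundD[OF w])
    have dual: "ap_bound (t / (t - 1)) K' (\<lambda>x. w x powr (- 1 / (t - 1)))"
      unfolding K'_def using K by (intro ap_bound_dual w t) auto
    have "(\<integral>\<^sup>+x. ennreal (w x) * epowr (hl_max (\<lambda>y. epowr (g y) k) x) a \<partial>lebesgue)
      \<le> ennreal (a / (a - s) * 2 powr a * D) * (\<integral>\<^sup>+x. ennreal (w x) * epowr (epowr (g x) k) a \<partial>lebesgue)"
    proof (rule hl_max_strong_type)
      show "epowr (ennreal l) s * (\<integral>\<^sup>+x. ennreal (w x) * indicator {x. ennreal l < hl_max g x} x \<partial>lebesgue)
        \<le> ennreal D * (\<integral>\<^sup>+x. ennreal (w x) * epowr (g x) s \<partial>lebesgue)"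
        if "g \<in> borel_measurable lebesgue" "0 < l" for g l
        unfolding D_def using that by (intro ap_bound_weak_type[OF w t K e C s_def RH[OF dual]]) auto
    qed (use s a D in auto)
    moreover have "epowr (epowr (g x) k) a = epowr (g x) t" for x
      using k a s by (subst epowr_epowr) (auto simp: k_def)
    ultimately show ?thesis by (simp only: k)
  qed
  then show ?thesis using k(1) a s D by (intro exI[of _ k] conjI exI[of _ "a / (a - s) * 2 powr a * D"]) auto
qed

section \<open>The good-\<lambda> inequality\<close>

lemma nn_integral_ball_measure_mono_AE:
  assumes "AE x in lebesgue. x \<in> ball c r \<longrightarrow> f x \<le> g x" and [measurable]: "f \<in> borel_measurable lebesgue" "g \<in> borel_measurable lebesgue"
  shows "(\<integral>\<^sup>+y. f y \<partial>ball_measure (c::'a::euclidean_space) r) \<le> (\<integral>\<^sup>+y. g y \<partial>ball_measure c r)"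
proof -
  have "(\<integral>\<^sup>+y. f y * indicator (ball c r) y \<partial>lebesgue) \<le> (\<integral>\<^sup>+y. g y * indicator (ball c r) y \<partial>lebesgue)"
    using assms(1) by (intro nn_integral_mono_AE) (auto elim!: eventually_mono split: split_indicator)
  then show ?thesis by (simp add: nn_integral_ball_measure divide_right_mono_ennreal)
qed

lemma ennreal_mult_le_imp_le:
  assumes "ennreal a * x \<le> ennreal b * y" "0 < a" "0 \<le> b"
  shows "x \<le> ennreal (b / a) * y"
proof -
  have "x = ennreal (1 / a) * (ennreal a * x)"
    using assms(2) by (simp add: mult.assoc[symmetric] ennreal_mult[symmetric])
  also have "\<dots> \<le> ennreal (1 / a) * (ennreal b * y)" by (intro mult_left_mono assms) auto
  also have "\<dots> = ennreal (b / a) * y"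
    using assms by (simp add: mult.assoc[symmetric] ennreal_mult[symmetric])
  finally show ?thesis .
qed

lemma hl_max_weak_type_ball:
  fixes U :: "'a::euclidean_space \<Rightarrow> ennreal"
  assumes [measurable]: "U \<in> borel_measurable lebesgue" and r: "0 < r" and q: "0 < q" and l: "0 < l" and B: "0 \<le> B"
    and avg: "(\<integral>\<^sup>+y. epowr (U y) q \<partial>ball_measure c r) \<le> ennreal B" and q1: "1 \<le> q"
  shows "emeasure lebesgue {x. ennreal l < hl_max (\<lambda>y. U y * indicator (ball c r) y) x}
    \<le> ennreal (5 ^ DIM('a) * B / l powr q) * emeasure lebesgue (ball c r)"
proof -
  let ?U = "\<lambda>y. U y * indicator (ball c r) y"
  have "{x. ennreal l < hl_max ?U x} \<subseteq> {x. ennreal (l powr q) < hl_max (\<lambda>y. epowr (?U y) q) x}"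
  proof safe
    fix x assume "ennreal l < hl_max ?U x"
    then have "epowr (ennreal l) q < epowr (hl_max ?U x) q" using q by (simp add: epowr_less_iff)
    also have "\<dots> \<le> hl_max (\<lambda>y. epowr (?U y) q) x" using q1 by (intro hl_max_jensen) auto
    finally show "ennreal (l powr q) < hl_max (\<lambda>y. epowr (?U y) q) x" using l q by (simp add: epowr_ennreal)
  qed
  then have "emeasure lebesgue {x. ennreal l < hl_max ?U x} \<le> emeasure lebesgue {x. ennreal (l powr q) < hl_max (\<lambda>y. epowr (?U y) q) x}"
    by (intro emeasure_mono lebesgue_superlevel) auto
  also have "\<dots> \<le> ennreal (5 ^ DIM('a) / l powr q) * (\<integral>\<^sup>+y. epowr (?U y) q \<partial>lebesgue)"
    using l by (intro ennreal_mult_le_imp_le hl_max_weak_type) auto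
  also have "(\<integral>\<^sup>+y. epowr (?U y) q \<partial>lebesgue) = (\<integral>\<^sup>+y. epowr (U y) q * indicator (ball c r) y \<partial>lebesgue)"
    using q by (intro nn_integral_cong) (auto split: split_indicator)
  also have "\<dots> = (\<integral>\<^sup>+y. epowr (U y) q \<partial>ball_measure c r) * emeasure lebesgue (ball c r)"
    using r by (simp add: ball_measure_mult)
  also have "ennreal (5 ^ DIM('a) / l powr q) * \<dots> \<le> ennreal (5 ^ DIM('a) / l powr q) * (ennreal B * emeasure lebesgue (ball c r))"
    by (intro mult_left_mono mult_right_mono avg) auto
  also have "\<dots> = ennreal (5 ^ DIM('a) * B / l powr q) * emeasure lebesgue (ball c r)"
    using B l by (simp add: mult.assoc[symmetric] ennreal_mult[symmetric])
  finally show ?thesis .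
qed

text \<open>Let a ball of radius r meet \<open>ball c d\<close>. If r \<ge> d/2, its 7-fold
  enlargement contains y because r + d + 2 d \<le> 7 r, so its F-average is at most 7^n l. Values
  above K l are therefore caused by balls inside \<open>ball c (2 * d)\<close>, where F \<le> U + V.
  The two terms of the bound are weak type (1,1) for U and weak type (q,q) for V, both at height K l
  / 2.\<close>

lemma good_lambda_local:
  fixes F U V :: "'a::euclidean_space \<Rightarrow> ennreal"
  assumes [measurable]: "F \<in> borel_measurable lebesgue" "U \<in> borel_measurable lebesgue" "V \<in> borel_measurable lebesgue"
    and q: "1 \<le> q" and d: "0 < d" and l: "0 < l" and \<gamma>: "0 \<le> \<gamma>" and A: "0 \<le> A" and K: "7 ^ DIM('a) \<le> K"
    and FUV: "AE x in lebesgue. x \<in> ball c (2 * d) \<longrightarrow> F x \<le> U x + V x"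
    and y: "y \<in> ball c (2 * d)" "hl_max F y \<le> ennreal l"
    and U: "(\<integral>\<^sup>+x. U x \<partial>ball_measure c (2 * d)) \<le> ennreal (A * (\<gamma> * l))"
    and V: "(\<integral>\<^sup>+x. epowr (V x) q \<partial>ball_measure c (2 * d)) \<le> ennreal ((A * (2 * l)) powr q)"
  shows "emeasure (ball_measure c (2 * d)) {x \<in> ball c d. ennreal (K * l) < hl_max F x}
    \<le> ennreal (5 ^ DIM('a) * (2 * A * \<gamma> / K + (4 * A / K) powr q))"
proof -
  define n where "n = DIM('a)"
  have K0: "0 < K" using K by (rule less_le_trans[rotated]) simp
  let ?B = "ball c (2 * d)"
  let ?h = "K * l / 2"
  have h: "0 < ?h" using K0 l by simp
  let ?EU = "{x. ennreal ?h < hl_max (\<lambda>y. U y * indicator ?B y) x}" and ?EV = "{x. ennreal ?h < hl_max (\<lambda>y. V y * indicator ?B y) x}"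
  have sub: "{x \<in> ball c d. ennreal (K * l) < hl_max F x} \<subseteq> ?EU \<union> ?EV"
  proof safe
    fix x assume x: "x \<in> ball c d" "ennreal (K * l) < hl_max F x" and nV: "\<not> ennreal ?h < hl_max (\<lambda>y. V y * indicator ?B y) x"
    obtain c' r where r: "0 < r" "x \<in> ball c' r" "ennreal (K * l) < (\<integral>\<^sup>+y. F y \<partial>ball_measure c' r)"
      using x(2) unfolding less_hl_max_iff by blast
    have xc: "dist c x < d" "dist c' x < r" "dist c y < 2 * d" using x(1) r(2) y(1) by auto
    have "r < d / 2"
    proof (rule ccontr)
      assume "\<not> r < d / 2"
      then have "dist c' y < 7 * r"
        using xc dist_triangle[of c' y x] dist_triangle[of x y c] by (simp add: dist_commute)
      then have "(\<integral>\<^sup>+y. F y \<partial>ball_measure c' (7 * r)) \<le> ennreal l"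
        using y(2) r(1) by (intro order_trans[OF hl_max_ge[of "7 * r" y c' F] y(2)]) auto
      moreover have "(\<integral>\<^sup>+y. F y \<partial>ball_measure c' r) \<le> ennreal (7 ^ DIM('a)) * (\<integral>\<^sup>+y. F y \<partial>ball_measure c' (7 * r))"
        using r(1) by (intro ball_measure_mono_ball) (auto intro!: subset_ball)
      ultimately have "(\<integral>\<^sup>+y. F y \<partial>ball_measure c' r) \<le> ennreal (7 ^ DIM('a)) * ennreal l"
        by (meson mult_left_mono order_trans zero_le)
      also have "\<dots> \<le> ennreal (K * l)"
        using K l by (simp add: ennreal_mult[symmetric] ennreal_leI)
      finally show False using r(3) by simp
    qed
    then have sb: "ball c' r \<subseteq> ?B"
    proof (intro subsetI)
      fix z assume "z \<in> ball c' r" "r < d / 2"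
      then show "z \<in> ?B"
        using xc dist_triangle[of c z x] dist_triangle[of x z c'] by (simp add: dist_commute)
    qed
    have "(\<integral>\<^sup>+y. F y \<partial>ball_measure c' r) \<le> (\<integral>\<^sup>+y. U y * indicator ?B y + V y * indicator ?B y \<partial>ball_measure c' r)"
      using FUV sb by (intro nn_integral_ball_measure_mono_AE) (auto elim!: eventually_mono split: split_indicator)
    also have "\<dots> = (\<integral>\<^sup>+y. U y * indicator ?B y \<partial>ball_measure c' r) + (\<integral>\<^sup>+y. V y * indicator ?B y \<partial>ball_measure c' r)"
      by (intro nn_integral_add) auto
    also have "(\<integral>\<^sup>+y. V y * indicator ?B y \<partial>ball_measure c' r) \<le> ennreal ?h"
      using nV hl_max_ge[OF r(1,2), of "\<lambda>y. V y * indicator ?B y"] by (simp add: not_less)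
    finally have "ennreal (K * l) < (\<integral>\<^sup>+y. U y * indicator ?B y \<partial>ball_measure c' r) + ennreal ?h"
      using r(3) by (auto intro: less_le_trans add_left_mono)
    moreover have "ennreal (K * l) = ennreal ?h + ennreal ?h" using h by (subst ennreal_plus[symmetric]) auto
    ultimately have "ennreal ?h < (\<integral>\<^sup>+y. U y * indicator ?B y \<partial>ball_measure c' r)"
      by (metis add_right_mono not_le)
    then show "ennreal ?h < hl_max (\<lambda>y. U y * indicator ?B y) x"
      using r(1,2) unfolding less_hl_max_iff by blast
  qed
  have EU: "emeasure lebesgue ?EU \<le> ennreal (5 ^ n * (A * (\<gamma> * l)) / ?h powr 1) * emeasure lebesgue ?B"
    unfolding n_def using d h A \<gamma> l U by (intro hl_max_weak_type_ball) auto
  have EV: "emeasure lebesgue ?EV \<le> ennreal (5 ^ n * (A * (2 * l)) powr q / ?h powr q) * emeasure lebesgue ?B"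
    unfolding n_def using d h A l q V by (intro hl_max_weak_type_ball) auto
  have meas: "?EU \<in> sets lebesgue" "?EV \<in> sets lebesgue" by (intro lebesgue_superlevel; simp)+
  have "emeasure lebesgue {x \<in> ball c d. ennreal (K * l) < hl_max F x} \<le> emeasure lebesgue (?EU \<union> ?EV)"
    using meas by (intro emeasure_mono sub) auto
  also have "\<dots> \<le> emeasure lebesgue ?EU + emeasure lebesgue ?EV" using meas by (rule emeasure_subadditive)
  also have "\<dots> \<le> ennreal (5 ^ n * (A * (\<gamma> * l)) / ?h powr 1) * emeasure lebesgue ?B + ennreal (5 ^ n * (A * (2 * l)) powr q / ?h powr q) * emeasure lebesgue ?B"
    by (intro add_mono EU EV)
  also have "\<dots> = ennreal (5 ^ n * (A * (\<gamma> * l)) / ?h powr 1 + 5 ^ n * (A * (2 * l)) powr q / ?h powr q) * emeasure lebesgue ?B"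
    using A \<gamma> l h K0 by (subst ennreal_plus) (auto simp: distrib_right)
  also have "5 ^ n * (A * (\<gamma> * l)) / ?h powr 1 + 5 ^ n * (A * (2 * l)) powr q / ?h powr q = 5 ^ n * (2 * A * \<gamma> / K + (4 * A / K) powr q)"
  proof -
    have "(A * (2 * l)) powr q / ?h powr q = ((A * (2 * l)) / ?h) powr q" by (simp only: powr_divide)
    also have "(A * (2 * l)) / ?h = 4 * A / K" using l K0 by simp
    finally have 1: "(A * (2 * l)) powr q / ?h powr q = (4 * A / K) powr q" .
    have 2: "(A * (\<gamma> * l)) / ?h powr 1 = 2 * A * \<gamma> / K" using l K0 h by simp
    show ?thesis unfolding distrib_left 1[symmetric] 2[symmetric] by simp
  qed
  finally have le: "emeasure lebesgue {x \<in> ball c d. ennreal (K * l) < hl_max F x} \<le> ennreal (5 ^ n * (2 * A * \<gamma> / K + (4 * A / K) powr q)) * emeasure lebesgue ?B" .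
  have "{x. ennreal (K * l) < hl_max F x} \<in> sets lebesgue" by (intro lebesgue_superlevel) simp
  then have ms: "{x \<in> ball c d. ennreal (K * l) < hl_max F x} \<in> sets lebesgue"
    using sets.Int[OF ball_measurable, of "{x. ennreal (K * l) < hl_max F x}" c d] by (simp add: Int_def)
  have "?B \<inter> {x \<in> ball c d. ennreal (K * l) < hl_max F x} = {x \<in> ball c d. ennreal (K * l) < hl_max F x}"
    using d by auto
  then have "emeasure (ball_measure c (2 * d)) {x \<in> ball c d. ennreal (K * l) < hl_max F x} = emeasure lebesgue {x \<in> ball c d. ennreal (K * l) < hl_max F x} / emeasure lebesgue ?B"
    using ms by (simp add: emeasure_ball_measure)
  also have "\<dots> \<le> (ennreal (5 ^ n * (2 * A * \<gamma> / K + (4 * A / K) powr q)) * emeasure lebesgue ?B) / emeasure lebesgue ?B"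
    by (intro divide_right_mono_ennreal le)
  also have "\<dots> = ennreal (5 ^ n * (2 * A * \<gamma> / K + (4 * A / K) powr q))"
    using d emeasure_ball_finite[of c "2 * d"] by (subst ennreal_times_divide[symmetric]) (simp add: less_top)
  finally show ?thesis by (simp add: n_def)
qed

lemma infinite_lebesgue_UNIV: "emeasure lebesgue (UNIV :: 'a::euclidean_space set) = \<infinity>"
  by (simp add: emeasure_completion)

text \<open>A Whitney-type covering: each ball has the distance to the complement of \<Omega> as its
  radius. Its double meets the complement, which supplies a point y with small maximal function,
  while a point z outside H supplies a small value of G. These points differ in general; hence the
  two separate points in the bound for V.\<close>

lemma good_lambda_level:
  fixes F G w :: "'a::euclidean_space \<Rightarrow> ennreal"
  assumes [measurable]: "F \<in> borel_measurable lebesgue" "G \<in> borel_measurable lebesgue" "w \<in> borel_measurable lebesgue"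
    and q: "1 \<le> q" and l: "0 < l" and \<gamma>: "0 \<le> \<gamma>" "\<gamma> \<le> 1" and A: "0 \<le> A" and K: "7 ^ DIM('a) \<le> K"
    and fin: "(\<integral>\<^sup>+x. F x \<partial>lebesgue) < \<infinity>"
    and dec: "\<And>c r. 0 < r \<Longrightarrow> \<exists>U\<in>borel_measurable lebesgue. \<exists>V\<in>borel_measurable lebesgue.
      (AE x in lebesgue. x \<in> ball c r \<longrightarrow> F x \<le> U x + V x) \<and>
      (\<forall>x\<in>ball c r. (\<integral>\<^sup>+y. U y \<partial>ball_measure c r) \<le> ennreal A * G x) \<and>
      (\<forall>x\<in>ball c r. \<forall>y\<in>ball c r. (\<integral>\<^sup>+y. epowr (V y) q \<partial>ball_measure c r) \<le> epowr (ennreal A * (hl_max F x + G y)) q)"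
    and \<theta>: "0 < \<theta>" and C: "0 \<le> C" and D: "0 \<le> D"
    and small: "\<And>c r E. 0 < r \<Longrightarrow> E \<in> sets lebesgue \<Longrightarrow>
      (\<integral>\<^sup>+y. w y * indicator E y \<partial>ball_measure c r) \<le> ennreal C * epowr (emeasure (ball_measure c r) E) \<theta> * (\<integral>\<^sup>+y. w y \<partial>ball_measure c r)"
    and dbl: "\<And>c r. 0 < r \<Longrightarrow> (\<integral>\<^sup>+y. w y * indicator (ball c (10 * r)) y \<partial>lebesgue) \<le> ennreal D * (\<integral>\<^sup>+y. w y * indicator (ball c r) y \<partial>lebesgue)"
  shows "(\<integral>\<^sup>+x. w x * indicator {x. ennreal (K * l) < hl_max F x} x \<partial>lebesgue)
    \<le> ennreal (C * D * (5 ^ DIM('a) * (2 * A * \<gamma> / K + (4 * A / K) powr q)) powr \<theta>) * (\<integral>\<^sup>+x. w x * indicator {x. ennreal l < hl_max F x} x \<partial>lebesgue)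
      + (\<integral>\<^sup>+x. w x * indicator {x. ennreal (\<gamma> * l) < G x} x \<partial>lebesgue)"
proof -
  define \<eta> where "\<eta> = 5 ^ DIM('a) * (2 * A * \<gamma> / K + (4 * A / K) powr q)"
  have K1: "1 \<le> K" using K by (rule order_trans[rotated]) simp
  have \<eta>: "0 \<le> \<eta>" using A \<gamma> K1 by (simp add: \<eta>_def)
  define \<Omega> where "\<Omega> = {x. ennreal l < hl_max F x}"
  define H where "H = {x. ennreal (\<gamma> * l) < G x}"
  define T where "T = {x. ennreal (K * l) < hl_max F x}"
  have op: "open \<Omega>" unfolding \<Omega>_def by (rule open_less_hl_max)
  have [measurable]: "\<Omega> \<in> sets lebesgue" "H \<in> sets lebesgue" "T \<in> sets lebesgue"
    unfolding \<Omega>_def H_def T_def by (intro lebesgue_superlevel; simp)+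
  have T\<Omega>: "T \<subseteq> \<Omega>"
  proof -
    have "ennreal l \<le> ennreal (K * l)" using K1 l by (intro ennreal_leI) simp
    then show ?thesis unfolding T_def \<Omega>_def by (auto intro: le_less_trans)
  qed
  \<comment> \<open>Integrability of F enters here. Finite measure keeps \<Omega> from being the
    whole space and bounds the distances to its complement.\<close>
  have fin\<Omega>: "emeasure lebesgue \<Omega> < \<infinity>"
  proof -
    have "ennreal l * emeasure lebesgue \<Omega> \<le> ennreal (5 ^ DIM('a)) * (\<integral>\<^sup>+y. F y \<partial>lebesgue)"
      unfolding \<Omega>_def by (rule hl_max_weak_type) simp
    also have "\<dots> < \<infinity>" using fin by (simp add: ennreal_mult_less_top)
    finally show ?thesis using l by (auto simp: ennreal_mult_less_top less_top[symmetric])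
  qed
  define d where "d x = infdist x (- \<Omega>)" for x
  have cl: "closed (- \<Omega>)" "- \<Omega> \<noteq> {}"
  proof -
    show "closed (- \<Omega>)" using op by (rule closed_Compl)
    show "- \<Omega> \<noteq> {}"
    proof
      assume "- \<Omega> = {}"
      then have "\<Omega> = UNIV" by blast
      then show False using fin\<Omega> infinite_lebesgue_UNIV[where 'a='a] by simp
    qed
  qed
  have d0: "0 < d x" if "x \<in> \<Omega>" for x
    using that cl infdist_pos_not_in_closed[of "- \<Omega>" x] by (simp add: d_def)
  have dsub: "ball x (d x) \<subseteq> \<Omega>" for x
  proof
    fix y assume "y \<in> ball x (d x)"
    then show "y \<in> \<Omega>" using infdist_le[of y "- \<Omega>" x] by (auto simp: d_def)
  qed
  have dnear: "\<exists>y. y \<in> ball x (2 * d x) \<and> y \<notin> \<Omega>" if x: "x \<in> \<Omega>" for x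
  proof -
    obtain y where "y \<in> - \<Omega>" "infdist x (- \<Omega>) = dist x y" using infdist_attains_inf[OF cl] by blast
    then show ?thesis using d0[OF x] by (intro exI[of _ y]) (auto simp: d_def)
  qed
  define v where "v = measure lebesgue (ball (0::'a) 1)"
  have v: "0 < v" "emeasure lebesgue (ball (0::'a) 1) = ennreal v"
  proof -
    show e: "emeasure lebesgue (ball (0::'a) 1) = ennreal v"
      unfolding v_def using emeasure_ball_finite[of "0::'a" 1] by (intro emeasure_eq_ennreal_measure) simp
    show "0 < v" using emeasure_ball_pos[of 1 "0::'a"] e by simp
  qed
  obtain m where m: "emeasure lebesgue \<Omega> = ennreal m" "0 \<le> m" using fin\<Omega> by (cases "emeasure lebesgue \<Omega>") auto
  \<comment> \<open>Vitali's lemma needs bounded radii. The ball of radius d x lies in \<Omega>, and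
    d x \<le> (d x)^n once d x > 1.\<close>
  have dbound: "d x \<le> max 1 (m / v)" if x: "x \<in> \<Omega>" for x
  proof (cases "d x \<le> 1")
    case False
    have "ennreal (d x ^ DIM('a) * v) = emeasure lebesgue (ball x (d x))"
      using emeasure_lebesgue_ball_conv_unit_ball[of "d x" x] d0[OF x] v by (simp add: ennreal_mult)
    also have "\<dots> \<le> ennreal m" unfolding m(1)[symmetric] by (intro emeasure_mono dsub) simp
    finally have "d x ^ DIM('a) * v \<le> m" using m(2) by (simp add: ennreal_le_iff)
    moreover have "d x ^ 1 \<le> d x ^ DIM('a)" using False by (intro power_increasing) (auto simp: DIM_positive Suc_leI)
    ultimately have "d x * v \<le> m" using v(1) by (metis mult_le_cancel_right_pos order_trans power_one_right)
    then show ?thesis using v(1) by (simp add: pos_le_divide_eq le_max_iff_disj)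
  qed simp
  obtain C' where C': "countable C'" "C' \<subseteq> \<Omega>"
    "pairwise (\<lambda>i j. disjnt (ball i (d i / 5)) (ball j (d j / 5))) C'"
    "\<Omega> \<subseteq> (\<Union>i\<in>C'. ball i (5 * (d i / 5)))"
  proof (rule Vitali_covering_lemma_balls[where S = \<Omega> and K = \<Omega> and a = "\<lambda>x. x" and r = "\<lambda>x. d x / 5" and B = "max 1 (m / v)"])
    show "\<Omega> \<subseteq> (\<Union>i\<in>\<Omega>. ball i (d i / 5))" using d0 by force
    show "0 < d i / 5 \<and> d i / 5 \<le> max 1 (m / v)" if "i \<in> \<Omega>" for i
      using d0[OF that] dbound[OF that] by simp
  qed blast
  let ?N = "density lebesgue w"
  have loc: "emeasure ?N (ball i (d i) \<inter> T - H) \<le> ennreal (C * D * \<eta> powr \<theta>) * emeasure ?N (ball i (d i / 5))" if i: "i \<in> C'" for i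
  proof (cases "ball i (d i) \<inter> T - H = {}")
    case False
    then obtain z where z: "z \<in> ball i (d i)" "z \<notin> H" by blast
    from z(2) have zG: "G z \<le> ennreal (\<gamma> * l)" by (simp add: H_def not_less)
    have i\<Omega>: "i \<in> \<Omega>" using i C'(2) by blast
    have d: "0 < d i" by (rule d0[OF i\<Omega>])
    obtain y where y: "y \<in> ball i (2 * d i)" "hl_max F y \<le> ennreal l" using dnear[OF i\<Omega>] by (auto simp: \<Omega>_def not_less)
    have z2: "z \<in> ball i (2 * d i)" using z(1) d by auto
    have d2: "0 < 2 * d i" using d by simp
    obtain U V where UV[measurable]: "U \<in> borel_measurable lebesgue" "V \<in> borel_measurable lebesgue"
      and UV': "AE x in lebesgue. x \<in> ball i (2 * d i) \<longrightarrow> F x \<le> U x + V x"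
        "\<And>x. x \<in> ball i (2 * d i) \<Longrightarrow> (\<integral>\<^sup>+y. U y \<partial>ball_measure i (2 * d i)) \<le> ennreal A * G x"
        "\<And>x y. x \<in> ball i (2 * d i) \<Longrightarrow> y \<in> ball i (2 * d i) \<Longrightarrow> (\<integral>\<^sup>+y. epowr (V y) q \<partial>ball_measure i (2 * d i)) \<le> epowr (ennreal A * (hl_max F x + G y)) q"
      using dec[OF d2, of i] by blast
    have "(\<integral>\<^sup>+y. U y \<partial>ball_measure i (2 * d i)) \<le> ennreal A * ennreal (\<gamma> * l)"
      by (intro order_trans[OF UV'(2)[OF z2]] mult_left_mono zG) auto
    then have U1: "(\<integral>\<^sup>+y. U y \<partial>ball_measure i (2 * d i)) \<le> ennreal (A * (\<gamma> * l))"
      using A \<gamma> l by (simp add: ennreal_mult)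
    have "hl_max F y + G z \<le> ennreal l + ennreal (\<gamma> * l)" by (intro add_mono y zG)
    also have "\<dots> = ennreal (l + \<gamma> * l)" using l \<gamma> by simp
    also have "\<dots> \<le> ennreal (2 * l)" using l \<gamma> by (intro ennreal_leI) simp
    finally have "ennreal A * (hl_max F y + G z) \<le> ennreal A * ennreal (2 * l)" by (rule mult_left_mono) simp
    also have "\<dots> = ennreal (A * (2 * l))" using A l by (simp add: ennreal_mult)
    finally have "epowr (ennreal A * (hl_max F y + G z)) q \<le> epowr (ennreal (A * (2 * l))) q" using q by (intro epowr_mono) auto
    also have "\<dots> = ennreal ((A * (2 * l)) powr q)" using q A l by (simp add: epowr_ennreal)
    finally have V1: "(\<integral>\<^sup>+y. epowr (V y) q \<partial>ball_measure i (2 * d i)) \<le> ennreal ((A * (2 * l)) powr q)"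
      using UV'(3)[OF y(1) z2] by (rule order_trans[rotated])
    have P: "emeasure (ball_measure i (2 * d i)) {x \<in> ball i (d i). ennreal (K * l) < hl_max F x} \<le> ennreal \<eta>"
      unfolding \<eta>_def by (rule good_lambda_local[OF _ _ _ q d l \<gamma>(1) A K UV'(1) y U1 V1]) measurable
    have eqT: "{x \<in> ball i (d i). ennreal (K * l) < hl_max F x} = ball i (d i) \<inter> T" by (auto simp: T_def)
    have "emeasure ?N (ball i (d i) \<inter> T - H) \<le> emeasure ?N (ball i (d i) \<inter> T)" by (intro emeasure_mono) auto
    also have "\<dots> = (\<integral>\<^sup>+y. w y * indicator (ball i (d i) \<inter> T) y * indicator (ball i (2 * d i)) y \<partial>lebesgue)"
      using d by (subst emeasure_density) (auto intro!: nn_integral_cong split: split_indicator)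
    also have "\<dots> = (\<integral>\<^sup>+y. w y * indicator (ball i (d i) \<inter> T) y \<partial>ball_measure i (2 * d i)) * emeasure lebesgue (ball i (2 * d i))"
      using d by (subst ball_measure_mult) auto
    also have "\<dots> \<le> (ennreal C * epowr (emeasure (ball_measure i (2 * d i)) (ball i (d i) \<inter> T)) \<theta> * (\<integral>\<^sup>+y. w y \<partial>ball_measure i (2 * d i))) * emeasure lebesgue (ball i (2 * d i))"
      using d by (intro mult_right_mono small) auto
    also have "\<dots> \<le> (ennreal C * epowr (ennreal \<eta>) \<theta> * (\<integral>\<^sup>+y. w y \<partial>ball_measure i (2 * d i))) * emeasure lebesgue (ball i (2 * d i))"
      using P \<theta> unfolding eqT by (intro mult_right_mono mult_left_mono epowr_mono) auto
    also have "\<dots> = ennreal C * ennreal (\<eta> powr \<theta>) * ((\<integral>\<^sup>+y. w y \<partial>ball_measure i (2 * d i)) * emeasure lebesgue (ball i (2 * d i)))"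
      using \<theta> \<eta> by (simp add: epowr_ennreal mult.assoc)
    also have "(\<integral>\<^sup>+y. w y \<partial>ball_measure i (2 * d i)) * emeasure lebesgue (ball i (2 * d i)) = (\<integral>\<^sup>+y. w y * indicator (ball i (10 * (d i / 5))) y \<partial>lebesgue)"
      using d by (subst ball_measure_mult) auto
    also have "\<dots> \<le> ennreal D * emeasure ?N (ball i (d i / 5))"
      using dbl[of "d i / 5" i] d by (simp add: emeasure_density)
    also have "ennreal C * ennreal (\<eta> powr \<theta>) * (ennreal D * emeasure ?N (ball i (d i / 5))) = ennreal (C * D * \<eta> powr \<theta>) * emeasure ?N (ball i (d i / 5))"
      using C D by (simp add: ennreal_mult ac_simps)
    finally show ?thesis by (simp add: mult_left_mono)
  next
    case True
    then show ?thesis by (simp only: emeasure_empty zero_le)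
  qed
  have "T - H \<subseteq> (\<Union>i\<in>C'. ball i (d i) \<inter> T - H)"
    using T\<Omega> C'(4) by fastforce
  then have "emeasure ?N (T - H) \<le> emeasure ?N (\<Union>i\<in>C'. ball i (d i) \<inter> T - H)"
  proof (rule emeasure_mono)
    show "(\<Union>i\<in>C'. ball i (d i) \<inter> T - H) \<in> sets ?N"
      unfolding sets_density by (intro sets.countable_UN'' C') measurable
  qed
  also have "\<dots> \<le> (\<integral>\<^sup>+i. emeasure ?N (ball i (d i) \<inter> T - H) \<partial>count_space C')"
    using C'(1) by (intro emeasure_UN_le_count_space) auto
  also have "\<dots> \<le> (\<integral>\<^sup>+i. ennreal (C * D * \<eta> powr \<theta>) * emeasure ?N (ball i (d i / 5)) \<partial>count_space C')"
    using loc by (intro nn_integral_mono) auto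
  also have "\<dots> = ennreal (C * D * \<eta> powr \<theta>) * (\<integral>\<^sup>+i. emeasure ?N (ball i (d i / 5)) \<partial>count_space C')"
    by (simp add: nn_integral_cmult)
  also have "(\<integral>\<^sup>+i. emeasure ?N (ball i (d i / 5)) \<partial>count_space C') = emeasure ?N (\<Union>i\<in>C'. ball i (d i / 5))"
    using C'(1,3) by (intro emeasure_UN_countable[symmetric]) (auto simp: disjoint_family_on_def pairwise_def disjnt_def)
  also have "\<dots> \<le> emeasure ?N \<Omega>"
  proof (intro emeasure_mono UN_least)
    fix i assume "i \<in> C'"
    then have "0 < d i" using C'(2) d0 by blast
    then have "ball i (d i / 5) \<subseteq> ball i (d i)" by (intro subset_ball) simp
    then show "ball i (d i / 5) \<subseteq> \<Omega>" using dsub by blast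
  qed simp
  finally have 1: "emeasure ?N (T - H) \<le> ennreal (C * D * \<eta> powr \<theta>) * emeasure ?N \<Omega>" by (simp add: mult_left_mono)
  have "emeasure ?N T \<le> emeasure ?N ((T - H) \<union> H)" by (intro emeasure_mono) auto
  also have "\<dots> \<le> emeasure ?N (T - H) + emeasure ?N H" by (intro emeasure_subadditive) auto
  also have "\<dots> \<le> ennreal (C * D * \<eta> powr \<theta>) * emeasure ?N \<Omega> + emeasure ?N H" by (intro add_mono 1) auto
  finally show ?thesis
    by (simp add: emeasure_density) (simp add: T_def H_def \<Omega>_def \<eta>_def)
qed

lemma SUP_epowr_min_of_nat:
  assumes t: "1 \<le> t" shows "(SUP n. epowr (min h (of_nat n)) t) = epowr h t"
proof (rule antisym)
  show "(SUP n. epowr (min h (of_nat n)) t) \<le> epowr h t"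
    using t by (intro SUP_least epowr_mono) auto
  show "epowr h t \<le> (SUP n. epowr (min h (of_nat n)) t)"
  proof (cases h)
    case (real r)
    obtain n where "r \<le> real n" using real_arch_simple by blast
    then have "h \<le> of_nat n" using real by (simp add: ennreal_of_nat_eq_real_of_nat ennreal_leI)
    then show ?thesis by (intro SUP_upper2[of n]) (auto simp: min_def)
  next
    case top
    have "of_nat n \<le> epowr (min h (of_nat n)) t" for n
    proof (cases "n = 0")
      case False
      then have "real n powr 1 \<le> real n powr t" using t by (intro powr_mono) auto
      then show ?thesis using top False t by (simp add: ennreal_of_nat_eq_real_of_nat epowr_ennreal_pos ennreal_leI)
    qed simp
    then have "(SUP n. of_nat n :: ennreal) \<le> (SUP n. epowr (min h (of_nat n)) t)" by (intro SUP_mono) auto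
    then have "(SUP n. epowr (min h (of_nat n)) t) = top" by (simp only: ennreal_SUP_of_nat_eq_top top_unique)
    then show ?thesis by (simp only: top_greatest)
  qed
qed

text \<open>The left-hand side is first truncated at height \<open>n\<close>, where it is finite because \<open>w\<close> is bounded, \<open>F\<close>
  is integrable and \<open>1 < t\<close>; it can then be absorbed.\<close>

lemma good_lambda:
  fixes F G w :: "'a::euclidean_space \<Rightarrow> ennreal"
  assumes meas[measurable]: "F \<in> borel_measurable lebesgue" "G \<in> borel_measurable lebesgue" "w \<in> borel_measurable lebesgue"
    and q: "1 \<le> q" and t: "1 < t" and \<gamma>: "0 < \<gamma>" "\<gamma> \<le> 1" and A: "0 \<le> A" and K: "7 ^ DIM('a) \<le> K"
    and fin: "(\<integral>\<^sup>+x. F x \<partial>lebesgue) < \<infinity>" and wN: "\<And>x. w x \<le> ennreal N"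
    and dec: "\<And>c r. 0 < r \<Longrightarrow> \<exists>U\<in>borel_measurable lebesgue. \<exists>V\<in>borel_measurable lebesgue.
      (AE x in lebesgue. x \<in> ball c r \<longrightarrow> F x \<le> U x + V x) \<and>
      (\<forall>x\<in>ball c r. (\<integral>\<^sup>+y. U y \<partial>ball_measure c r) \<le> ennreal A * G x) \<and>
      (\<forall>x\<in>ball c r. \<forall>y\<in>ball c r. (\<integral>\<^sup>+y. epowr (V y) q \<partial>ball_measure c r) \<le> epowr (ennreal A * (hl_max F x + G y)) q)"
    and \<theta>: "0 < \<theta>" and C: "0 \<le> C" and D: "0 \<le> D"
    and small: "\<And>c r E. 0 < r \<Longrightarrow> E \<in> sets lebesgue \<Longrightarrow>
      (\<integral>\<^sup>+y. w y * indicator E y \<partial>ball_measure c r) \<le> ennreal C * epowr (emeasure (ball_measure c r) E) \<theta> * (\<integral>\<^sup>+y. w y \<partial>ball_measure c r)"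
    and dbl: "\<And>c r. 0 < r \<Longrightarrow> (\<integral>\<^sup>+y. w y * indicator (ball c (10 * r)) y \<partial>lebesgue) \<le> ennreal D * (\<integral>\<^sup>+y. w y * indicator (ball c r) y \<partial>lebesgue)"
    and absorb: "K powr t * (C * D * (5 ^ DIM('a) * (2 * A * \<gamma> / K + (4 * A / K) powr q)) powr \<theta>) \<le> 1 / 2"
  shows "(\<integral>\<^sup>+x. w x * epowr (hl_max F x) t \<partial>lebesgue) \<le> ennreal (2 * (K / \<gamma>) powr t) * (\<integral>\<^sup>+x. w x * epowr (G x) t \<partial>lebesgue)"
proof -
  define e where "e = C * D * (5 ^ DIM('a) * (2 * A * \<gamma> / K + (4 * A / K) powr q)) powr \<theta>"
  have e: "0 \<le> e" using C D by (simp add: e_def)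
  have K1: "1 \<le> K" using K by (rule order_trans[rotated]) simp
  define Y where "Y = (\<integral>\<^sup>+x. w x * epowr (G x) t \<partial>lebesgue)"
  have trunc: "(\<integral>\<^sup>+x. w x * epowr (min (hl_max F x) (of_nat n)) t \<partial>lebesgue) \<le> ennreal (2 * (K / \<gamma>) powr t) * Y" for n
  proof -
    define m where "m x = min (hl_max F x) (of_nat n)" for x
    have [measurable]: "m \<in> borel_measurable lebesgue" unfolding m_def by measurable
    define X where "X = (\<integral>\<^sup>+x. w x * epowr (m x) t \<partial>lebesgue)"
    \<comment> \<open>For K l < n the truncation affects neither superlevel set of the maximal
      function. For K l \<ge> n the set on the left is empty because \<open>m\<close> is at most
      n.\<close>
    have lev: "(\<integral>\<^sup>+x. w x * indicator {x. ennreal l < ennreal (1/K) * m x} x \<partial>lebesgue)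
      \<le> ennreal e * (\<integral>\<^sup>+x. w x * indicator {x. ennreal l < m x} x \<partial>lebesgue) + (\<integral>\<^sup>+x. w x * indicator {x. ennreal l < ennreal (1/\<gamma>) * G x} x \<partial>lebesgue)"
      if l: "0 < l" for l
    proof -
      have sc: "ennreal l < ennreal (1/k) * z \<longleftrightarrow> ennreal (k * l) < z" if "0 < k" for k z
        using that l by (cases z) (auto simp: ennreal_mult[symmetric] ennreal_less_iff ennreal_mult_top field_simps)
      show ?thesis
      proof (cases "K * l < real n")
        case True
        have "l \<le> K * l" using K1 l by simp
        then have "l < real n" using True by simp
        have 1: "(ennreal l < ennreal (1/K) * m x) = (ennreal (K * l) < hl_max F x)" for x
          using True K1 by (simp only: sc m_def min_less_iff_conj ennreal_of_nat_eq_real_of_nat[symmetric] ennreal_less_iff) (auto simp: ennreal_of_nat_eq_real_of_nat ennreal_less_iff l less_imp_le sc)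
        have 2: "(ennreal l < m x) = (ennreal l < hl_max F x)" for x
          using \<open>l < real n\<close> l by (auto simp: m_def ennreal_of_nat_eq_real_of_nat ennreal_less_iff)
        have 3: "(ennreal l < ennreal (1/\<gamma>) * G x) = (ennreal (\<gamma> * l) < G x)" for x using \<gamma> by (intro sc) auto
        show ?thesis unfolding 1 2 3 e_def
          by (rule good_lambda_level[OF meas q l less_imp_le[OF \<gamma>(1)] \<gamma>(2) A K fin dec \<theta> C D small dbl])
      next
        case False
        have "\<not> ennreal l < ennreal (1/K) * m x" for x
        proof -
          have "m x \<le> of_nat n" by (simp add: m_def)
          also have "\<dots> \<le> ennreal (K * l)" using False by (simp add: ennreal_of_nat_eq_real_of_nat ennreal_leI)
          finally show ?thesis using K1 by (subst sc) auto
        qed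
        then show ?thesis by simp
      qed
    qed
    \<comment> \<open>Weak type (1,1) bounds the measure of the superlevel sets by a multiple of
      1/l. Up to height n this leaves the integral of l^(t-2), which is finite for t > 1.\<close>
    have Xfin: "X < top"
    proof -
      have "X \<le> (\<integral>\<^sup>+x. ennreal N * (1 * epowr (m x) t) \<partial>lebesgue)"
        unfolding X_def using wN by (intro nn_integral_mono) (auto intro: mult_right_mono)
      also have "\<dots> = ennreal N * (\<integral>\<^sup>+x. 1 * epowr (m x) t \<partial>lebesgue)" by (simp add: nn_integral_cmult)
      also have "(\<integral>\<^sup>+x. 1 * epowr (m x) t \<partial>lebesgue) = (\<integral>\<^sup>+l. ennreal (t * l powr (t - 1)) * indicator {0<..} l * (\<integral>\<^sup>+x. 1 * indicator {x. ennreal l < m x} x \<partial>lebesgue) \<partial>lborel)"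
        using t by (intro layer_cake sigma_finite_lebesgue) auto
      also have "\<dots> \<le> (\<integral>\<^sup>+l. ennreal (t / (t - 1) * 5 ^ DIM('a)) * (\<integral>\<^sup>+x. F x \<partial>lebesgue) * (ennreal ((t - 1) * l powr (t - 1 - 1)) * indicator {0<..<real n} l) \<partial>lborel)"
      proof (intro nn_integral_mono)
        fix l :: real
        show "ennreal (t * l powr (t - 1)) * indicator {0<..} l * (\<integral>\<^sup>+x. 1 * indicator {x. ennreal l < m x} x \<partial>lebesgue)
          \<le> ennreal (t / (t - 1) * 5 ^ DIM('a)) * (\<integral>\<^sup>+x. F x \<partial>lebesgue) * (ennreal ((t - 1) * l powr (t - 1 - 1)) * indicator {0<..<real n} l)"
        proof (cases "0 < l \<and> l < real n")
          case True
          have ms: "{x. ennreal l < m x} \<in> sets lebesgue" "{x. ennreal l < hl_max F x} \<in> sets lebesgue"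
            by (intro lebesgue_superlevel; simp)+
          have "(\<integral>\<^sup>+x. 1 * indicator {x. ennreal l < m x} x \<partial>lebesgue) = emeasure lebesgue {x. ennreal l < m x}" using ms by simp
          also have "\<dots> \<le> emeasure lebesgue {x. ennreal l < hl_max F x}" using ms by (intro emeasure_mono) (auto simp: m_def)
          also have "\<dots> \<le> ennreal (5 ^ DIM('a) / l) * (\<integral>\<^sup>+x. F x \<partial>lebesgue)"
            using True by (intro ennreal_mult_le_imp_le hl_max_weak_type) auto
          finally have "ennreal (t * l powr (t - 1)) * (\<integral>\<^sup>+x. 1 * indicator {x. ennreal l < m x} x \<partial>lebesgue)
            \<le> ennreal (t * l powr (t - 1)) * (ennreal (5 ^ DIM('a) / l) * (\<integral>\<^sup>+x. F x \<partial>lebesgue))" by (rule mult_left_mono) simp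
          also have "\<dots> = ennreal (t / (t - 1) * 5 ^ DIM('a)) * (\<integral>\<^sup>+x. F x \<partial>lebesgue) * ennreal ((t - 1) * l powr (t - 1 - 1))"
          proof -
            have lq: "l powr (t - 1) / l = l powr (t - 1 - 1)" using True powr_diff[of l "t - 1" 1] by simp
            have "t * l powr (t - 1) * (5 ^ DIM('a) / l) = t * 5 ^ DIM('a) * (l powr (t - 1) / l)" by simp
            also have "\<dots> = t * 5 ^ DIM('a) * l powr (t - 1 - 1)" by (simp only: lq)
            also have "\<dots> = t / (t - 1) * 5 ^ DIM('a) * ((t - 1) * l powr (t - 1 - 1))" using t by simp
            finally have eq: "t * l powr (t - 1) * (5 ^ DIM('a) / l) = t / (t - 1) * 5 ^ DIM('a) * ((t - 1) * l powr (t - 1 - 1))" .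
            have gen: "ennreal x * (ennreal y * j) = ennreal z * j * ennreal v" if "x * y = z * v" "0 \<le> x" "0 \<le> y" "0 \<le> z" "0 \<le> v" for x y z v j
            proof -
              have "ennreal x * (ennreal y * j) = ennreal (x * y) * j" using that(2,3) by (simp add: ennreal_mult mult.assoc)
              also have "\<dots> = ennreal z * j * ennreal v" unfolding that(1) using that(4,5) by (simp add: ennreal_mult ac_simps)
              finally show ?thesis .
            qed
            show ?thesis by (rule gen[OF eq]) (use t True in auto)
          qed
          finally show ?thesis using True by simp
        next
          case False
          have "{x. ennreal l < m x} = {}" if "0 < l"
          proof -
            have "m x \<le> ennreal l" for x
            proof -
              have "m x \<le> of_nat n" by (simp add: m_def)
              also have "\<dots> \<le> ennreal l" using that False by (simp add: ennreal_of_nat_eq_real_of_nat ennreal_leI)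
              finally show ?thesis .
            qed
            then show ?thesis by (auto simp: not_less)
          qed
          then show ?thesis by (cases "0 < l") auto
        qed
      qed
      also have "\<dots> = ennreal (t / (t - 1) * 5 ^ DIM('a)) * (\<integral>\<^sup>+x. F x \<partial>lebesgue) * (\<integral>\<^sup>+l. ennreal ((t - 1) * l powr (t - 1 - 1)) * indicator {0<..<real n} l \<partial>lborel)"
        by (intro nn_integral_cmult) measurable
      also have "(\<integral>\<^sup>+l. ennreal ((t - 1) * l powr (t - 1 - 1)) * indicator {0<..<real n} l \<partial>lborel) = ennreal (if 0 < real n then real n powr (t - 1) else 0)"
        using t by (intro nn_integral_powr_Ioo) simp
      finally have "X \<le> ennreal N * (ennreal (t / (t - 1) * 5 ^ DIM('a)) * (\<integral>\<^sup>+x. F x \<partial>lebesgue) * ennreal (if 0 < real n then real n powr (t - 1) else 0))"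
        by (simp only: mult_left_mono zero_le)
      also have "\<dots> < top" using fin by (simp add: ennreal_mult_less_top)
      finally show ?thesis .
    qed
    have "ennreal (K powr (- t)) * X = (\<integral>\<^sup>+x. w x * epowr (ennreal (1/K) * m x) t \<partial>lebesgue)"
    proof -
      have 1: "epowr (ennreal (1/K)) t = ennreal (K powr (- t))" using K1 by (subst epowr_ennreal_pos) (auto simp: powr_divide powr_minus_divide)
      have "(\<integral>\<^sup>+x. w x * epowr (ennreal (1/K) * m x) t \<partial>lebesgue) = (\<integral>\<^sup>+x. ennreal (K powr (- t)) * (w x * epowr (m x) t) \<partial>lebesgue)"
        using t by (intro nn_integral_cong) (simp only: epowr_mult 1 ac_simps less_imp_le)
      then show ?thesis by (simp add: X_def nn_integral_cmult)
    qed
    also have "\<dots> = (\<integral>\<^sup>+l. ennreal (t * l powr (t - 1)) * indicator {0<..} l * (\<integral>\<^sup>+x. w x * indicator {x. ennreal l < ennreal (1/K) * m x} x \<partial>lebesgue) \<partial>lborel)"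
      using t by (intro layer_cake sigma_finite_lebesgue) auto
    also have "\<dots> \<le> (\<integral>\<^sup>+l. ennreal e * (ennreal (t * l powr (t - 1)) * indicator {0<..} l * (\<integral>\<^sup>+x. w x * indicator {x. ennreal l < m x} x \<partial>lebesgue))
       + ennreal (t * l powr (t - 1)) * indicator {0<..} l * (\<integral>\<^sup>+x. w x * indicator {x. ennreal l < ennreal (1/\<gamma>) * G x} x \<partial>lebesgue) \<partial>lborel)"
    proof (intro nn_integral_mono)
      fix l :: real
      show "ennreal (t * l powr (t - 1)) * indicator {0<..} l * (\<integral>\<^sup>+x. w x * indicator {x. ennreal l < ennreal (1/K) * m x} x \<partial>lebesgue)
        \<le> ennreal e * (ennreal (t * l powr (t - 1)) * indicator {0<..} l * (\<integral>\<^sup>+x. w x * indicator {x. ennreal l < m x} x \<partial>lebesgue))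
       + ennreal (t * l powr (t - 1)) * indicator {0<..} l * (\<integral>\<^sup>+x. w x * indicator {x. ennreal l < ennreal (1/\<gamma>) * G x} x \<partial>lebesgue)"
      proof (cases "0 < l")
        case True
        from mult_left_mono[OF lev[OF True], of "ennreal (t * l powr (t - 1))"] True show ?thesis
          by (simp only: distrib_left indicator_simps greaterThan_iff mult_1_right mult.left_commute[of "ennreal e"]) simp
      qed simp
    qed
    also have "\<dots> = ennreal e * (\<integral>\<^sup>+l. ennreal (t * l powr (t - 1)) * indicator {0<..} l * (\<integral>\<^sup>+x. w x * indicator {x. ennreal l < m x} x \<partial>lebesgue) \<partial>lborel)
       + (\<integral>\<^sup>+l. ennreal (t * l powr (t - 1)) * indicator {0<..} l * (\<integral>\<^sup>+x. w x * indicator {x. ennreal l < ennreal (1/\<gamma>) * G x} x \<partial>lebesgue) \<partial>lborel)"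
    proof -
      have [measurable]: "(\<lambda>l. \<integral>\<^sup>+x. w x * indicator {x. ennreal l < m x} x \<partial>lebesgue) \<in> borel_measurable lborel"
        "(\<lambda>l. \<integral>\<^sup>+x. w x * indicator {x. ennreal l < ennreal (1/\<gamma>) * G x} x \<partial>lebesgue) \<in> borel_measurable lborel"
        by (intro layer_cake_measurable sigma_finite_lebesgue; measurable)+
      show ?thesis by (subst nn_integral_add) (auto simp: nn_integral_cmult)
    qed
    also have "(\<integral>\<^sup>+l. ennreal (t * l powr (t - 1)) * indicator {0<..} l * (\<integral>\<^sup>+x. w x * indicator {x. ennreal l < m x} x \<partial>lebesgue) \<partial>lborel) = X"
      unfolding X_def using t by (intro layer_cake[symmetric] sigma_finite_lebesgue) auto
    also have "(\<integral>\<^sup>+l. ennreal (t * l powr (t - 1)) * indicator {0<..} l * (\<integral>\<^sup>+x. w x * indicator {x. ennreal l < ennreal (1/\<gamma>) * G x} x \<partial>lebesgue) \<partial>lborel)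
      = (\<integral>\<^sup>+x. w x * epowr (ennreal (1/\<gamma>) * G x) t \<partial>lebesgue)"
      using t by (intro layer_cake[symmetric] sigma_finite_lebesgue) auto
    also have "\<dots> = ennreal ((1/\<gamma>) powr t) * Y"
    proof -
      have 1: "epowr (ennreal (1/\<gamma>)) t = ennreal ((1/\<gamma>) powr t)" using \<gamma> by (intro epowr_ennreal_pos) simp
      have "(\<integral>\<^sup>+x. w x * epowr (ennreal (1/\<gamma>) * G x) t \<partial>lebesgue) = (\<integral>\<^sup>+x. ennreal ((1/\<gamma>) powr t) * (w x * epowr (G x) t) \<partial>lebesgue)"
        using t by (intro nn_integral_cong) (simp only: epowr_mult 1 ac_simps less_imp_le)
      then show ?thesis by (simp add: Y_def nn_integral_cmult)
    qed
    finally have "ennreal (K powr t) * (ennreal (K powr (- t)) * X) \<le> ennreal (K powr t) * (ennreal e * X + ennreal ((1/\<gamma>) powr t) * Y)"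
      by (rule mult_left_mono) simp
    moreover have "ennreal (K powr t) * (ennreal (K powr (- t)) * X) = X"
    proof -
      have "K powr t * K powr (- t) = 1" using K1 by (simp add: powr_add[symmetric])
      then have "ennreal (K powr t) * ennreal (K powr (- t)) = 1" by (simp only: ennreal_mult[symmetric] powr_ge_zero ennreal_1)
      then show ?thesis by (simp only: mult.assoc[symmetric] mult_1_left)
    qed
    ultimately have "X \<le> ennreal (K powr t) * (ennreal ((1/\<gamma>) powr t) * Y) + ennreal (K powr t * e) * X"
      using e by (simp add: distrib_left ennreal_mult ac_simps)
    also have "\<dots> \<le> ennreal (K powr t) * (ennreal ((1/\<gamma>) powr t) * Y) + ennreal (1/2) * X"
      using absorb by (intro add_left_mono mult_right_mono ennreal_leI) (auto simp: e_def)
    finally have "X \<le> 2 * (ennreal (K powr t) * (ennreal ((1/\<gamma>) powr t) * Y))" using Xfin by (rule ennreal_absorb_half)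
    also have "\<dots> = ennreal (2 * (K / \<gamma>) powr t) * Y"
    proof -
      have "2 * (K / \<gamma>) powr t = 2 * (K powr t * (1/\<gamma>) powr t)" by (simp add: powr_divide)
      then show ?thesis by (simp add: ennreal_mult mult.assoc)
    qed
    finally show ?thesis by (simp add: X_def m_def)
  qed
  have "(\<integral>\<^sup>+x. w x * epowr (hl_max F x) t \<partial>lebesgue) = (\<integral>\<^sup>+x. (SUP n. w x * epowr (min (hl_max F x) (of_nat n)) t) \<partial>lebesgue)"
    using t by (intro nn_integral_cong) (simp add: SUP_mult_left_ennreal[symmetric] SUP_epowr_min_of_nat)
  also have "\<dots> = (SUP n. \<integral>\<^sup>+x. w x * epowr (min (hl_max F x) (of_nat n)) t \<partial>lebesgue)"
  proof (intro nn_integral_monotone_convergence_SUP)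
    show "incseq (\<lambda>n x. w x * epowr (min (hl_max F x) (of_nat n)) t)"
      unfolding incseq_def le_fun_def using t by (intro allI impI mult_left_mono epowr_mono min.mono) auto
  qed measurable
  also have "\<dots> \<le> ennreal (2 * (K / \<gamma>) powr t) * Y" by (intro SUP_least trunc)
  finally show ?thesis by (simp add: Y_def)
qed

text \<open>With \<gamma> = K^(1-q) both summands scale like K^(-q), so the expression is a constant
  multiple of K^(t - q \<theta>). This tends to 0 as K grows since t < q \<theta>; \<open>L\<close>
  and \<open>d\<close> turn the limit into an explicit choice of K.\<close>

lemma good_lambda_constants:
  fixes A B t q \<theta> M n :: real
  assumes q: "1 \<le> q" and t: "0 < t" "t < q * \<theta>" and \<theta>: "0 < \<theta>" and nonneg: "0 \<le> A" "0 \<le> B" "0 \<le> n" and M: "1 \<le> M"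
  shows "\<exists>K \<gamma>. M \<le> K \<and> 0 < \<gamma> \<and> \<gamma> \<le> 1 \<and> K powr t * (B * (n * (2 * A * \<gamma> / K + (4 * A / K) powr q)) powr \<theta>) \<le> 1 / 2"
proof -
  define c where "c = n * (2 * A + (4 * A) powr q)"
  have c: "0 \<le> c" using nonneg by (simp add: c_def)
  define L where "L = 2 * B * c powr \<theta> + 1"
  have L: "1 \<le> L" using nonneg by (simp add: L_def)
  define d where "d = q * \<theta> - t"
  have d: "0 < d" using t by (simp add: d_def)
  define K where "K = max M (L powr (1 / d))"
  have K: "1 \<le> K" "M \<le> K" "L powr (1 / d) \<le> K" using M by (auto simp: K_def)
  define \<gamma> where "\<gamma> = K powr (1 - q)"
  have \<gamma>: "0 < \<gamma>" "\<gamma> \<le> 1" using K q powr_mono[of "1 - q" 0 K] by (auto simp: \<gamma>_def)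
  have "2 * A * \<gamma> / K + (4 * A / K) powr q = (2 * A + (4 * A) powr q) * K powr (- q)"
  proof -
    have "\<gamma> / K = K powr (- q)" using K powr_diff[of K "1 - q" 1] by (simp add: \<gamma>_def)
    moreover have "(4 * A / K) powr q = (4 * A) powr q * K powr (- q)" using K by (simp add: powr_divide powr_minus_divide)
    ultimately show ?thesis by (simp add: distrib_right times_divide_eq_right[symmetric] del: times_divide_eq_right)
  qed
  then have "n * (2 * A * \<gamma> / K + (4 * A / K) powr q) = c * K powr (- q)" by (simp add: c_def mult.assoc)
  then have "(n * (2 * A * \<gamma> / K + (4 * A / K) powr q)) powr \<theta> = c powr \<theta> * K powr (- (q * \<theta>))"
    using c by (simp add: powr_mult powr_powr)
  then have "K powr t * (B * (n * (2 * A * \<gamma> / K + (4 * A / K) powr q)) powr \<theta>) = B * c powr \<theta> * (K powr t * K powr (- (q * \<theta>)))"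
    by simp
  also have "K powr t * K powr (- (q * \<theta>)) = K powr (- d)" by (simp add: powr_add[symmetric] d_def)
  also have "B * c powr \<theta> * K powr (- d) \<le> 1 / 2"
  proof -
    have "(L powr (1 / d)) powr d \<le> K powr d" using K d by (intro powr_mono2) auto
    then have "L \<le> K powr d" using L d by (simp add: powr_powr)
    then have "2 * B * c powr \<theta> \<le> K powr d" by (simp add: L_def)
    moreover have "0 < K powr d" using K by simp
    ultimately show ?thesis by (simp add: powr_minus_divide field_simps)
  qed
  finally show ?thesis using K(2) \<gamma> by blast
qed

section \<open>Seminorms on Lebesgue spaces\<close>

lemma eLp_norm_ennreal:
  "0 < p \<Longrightarrow> eLp_norm M (ennreal p) f = epowr (\<integral>\<^sup>+x. epowr (ennreal (norm (f x))) p \<partial>M) (1 / p)"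
  by (simp add: eLp_norm_def)

lemma Lp_space_iff:
  assumes "0 < p"
  shows "f \<in> Lp_space p \<longleftrightarrow> f \<in> borel_measurable lebesgue \<and> (\<integral>\<^sup>+x. epowr (ennreal (norm (f x))) p \<partial>lebesgue) < \<infinity>"
  using assms by (simp add: Lp_space_def eLp_norm_ennreal less_top[symmetric])

lemma epowr_norm_add_le:
  "0 \<le> p \<Longrightarrow> epowr (ennreal (norm (u + v))) p \<le> ennreal (2 powr p) * (epowr (ennreal (norm u)) p + epowr (ennreal (norm v)) p)"
  by (rule order_trans[OF epowr_mono epowr_add_le])
     (auto simp: ennreal_plus[symmetric] norm_triangle_ineq ennreal_leI simp del: ennreal_plus)

lemma Lp_space_add:
  fixes f g :: "'a::euclidean_space \<Rightarrow> 'k::{real_normed_field, euclidean_space}"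
  assumes p: "0 < p" and "f \<in> Lp_space p" "g \<in> Lp_space p"
  shows "(\<lambda>x. f x + g x) \<in> Lp_space p"
proof -
  have [measurable]: "f \<in> borel_measurable lebesgue" "g \<in> borel_measurable lebesgue" and
    fin: "(\<integral>\<^sup>+x. epowr (ennreal (norm (f x))) p \<partial>lebesgue) < \<infinity>" "(\<integral>\<^sup>+x. epowr (ennreal (norm (g x))) p \<partial>lebesgue) < \<infinity>"
    using assms by (auto simp: Lp_space_iff)
  have "(\<integral>\<^sup>+x. epowr (ennreal (norm (f x + g x))) p \<partial>lebesgue)
    \<le> (\<integral>\<^sup>+x. ennreal (2 powr p) * (epowr (ennreal (norm (f x))) p + epowr (ennreal (norm (g x))) p) \<partial>lebesgue)"
    using p by (intro nn_integral_mono epowr_norm_add_le) auto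
  also have "\<dots> = ennreal (2 powr p) * ((\<integral>\<^sup>+x. epowr (ennreal (norm (f x))) p \<partial>lebesgue) + (\<integral>\<^sup>+x. epowr (ennreal (norm (g x))) p \<partial>lebesgue))"
    by (simp add: nn_integral_cmult nn_integral_add)
  also have "\<dots> < \<infinity>" using fin by (simp add: ennreal_mult_less_top)
  finally show ?thesis using p by (simp add: Lp_space_iff)
qed

lemma Lp_space_cmult:
  fixes f :: "'a::euclidean_space \<Rightarrow> 'k::{real_normed_field, euclidean_space}"
  assumes p: "0 < p" and "f \<in> Lp_space p"
  shows "(\<lambda>x. c * f x) \<in> Lp_space p"
proof -
  have [measurable]: "f \<in> borel_measurable lebesgue" and
    fin: "(\<integral>\<^sup>+x. epowr (ennreal (norm (f x))) p \<partial>lebesgue) < \<infinity>"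
    using assms by (auto simp: Lp_space_iff)
  have "(\<integral>\<^sup>+x. epowr (ennreal (norm (c * f x))) p \<partial>lebesgue) = (\<integral>\<^sup>+x. epowr (ennreal (norm c)) p * epowr (ennreal (norm (f x))) p \<partial>lebesgue)"
    using p by (intro nn_integral_cong) (simp add: norm_mult ennreal_mult epowr_mult)
  also have "\<dots> = epowr (ennreal (norm c)) p * (\<integral>\<^sup>+x. epowr (ennreal (norm (f x))) p \<partial>lebesgue)"
    by (simp add: nn_integral_cmult)
  also have "\<dots> < \<infinity>" using fin p by (simp add: ennreal_mult_less_top epowr_less_top)
  finally show ?thesis using p by (simp add: Lp_space_iff)
qed

lemma Lp_space_zero: "0 < p \<Longrightarrow> (\<lambda>x. 0) \<in> Lp_space p"
  by (simp add: Lp_space_iff)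

lemma Lp_space_sum:
  fixes g :: "'i \<Rightarrow> 'a::euclidean_space \<Rightarrow> 'k::{real_normed_field, euclidean_space}"
  assumes p: "0 < p" and "finite I" "\<And>i. i \<in> I \<Longrightarrow> g i \<in> Lp_space p"
  shows "(\<lambda>x. \<Sum>i\<in>I. c i * g i x) \<in> Lp_space p"
  using assms(2,3)
proof (induction I rule: finite_induct)
  case (insert i I)
  then show ?case using p by (simp add: Lp_space_add Lp_space_cmult)
qed (use p in \<open>simp add: Lp_space_zero\<close>)

lemma Lp_space_diff:
  fixes f g :: "'a::euclidean_space \<Rightarrow> 'k::{real_normed_field, euclidean_space}"
  assumes p: "0 < p" and "f \<in> Lp_space p" "g \<in> Lp_space p"
  shows "(\<lambda>x. f x - g x) \<in> Lp_space p"
  using Lp_space_add[OF p assms(2) Lp_space_cmult[OF p assms(3), of "-1"]] by simp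

lemma Linf_cD:
  assumes "f \<in> Linf_c"
  shows "f \<in> borel_measurable lebesgue"
    and "\<exists>c>0. \<exists>R>0. \<forall>x. norm (f x) \<le> c * indicator (ball 0 R) x"
proof -
  show "f \<in> borel_measurable lebesgue" using assms by (simp add: Linf_c_def)
  obtain c where c: "0 < c" "\<And>x. norm (f x) \<le> c"
    using assms unfolding Linf_c_def by (auto simp: bounded_pos)
  obtain K where K: "compact K" "\<And>x. x \<notin> K \<Longrightarrow> f x = 0" using assms by (auto simp: Linf_c_def)
  obtain R where R: "0 < R" "K \<subseteq> ball 0 R"
    using compact_imp_bounded[OF K(1)] by (metis bounded_subset_ballD)
  show "\<exists>c>0. \<exists>R>0. \<forall>x. norm (f x) \<le> c * indicator (ball 0 R) x"
  proof -
    have "norm (f x) \<le> c * indicator (ball 0 R) x" for x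
      using c K R by (cases "x \<in> K") (auto split: split_indicator)
    then show ?thesis using c(1) R(1) by blast
  qed
qed

lemma Linf_c_mult:
  fixes f g :: "'a::euclidean_space \<Rightarrow> 'k::{real_normed_field, euclidean_space}"
  assumes f: "f \<in> Linf_c" and g[measurable]: "g \<in> borel_measurable lebesgue" and N: "\<And>x. norm (g x) \<le> N"
  shows "(\<lambda>x. g x * f x) \<in> Linf_c"
proof -
  have [measurable]: "f \<in> borel_measurable lebesgue" by (rule Linf_cD[OF f])
  obtain c where c: "0 < c" "\<And>x. norm (f x) \<le> c"
    using f unfolding Linf_c_def by (auto simp: bounded_pos)
  have "norm (g x * f x) \<le> N * c" for x
    unfolding norm_mult using N[of x] c by (intro mult_mono) (auto intro: order_trans[OF norm_ge_zero])
  then have "bounded (range (\<lambda>x. g x * f x))" by (auto simp: bounded_iff)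
  then show ?thesis using f by (auto simp: Linf_c_def)
qed

lemma Linf_c_subset_Lp_space:
  fixes f :: "'a::euclidean_space \<Rightarrow> 'k::{real_normed_field, euclidean_space}"
  assumes p: "0 < p" and f: "f \<in> Linf_c"
  shows "f \<in> Lp_space p"
proof -
  have [measurable]: "f \<in> borel_measurable lebesgue" by (rule Linf_cD[OF f])
  obtain c R where c: "\<And>x. norm (f x) \<le> c * indicator (ball 0 R) x" "0 < c" using Linf_cD(2)[OF f] by blast
  have "(\<integral>\<^sup>+x. epowr (ennreal (norm (f x))) p \<partial>lebesgue) \<le> (\<integral>\<^sup>+x. epowr (ennreal c) p * indicator (ball (0::'a) R) x \<partial>lebesgue)"
  proof (intro nn_integral_mono)
    fix x
    have "epowr (ennreal (norm (f x))) p \<le> epowr (ennreal (c * indicator (ball 0 R) x)) p"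
      using p by (intro epowr_mono ennreal_leI c) auto
    also have "\<dots> = epowr (ennreal c) p * indicator (ball 0 R) x" using p by (auto split: split_indicator)
    finally show "epowr (ennreal (norm (f x))) p \<le> \<dots>" .
  qed
  also have "\<dots> = epowr (ennreal c) p * emeasure lebesgue (ball (0::'a) R)" by (simp add: nn_integral_cmult_indicator)
  also have "\<dots> < \<infinity>" using p emeasure_ball_finite[of "0::'a" R] by (simp add: ennreal_mult_less_top epowr_less_top)
  finally show ?thesis using p by (simp add: Lp_space_iff)
qed

section \<open>Pointwise seminorms and measurability\<close>

text \<open>The body of \<open>sublinear_op_on\<close> at one point. Almost every x satisfies it for
  all functions at once, so at such x it may be applied to functions that depend on x.\<close>

definition seminorm_at :: "('a \<Rightarrow> 'b::real_normed_field) set \<Rightarrow> (('a \<Rightarrow> 'b) \<Rightarrow> ('a \<Rightarrow> 'b)) \<Rightarrow> 'a \<Rightarrow> bool" where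
  "seminorm_at S T x \<longleftrightarrow>
    (\<forall>f\<in>S. \<forall>g\<in>S. norm (T (\<lambda>y. f y + g y) x) \<le> norm (T f x) + norm (T g x)) \<and>
    (\<forall>f\<in>S. \<forall>c. norm (T (\<lambda>y. c * f y) x) = norm c * norm (T f x))"

lemma sublinear_op_on_AE: "sublinear_op_on S T \<Longrightarrow> AE x in lebesgue. seminorm_at S T x"
  unfolding sublinear_op_on_def seminorm_at_def .

lemma seminorm_at_add:
  "seminorm_at S T x \<Longrightarrow> f \<in> S \<Longrightarrow> g \<in> S \<Longrightarrow> norm (T (\<lambda>y. f y + g y) x) \<le> norm (T f x) + norm (T g x)"
  unfolding seminorm_at_def by blast

lemma seminorm_at_cmult:
  "seminorm_at S T x \<Longrightarrow> f \<in> S \<Longrightarrow> norm (T (\<lambda>y. c * f y) x) = norm c * norm (T f x)"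
  unfolding seminorm_at_def by blast

lemma seminorm_at_sum:
  fixes g :: "'i \<Rightarrow> 'a::euclidean_space \<Rightarrow> 'k::{real_normed_field, euclidean_space}"
  assumes sn: "seminorm_at (Lp_space p) T x" and p: "0 < p" and "finite I" "\<And>i. i \<in> I \<Longrightarrow> g i \<in> Lp_space p"
  shows "norm (T (\<lambda>y. \<Sum>i\<in>I. c i * g i y) x) \<le> (\<Sum>i\<in>I. norm (c i) * norm (T (g i) x))"
  using assms(3,4)
proof (induction I rule: finite_induct)
  case empty
  \<comment> \<open>Homogeneity with the scalar 0 yields T 0 = 0 at x.\<close>
  have "norm (T (\<lambda>y. 0 * 0) x) = norm (0::'k) * norm (T (\<lambda>y. 0) x)"
    using seminorm_at_cmult[OF sn Lp_space_zero[OF p], of 0] .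
  then show ?case by simp
next
  case (insert i I)
  have "norm (T (\<lambda>y. c i * g i y + (\<Sum>i\<in>I. c i * g i y)) x) \<le> norm (T (\<lambda>y. c i * g i y) x) + norm (T (\<lambda>y. \<Sum>i\<in>I. c i * g i y) x)"
    using insert p by (intro seminorm_at_add[OF sn] Lp_space_cmult Lp_space_sum) auto
  also have "norm (T (\<lambda>y. c i * g i y) x) = norm (c i) * norm (T (g i) x)"
    using insert by (intro seminorm_at_cmult[OF sn]) auto
  also have "norm (T (\<lambda>y. \<Sum>i\<in>I. c i * g i y) x) \<le> (\<Sum>i\<in>I. norm (c i) * norm (T (g i) x))"
    using insert by auto
  finally show ?case using insert by simp
qed

lemma seminorm_at_diff:
  fixes f g :: "'a::euclidean_space \<Rightarrow> 'k::{real_normed_field, euclidean_space}"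
  assumes sn: "seminorm_at (Lp_space p) T x" and p: "0 < p" and f: "f \<in> Lp_space p" "g \<in> Lp_space p"
  shows "\<bar>norm (T f x) - norm (T g x)\<bar> \<le> norm (T (\<lambda>y. f y - g y) x)"
proof -
  have d: "(\<lambda>y. f y - g y) \<in> Lp_space p" by (rule Lp_space_diff[OF p f])
  have "norm (T (\<lambda>y. f y - g y + g y) x) \<le> norm (T (\<lambda>y. f y - g y) x) + norm (T g x)"
    by (rule seminorm_at_add[OF sn d f(2)])
  moreover have "norm (T (\<lambda>y. - 1 * (f y - g y) + f y) x) \<le> norm (T (\<lambda>y. - 1 * (f y - g y)) x) + norm (T f x)"
    by (rule seminorm_at_add[OF sn Lp_space_cmult[OF p d] f(1)])
  moreover have "norm (T (\<lambda>y. - 1 * (f y - g y)) x) = norm (T (\<lambda>y. f y - g y) x)"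
    using seminorm_at_cmult[OF sn d, of "- 1"] by simp
  ultimately show ?thesis by simp
qed

text \<open>Lebesgue measure is complete, so g may be changed to 0 on the null set where convergence
  fails.\<close>

lemma borel_measurable_lebesgue_AE_LIMSEQ:
  fixes h :: "nat \<Rightarrow> 'a::euclidean_space \<Rightarrow> real"
  assumes [measurable]: "\<And>i. h i \<in> borel_measurable lebesgue" and lim: "AE x in lebesgue. (\<lambda>i. h i x) \<longlonglongrightarrow> g x"
  shows "g \<in> borel_measurable lebesgue"
proof -
  obtain N where N: "{x \<in> space lebesgue. \<not> (\<lambda>i. h i x) \<longlonglongrightarrow> g x} \<subseteq> N" "N \<in> null_sets lebesgue"
    using lim by (auto simp: eventually_ae_filter)
  have [measurable]: "N \<in> sets lebesgue" using N(2) by auto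
  have "(\<lambda>x. indicator (- N) x * g x) \<in> borel_measurable lebesgue"
  proof (rule borel_measurable_LIMSEQ_real[where u = "\<lambda>i x. indicator (- N) x * h i x"])
    show "(\<lambda>i. indicator (- N) x * h i x) \<longlonglongrightarrow> indicator (- N) x * g x" for x
      using N(1) by (auto split: split_indicator)
    show "(\<lambda>x. indicator (- N) x * h i x) \<in> borel_measurable lebesgue" for i
    proof -
      have "- N \<in> sets lebesgue" using sets.compl_sets[of N lebesgue] by (simp add: Compl_eq_Diff_UNIV)
      then show ?thesis by measurable
    qed
  qed
  moreover have "AE x in lebesgue. indicator (- N) x * g x = g x"
    using AE_not_in[OF N(2)] by (auto elim!: eventually_mono)
  ultimately show ?thesis by (rule borel_measurable_AE)
qed

text \<open>The argument of T varies with the point of evaluation, so measurability of each T g is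
  not enough. For simple coefficients the space splits into finitely many pieces on each of which T
  acts on a fixed function. The general case follows because the seminorm at x is continuous in the
  coefficients.\<close>

lemma seminorm_sum_measurable:
  fixes g :: "nat \<Rightarrow> 'a::euclidean_space \<Rightarrow> 'k::{real_normed_field, euclidean_space}"
  assumes T: "AE x in lebesgue. seminorm_at (Lp_space p) T x" and p: "0 < p"
    and TL: "\<And>f. f \<in> Lp_space p \<Longrightarrow> T f \<in> borel_measurable lebesgue"
    and g: "\<And>i. i \<le> k \<Longrightarrow> g i \<in> Lp_space p"
    and c[measurable]: "\<And>i. c i \<in> borel_measurable lebesgue"
  shows "(\<lambda>x. norm (T (\<lambda>y. \<Sum>i\<le>k. c i x * g i y) x)) \<in> borel_measurable lebesgue"
proof -
  have "\<exists>F. \<forall>j. simple_function lebesgue (F j) \<and> (\<forall>x. (\<lambda>j. F j x) \<longlonglongrightarrow> c i x)" for i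
    using borel_measurable_implies_sequence_metric[OF c, of i 0] by auto
  then obtain F where F: "\<And>i j. simple_function lebesgue (F i j)" "\<And>i x. (\<lambda>j. F i j x) \<longlonglongrightarrow> c i x" by metis
  show ?thesis
  proof (rule borel_measurable_lebesgue_AE_LIMSEQ)
    fix j
    \<comment> \<open>Restricted to indices up to k, the vector of simple coefficients takes values
      in a finite set.\<close>
    let ?v = "\<lambda>x. restrict (\<lambda>i. F i j x) {..k}"
    let ?A = "PiE {..k} (\<lambda>i. F i j ` UNIV)"
    have fin: "finite ?A" using F(1) by (intro finite_PiE) (auto simp: simple_function_def)
    have "(\<lambda>x. norm (T (\<lambda>y. \<Sum>i\<le>k. ?v x i * g i y) x)) \<in> borel_measurable lebesgue"
    proof (rule measurable_compose_countable'[where f = "\<lambda>v x. norm (T (\<lambda>y. \<Sum>i\<le>k. v i * g i y) x)" and g = ?v and I = ?A])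
      show "(\<lambda>x. norm (T (\<lambda>y. \<Sum>i\<le>k. v i * g i y) x)) \<in> borel_measurable lebesgue" for v
      proof -
        have "(\<lambda>y. \<Sum>i\<le>k. v i * g i y) \<in> Lp_space p" using p g by (intro Lp_space_sum) auto
        then have [measurable]: "T (\<lambda>y. \<Sum>i\<le>k. v i * g i y) \<in> borel_measurable lebesgue" by (rule TL)
        show ?thesis by measurable
      qed
      show "?v \<in> measurable lebesgue (count_space ?A)"
      proof (subst measurable_count_space_eq_countable)
        show "countable ?A" using fin by (rule countable_finite)
        have "?v -` {a} \<inter> space lebesgue \<in> sets lebesgue" if a: "a \<in> ?A" for a
        proof -
          have "?v -` {a} \<inter> space lebesgue = (\<Inter>i\<in>{..k}. F i j -` {a i} \<inter> space lebesgue)"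
            using a by (auto simp: fun_eq_iff restrict_def PiE_def extensional_def)
          moreover have "F i j -` {a i} \<inter> space lebesgue \<in> sets lebesgue" for i
            using F(1) by (rule simple_functionD)
          ultimately show ?thesis by (auto intro!: sets.finite_INT)
        qed
        then show "?v \<in> space lebesgue \<rightarrow> ?A \<and> (\<forall>a\<in>?A. ?v -` {a} \<inter> space lebesgue \<in> sets lebesgue)" by auto
      qed
      show "countable ?A" using fin by (rule countable_finite)
    qed
    moreover have "(\<Sum>i\<le>k. ?v x i * g i y) = (\<Sum>i\<le>k. F i j x * g i y)" for x y by (intro sum.cong) auto
    ultimately show "(\<lambda>x. norm (T (\<lambda>y. \<Sum>i\<le>k. F i j x * g i y) x)) \<in> borel_measurable lebesgue" by simp
  next
    show "AE x in lebesgue. (\<lambda>j. norm (T (\<lambda>y. \<Sum>i\<le>k. F i j x * g i y) x)) \<longlonglongrightarrow> norm (T (\<lambda>y. \<Sum>i\<le>k. c i x * g i y) x)"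
      using T
    proof eventually_elim
      case (elim x)
      have bd: "\<bar>norm (T (\<lambda>y. \<Sum>i\<le>k. F i j x * g i y) x) - norm (T (\<lambda>y. \<Sum>i\<le>k. c i x * g i y) x)\<bar> \<le> (\<Sum>i\<le>k. norm (F i j x - c i x) * norm (T (g i) x))" for j
      proof -
        have "\<bar>norm (T (\<lambda>y. \<Sum>i\<le>k. F i j x * g i y) x) - norm (T (\<lambda>y. \<Sum>i\<le>k. c i x * g i y) x)\<bar>
          \<le> norm (T (\<lambda>y. (\<Sum>i\<le>k. F i j x * g i y) - (\<Sum>i\<le>k. c i x * g i y)) x)"
          using p g by (intro seminorm_at_diff[OF elim p] Lp_space_sum) auto
        also have "(\<lambda>y. (\<Sum>i\<le>k. F i j x * g i y) - (\<Sum>i\<le>k. c i x * g i y)) = (\<lambda>y. \<Sum>i\<le>k. (F i j x - c i x) * g i y)"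
          by (simp add: sum_subtractf[symmetric] left_diff_distrib)
        also have "norm (T \<dots> x) \<le> (\<Sum>i\<le>k. norm (F i j x - c i x) * norm (T (g i) x))"
          using g by (intro seminorm_at_sum[OF elim p]) auto
        finally show ?thesis .
      qed
      have "(\<lambda>j. \<Sum>i\<le>k. norm (F i j x - c i x) * norm (T (g i) x)) \<longlonglongrightarrow> (\<Sum>i\<le>k. norm (c i x - c i x) * norm (T (g i) x))"
        by (intro tendsto_intros F(2))
      then have "(\<lambda>j. \<Sum>i\<le>k. norm (F i j x - c i x) * norm (T (g i) x)) \<longlonglongrightarrow> 0" by simp
      then have "(\<lambda>j. norm (T (\<lambda>y. \<Sum>i\<le>k. F i j x * g i y) x) - norm (T (\<lambda>y. \<Sum>i\<le>k. c i x * g i y) x)) \<longlonglongrightarrow> 0"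
        by (rule Lim_null_comparison[rotated]) (simp add: bd)
      then show ?case by (simp add: LIM_zero_iff)
    qed
  qed
qed

section \<open>Oscillation under truncation and dilation\<close>

text \<open>The centres \<open>a c r\<close> need not be averages: this makes the notion stable under truncation of \<open>b\<close>.\<close>

definition osc_bound :: "('a::euclidean_space \<Rightarrow> 'b::euclidean_space) \<Rightarrow> ('a \<Rightarrow> real \<Rightarrow> 'b) \<Rightarrow> real \<Rightarrow> bool" where
  "osc_bound b a \<beta> \<longleftrightarrow> b \<in> borel_measurable lebesgue \<and>
    (\<forall>c r. 0 < r \<longrightarrow> (\<integral>\<^sup>+y. ennreal (norm (b y - a c r)) \<partial>ball_measure c r) \<le> ennreal \<beta>)"

lemma osc_boundD:
  assumes "osc_bound b a \<beta>"
  shows "b \<in> borel_measurable lebesgue"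
    and "0 < r \<Longrightarrow> (\<integral>\<^sup>+y. ennreal (norm (b y - a c r)) \<partial>ball_measure c r) \<le> ennreal \<beta>"
  using assms by (auto simp: osc_bound_def)

text \<open>The metric projection onto a closed ball treats real and complex scalars alike. It is
  1-Lipschitz, so oscillation about a truncated centre does not increase.\<close>

definition truncate :: "nat \<Rightarrow> 'b::euclidean_space \<Rightarrow> 'b" where
  "truncate N = closest_point (cball 0 (real N))"

lemma truncate_norm_le: "norm (truncate N x) \<le> real N"
  using closest_point_in_set[of "cball 0 (real N)" x] by (simp add: truncate_def)

lemma truncate_eq: "norm x \<le> real N \<Longrightarrow> truncate N x = x"
  by (simp add: truncate_def closest_point_self)

lemma truncate_dist_le: "norm (truncate N x - truncate N y) \<le> norm (x - y)"
  using closest_point_lipschitz[of "cball 0 (real N)" x y] by (simp add: truncate_def dist_norm)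

lemma truncate_norm_le_norm:
  fixes x :: "'b::euclidean_space" shows "norm (truncate N x) \<le> norm x"
  using truncate_dist_le[of N x 0] truncate_eq[of "0::'b" N] by simp

lemma truncate_measurable [measurable]: "truncate N \<in> borel_measurable borel"
  unfolding truncate_def by (intro borel_measurable_continuous_onI continuous_on_closest_point) auto

lemma osc_bound_truncate:
  assumes "osc_bound b a \<beta>"
  shows "osc_bound (\<lambda>x. truncate N (b x)) (\<lambda>c r. truncate N (a c r)) \<beta>"
  unfolding osc_bound_def
proof (intro conjI allI impI)
  have [measurable]: "b \<in> borel_measurable lebesgue" by (rule osc_boundD[OF assms])
  show "(\<lambda>x. truncate N (b x)) \<in> borel_measurable lebesgue" by measurable
  fix c :: 'a and r :: real assume r: "0 < r"
  have "(\<integral>\<^sup>+y. ennreal (norm (truncate N (b y) - truncate N (a c r))) \<partial>ball_measure c r) \<le> (\<integral>\<^sup>+y. ennreal (norm (b y - a c r)) \<partial>ball_measure c r)"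
    by (intro nn_integral_mono ennreal_leI truncate_dist_le)
  also note osc_boundD(2)[OF assms r]
  finally show "(\<integral>\<^sup>+y. ennreal (norm (truncate N (b y) - truncate N (a c r))) \<partial>ball_measure c r) \<le> ennreal \<beta>" .
qed

text \<open>The constant for bounded functions does not involve their bound. Fatou's lemma along the
  truncations, with the centres truncated as well, therefore reaches every b.\<close>

lemma john_nirenberg:
  fixes b :: "'a::euclidean_space \<Rightarrow> 'b::euclidean_space"
  assumes b: "osc_bound b a \<beta>" and q: "0 < q" and \<beta>: "0 < \<beta>" and r: "0 < r"
  shows "(\<integral>\<^sup>+y. epowr (ennreal (norm (b y - a c r))) q \<partial>ball_measure c r) \<le> ennreal (john_nirenberg_const DIM('a) q * \<beta> powr q)"
proof -
  have [measurable]: "b \<in> borel_measurable lebesgue" by (rule osc_boundD[OF b])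
  define g where "g N y = epowr (ennreal (norm (truncate N (b y) - truncate N (a c r)))) q" for N y
  have [measurable]: "g N \<in> borel_measurable lebesgue" for N unfolding g_def by measurable
  have lim: "liminf (\<lambda>N. g N y) = epowr (ennreal (norm (b y - a c r))) q" for y
  proof (rule lim_imp_Liminf)
    obtain M where M: "max (norm (b y)) (norm (a c r)) \<le> real M" using real_arch_simple by blast
    have "g N y = epowr (ennreal (norm (b y - a c r))) q" if "M \<le> N" for N
      using that M unfolding g_def by (subst (1 2) truncate_eq) auto
    then show "(\<lambda>N. g N y) \<longlonglongrightarrow> epowr (ennreal (norm (b y - a c r))) q"
      by (intro tendsto_eventually eventually_sequentiallyI[of M])
  qed simp
  have "(\<integral>\<^sup>+y. epowr (ennreal (norm (b y - a c r))) q \<partial>ball_measure c r) = (\<integral>\<^sup>+y. liminf (\<lambda>N. g N y) \<partial>ball_measure c r)"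
    by (simp only: lim)
  also have "\<dots> \<le> liminf (\<lambda>N. \<integral>\<^sup>+y. g N y \<partial>ball_measure c r)"
    by (intro nn_integral_liminf) measurable
  also have "\<dots> \<le> ennreal (john_nirenberg_const DIM('a) q * \<beta> powr q)"
  proof (rule Liminf_le)
    show "\<forall>\<^sub>F N in sequentially. (\<integral>\<^sup>+y. g N y \<partial>ball_measure c r) \<le> ennreal (john_nirenberg_const DIM('a) q * \<beta> powr q)"
    proof (intro always_eventually allI)
      fix N
      show "(\<integral>\<^sup>+y. g N y \<partial>ball_measure c r) \<le> ennreal (john_nirenberg_const DIM('a) q * \<beta> powr q)"
        unfolding g_def using osc_boundD[OF osc_bound_truncate[OF b, of N]] q \<beta> r
        by (intro john_nirenberg_bounded[where a = "\<lambda>c r. truncate N (a c r)" and N = "real N"] truncate_norm_le) auto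
    qed
  qed simp
  finally show ?thesis .
qed

lemma john_nirenberg_const_nonneg: "0 \<le> john_nirenberg_const n q"
  by (auto simp: john_nirenberg_const_def Let_def)

definition dilate_const :: "nat \<Rightarrow> real \<Rightarrow> real" where
  "dilate_const n q = 2 powr q * (john_nirenberg_const n q + (1 + 2 ^ n) powr q)"

lemma dilate_const_nonneg: "0 \<le> dilate_const n q"
  by (simp add: dilate_const_def john_nirenberg_const_nonneg)

text \<open>The centres of a ball and of its double differ by at most (1 + 2^n) \<beta>, and j such
  steps lead from r to 2^j r. The remaining unit in \<open>Suc j\<close> accounts for the
  oscillation about the last centre, which is present also for j = 0.\<close>

lemma osc_bound_dilate:
  fixes b :: "'a::euclidean_space \<Rightarrow> 'b::euclidean_space"
  assumes b: "osc_bound b a \<beta>" and q: "0 < q" and \<beta>: "0 < \<beta>" and r: "0 < r"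
  shows "(\<integral>\<^sup>+y. epowr (ennreal (norm (b y - a c r))) q \<partial>ball_measure c (2 ^ j * r)) \<le> ennreal (dilate_const DIM('a) q * (real (Suc j) * \<beta>) powr q)"
proof -
  have [measurable]: "b \<in> borel_measurable lebesgue" by (rule osc_boundD[OF b])
  have step: "norm (a c (2 ^ Suc i * r) - a c (2 ^ i * r)) \<le> (1 + 2 ^ DIM('a)) * \<beta>" for i
  proof -
    have ri: "0 < 2 ^ i * r" "0 < 2 ^ Suc i * r" using r by auto
    interpret prob_space "ball_measure c (2 ^ i * r)" using ri(1) by (rule prob_space_ball_measure)
    have "ennreal (norm (a c (2 ^ Suc i * r) - a c (2 ^ i * r))) \<le>
       (\<integral>\<^sup>+y. ennreal (norm (b y - a c (2 ^ Suc i * r))) \<partial>ball_measure c (2 ^ i * r)) + (\<integral>\<^sup>+y. ennreal (norm (b y - a c (2 ^ i * r))) \<partial>ball_measure c (2 ^ i * r))"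
      by (rule norm_diff_le_nn_integral) simp
    also have "(\<integral>\<^sup>+y. ennreal (norm (b y - a c (2 ^ Suc i * r))) \<partial>ball_measure c (2 ^ i * r))
       \<le> ennreal (2 ^ DIM('a)) * (\<integral>\<^sup>+y. ennreal (norm (b y - a c (2 ^ Suc i * r))) \<partial>ball_measure c (2 * (2 ^ i * r)))"
      using ri r by (intro ball_measure_mono_ball) (auto intro!: subset_ball)
    also have "2 * (2 ^ i * r) = 2 ^ Suc i * r" by simp
    also have "ennreal (2 ^ DIM('a)) * (\<integral>\<^sup>+y. ennreal (norm (b y - a c (2 ^ Suc i * r))) \<partial>ball_measure c (2 ^ Suc i * r)) \<le> ennreal (2 ^ DIM('a)) * ennreal \<beta>"
      by (intro mult_left_mono osc_boundD(2)[OF b ri(2)]) auto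
    also have "(\<integral>\<^sup>+y. ennreal (norm (b y - a c (2 ^ i * r))) \<partial>ball_measure c (2 ^ i * r)) \<le> ennreal \<beta>"
      by (rule osc_boundD(2)[OF b ri(1)])
    also have "ennreal (2 ^ DIM('a)) * ennreal \<beta> + ennreal \<beta> = ennreal ((1 + 2 ^ DIM('a)) * \<beta>)"
      using \<beta> by (simp add: ennreal_mult[symmetric] ennreal_plus[symmetric] distrib_right add.commute del: ennreal_plus)
    finally have "ennreal (norm (a c (2 ^ Suc i * r) - a c (2 ^ i * r))) \<le> ennreal ((1 + 2 ^ DIM('a)) * \<beta>)"
      by (simp add: add_right_mono add_left_mono)
    then show ?thesis using \<beta> by (subst (asm) ennreal_le_iff) auto
  qed
  have tele: "norm (a c (2 ^ j * r) - a c r) \<le> real j * ((1 + 2 ^ DIM('a)) * \<beta>)"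
  proof (induction j)
    case (Suc j)
    have "norm (a c (2 ^ Suc j * r) - a c r) \<le> norm (a c (2 ^ Suc j * r) - a c (2 ^ j * r)) + norm (a c (2 ^ j * r) - a c r)"
      using norm_triangle_ineq[of "a c (2 ^ Suc j * r) - a c (2 ^ j * r)" "a c (2 ^ j * r) - a c r"] by simp
    also have "\<dots> \<le> (1 + 2 ^ DIM('a)) * \<beta> + real j * ((1 + 2 ^ DIM('a)) * \<beta>)" by (intro add_mono step Suc)
    finally show ?case by (simp add: algebra_simps)
  qed simp
  let ?r = "2 ^ j * r"
  have rj: "0 < ?r" using r by simp
  interpret prob_space "ball_measure c ?r" using rj by (rule prob_space_ball_measure)
  have sj: "0 < real (Suc j) * \<beta>" using \<beta> by simp
  have t1: "(\<integral>\<^sup>+y. epowr (ennreal (norm (b y - a c ?r))) q \<partial>ball_measure c ?r) \<le> ennreal (john_nirenberg_const DIM('a) q * (real (Suc j) * \<beta>) powr q)"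
  proof (rule order_trans[OF john_nirenberg[OF b q \<beta> rj]])
    have "\<beta> powr q \<le> (real (Suc j) * \<beta>) powr q" using \<beta> q by (intro powr_mono2) auto
    then show "ennreal (john_nirenberg_const DIM('a) q * \<beta> powr q) \<le> ennreal (john_nirenberg_const DIM('a) q * (real (Suc j) * \<beta>) powr q)"
      by (intro ennreal_leI mult_left_mono john_nirenberg_const_nonneg)
  qed
  have t2: "epowr (ennreal (norm (a c ?r - a c r))) q \<le> ennreal ((1 + 2 ^ DIM('a)) powr q * (real (Suc j) * \<beta>) powr q)"
  proof -
    have "norm (a c ?r - a c r) \<le> (1 + 2 ^ DIM('a)) * (real (Suc j) * \<beta>)"
    proof (rule order_trans[OF tele])
      have "real j * ((1 + 2 ^ DIM('a)) * \<beta>) \<le> real (Suc j) * ((1 + 2 ^ DIM('a)) * \<beta>)"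
        using \<beta> by (intro mult_right_mono) auto
      then show "real j * ((1 + 2 ^ DIM('a)) * \<beta>) \<le> (1 + 2 ^ DIM('a)) * (real (Suc j) * \<beta>)"
        by (simp only: ac_simps)
    qed
    then have "epowr (ennreal (norm (a c ?r - a c r))) q \<le> epowr (ennreal ((1 + 2 ^ DIM('a)) * (real (Suc j) * \<beta>))) q"
      using q by (intro epowr_mono ennreal_leI) auto
    also have "\<dots> = ennreal ((1 + 2 ^ DIM('a)) powr q * (real (Suc j) * \<beta>) powr q)"
      using q sj by (subst epowr_ennreal) (auto simp: powr_mult)
    finally show ?thesis .
  qed
  have "(\<integral>\<^sup>+y. epowr (ennreal (norm (b y - a c r))) q \<partial>ball_measure c ?r)
    \<le> ennreal (2 powr q) * ((\<integral>\<^sup>+y. epowr (ennreal (norm (b y - a c ?r))) q \<partial>ball_measure c ?r) + epowr (ennreal (norm (a c ?r - a c r))) q)"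
    using q by (intro nn_integral_epowr_shift) auto
  also have "\<dots> \<le> ennreal (2 powr q) * (ennreal (john_nirenberg_const DIM('a) q * (real (Suc j) * \<beta>) powr q) + ennreal ((1 + 2 ^ DIM('a)) powr q * (real (Suc j) * \<beta>) powr q))"
    by (intro mult_left_mono add_mono t1 t2) auto
  also have "\<dots> = ennreal (2 powr q * (john_nirenberg_const DIM('a) q * (real (Suc j) * \<beta>) powr q + (1 + 2 ^ DIM('a)) powr q * (real (Suc j) * \<beta>) powr q))"
    using john_nirenberg_const_nonneg by (subst ennreal_plus[symmetric]) (auto simp: ennreal_mult)
  also have "2 powr q * (john_nirenberg_const DIM('a) q * (real (Suc j) * \<beta>) powr q + (1 + 2 ^ DIM('a)) powr q * (real (Suc j) * \<beta>) powr q)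
    = dilate_const DIM('a) q * (real (Suc j) * \<beta>) powr q"
    by (simp only: dilate_const_def distrib_left distrib_right mult.assoc)
  finally show ?thesis .
qed

text \<open>The operator H -> M(H^k)^(1/k). For k > 1 it controls averages of H times a power of the
  oscillation of b, which M H alone does not.\<close>

definition hl_max_pow :: "real \<Rightarrow> ('a::euclidean_space \<Rightarrow> ennreal) \<Rightarrow> 'a \<Rightarrow> ennreal" where
  "hl_max_pow k H x = epowr (hl_max (\<lambda>y. epowr (H y) k) x) (1 / k)"

lemma hl_max_pow_measurable [measurable]: "hl_max_pow k H \<in> borel_measurable lebesgue"
  unfolding hl_max_pow_def by measurable

text \<open>Hoelder's inequality with exponents k and k/(k-1) separates H from the oscillation,
  whose power s = p m k/(k-1) is controlled by \<open>osc_bound_dilate\<close>. The constant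
  precedes all other objects and depends on m, k, p and the dimension only.\<close>

lemma osc_product:
  assumes k: "1 < k" and p: "0 < p"
  shows "\<exists>C\<ge>0. \<forall>(b :: 'a::euclidean_space \<Rightarrow> 'b::euclidean_space) a \<beta> H c r j x. osc_bound b a \<beta> \<longrightarrow> 0 < \<beta> \<longrightarrow> H \<in> borel_measurable lebesgue \<longrightarrow> 0 < r \<longrightarrow> x \<in> ball c r \<longrightarrow>
    (\<integral>\<^sup>+y. epowr (ennreal (norm (b y - a c r) ^ m)) p * H y \<partial>ball_measure c (2 ^ j * r)) \<le> ennreal (C * ((real (Suc j) * \<beta>) ^ m) powr p) * hl_max_pow k H x"
proof (cases "m = 0")
  \<comment> \<open>The oscillation bound requires a positive exponent s, so m = 0 is treated apart;
    there the claim is Jensen's inequality.\<close>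
  case True
  have "(\<integral>\<^sup>+y. H y \<partial>ball_measure c (2 ^ j * r)) \<le> hl_max_pow k H x"
    if [measurable]: "H \<in> borel_measurable lebesgue" and r: "0 < r" and x: "x \<in> ball c r" for H and c x :: 'a and r j
  proof -
    have rj: "0 < 2 ^ j * r" using r by simp
    have "ball c r \<subseteq> ball c (2 ^ j * r)" using r by (intro subset_ball) auto
    with x have xj: "x \<in> ball c (2 ^ j * r)" by blast
    interpret prob_space "ball_measure c (2 ^ j * r)" using rj by (rule prob_space_ball_measure)
    have "(\<integral>\<^sup>+y. H y \<partial>ball_measure c (2 ^ j * r)) \<le> epowr (\<integral>\<^sup>+y. epowr (H y) k \<partial>ball_measure c (2 ^ j * r)) (1 / k)"
      using k by (intro nn_integral_le_epowr) auto
    also have "\<dots> \<le> hl_max_pow k H x"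
      unfolding hl_max_pow_def using k by (intro epowr_mono hl_max_ge rj xj) auto
    finally show ?thesis .
  qed
  then show ?thesis using True p by (intro exI[of _ 1]) auto
next
  case False
  define s where "s = p * (k / (k - 1)) * real m"
  have s: "0 < s" using False k p by (simp add: s_def)
  have sk: "s * (1 - 1/k) = p * real m" using k by (simp add: s_def field_simps)
  define C where "C = dilate_const DIM('a) s powr (1 - 1/k)"
  have "(\<integral>\<^sup>+y. epowr (ennreal (norm (b y - a c r) ^ m)) p * H y \<partial>ball_measure c (2 ^ j * r)) \<le> ennreal (C * ((real (Suc j) * \<beta>) ^ m) powr p) * hl_max_pow k H x"
    if b: "osc_bound b a \<beta>" and \<beta>: "0 < \<beta>" and [measurable]: "H \<in> borel_measurable lebesgue" and r: "0 < r" and x: "x \<in> ball c r"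
    for b :: "'a \<Rightarrow> 'b" and a \<beta> H c r j x
  proof -
    have [measurable]: "b \<in> borel_measurable lebesgue" by (rule osc_boundD[OF b])
    have rj: "0 < 2 ^ j * r" using r by simp
    have "ball c r \<subseteq> ball c (2 ^ j * r)" using r by (intro subset_ball) auto
    with x have xj: "x \<in> ball c (2 ^ j * r)" by blast
    let ?P = "ball_measure c (2 ^ j * r)"
    have eq: "epowr (ennreal (norm (b y - a c r) ^ m)) p * H y = epowr (epowr (H y) k) (1/k) * epowr (epowr (ennreal (norm (b y - a c r))) s) (1 - 1/k)" for y
    proof -
      have "norm (b y - a c r) ^ m = norm (b y - a c r) powr real m"
        using False by (cases "norm (b y - a c r) = 0") (auto simp: powr_realpow)
      then have "epowr (ennreal (norm (b y - a c r) ^ m)) p = epowr (ennreal (norm (b y - a c r))) (p * real m)"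
        using False p by (simp add: epowr_ennreal powr_powr mult.commute)
      also have "\<dots> = epowr (epowr (ennreal (norm (b y - a c r))) s) (1 - 1/k)"
        using s k by (simp only: sk[symmetric]) (subst epowr_epowr, auto)
      finally have 1: "epowr (ennreal (norm (b y - a c r) ^ m)) p = epowr (epowr (ennreal (norm (b y - a c r))) s) (1 - 1/k)" .
      have 2: "epowr (epowr (H y) k) (1/k) = H y" using k by (intro epowr_inv) simp
      show ?thesis unfolding 1 2 by (rule mult.commute)
    qed
    have "(\<integral>\<^sup>+y. epowr (ennreal (norm (b y - a c r) ^ m)) p * H y \<partial>?P)
      \<le> epowr (\<integral>\<^sup>+y. epowr (H y) k \<partial>?P) (1/k) * epowr (\<integral>\<^sup>+y. epowr (ennreal (norm (b y - a c r))) s \<partial>?P) (1 - 1/k)"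
      unfolding eq using k by (intro hoelder_nn_integral) auto
    also have "\<dots> \<le> hl_max_pow k H x * epowr (ennreal (dilate_const DIM('a) s * (real (Suc j) * \<beta>) powr s)) (1 - 1/k)"
      unfolding hl_max_pow_def using k by (intro mult_mono epowr_mono hl_max_ge rj xj osc_bound_dilate[OF b s \<beta> r]) auto
    also have "epowr (ennreal (dilate_const DIM('a) s * (real (Suc j) * \<beta>) powr s)) (1 - 1/k) = ennreal (C * ((real (Suc j) * \<beta>) ^ m) powr p)"
    proof -
      have "0 < real (Suc j) * \<beta>" using \<beta> by simp
      then have "((real (Suc j) * \<beta>) powr s) powr (1 - 1/k) = ((real (Suc j) * \<beta>) ^ m) powr p"
        by (simp only: powr_powr sk powr_realpow[symmetric] mult.commute)
      then show ?thesis using k dilate_const_nonneg[of "DIM('a)" s]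
        by (subst epowr_ennreal) (auto simp: powr_mult C_def)
    qed
    finally show ?thesis by (simp add: mult.commute)
  qed
  then show ?thesis by (intro exI[of _ C]) (auto simp: C_def)
qed

section \<open>Commutators\<close>

lemma binomial_le_two_power: "m \<le> k \<Longrightarrow> real (k choose m) \<le> 2 ^ k"
proof -
  assume "m \<le> k"
  then have "k choose m \<le> (\<Sum>i\<le>k. k choose i)" by (intro member_le_sum) auto
  then have "k choose m \<le> 2 ^ k" by (simp add: choose_row_sum)
  then have "real (k choose m) \<le> real (2 ^ k)" by (rule of_nat_mono)
  then show ?thesis by simp
qed

text \<open>For u = b(x) and v = b(y) the powers of u - v produce the commutators of order m at x,
  while the other factors do not depend on y.\<close>

lemma commutator_shift_expand:
  fixes u v c :: "'k::comm_ring_1"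
  shows "(c - v) ^ k = (\<Sum>m\<le>k. (of_nat (k choose m) * (c - u) ^ (k - m)) * (u - v) ^ m)"
proof -
  have "(c - v) ^ k = ((u - v) + (c - u)) ^ k" by simp
  also have "\<dots> = (\<Sum>m\<le>k. of_nat (k choose m) * (u - v) ^ m * (c - u) ^ (k - m))" by (rule binomial_ring)
  finally show ?thesis by (simp add: ac_simps)
qed

text \<open>Both bounds come from one binomial identity between T applied to (c - b)^k f and the
  commutators of order at most k at x. The first reads it as an expansion; the second solves it for
  the term of order k, whose coefficient is 1.\<close>

lemma seminorm_at_commutator:
  fixes b f :: "'a::euclidean_space \<Rightarrow> 'k::{real_normed_field, euclidean_space}"
  assumes sn: "seminorm_at (Lp_space p) T x" and p: "0 < p"
    and L: "\<And>m. m \<le> k \<Longrightarrow> (\<lambda>y. (b x - b y) ^ m * f y) \<in> Lp_space p"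
  shows "norm (T (\<lambda>y. (c - b y) ^ k * f y) x) \<le> (\<Sum>m\<le>k. 2 ^ k * norm (b x - c) ^ (k - m) * norm (commutator T m b f x))" (is ?A)
    and "norm (commutator T k b f x) \<le> norm (T (\<lambda>y. (c - b y) ^ k * f y) x) + (\<Sum>m<k. 2 ^ k * norm (b x - c) ^ (k - m) * norm (commutator T m b f x))" (is ?B)
proof -
  define d where "d = (\<lambda>m. of_nat (k choose m) * (c - b x) ^ (k - m))"
  define g where "g = (\<lambda>m y. (b x - b y) ^ m * f y)"
  have g: "g m \<in> Lp_space p" if "m \<le> k" for m using L[OF that] by (simp add: g_def)
  have comm: "commutator T m b f x = T (g m) x" for m by (simp add: commutator_def g_def)
  have exp: "(\<lambda>y. (c - b y) ^ k * f y) = (\<lambda>y. \<Sum>m\<le>k. d m * g m y)"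
    unfolding commutator_shift_expand[of c _ k "b x"] by (simp add: d_def g_def sum_distrib_right mult.assoc)
  have dn: "norm (d m) * norm (T (g m) x) \<le> 2 ^ k * norm (b x - c) ^ (k - m) * norm (commutator T m b f x)" if "m \<le> k" for m
  proof -
    have "norm (d m) = real (k choose m) * norm (b x - c) ^ (k - m)"
      by (simp add: d_def norm_mult norm_power norm_minus_commute)
    also have "\<dots> \<le> 2 ^ k * norm (b x - c) ^ (k - m)" by (intro mult_right_mono binomial_le_two_power that) auto
    finally show ?thesis unfolding comm by (rule mult_right_mono) simp
  qed
  show ?A
    unfolding exp using g dn by (intro order_trans[OF seminorm_at_sum[OF sn p]] sum_mono) auto
  have h: "(\<lambda>y. (c - b y) ^ k * f y) \<in> Lp_space p" unfolding exp using g p by (intro Lp_space_sum) auto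
  have dk: "d k = 1" by (simp add: d_def)
  have "g k = (\<lambda>y. (c - b y) ^ k * f y + (\<Sum>m<k. (- d m) * g m y))"
  proof
    fix y
    have "(\<Sum>m\<le>k. d m * g m y) = d k * g k y + (\<Sum>m<k. d m * g m y)"
      by (simp add: lessThan_Suc_atMost[symmetric])
    then show "g k y = (c - b y) ^ k * f y + (\<Sum>m<k. (- d m) * g m y)"
      using fun_cong[OF exp, of y] by (simp add: dk sum_negf)
  qed
  then have "norm (T (g k) x) = norm (T (\<lambda>y. (c - b y) ^ k * f y + (\<Sum>m<k. (- d m) * g m y)) x)" by simp
  also have "\<dots> \<le> norm (T (\<lambda>y. (c - b y) ^ k * f y) x) + norm (T (\<lambda>y. \<Sum>m<k. (- d m) * g m y) x)"
    using g p by (intro seminorm_at_add[OF sn h] Lp_space_sum) auto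
  also have "norm (T (\<lambda>y. \<Sum>m<k. (- d m) * g m y) x) \<le> (\<Sum>m<k. norm (- d m) * norm (T (g m) x))"
    using g by (intro seminorm_at_sum[OF sn p]) auto
  also have "\<dots> \<le> (\<Sum>m<k. 2 ^ k * norm (b x - c) ^ (k - m) * norm (commutator T m b f x))"
    using dn by (intro sum_mono) auto
  finally show ?B by (simp add: comm)
qed

lemma epowr_sum_le':
  assumes "0 < a" "finite I" "card I \<le> n"
  shows "epowr (\<Sum>i\<in>I. x i) a \<le> ennreal (real n powr a) * (\<Sum>i\<in>I. epowr (x i) a)"
proof (cases "I = {}")
  case False
  have "epowr (\<Sum>i\<in>I. x i) a \<le> ennreal (real (card I) powr a) * (\<Sum>i\<in>I. epowr (x i) a)"
    using assms False by (intro epowr_sum_le) auto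
  also have "\<dots> \<le> ennreal (real n powr a) * (\<Sum>i\<in>I. epowr (x i) a)"
    using assms by (intro mult_right_mono ennreal_leI powr_mono2) auto
  finally show ?thesis .
qed (use assms in simp)

lemma epowr_commutator_sum_le:
  assumes p: "0 < p" and "finite I" "card I \<le> Suc k" and nonneg: "\<And>m. 0 \<le> (u m :: real)" "\<And>m. 0 \<le> (z m :: real)"
  shows "epowr (ennreal (\<Sum>m\<in>I. 2 ^ k * u m * z m)) p \<le> ennreal ((real (Suc k) * 2 ^ k) powr p) * (\<Sum>m\<in>I. epowr (ennreal (u m)) p * epowr (ennreal (z m)) p)"
proof -
  have "ennreal (\<Sum>m\<in>I. 2 ^ k * u m * z m) = (\<Sum>m\<in>I. ennreal (2 ^ k) * (ennreal (u m) * ennreal (z m)))"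
    using nonneg by (subst sum_ennreal[symmetric]) (auto simp: ennreal_mult mult.assoc)
  then have "epowr (ennreal (\<Sum>m\<in>I. 2 ^ k * u m * z m)) p \<le> ennreal (real (Suc k) powr p) * (\<Sum>m\<in>I. epowr (ennreal (2 ^ k) * (ennreal (u m) * ennreal (z m))) p)"
    using epowr_sum_le'[OF assms(1,2,3)] by simp
  also have "\<dots> = ennreal (real (Suc k) powr p) * (\<Sum>m\<in>I. ennreal ((2 ^ k) powr p) * (epowr (ennreal (u m)) p * epowr (ennreal (z m)) p))"
    using p by (simp add: epowr_mult epowr_ennreal_pos del: ennreal_power)
  also have "\<dots> = ennreal ((real (Suc k) * 2 ^ k) powr p) * (\<Sum>m\<in>I. epowr (ennreal (u m)) p * epowr (ennreal (z m)) p)"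
    by (subst powr_mult) (auto simp: ennreal_mult sum_distrib_left mult.assoc)
  finally show ?thesis .
qed

lemma epowr_suminf_dominated:
  assumes p: "0 < p" and S: "(\<Sum>j. ennreal (s j)) \<le> ennreal L" and s: "\<And>j. 0 \<le> s j" and L: "0 \<le> L"
    and x: "\<And>j. x j \<le> ennreal (e j) * X" and e: "\<And>j. 0 \<le> e j" "\<And>j. 0 \<le> d j" "\<And>j. d j * e j \<le> s j"
  shows "(\<Sum>j. ennreal (d j) * x j) \<le> ennreal L * X"
proof -
  have "(\<Sum>j. ennreal (d j) * x j) \<le> (\<Sum>j. ennreal (s j) * X)"
  proof (intro suminf_le summableI)
    fix j
    have "ennreal (d j) * x j \<le> ennreal (d j) * (ennreal (e j) * X)" by (intro mult_left_mono x) auto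
    also have "\<dots> = ennreal (d j * e j) * X" using e by (simp add: ennreal_mult mult.assoc)
    also have "\<dots> \<le> ennreal (s j) * X" by (intro mult_right_mono ennreal_leI e) auto
    finally show "ennreal (d j) * x j \<le> ennreal (s j) * X" .
  qed
  also have "\<dots> = (\<Sum>j. ennreal (s j)) * X" by simp
  also have "\<dots> \<le> ennreal L * X" by (intro mult_right_mono S) auto
  finally show ?thesis .
qed

section \<open>Operators with off-diagonal bounds and finite q0\<close>

text \<open>The series starts at index 0, so \<open>\<alpha> j\<close> belongs to the dilation by
  2^(j+2), on which the oscillation of b costs the factor j + 3. The exponent q0 is a real number:
  an infinite one is replaced before the locale is interpreted.\<close>

locale off_diagonal_operator =
  fixes T :: "('a::euclidean_space \<Rightarrow> 'k::{real_normed_field, euclidean_space}) \<Rightarrow> ('a \<Rightarrow> 'k)"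
    and A :: "real \<Rightarrow> ('a \<Rightarrow> 'k) \<Rightarrow> ('a \<Rightarrow> 'k)"
    and p0 q0 C :: real and \<alpha> :: "nat \<Rightarrow> real"
  assumes p0: "1 \<le> p0" and q0: "p0 < q0" and C: "0 \<le> C"
    and sublinear: "sublinear_op_on (Lp_space p0) T"
    and bounded: "bounded_on_Lp p0 T"
    and A: "\<And>r f. r > 0 \<Longrightarrow> f \<in> Linf_c \<Longrightarrow> A r f \<in> Lp_space p0"
    and \<alpha>: "\<And>j. 0 \<le> \<alpha> j"
    and off_diagonal: "\<And>f x r. f \<in> Linf_c \<Longrightarrow> r > 0 \<Longrightarrow>
      eLp_norm (ball_measure x r) (ennreal p0) (T (\<lambda>y. f y - A r f y))
      \<le> ennreal C * (\<Sum>j. ennreal (\<alpha> j) * eLp_norm (ball_measure x (2 ^ (j + 2) * r)) (ennreal p0) f)"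
    and on_diagonal: "\<And>f x r. f \<in> Linf_c \<Longrightarrow> r > 0 \<Longrightarrow>
      eLp_norm (ball_measure x r) (ennreal q0) (T (A r f))
      \<le> (\<Sum>j. ennreal (\<alpha> j) * eLp_norm (ball_measure x (2 ^ (j + 2) * r)) (ennreal p0) (T f))"
begin

lemma p0_pos: "0 < p0" using p0 by simp
lemma q0_pos: "0 < q0" using p0 q0 by simp

lemma T_Lp: "f \<in> Lp_space p0 \<Longrightarrow> T f \<in> Lp_space p0"
  using bounded by (simp add: bounded_on_Lp_def)

lemma T_measurable: "f \<in> Lp_space p0 \<Longrightarrow> T f \<in> borel_measurable lebesgue"
  using T_Lp by (auto simp: Lp_space_def)

lemma AE_seminorm: "AE x in lebesgue. seminorm_at (Lp_space p0) T x"
  by (rule sublinear_op_on_AE[OF sublinear])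

definition comm_pow :: "nat \<Rightarrow> ('a \<Rightarrow> 'k) \<Rightarrow> ('a \<Rightarrow> 'k) \<Rightarrow> 'a \<Rightarrow> ennreal" where
  "comm_pow m b f x = epowr (ennreal (norm (commutator T m b f x))) p0"

text \<open>Expanding (b(x) - b(y))^k in powers of b(y) exhibits the commutator as T of a finite sum
  of fixed functions whose coefficients depend measurably on x.\<close>

lemma commutator_norm_measurable:
  fixes b f :: "'a \<Rightarrow> 'k"
  assumes [measurable]: "b \<in> borel_measurable lebesgue" and L: "\<And>j. j \<le> k \<Longrightarrow> (\<lambda>y. b y ^ j * f y) \<in> Lp_space p0"
  shows "(\<lambda>x. norm (commutator T k b f x)) \<in> borel_measurable lebesgue"
proof -
  define c where "c j x = of_nat (k choose j) * (b x) ^ (k - j) * (- 1) ^ j" for j x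
  have [measurable]: "c j \<in> borel_measurable lebesgue" for j unfolding c_def by measurable
  have eq: "commutator T k b f x = T (\<lambda>y. \<Sum>j\<le>k. c j x * (b y ^ j * f y)) x" for x
  proof -
    have "(b x - b y) ^ k * f y = (\<Sum>j\<le>k. c j x * (b y ^ j * f y))" for y
    proof -
      have "(b x - b y) ^ k = (- b y + b x) ^ k" by simp
      also have "\<dots> = (\<Sum>j\<le>k. of_nat (k choose j) * (- b y) ^ j * b x ^ (k - j))" by (rule binomial_ring)
      also have "\<dots> = (\<Sum>j\<le>k. c j x * b y ^ j)"
        by (intro sum.cong) (auto simp: c_def power_minus[of "b y"] ac_simps)
      finally show ?thesis by (simp add: sum_distrib_right mult.assoc)
    qed
    then show ?thesis by (simp add: commutator_def)
  qed
  show ?thesis unfolding eq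
    by (rule seminorm_sum_measurable[OF AE_seminorm p0_pos T_measurable L]) auto
qed

lemma power_mult_Linf_c:
  fixes b f :: "'a \<Rightarrow> 'k"
  assumes f: "f \<in> Linf_c" and [measurable]: "b \<in> borel_measurable lebesgue" and N: "\<And>x. norm (b x) \<le> N"
  shows "(\<lambda>y. (c - b y) ^ m * f y) \<in> Linf_c"
proof (rule Linf_c_mult[OF f])
  show "norm ((c - b x) ^ m) \<le> (norm c + N) ^ m" for x
    unfolding norm_power using norm_triangle_ineq4[of c "b x"] N[of x] by (intro power_mono) auto
qed measurable

lemma comm_pow_measurable:
  assumes f: "f \<in> Linf_c" and b[measurable]: "b \<in> borel_measurable lebesgue" and N: "\<And>x. norm (b x) \<le> N"
  shows "comm_pow m b f \<in> borel_measurable lebesgue"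
proof -
  have "(\<lambda>x. norm (commutator T m b f x)) \<in> borel_measurable lebesgue"
  proof (rule commutator_norm_measurable[OF b])
    fix j
    have "(\<lambda>y. b y ^ j * f y) \<in> Linf_c"
    proof (rule Linf_c_mult[OF f])
      show "norm (b x ^ j) \<le> N ^ j" for x unfolding norm_power by (intro power_mono N) auto
    qed measurable
    then show "(\<lambda>y. b y ^ j * f y) \<in> Lp_space p0" by (rule Linf_c_subset_Lp_space[OF p0_pos])
  qed
  then show ?thesis unfolding comm_pow_def by measurable
qed

text \<open>With \<open>c = 0\<close> the commutator is dominated by finitely many functions in \<open>L\<^sup>p\<close>.\<close>

lemma comm_pow_integrable:
  assumes f: "f \<in> Linf_c" and b[measurable]: "b \<in> borel_measurable lebesgue" and N: "\<And>x. norm (b x) \<le> N"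
  shows "(\<integral>\<^sup>+x. comm_pow k b f x \<partial>lebesgue) < \<infinity>"
proof (induction k rule: less_induct)
  case (less k)
  have N0: "0 \<le> N" using N[of 0] norm_ge_zero order_trans by blast
  define h where "h y = (0 - b y) ^ k * f y" for y
  have h: "h \<in> Lp_space p0" unfolding h_def by (intro Linf_c_subset_Lp_space[OF p0_pos] power_mult_Linf_c[OF f b N])
  have [measurable]: "T h \<in> borel_measurable lebesgue" using h by (rule T_measurable)
  have [measurable]: "comm_pow m b f \<in> borel_measurable lebesgue" for m by (rule comm_pow_measurable[OF f b N])
  let ?c = "ennreal ((real (Suc k) * 2 ^ k) powr p0)"
  have "(\<integral>\<^sup>+x. comm_pow k b f x \<partial>lebesgue) \<le> (\<integral>\<^sup>+x. ennreal (2 powr p0) * (epowr (ennreal (norm (T h x))) p0 + ?c * (\<Sum>m<k. epowr (ennreal (N ^ (k - m))) p0 * comm_pow m b f x)) \<partial>lebesgue)"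
    using AE_seminorm
  proof (intro nn_integral_mono_AE, eventually_elim)
    case (elim x)
    have "norm (commutator T k b f x) \<le> norm (T h x) + (\<Sum>m<k. 2 ^ k * norm (b x - 0) ^ (k - m) * norm (commutator T m b f x))"
      unfolding h_def
      by (intro seminorm_at_commutator(2)[OF elim(2) p0_pos] Linf_c_subset_Lp_space[OF p0_pos] power_mult_Linf_c[OF f b N])
    also have "\<dots> \<le> norm (T h x) + (\<Sum>m<k. 2 ^ k * N ^ (k - m) * norm (commutator T m b f x))"
      using N by (intro add_left_mono sum_mono mult_right_mono mult_left_mono power_mono) auto
    finally have "ennreal (norm (commutator T k b f x)) \<le> ennreal (norm (T h x)) + ennreal (\<Sum>m<k. 2 ^ k * N ^ (k - m) * norm (commutator T m b f x))"
      using N0 by (subst ennreal_plus[symmetric]) (auto intro!: sum_nonneg ennreal_leI)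
    then have "comm_pow k b f x \<le> epowr (ennreal (norm (T h x)) + ennreal (\<Sum>m<k. 2 ^ k * N ^ (k - m) * norm (commutator T m b f x))) p0"
      unfolding comm_pow_def using p0_pos by (intro epowr_mono) auto
    also have "\<dots> \<le> ennreal (2 powr p0) * (epowr (ennreal (norm (T h x))) p0 + epowr (ennreal (\<Sum>m<k. 2 ^ k * N ^ (k - m) * norm (commutator T m b f x))) p0)"
      using p0_pos by (intro epowr_add_le) auto
    also have "\<dots> \<le> ennreal (2 powr p0) * (epowr (ennreal (norm (T h x))) p0 + ?c * (\<Sum>m<k. epowr (ennreal (N ^ (k - m))) p0 * comm_pow m b f x))"
      unfolding comm_pow_def using p0_pos N0 by (intro mult_left_mono add_left_mono epowr_commutator_sum_le) auto
    finally show ?case .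
  qed
  also have "\<dots> = ennreal (2 powr p0) * ((\<integral>\<^sup>+x. epowr (ennreal (norm (T h x))) p0 \<partial>lebesgue) + ?c * (\<Sum>m<k. epowr (ennreal (N ^ (k - m))) p0 * (\<integral>\<^sup>+x. comm_pow m b f x \<partial>lebesgue)))"
    by (simp add: nn_integral_cmult nn_integral_add nn_integral_sum)
  also have "\<dots> < \<infinity>"
    using less T_Lp[OF h] p0_pos by (auto simp: Lp_space_iff ennreal_mult_less_top intro!: epowr_less_top)
  finally show ?case .
qed

text \<open>This is the function G. A commutator of order m < k carries \<beta>^(k-m) and f carries
  \<beta>^k, so that after the induction every term has the homogeneity \<beta>^k. The outer power
  p0 matches that of \<open>comm_pow\<close>.\<close>

definition comm_major :: "real \<Rightarrow> real \<Rightarrow> nat \<Rightarrow> ('a \<Rightarrow> 'k) \<Rightarrow> ('a \<Rightarrow> 'k) \<Rightarrow> 'a \<Rightarrow> ennreal" where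
  "comm_major \<kappa> \<beta> k b f x = ennreal ((\<beta> ^ k) powr p0) * hl_max_pow \<kappa> (\<lambda>y. epowr (ennreal (norm (f y))) p0) x
    + (\<Sum>m<k. ennreal ((\<beta> ^ (k - m)) powr p0) * hl_max_pow \<kappa> (comm_pow m b f) x)"

lemma comm_major_measurable [measurable]: "comm_major \<kappa> \<beta> k b f \<in> borel_measurable lebesgue"
  unfolding comm_major_def by measurable

definition expand_const :: "nat \<Rightarrow> real" where
  "expand_const k = (real (Suc k) * 2 ^ k) powr p0"

definition split_const :: "nat \<Rightarrow> real" where
  "split_const k = 2 powr p0 * (2 powr p0 + expand_const k)"

lemma const_nonneg: "0 \<le> expand_const k" "0 \<le> split_const k"
  by (simp_all add: expand_const_def split_const_def)

text \<open>Meant for g = A r h. In the first bound the first group becomes U, with the off-diagonal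
  part and the lower orders, and the last term becomes V. The second bound serves the right-hand
  side of the on-diagonal hypothesis; there the commutator of order k returns with the oscillation
  to the power 0.\<close>

lemma comm_pow_split:
  assumes sn: "seminorm_at (Lp_space p0) T x" and f: "f \<in> Linf_c" and b: "b \<in> borel_measurable lebesgue" and N: "\<And>x. norm (b x) \<le> N"
    and h: "h = (\<lambda>y. (c - b y) ^ k * f y)" and g: "g \<in> Lp_space p0"
  shows "comm_pow k b f x \<le> ennreal (split_const k) * (epowr (ennreal (norm (T (\<lambda>y. h y - g y) x))) p0
      + (\<Sum>m<k. epowr (ennreal (norm (b x - c) ^ (k - m))) p0 * comm_pow m b f x)) + ennreal (split_const k) * epowr (ennreal (norm (T g x))) p0"
    and "epowr (ennreal (norm (T h x))) p0 \<le> ennreal (expand_const k) * (\<Sum>m\<le>k. epowr (ennreal (norm (b x - c) ^ (k - m))) p0 * comm_pow m b f x)"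
proof -
  have L: "(\<lambda>y. (d - b y) ^ m * f y) \<in> Lp_space p0" for d m
    by (intro Linf_c_subset_Lp_space[OF p0_pos] power_mult_Linf_c[OF f b N])
  have hL: "h \<in> Lp_space p0" unfolding h by (rule L)
  let ?S = "\<Sum>m<k. 2 ^ k * norm (b x - c) ^ (k - m) * norm (commutator T m b f x)"
  let ?X = "epowr (ennreal (norm (T (\<lambda>y. h y - g y) x))) p0" and ?Y = "epowr (ennreal (norm (T g x))) p0"
  let ?Z = "\<Sum>m<k. epowr (ennreal (norm (b x - c) ^ (k - m))) p0 * comm_pow m b f x"
  have "norm (commutator T k b f x) \<le> norm (T h x) + ?S"
    unfolding h by (intro seminorm_at_commutator(2)[OF sn p0_pos] L)
  moreover have "norm (T (\<lambda>y. h y - g y + g y) x) \<le> norm (T (\<lambda>y. h y - g y) x) + norm (T g x)"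
    by (intro seminorm_at_add[OF sn] Lp_space_diff p0_pos hL g)
  ultimately have "norm (commutator T k b f x) \<le> (norm (T (\<lambda>y. h y - g y) x) + norm (T g x)) + ?S" by simp
  then have "ennreal (norm (commutator T k b f x)) \<le> (ennreal (norm (T (\<lambda>y. h y - g y) x)) + ennreal (norm (T g x))) + ennreal ?S"
    by (subst ennreal_plus[symmetric], simp, simp, subst ennreal_plus[symmetric]) (auto intro!: sum_nonneg ennreal_leI)
  then have "comm_pow k b f x \<le> epowr ((ennreal (norm (T (\<lambda>y. h y - g y) x)) + ennreal (norm (T g x))) + ennreal ?S) p0"
    unfolding comm_pow_def using p0_pos by (intro epowr_mono) auto
  also have "\<dots> \<le> ennreal (2 powr p0) * (epowr (ennreal (norm (T (\<lambda>y. h y - g y) x)) + ennreal (norm (T g x))) p0 + epowr (ennreal ?S) p0)"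
    using p0_pos by (intro epowr_add_le) auto
  also have "\<dots> \<le> ennreal (2 powr p0) * (ennreal (2 powr p0) * (?X + ?Y) + ennreal (expand_const k) * ?Z)"
    unfolding expand_const_def comm_pow_def using p0_pos
    by (intro mult_left_mono add_mono epowr_add_le epowr_commutator_sum_le) auto
  also have "\<dots> \<le> ennreal (2 powr p0) * (ennreal (2 powr p0 + expand_const k) * (?X + ?Y) + ennreal (2 powr p0 + expand_const k) * ?Z)"
    using const_nonneg(1)[of k] by (intro mult_left_mono add_mono mult_right_mono ennreal_leI) auto
  also have "\<dots> = ennreal (split_const k) * (?X + ?Z) + ennreal (split_const k) * ?Y"
  proof -
    have "P * (R * (X + Y) + R * Z) = (P * R) * (X + Z) + (P * R) * Y" for P R X Y Z :: ennreal
      by (simp add: distrib_left ac_simps)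
    moreover have "ennreal (split_const k) = ennreal (2 powr p0) * ennreal (2 powr p0 + expand_const k)"
      unfolding split_const_def using const_nonneg(1)[of k] by (intro ennreal_mult) auto
    ultimately show ?thesis by (simp only:)
  qed
  finally show "comm_pow k b f x \<le> ennreal (split_const k) * (?X + ?Z) + ennreal (split_const k) * ?Y" .
  have "ennreal (norm (T h x)) \<le> ennreal (\<Sum>m\<le>k. 2 ^ k * norm (b x - c) ^ (k - m) * norm (commutator T m b f x))"
    unfolding h by (intro ennreal_leI seminorm_at_commutator(1)[OF sn p0_pos] L)
  then have "epowr (ennreal (norm (T h x))) p0 \<le> epowr (ennreal (\<Sum>m\<le>k. 2 ^ k * norm (b x - c) ^ (k - m) * norm (commutator T m b f x))) p0"
    using p0_pos by (intro epowr_mono) auto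
  also have "\<dots> \<le> ennreal (expand_const k) * (\<Sum>m\<le>k. epowr (ennreal (norm (b x - c) ^ (k - m))) p0 * comm_pow m b f x)"
    unfolding expand_const_def comm_pow_def using p0_pos by (intro epowr_commutator_sum_le) auto
  finally show "epowr (ennreal (norm (T h x))) p0 \<le> \<dots>" .
qed

lemma eLp_norm_powr: "epowr (eLp_norm M (ennreal p0) g) p0 = (\<integral>\<^sup>+x. epowr (ennreal (norm (g x))) p0 \<partial>M)"
  by (simp add: eLp_norm_ennreal p0_pos epowr_inv')

text \<open>On the dilate by 2^(j+2) the oscillation costs (j + 3)^k in the L^p0 average, and
  \<open>sumL\<close> sums these factors against \<alpha>. The quantity M is common to all dilates
  and leaves the sum.\<close>

lemma off_diagonal_average:
  assumes f: "f \<in> Linf_c" and b[measurable]: "b \<in> borel_measurable lebesgue" and N: "\<And>x. norm (b x) \<le> N"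
    and h: "h = (\<lambda>y. (a - b y) ^ k * f y)" and r: "0 < r" and \<beta>: "0 < \<beta>" and L: "0 \<le> L" and Q: "0 \<le> Q"
    and sumL: "(\<Sum>j. ennreal (\<alpha> j * real (j + 3) ^ k)) \<le> ennreal L"
    and hQ: "\<And>j. (\<integral>\<^sup>+y. epowr (ennreal (norm (b y - a) ^ k)) p0 * epowr (ennreal (norm (f y))) p0 \<partial>ball_measure c (2 ^ j * r))
      \<le> ennreal (Q * ((real (Suc j) * \<beta>) ^ k) powr p0) * M"
  shows "(\<integral>\<^sup>+y. epowr (ennreal (norm (T (\<lambda>y. h y - A r h y) y))) p0 \<partial>ball_measure c r)
    \<le> ennreal ((C * L) powr p0 * Q) * (ennreal ((\<beta> ^ k) powr p0) * M)"
proof -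
  have hc: "h \<in> Linf_c" unfolding h by (rule power_mult_Linf_c[OF f b N])
  let ?X = "ennreal (Q powr (1/p0) * \<beta> ^ k) * epowr M (1/p0)"
  have summand: "eLp_norm (ball_measure c (2 ^ (j + 2) * r)) (ennreal p0) h \<le> ennreal (real (j + 3) ^ k) * ?X" for j
  proof -
    have "eLp_norm (ball_measure c (2 ^ (j + 2) * r)) (ennreal p0) h
       = epowr (\<integral>\<^sup>+y. epowr (ennreal (norm (b y - a) ^ k)) p0 * epowr (ennreal (norm (f y))) p0 \<partial>ball_measure c (2 ^ (j + 2) * r)) (1/p0)"
      unfolding eLp_norm_ennreal[OF p0_pos] h using p0_pos
      by (simp add: norm_mult norm_power norm_minus_commute ennreal_mult epowr_mult)
    also have "\<dots> \<le> epowr (ennreal (Q * ((real (Suc (j + 2)) * \<beta>) ^ k) powr p0) * M) (1/p0)"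
      using p0_pos by (intro epowr_mono hQ) auto
    also have "\<dots> = ennreal (Q powr (1/p0) * (real (Suc (j + 2)) * \<beta>) ^ k) * epowr M (1/p0)"
    proof -
      have "0 < (real (Suc (j + 2)) * \<beta>) ^ k" using \<beta> by simp
      then have "(((real (Suc (j + 2)) * \<beta>) ^ k) powr p0) powr (1/p0) = (real (Suc (j + 2)) * \<beta>) ^ k"
        using p0_pos by (simp only: powr_powr) simp
      then have "epowr (ennreal (Q * ((real (Suc (j + 2)) * \<beta>) ^ k) powr p0)) (1/p0) = ennreal (Q powr (1/p0) * (real (Suc (j + 2)) * \<beta>) ^ k)"
        using p0_pos Q by (subst epowr_ennreal) (auto simp: powr_mult)
      then show ?thesis using p0_pos by (simp only: epowr_mult less_imp_le zero_less_divide_1_iff)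
    qed
    also have "\<dots> = ennreal (real (j + 3) ^ k) * ?X"
    proof -
      have "Q powr (1/p0) * (real (Suc (j + 2)) * \<beta>) ^ k = real (j + 3) ^ k * (Q powr (1/p0) * \<beta> ^ k)"
        by (simp add: power_mult_distrib add.commute)
      then have "ennreal (Q powr (1/p0) * (real (Suc (j + 2)) * \<beta>) ^ k) = ennreal (real (j + 3) ^ k * (Q powr (1/p0) * \<beta> ^ k))"
        by (rule arg_cong)
      also have "\<dots> = ennreal (real (j + 3) ^ k) * ennreal (Q powr (1/p0) * \<beta> ^ k)"
        using \<beta> by (intro ennreal_mult) auto
      finally show ?thesis by (simp only: mult.assoc)
    qed
    finally show ?thesis .
  qed
  have "(\<integral>\<^sup>+y. epowr (ennreal (norm (T (\<lambda>y. h y - A r h y) y))) p0 \<partial>ball_measure c r)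
    \<le> epowr (ennreal C * (\<Sum>j. ennreal (\<alpha> j) * eLp_norm (ball_measure c (2 ^ (j + 2) * r)) (ennreal p0) h)) p0"
    unfolding eLp_norm_powr[symmetric] using p0_pos by (intro epowr_mono off_diagonal hc r) auto
  also have "\<dots> \<le> epowr (ennreal C * (ennreal L * ?X)) p0"
    using p0_pos by (intro epowr_mono mult_left_mono epowr_suminf_dominated[OF p0_pos sumL _ L summand]) (auto simp: \<alpha>)
  also have "\<dots> = ennreal ((C * L) powr p0 * Q) * (ennreal ((\<beta> ^ k) powr p0) * M)"
  proof -
    have 1: "epowr (epowr M (1/p0)) p0 = M" by (rule epowr_inv'[OF p0_pos])
    have 2: "epowr (ennreal (Q powr (1/p0) * \<beta> ^ k)) p0 = ennreal Q * ennreal ((\<beta> ^ k) powr p0)"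
    proof -
      have "(Q powr (1/p0)) powr p0 = Q" using Q p0_pos by (simp add: powr_powr)
      then show ?thesis using \<beta> p0_pos Q by (subst epowr_ennreal) (auto simp: powr_mult ennreal_mult)
    qed
    have 3: "epowr (ennreal C) p0 * epowr (ennreal L) p0 = ennreal ((C * L) powr p0)"
      using C L p0_pos by (simp add: epowr_ennreal powr_mult ennreal_mult)
    have "epowr (ennreal C * (ennreal L * ?X)) p0 = (epowr (ennreal C) p0 * epowr (ennreal L) p0) * (epowr (ennreal (Q powr (1/p0) * \<beta> ^ k)) p0 * epowr (epowr M (1/p0)) p0)"
      using p0_pos by (simp only: epowr_mult less_imp_le mult.assoc)
    also have "\<dots> = ennreal ((C * L) powr p0) * (ennreal Q * ennreal ((\<beta> ^ k) powr p0) * M)" by (simp only: 1 2 3)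
    also have "\<dots> = ennreal ((C * L) powr p0 * Q) * (ennreal ((\<beta> ^ k) powr p0) * M)"
      using Q by (simp add: ennreal_mult mult.assoc)
    finally show ?thesis .
  qed
  finally show ?thesis .
qed

text \<open>The same summation with T h on the right. The L^q0 average is written as the average of
  the power q0/p0 of |T A_r h|^p0, since F is itself a p0-th power.\<close>

lemma on_diagonal_average:
  assumes h: "h \<in> Linf_c" and r: "0 < r" and L: "0 \<le> L" and Q: "0 \<le> Q"
    and sumL: "(\<Sum>j. ennreal (\<alpha> j * real (j + 3) ^ k)) \<le> ennreal L"
    and hQ: "\<And>j. (\<integral>\<^sup>+y. epowr (ennreal (norm (T h y))) p0 \<partial>ball_measure c (2 ^ (j + 2) * r))
      \<le> ennreal (Q * (real (j + 3) ^ k) powr p0) * M"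
  shows "(\<integral>\<^sup>+y. epowr (epowr (ennreal (norm (T (A r h) y))) p0) (q0 / p0) \<partial>ball_measure c r)
    \<le> epowr (ennreal (L powr p0 * Q) * M) (q0 / p0)"
proof -
  let ?X = "ennreal (Q powr (1/p0)) * epowr M (1/p0)"
  have summand: "eLp_norm (ball_measure c (2 ^ (j + 2) * r)) (ennreal p0) (T h) \<le> ennreal (real (j + 3) ^ k) * ?X" for j
  proof -
    have "eLp_norm (ball_measure c (2 ^ (j + 2) * r)) (ennreal p0) (T h) \<le> epowr (ennreal (Q * (real (j + 3) ^ k) powr p0) * M) (1/p0)"
      unfolding eLp_norm_ennreal[OF p0_pos] using p0_pos by (intro epowr_mono hQ) auto
    also have "\<dots> = ennreal (Q powr (1/p0) * real (j + 3) ^ k) * epowr M (1/p0)"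
    proof -
      have "((real (j + 3) ^ k) powr p0) powr (1/p0) = real (j + 3) ^ k"
        using p0_pos by (simp only: powr_powr) simp
      then have "epowr (ennreal (Q * (real (j + 3) ^ k) powr p0)) (1/p0) = ennreal (Q powr (1/p0) * real (j + 3) ^ k)"
        using p0_pos Q by (subst epowr_ennreal) (auto simp: powr_mult)
      then show ?thesis using p0_pos by (simp only: epowr_mult less_imp_le zero_less_divide_1_iff)
    qed
    also have "\<dots> = ennreal (real (j + 3) ^ k) * ?X"
      by (subst ennreal_mult) (auto simp: ac_simps)
    finally show ?thesis .
  qed
  have "epowr (\<integral>\<^sup>+y. epowr (ennreal (norm (T (A r h) y))) q0 \<partial>ball_measure c r) (1/q0)
    \<le> (\<Sum>j. ennreal (\<alpha> j) * eLp_norm (ball_measure c (2 ^ (j + 2) * r)) (ennreal p0) (T h))"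
    using on_diagonal[OF h r, of c] by (simp only: eLp_norm_ennreal[OF q0_pos])
  also have "\<dots> \<le> ennreal L * ?X"
    by (intro epowr_suminf_dominated[OF p0_pos sumL _ L summand]) (auto simp: \<alpha>)
  finally have "(\<integral>\<^sup>+y. epowr (ennreal (norm (T (A r h) y))) q0 \<partial>ball_measure c r) \<le> epowr (ennreal L * ?X) q0"
    using le_epowrI[of "1/q0"] q0_pos by simp
  also have "epowr (ennreal L * ?X) q0 = epowr (ennreal (L powr p0 * Q) * M) (q0 / p0)"
  proof -
    have "ennreal L * ?X = epowr (ennreal (L powr p0 * Q) * M) (1/p0)"
    proof -
      have "(L powr p0) powr (1/p0) = L" using L p0_pos by (simp add: powr_powr)
      then have "epowr (ennreal (L powr p0 * Q)) (1/p0) = ennreal L * ennreal (Q powr (1/p0))"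
        using L Q p0_pos by (subst epowr_ennreal) (auto simp: powr_mult ennreal_mult)
      then show ?thesis using p0_pos by (simp only: epowr_mult less_imp_le zero_less_divide_1_iff mult.assoc)
    qed
    then have "epowr (ennreal L * ?X) q0 = epowr (epowr (ennreal (L powr p0 * Q) * M) (1/p0)) q0" by (rule arg_cong)
    also have "\<dots> = epowr (ennreal (L powr p0 * Q) * M) (q0 / p0)"
      using p0_pos q0_pos by (subst epowr_epowr) auto
    finally show ?thesis .
  qed
  finally show ?thesis using p0_pos q0_pos by (simp add: epowr_epowr)
qed

text \<open>For V, T h on the dilated balls is expanded back into commutators: the one of order k
  gives the maximal function of F, the lower ones the majorant. Each term is an average over a ball
  containing both x and y, so the two may be evaluated at different points. B precedes f, b, the
  ball and the bound on b.\<close>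

lemma commutator_decomposition:
  assumes \<kappa>: "1 < \<kappa>" and L: "0 \<le> L"
    and sumL: "(\<Sum>j. ennreal (\<alpha> j * real (j + 3) ^ k)) \<le> ennreal L"
  shows "\<exists>B\<ge>0. \<forall>f b a \<beta> N c r. f \<in> Linf_c \<longrightarrow> osc_bound b a \<beta> \<longrightarrow> 0 < \<beta> \<longrightarrow> (\<forall>x. norm (b x) \<le> N) \<longrightarrow> 0 < r \<longrightarrow>
    (\<exists>U\<in>borel_measurable lebesgue. \<exists>V\<in>borel_measurable lebesgue.
      (AE x in lebesgue. x \<in> ball c r \<longrightarrow> comm_pow k b f x \<le> U x + V x) \<and>
      (\<forall>x\<in>ball c r. (\<integral>\<^sup>+y. U y \<partial>ball_measure c r) \<le> ennreal B * comm_major \<kappa> \<beta> k b f x) \<and>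
      (\<forall>x\<in>ball c r. \<forall>y\<in>ball c r. (\<integral>\<^sup>+y. epowr (V y) (q0 / p0) \<partial>ball_measure c r)
        \<le> epowr (ennreal B * (hl_max (comm_pow k b f) x + comm_major \<kappa> \<beta> k b f y)) (q0 / p0)))"
proof -
  define P where "P m E \<longleftrightarrow> (\<forall>(b :: 'a \<Rightarrow> 'k) a \<beta> H c r j x. osc_bound b a \<beta> \<longrightarrow> 0 < \<beta> \<longrightarrow> H \<in> borel_measurable lebesgue \<longrightarrow> 0 < r \<longrightarrow> x \<in> ball c r \<longrightarrow>
    (\<integral>\<^sup>+y. epowr (ennreal (norm (b y - a c r) ^ m)) p0 * H y \<partial>ball_measure c (2 ^ j * r)) \<le> ennreal (E * ((real (Suc j) * \<beta>) ^ m) powr p0) * hl_max_pow \<kappa> H x)" for m E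
  have "\<exists>E. 0 \<le> E \<and> P m E" for m unfolding P_def by (rule osc_product[OF \<kappa> p0_pos])
  then obtain D where D: "\<And>m. 0 \<le> D m" and DP: "\<And>m. P m (D m)" by metis
  have D': "(\<integral>\<^sup>+y. epowr (ennreal (norm (b y - a c r) ^ m)) p0 * H y \<partial>ball_measure c (2 ^ j * r)) \<le> ennreal (D m * ((real (Suc j) * \<beta>) ^ m) powr p0) * hl_max_pow \<kappa> H x"
    if "osc_bound b a \<beta>" "0 < \<beta>" "H \<in> borel_measurable lebesgue" "0 < r" "x \<in> ball c r" for m and b :: "'a \<Rightarrow> 'k" and a \<beta> H c r j x
    using DP[of m] that unfolding P_def by blast
  define Q where "Q = (\<Sum>m\<le>k. D m)"
  have Q: "0 \<le> Q" unfolding Q_def by (intro sum_nonneg D)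
  have DQ: "D m \<le> Q" if "m \<le> k" for m unfolding Q_def using that by (intro member_le_sum) (auto simp: D)
  have prod: "(\<integral>\<^sup>+y. epowr (ennreal (norm (b y - a c r) ^ m)) p0 * H y \<partial>ball_measure c (2 ^ j * r)) \<le> ennreal (Q * ((real (Suc j) * \<beta>) ^ m) powr p0) * hl_max_pow \<kappa> H x"
    if "m \<le> k" "osc_bound b a \<beta>" "0 < \<beta>" "H \<in> borel_measurable lebesgue" "0 < r" "x \<in> ball c r" for m and b :: "'a \<Rightarrow> 'k" and a \<beta> H c r j x
    by (rule order_trans[OF D'[OF that(2-6)]]) (intro mult_right_mono ennreal_leI DQ that(1), auto)
  define e where "e = expand_const k"
  define s where "s = split_const k"
  have es: "0 \<le> e" "0 \<le> s" unfolding e_def s_def by (rule const_nonneg)+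
  \<comment> \<open>The first summand serves U, the second V. Here s comes from the splitting, e
    from the expansion of T h, and Q dominates the product constants of all orders up to k.\<close>
  define B where "B = s * ((C * L) powr p0 * Q + Q) + s * (L powr p0 * (e * (Q + 1)))"
  have B1: "s * ((C * L) powr p0 * Q + Q) \<le> B" and B2: "s * (L powr p0 * (e * (Q + 1))) \<le> B" and B0: "0 \<le> B"
    using es Q by (auto simp: B_def)
  have "\<exists>U\<in>borel_measurable lebesgue. \<exists>V\<in>borel_measurable lebesgue.
      (AE x in lebesgue. x \<in> ball c r \<longrightarrow> comm_pow k b f x \<le> U x + V x) \<and>
      (\<forall>x\<in>ball c r. (\<integral>\<^sup>+y. U y \<partial>ball_measure c r) \<le> ennreal B * comm_major \<kappa> \<beta> k b f x) \<and>
      (\<forall>x\<in>ball c r. \<forall>y\<in>ball c r. (\<integral>\<^sup>+y. epowr (V y) (q0 / p0) \<partial>ball_measure c r)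
        \<le> epowr (ennreal B * (hl_max (comm_pow k b f) x + comm_major \<kappa> \<beta> k b f y)) (q0 / p0))"
    if f: "f \<in> Linf_c" and osc: "osc_bound b a \<beta>" and \<beta>: "0 < \<beta>" and N: "\<And>x. norm (b x) \<le> N" and r: "0 < r" for f b a \<beta> N c r
  proof -
    have b[measurable]: "b \<in> borel_measurable lebesgue" by (rule osc_boundD[OF osc])
    have [measurable]: "f \<in> borel_measurable lebesgue" by (rule Linf_cD[OF f])
    have F[measurable]: "comm_pow m b f \<in> borel_measurable lebesgue" for m by (rule comm_pow_measurable[OF f b N])
    define h where "h = (\<lambda>y. (a c r - b y) ^ k * f y)"
    have hc: "h \<in> Linf_c" unfolding h_def by (rule power_mult_Linf_c[OF f b N])
    have hL: "h \<in> Lp_space p0" by (rule Linf_c_subset_Lp_space[OF p0_pos hc])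
    have AL: "A r h \<in> Lp_space p0" by (rule A[OF r hc])
    have [measurable]: "T h \<in> borel_measurable lebesgue" "T (A r h) \<in> borel_measurable lebesgue" "T (\<lambda>y. h y - A r h y) \<in> borel_measurable lebesgue"
      by (intro T_measurable hL AL Lp_space_diff p0_pos)+
    define Z where "Z m y = epowr (ennreal (norm (b y - a c r) ^ (k - m))) p0 * comm_pow m b f y" for m y
    have [measurable]: "Z m \<in> borel_measurable lebesgue" for m unfolding Z_def by measurable
    define X where "X y = epowr (ennreal (norm (T (\<lambda>y. h y - A r h y) y))) p0" for y
    have [measurable]: "X \<in> borel_measurable lebesgue" unfolding X_def by measurable
    define U where "U y = ennreal s * (X y + (\<Sum>m<k. Z m y))" for y
    define V where "V y = ennreal s * epowr (ennreal (norm (T (A r h) y))) p0" for y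
    have [measurable]: "U \<in> borel_measurable lebesgue" "V \<in> borel_measurable lebesgue" unfolding U_def V_def by measurable
    have AEF: "AE x in lebesgue. x \<in> ball c r \<longrightarrow> comm_pow k b f x \<le> U x + V x"
      using AE_seminorm
    proof eventually_elim
      case (elim x)
      show ?case unfolding U_def V_def Z_def X_def s_def
        using comm_pow_split(1)[OF elim f b N h_def AL] by blast
    qed
    have Zavg: "(\<integral>\<^sup>+y. Z m y \<partial>ball_measure c (2 ^ j * r)) \<le> ennreal (Q * ((real (Suc j) * \<beta>) ^ (k - m)) powr p0) * hl_max_pow \<kappa> (comm_pow m b f) x"
      if "x \<in> ball c r" for x m j
      unfolding Z_def by (intro prod osc \<beta> r that) auto
    have G1: "ennreal ((\<beta> ^ k) powr p0) * hl_max_pow \<kappa> (\<lambda>y. epowr (ennreal (norm (f y))) p0) x \<le> comm_major \<kappa> \<beta> k b f x" for x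
      unfolding comm_major_def by simp
    have G2: "(\<Sum>m<k. ennreal ((\<beta> ^ (k - m)) powr p0) * hl_max_pow \<kappa> (comm_pow m b f) x) \<le> comm_major \<kappa> \<beta> k b f x" for x
      unfolding comm_major_def by simp
    have Uavg: "(\<integral>\<^sup>+y. U y \<partial>ball_measure c r) \<le> ennreal B * comm_major \<kappa> \<beta> k b f x" if x: "x \<in> ball c r" for x
    proof -
      have "(\<integral>\<^sup>+y. X y \<partial>ball_measure c r) \<le> ennreal ((C * L) powr p0 * Q) * (ennreal ((\<beta> ^ k) powr p0) * hl_max_pow \<kappa> (\<lambda>y. epowr (ennreal (norm (f y))) p0) x)"
        unfolding X_def
        by (rule off_diagonal_average[OF f b N h_def r \<beta> L Q sumL prod[OF order_refl osc \<beta> _ r x]]) measurable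
      also have "\<dots> \<le> ennreal ((C * L) powr p0 * Q) * comm_major \<kappa> \<beta> k b f x" by (intro mult_left_mono G1) auto
      finally have 1: "(\<integral>\<^sup>+y. X y \<partial>ball_measure c r) \<le> ennreal ((C * L) powr p0 * Q) * comm_major \<kappa> \<beta> k b f x" .
      have "(\<Sum>m<k. \<integral>\<^sup>+y. Z m y \<partial>ball_measure c r) \<le> (\<Sum>m<k. ennreal Q * (ennreal ((\<beta> ^ (k - m)) powr p0) * hl_max_pow \<kappa> (comm_pow m b f) x))"
      proof (intro sum_mono)
        fix m
        show "(\<integral>\<^sup>+y. Z m y \<partial>ball_measure c r) \<le> ennreal Q * (ennreal ((\<beta> ^ (k - m)) powr p0) * hl_max_pow \<kappa> (comm_pow m b f) x)"
          using Zavg[OF x, where m = m and j = 0] Q by (simp add: ennreal_mult mult.assoc)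
      qed
      also have "\<dots> = ennreal Q * (\<Sum>m<k. ennreal ((\<beta> ^ (k - m)) powr p0) * hl_max_pow \<kappa> (comm_pow m b f) x)"
        by (simp add: sum_distrib_left)
      also have "\<dots> \<le> ennreal Q * comm_major \<kappa> \<beta> k b f x" by (intro mult_left_mono G2) auto
      finally have 2: "(\<Sum>m<k. \<integral>\<^sup>+y. Z m y \<partial>ball_measure c r) \<le> ennreal Q * comm_major \<kappa> \<beta> k b f x" .
      have "(\<integral>\<^sup>+y. U y \<partial>ball_measure c r) = ennreal s * ((\<integral>\<^sup>+y. X y \<partial>ball_measure c r) + (\<Sum>m<k. \<integral>\<^sup>+y. Z m y \<partial>ball_measure c r))"
        unfolding U_def by (simp add: nn_integral_cmult nn_integral_add nn_integral_sum)
      also have "\<dots> \<le> ennreal s * (ennreal ((C * L) powr p0 * Q) * comm_major \<kappa> \<beta> k b f x + ennreal Q * comm_major \<kappa> \<beta> k b f x)"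
        by (intro mult_left_mono add_mono 1 2) auto
      also have "\<dots> = ennreal (s * ((C * L) powr p0 * Q + Q)) * comm_major \<kappa> \<beta> k b f x"
      proof -
        have "ennreal (u * (v + z)) = ennreal u * (ennreal v + ennreal z)" if "0 \<le> u" "0 \<le> v" "0 \<le> z" for u v z
          using that by (simp add: ennreal_mult)
        then show ?thesis using es Q by (simp only: distrib_right mult.assoc mult_nonneg_nonneg powr_ge_zero)
      qed
      also have "\<dots> \<le> ennreal B * comm_major \<kappa> \<beta> k b f x" by (intro mult_right_mono ennreal_leI B1) auto
      finally show ?thesis .
    qed
    have Vavg: "(\<integral>\<^sup>+y. epowr (V y) (q0 / p0) \<partial>ball_measure c r) \<le> epowr (ennreal B * (hl_max (comm_pow k b f) x + comm_major \<kappa> \<beta> k b f y)) (q0 / p0)"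
      if x: "x \<in> ball c r" and y: "y \<in> ball c r" for x y
    proof -
      define M where "M = hl_max (comm_pow k b f) x + comm_major \<kappa> \<beta> k b f y"
      have Th: "(\<integral>\<^sup>+y. epowr (ennreal (norm (T h y))) p0 \<partial>ball_measure c (2 ^ (j + 2) * r)) \<le> ennreal (e * (Q + 1) * (real (j + 3) ^ k) powr p0) * M" for j
      proof -
        let ?r = "2 ^ (j + 2) * r" and ?t = "(real (j + 3) ^ k) powr p0"
        have rj: "0 < ?r" using r by simp
        have "(1::real) \<le> 2 ^ (j + 2)" by (rule one_le_power) simp
        then have "1 * r \<le> ?r" using r by (intro mult_right_mono) auto
        then have "ball c r \<subseteq> ball c ?r" by (intro subset_ball) simp
        then have xj: "x \<in> ball c ?r" using x by blast
        have t1: "1 \<le> ?t" using p0_pos by (intro ge_one_powr_ge_zero) auto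
        have "(\<integral>\<^sup>+y. epowr (ennreal (norm (T h y))) p0 \<partial>ball_measure c ?r) \<le> (\<integral>\<^sup>+y. ennreal e * (\<Sum>m\<le>k. Z m y) \<partial>ball_measure c ?r)"
        proof (rule nn_integral_ball_measure_mono_AE)
          show "AE y in lebesgue. y \<in> ball c ?r \<longrightarrow> epowr (ennreal (norm (T h y))) p0 \<le> ennreal e * (\<Sum>m\<le>k. Z m y)"
            using AE_seminorm
          proof eventually_elim
            case (elim z)
            show ?case unfolding Z_def e_def
              using comm_pow_split(2)[OF elim f b N h_def AL] by blast
          qed
        qed measurable
        also have "\<dots> = ennreal e * (\<Sum>m\<le>k. \<integral>\<^sup>+y. Z m y \<partial>ball_measure c ?r)"
          by (simp add: nn_integral_cmult nn_integral_sum)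
        also have "(\<Sum>m\<le>k. \<integral>\<^sup>+y. Z m y \<partial>ball_measure c ?r) = (\<integral>\<^sup>+y. Z k y \<partial>ball_measure c ?r) + (\<Sum>m<k. \<integral>\<^sup>+y. Z m y \<partial>ball_measure c ?r)"
          by (simp add: lessThan_Suc_atMost[symmetric])
        also have "\<dots> \<le> ennreal ?t * hl_max (comm_pow k b f) x + ennreal (Q * ?t) * comm_major \<kappa> \<beta> k b f y"
        proof (rule add_mono)
          \<comment> \<open>For m = k the oscillation factor has exponent 0, so this is a plain
            average of F, bounded by its maximal function at x.\<close>
          have "(\<integral>\<^sup>+y. Z k y \<partial>ball_measure c ?r) \<le> 1 * hl_max (comm_pow k b f) x"
            using hl_max_ge[OF rj xj, of "comm_pow k b f"] by (simp add: Z_def)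
          also have "\<dots> \<le> ennreal ?t * hl_max (comm_pow k b f) x"
            using t1 by (intro mult_right_mono) (auto simp: ennreal_ge_1)
          finally show "(\<integral>\<^sup>+y. Z k y \<partial>ball_measure c ?r) \<le> ennreal ?t * hl_max (comm_pow k b f) x" .
          have "(\<Sum>m<k. \<integral>\<^sup>+y. Z m y \<partial>ball_measure c ?r) \<le> (\<Sum>m<k. ennreal (Q * ?t) * (ennreal ((\<beta> ^ (k - m)) powr p0) * hl_max_pow \<kappa> (comm_pow m b f) y))"
          proof (intro sum_mono)
            fix m
            have "(\<integral>\<^sup>+y. Z m y \<partial>ball_measure c ?r) \<le> ennreal (Q * ((real (Suc (j + 2)) * \<beta>) ^ (k - m)) powr p0) * hl_max_pow \<kappa> (comm_pow m b f) y"
              by (rule Zavg[OF y])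
            also have "\<dots> \<le> ennreal (Q * (?t * (\<beta> ^ (k - m)) powr p0)) * hl_max_pow \<kappa> (comm_pow m b f) y"
            proof (intro mult_right_mono ennreal_leI mult_left_mono Q)
              have "real (j + 3) ^ (k - m) \<le> real (j + 3) ^ k" by (intro power_increasing) auto
              then have "(real (j + 3) ^ (k - m)) powr p0 \<le> ?t" using p0_pos by (intro powr_mono2) auto
              then have "(real (j + 3) ^ (k - m)) powr p0 * (\<beta> ^ (k - m)) powr p0 \<le> ?t * (\<beta> ^ (k - m)) powr p0"
                by (intro mult_right_mono) auto
              moreover have "real (Suc (j + 2)) = real (j + 3)" by simp
              ultimately show "((real (Suc (j + 2)) * \<beta>) ^ (k - m)) powr p0 \<le> ?t * (\<beta> ^ (k - m)) powr p0"
                using \<beta> by (simp only: power_mult_distrib powr_mult)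
            qed auto
            also have "\<dots> = ennreal (Q * ?t) * (ennreal ((\<beta> ^ (k - m)) powr p0) * hl_max_pow \<kappa> (comm_pow m b f) y)"
              using Q by (simp add: ennreal_mult mult.assoc)
            finally show "(\<integral>\<^sup>+y. Z m y \<partial>ball_measure c ?r) \<le> \<dots>" .
          qed
          also have "\<dots> = ennreal (Q * ?t) * (\<Sum>m<k. ennreal ((\<beta> ^ (k - m)) powr p0) * hl_max_pow \<kappa> (comm_pow m b f) y)"
            by (simp add: sum_distrib_left)
          also have "\<dots> \<le> ennreal (Q * ?t) * comm_major \<kappa> \<beta> k b f y" by (intro mult_left_mono G2) auto
          finally show "(\<Sum>m<k. \<integral>\<^sup>+y. Z m y \<partial>ball_measure c ?r) \<le> \<dots>" .
        qed
        also have "\<dots> \<le> ennreal ((Q + 1) * ?t) * hl_max (comm_pow k b f) x + ennreal ((Q + 1) * ?t) * comm_major \<kappa> \<beta> k b f y"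
          using Q by (intro add_mono mult_right_mono ennreal_leI) (auto simp: distrib_right)
        also have "\<dots> = ennreal ((Q + 1) * ?t) * M" by (simp add: M_def distrib_left)
        finally have "(\<integral>\<^sup>+y. epowr (ennreal (norm (T h y))) p0 \<partial>ball_measure c ?r) \<le> ennreal e * (ennreal ((Q + 1) * ?t) * M)"
          by (simp add: mult_left_mono)
        also have "\<dots> = ennreal (e * (Q + 1) * ?t) * M" using es Q by (simp add: ennreal_mult mult.assoc)
        finally show ?thesis .
      qed
      have eQ: "0 \<le> e * (Q + 1)" using es Q by simp
      have q: "0 < q0 / p0" using p0_pos q0_pos by simp
      have "(\<integral>\<^sup>+y. epowr (V y) (q0 / p0) \<partial>ball_measure c r) = epowr (ennreal s) (q0 / p0) * (\<integral>\<^sup>+y. epowr (epowr (ennreal (norm (T (A r h) y))) p0) (q0 / p0) \<partial>ball_measure c r)"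
        unfolding V_def using q by (simp add: epowr_mult nn_integral_cmult)
      also have "\<dots> \<le> epowr (ennreal s) (q0 / p0) * epowr (ennreal (L powr p0 * (e * (Q + 1))) * M) (q0 / p0)"
        by (intro mult_left_mono on_diagonal_average[OF hc r L eQ sumL Th]) auto
      also have "\<dots> = epowr (ennreal (s * (L powr p0 * (e * (Q + 1)))) * M) (q0 / p0)"
      proof -
        have "ennreal (s * (L powr p0 * (e * (Q + 1)))) = ennreal s * ennreal (L powr p0 * (e * (Q + 1)))"
          using es eQ by (intro ennreal_mult) auto
        then show ?thesis using q by (simp only: epowr_mult less_imp_le mult.assoc)
      qed
      also have "\<dots> \<le> epowr (ennreal B * M) (q0 / p0)"
        using q by (intro epowr_mono mult_right_mono ennreal_leI B2) auto
      finally show ?thesis unfolding M_def .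
    qed
    show ?thesis
      by (intro bexI[of _ U] bexI[of _ V] conjI AEF ballI Uavg Vavg) auto
  qed
  then show ?thesis using B0 by (intro exI[of _ B]) blast
qed

end

section \<open>The weighted estimate for bounded b\<close>

text \<open>What the good-lambda argument and the bound for the majorant ask of a weight:
  boundedness without a rate, small sets, doubling, and the maximal operator with power \<kappa> on
  L^t(w). The constants are parameters so that a family of truncated weights can share them.\<close>

definition good_weight :: "real \<Rightarrow> real \<Rightarrow> real \<Rightarrow> real \<Rightarrow> real \<Rightarrow> real \<Rightarrow> ('a::euclidean_space \<Rightarrow> ennreal) \<Rightarrow> bool" where
  "good_weight t \<theta> C D \<kappa> E w \<longleftrightarrow> w \<in> borel_measurable lebesgue \<and> (\<exists>N. \<forall>x. w x \<le> ennreal N) \<and>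
    (\<forall>c r A. 0 < r \<longrightarrow> A \<in> sets lebesgue \<longrightarrow> (\<integral>\<^sup>+y. w y * indicator A y \<partial>ball_measure c r)
      \<le> ennreal C * epowr (emeasure (ball_measure c r) A) \<theta> * (\<integral>\<^sup>+y. w y \<partial>ball_measure c r)) \<and>
    (\<forall>c r. 0 < r \<longrightarrow> (\<integral>\<^sup>+y. w y * indicator (ball c (10 * r)) y \<partial>lebesgue)
      \<le> ennreal D * (\<integral>\<^sup>+y. w y * indicator (ball c r) y \<partial>lebesgue)) \<and>
    (\<forall>g\<in>borel_measurable lebesgue. (\<integral>\<^sup>+x. w x * epowr (hl_max (\<lambda>y. epowr (g y) \<kappa>) x) (t / \<kappa>) \<partial>lebesgue)
      \<le> ennreal E * (\<integral>\<^sup>+x. w x * epowr (g x) t \<partial>lebesgue))"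

lemma good_weightD:
  assumes "good_weight t \<theta> C D \<kappa> E w"
  shows "w \<in> borel_measurable lebesgue" and "\<exists>N. \<forall>x. w x \<le> ennreal N"
    and "0 < r \<Longrightarrow> A \<in> sets lebesgue \<Longrightarrow> (\<integral>\<^sup>+y. w y * indicator A y \<partial>ball_measure c r)
      \<le> ennreal C * epowr (emeasure (ball_measure c r) A) \<theta> * (\<integral>\<^sup>+y. w y \<partial>ball_measure c r)"
    and "0 < r \<Longrightarrow> (\<integral>\<^sup>+y. w y * indicator (ball c (10 * r)) y \<partial>lebesgue) \<le> ennreal D * (\<integral>\<^sup>+y. w y * indicator (ball c r) y \<partial>lebesgue)"
    and "g \<in> borel_measurable lebesgue \<Longrightarrow> (\<integral>\<^sup>+x. w x * epowr (hl_max (\<lambda>y. epowr (g y) \<kappa>) x) (t / \<kappa>) \<partial>lebesgue)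
      \<le> ennreal E * (\<integral>\<^sup>+x. w x * epowr (g x) t \<partial>lebesgue)"
  using assms unfolding good_weight_def by blast+

lemma summable_shift_power:
  fixes \<alpha> :: "nat \<Rightarrow> real"
  assumes "summable (\<lambda>j. \<alpha> j * real (j + 3) ^ k)" "\<And>j. 0 \<le> \<alpha> j" "m \<le> k"
  shows "\<exists>L\<ge>0. (\<Sum>j. ennreal (\<alpha> j * real (j + 3) ^ m)) \<le> ennreal L"
proof -
  have "real (j + 3) ^ m \<le> real (j + 3) ^ k" for j using assms(3) by (intro power_increasing) auto
  then have le: "\<alpha> j * real (j + 3) ^ m \<le> \<alpha> j * real (j + 3) ^ k" for j using assms(2) by (intro mult_left_mono)
  have "summable (\<lambda>j. \<alpha> j * real (j + 3) ^ m)"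
    by (rule summable_comparison_test'[OF assms(1), of 0]) (use le assms(2) in \<open>auto simp: abs_mult\<close>)
  then have "(\<Sum>j. ennreal (\<alpha> j * real (j + 3) ^ m)) = ennreal (\<Sum>j. \<alpha> j * real (j + 3) ^ m)" and "0 \<le> (\<Sum>j. \<alpha> j * real (j + 3) ^ m)"
    using assms(2) by (auto intro!: suminf_ennreal2 suminf_nonneg)
  then show ?thesis by (intro exI[of _ "\<Sum>j. \<alpha> j * real (j + 3) ^ m"]) simp
qed

context off_diagonal_operator
begin

text \<open>The factor \<beta>^(k-m) of the majorant and \<beta>^m of the induction hypothesis
  combine to \<beta>^k; each maximal operator costs E.\<close>

lemma comm_major_integral:
  assumes w: "good_weight t \<theta> C1 D \<kappa> E w" and t: "1 < t" and \<kappa>: "1 < \<kappa>" and \<beta>: "0 < \<beta>" and E: "0 \<le> E"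
    and [measurable]: "f \<in> borel_measurable lebesgue" and F: "\<And>m. comm_pow m b f \<in> borel_measurable lebesgue"
    and B: "\<And>m. 0 \<le> B m" and IH: "\<And>m. m < k \<Longrightarrow> (\<integral>\<^sup>+x. w x * epowr (comm_pow m b f x) t \<partial>lebesgue) \<le> ennreal (B m * (\<beta> ^ m) powr (p0 * t)) * I"
    and I: "I = (\<integral>\<^sup>+x. w x * epowr (epowr (ennreal (norm (f x))) p0) t \<partial>lebesgue)"
  shows "(\<integral>\<^sup>+x. w x * epowr (comm_major \<kappa> \<beta> k b f x) t \<partial>lebesgue)
    \<le> ennreal (2 powr t * (E + real k powr t * (\<Sum>m<k. E * B m)) * (\<beta> ^ k) powr (p0 * t)) * I"
proof -
  note F[measurable]
  have [measurable]: "w \<in> borel_measurable lebesgue" by (rule good_weightD[OF w])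
  define J where "J H = (\<integral>\<^sup>+x. w x * epowr (hl_max_pow \<kappa> H x) t \<partial>lebesgue)" for H
  have J: "J H \<le> ennreal E * (\<integral>\<^sup>+x. w x * epowr (H x) t \<partial>lebesgue)" if "H \<in> borel_measurable lebesgue" for H
  proof -
    have "epowr (hl_max_pow \<kappa> H x) t = epowr (hl_max (\<lambda>y. epowr (H y) \<kappa>) x) (t / \<kappa>)" for x
      unfolding hl_max_pow_def using \<kappa> t by (subst epowr_epowr) auto
    then show ?thesis unfolding J_def using good_weightD(5)[OF w that] by simp
  qed
  define s where "s = p0 * t"
  have bp: "epowr (ennreal ((\<beta> ^ i) powr p0)) t = ennreal ((\<beta> ^ i) powr s)" for i
    using \<beta> t by (subst epowr_ennreal) (auto simp: powr_powr s_def)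
  let ?H = "\<lambda>y. epowr (ennreal (norm (f y))) p0"
  have "(\<integral>\<^sup>+x. w x * epowr (comm_major \<kappa> \<beta> k b f x) t \<partial>lebesgue)
    \<le> (\<integral>\<^sup>+x. ennreal (2 powr t) * (ennreal ((\<beta> ^ k) powr s) * (w x * epowr (hl_max_pow \<kappa> ?H x) t)
       + ennreal (real k powr t) * (\<Sum>m<k. ennreal ((\<beta> ^ (k - m)) powr s) * (w x * epowr (hl_max_pow \<kappa> (comm_pow m b f) x) t))) \<partial>lebesgue)"
  proof (intro nn_integral_mono)
    fix x
    have "epowr (comm_major \<kappa> \<beta> k b f x) t \<le> ennreal (2 powr t) * (epowr (ennreal ((\<beta> ^ k) powr p0) * hl_max_pow \<kappa> ?H x) t
      + epowr (\<Sum>m<k. ennreal ((\<beta> ^ (k - m)) powr p0) * hl_max_pow \<kappa> (comm_pow m b f) x) t)"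
      unfolding comm_major_def using t by (intro epowr_add_le) auto
    also have "\<dots> \<le> ennreal (2 powr t) * (epowr (ennreal ((\<beta> ^ k) powr p0) * hl_max_pow \<kappa> ?H x) t
      + ennreal (real k powr t) * (\<Sum>m<k. epowr (ennreal ((\<beta> ^ (k - m)) powr p0) * hl_max_pow \<kappa> (comm_pow m b f) x) t))"
      using t by (intro mult_left_mono add_left_mono epowr_sum_le') auto
    also have "\<dots> = ennreal (2 powr t) * (ennreal ((\<beta> ^ k) powr s) * epowr (hl_max_pow \<kappa> ?H x) t
      + ennreal (real k powr t) * (\<Sum>m<k. ennreal ((\<beta> ^ (k - m)) powr s) * epowr (hl_max_pow \<kappa> (comm_pow m b f) x) t))"
      using t by (simp only: epowr_mult bp less_imp_le less_trans[OF zero_less_one])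
    finally have "w x * epowr (comm_major \<kappa> \<beta> k b f x) t \<le> w x * \<dots>" by (rule mult_left_mono) simp
    also have "\<dots> = ennreal (2 powr t) * (ennreal ((\<beta> ^ k) powr s) * (w x * epowr (hl_max_pow \<kappa> ?H x) t)
       + ennreal (real k powr t) * (\<Sum>m<k. ennreal ((\<beta> ^ (k - m)) powr s) * (w x * epowr (hl_max_pow \<kappa> (comm_pow m b f) x) t)))"
      by (simp only: distrib_left sum_distrib_left ac_simps)
    finally show "w x * epowr (comm_major \<kappa> \<beta> k b f x) t \<le> \<dots>" .
  qed
  also have "\<dots> = ennreal (2 powr t) * (ennreal ((\<beta> ^ k) powr s) * J ?H
       + ennreal (real k powr t) * (\<Sum>m<k. ennreal ((\<beta> ^ (k - m)) powr s) * J (comm_pow m b f)))"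
    unfolding J_def by (simp add: nn_integral_cmult nn_integral_add nn_integral_sum)
  also have "\<dots> \<le> ennreal (2 powr t) * (ennreal ((\<beta> ^ k) powr s) * (ennreal E * I)
       + ennreal (real k powr t) * (\<Sum>m<k. ennreal ((\<beta> ^ k) powr s) * (ennreal (E * B m) * I)))"
  proof (intro mult_left_mono add_mono sum_mono)
    show "J ?H \<le> ennreal E * I" unfolding I by (rule J) measurable
    fix m assume "m \<in> {..<k}"
    then have m: "m < k" by simp
    have "J (comm_pow m b f) \<le> ennreal E * (ennreal (B m * (\<beta> ^ m) powr s) * I)"
      unfolding s_def by (rule order_trans[OF J[OF F]]) (intro mult_left_mono IH m, auto)
    then have "ennreal ((\<beta> ^ (k - m)) powr s) * J (comm_pow m b f) \<le> ennreal ((\<beta> ^ (k - m)) powr s) * (ennreal E * (ennreal (B m * (\<beta> ^ m) powr s) * I))"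
      by (rule mult_left_mono) simp
    also have "\<dots> = ennreal ((\<beta> ^ (k - m)) powr s * (\<beta> ^ m) powr s) * (ennreal (E * B m) * I)"
      using E B[of m] by (simp add: ennreal_mult ac_simps)
    also have "(\<beta> ^ (k - m)) powr s * (\<beta> ^ m) powr s = (\<beta> ^ k) powr s"
    proof -
      have "\<beta> ^ (k - m) * \<beta> ^ m = \<beta> ^ k" using m by (simp add: power_add[symmetric])
      then show ?thesis using \<beta> by (simp add: powr_mult[symmetric])
    qed
    finally show "ennreal ((\<beta> ^ (k - m)) powr s) * J (comm_pow m b f) \<le> ennreal ((\<beta> ^ k) powr s) * (ennreal (E * B m) * I)" .
  qed auto
  also have "\<dots> = ennreal (2 powr t * (E + real k powr t * (\<Sum>m<k. E * B m)) * (\<beta> ^ k) powr s) * I"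
  proof -
    have S: "(\<Sum>m<k. ennreal ((\<beta> ^ k) powr s) * (ennreal (E * B m) * I)) = ennreal ((\<beta> ^ k) powr s) * (ennreal (\<Sum>m<k. E * B m) * I)"
    proof -
      have "(\<Sum>m<k. ennreal (E * B m)) = ennreal (\<Sum>m<k. E * B m)" using E B by (intro sum_ennreal) auto
      then show ?thesis by (simp only: sum_distrib_left[symmetric] sum_distrib_right[symmetric])
    qed
    have gen: "ennreal P * (ennreal R * (ennreal E * I) + ennreal T' * (ennreal R * (ennreal S' * I))) = ennreal (P * (E + T' * S') * R) * I"
      if "0 \<le> P" "0 \<le> R" "0 \<le> T'" "0 \<le> S'" for P R T' S'
      using that E by (simp add: ennreal_mult distrib_left distrib_right ac_simps)
    show ?thesis unfolding S by (rule gen) (use E B in \<open>auto intro!: sum_nonneg\<close>)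
  qed
  finally show ?thesis by (simp only: s_def)
qed

text \<open>F lies almost everywhere below its maximal function, the good-lambda inequality replaces
  that by the majorant, and the majorant contains only f and lower orders. The bound N on b gives
  measurability and integrability of F, but stays out of B.\<close>

lemma comm_pow_weighted_bounded:
  assumes t: "1 < t" and \<theta>: "0 < \<theta>" "t < q0 / p0 * \<theta>" and \<kappa>: "1 < \<kappa>" and nonneg: "0 \<le> C1" "0 \<le> D" "0 \<le> E"
    and sm: "summable (\<lambda>j. \<alpha> j * real (j + 3) ^ k)"
  shows "m \<le> k \<Longrightarrow> \<exists>B\<ge>0. \<forall>w f b a \<beta> N. good_weight t \<theta> C1 D \<kappa> E w \<longrightarrow> f \<in> Linf_c \<longrightarrow> osc_bound b a \<beta> \<longrightarrow> 0 < \<beta> \<longrightarrow> (\<forall>x. norm (b x) \<le> N) \<longrightarrow>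
    (\<integral>\<^sup>+x. w x * epowr (comm_pow m b f x) t \<partial>lebesgue)
      \<le> ennreal (B * (\<beta> ^ m) powr (p0 * t)) * (\<integral>\<^sup>+x. w x * epowr (epowr (ennreal (norm (f x))) p0) t \<partial>lebesgue)"
proof (induction m rule: less_induct)
  case (less m)
  define P where "P i B \<longleftrightarrow> (\<forall>w f b a \<beta> N. good_weight t \<theta> C1 D \<kappa> E w \<longrightarrow> f \<in> Linf_c \<longrightarrow> osc_bound b a \<beta> \<longrightarrow> 0 < \<beta> \<longrightarrow> (\<forall>x. norm (b x) \<le> N) \<longrightarrow>
    (\<integral>\<^sup>+x. w x * epowr (comm_pow i b f x) t \<partial>lebesgue)
      \<le> ennreal (B * (\<beta> ^ i) powr (p0 * t)) * (\<integral>\<^sup>+x. w x * epowr (epowr (ennreal (norm (f x))) p0) t \<partial>lebesgue))" for i B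
  \<comment> \<open>Guarding the property by i < m allows constants to be chosen for all i at
    once.\<close>
  have "\<exists>B. 0 \<le> B \<and> (i < m \<longrightarrow> P i B)" for i
  proof (cases "i < m")
    case True
    with less.IH[OF True] less.prems show ?thesis unfolding P_def by fastforce
  qed auto
  then obtain B where B: "\<And>i. 0 \<le> B i" and BP: "\<And>i. i < m \<Longrightarrow> P i (B i)" by metis
  obtain L where L: "0 \<le> L" "(\<Sum>j. ennreal (\<alpha> j * real (j + 3) ^ m)) \<le> ennreal L"
    using summable_shift_power[OF sm \<alpha> less.prems] by blast
  obtain A' where A': "0 \<le> A'" and dec: "\<And>f b a \<beta> N c r. f \<in> Linf_c \<Longrightarrow> osc_bound b a \<beta> \<Longrightarrow> 0 < \<beta> \<Longrightarrow> (\<forall>x. norm (b x) \<le> N) \<Longrightarrow> 0 < r \<Longrightarrow>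
    (\<exists>U\<in>borel_measurable lebesgue. \<exists>V\<in>borel_measurable lebesgue.
      (AE x in lebesgue. x \<in> ball c r \<longrightarrow> comm_pow m b f x \<le> U x + V x) \<and>
      (\<forall>x\<in>ball c r. (\<integral>\<^sup>+y. U y \<partial>ball_measure c r) \<le> ennreal A' * comm_major \<kappa> \<beta> m b f x) \<and>
      (\<forall>x\<in>ball c r. \<forall>y\<in>ball c r. (\<integral>\<^sup>+y. epowr (V y) (q0 / p0) \<partial>ball_measure c r)
        \<le> epowr (ennreal A' * (hl_max (comm_pow m b f) x + comm_major \<kappa> \<beta> m b f y)) (q0 / p0)))"
    using commutator_decomposition[OF \<kappa> L] by blast
  have q: "1 \<le> q0 / p0" using q0 p0_pos by simp
  have M: "1 \<le> (7::real) ^ DIM('a)" by simp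
  have t0: "0 < t" using t by simp
  obtain K \<gamma> where K: "7 ^ DIM('a) \<le> K" and \<gamma>: "0 < \<gamma>" "\<gamma> \<le> 1" and
    absorb: "K powr t * (C1 * D * (5 ^ DIM('a) * (2 * A' * \<gamma> / K + (4 * A' / K) powr (q0 / p0))) powr \<theta>) \<le> 1 / 2"
    using good_lambda_constants[OF q t0 \<theta>(2) \<theta>(1) A' _ _ M, of "C1 * D" "5 ^ DIM('a)"] nonneg by auto
  define R where "R = 2 powr t * (E + real m powr t * (\<Sum>i<m. E * B i))"
  have R: "0 \<le> R" using nonneg B by (auto simp: R_def intro!: mult_nonneg_nonneg add_nonneg_nonneg sum_nonneg)
  have "P m (2 * (K / \<gamma>) powr t * R)"
    unfolding P_def
  proof (intro allI impI)
    fix w :: "'a \<Rightarrow> ennreal" and f b :: "'a \<Rightarrow> 'k" and a \<beta> N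
    assume w: "good_weight t \<theta> C1 D \<kappa> E w" and f: "f \<in> Linf_c" and osc: "osc_bound b a \<beta>" and \<beta>: "0 < \<beta>" and N: "\<forall>x. norm (b x) \<le> N"
    have b: "b \<in> borel_measurable lebesgue" by (rule osc_boundD[OF osc])
    have [measurable]: "f \<in> borel_measurable lebesgue" by (rule Linf_cD[OF f])
    have [measurable]: "w \<in> borel_measurable lebesgue" by (rule good_weightD[OF w])
    have F[measurable]: "comm_pow i b f \<in> borel_measurable lebesgue" for i using comm_pow_measurable[OF f b] N by blast
    have fin: "(\<integral>\<^sup>+x. comm_pow m b f x \<partial>lebesgue) < \<infinity>" using comm_pow_integrable[OF f b] N by blast
    obtain Nw where Nw: "\<And>x. w x \<le> ennreal Nw" using good_weightD(2)[OF w] by blast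
    let ?I = "\<integral>\<^sup>+x. w x * epowr (epowr (ennreal (norm (f x))) p0) t \<partial>lebesgue"
    have "(\<integral>\<^sup>+x. w x * epowr (comm_pow m b f x) t \<partial>lebesgue) \<le> (\<integral>\<^sup>+x. w x * epowr (hl_max (comm_pow m b f) x) t \<partial>lebesgue)"
      using AE_le_hl_max[OF F[of m]] t
      by (intro nn_integral_mono_AE) (auto elim!: eventually_mono intro!: mult_left_mono epowr_mono)
    also have "\<dots> \<le> ennreal (2 * (K / \<gamma>) powr t) * (\<integral>\<^sup>+x. w x * epowr (comm_major \<kappa> \<beta> m b f x) t \<partial>lebesgue)"
      by (rule good_lambda[OF F comm_major_measurable _ q t \<gamma> A' K fin Nw dec[OF f osc \<beta> N] \<theta>(1) nonneg(1,2) good_weightD(3)[OF w] good_weightD(4)[OF w] absorb]) measurable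
    also have "(\<integral>\<^sup>+x. w x * epowr (comm_major \<kappa> \<beta> m b f x) t \<partial>lebesgue) \<le> ennreal (R * (\<beta> ^ m) powr (p0 * t)) * ?I"
      unfolding R_def
    proof (rule comm_major_integral[OF w t \<kappa> \<beta> nonneg(3) _ F B _ refl])
      fix i assume "i < m"
      then show "(\<integral>\<^sup>+x. w x * epowr (comm_pow i b f x) t \<partial>lebesgue) \<le> ennreal (B i * (\<beta> ^ i) powr (p0 * t)) * ?I"
        using BP w f osc \<beta> N unfolding P_def by blast
    qed measurable
    also have "ennreal (2 * (K / \<gamma>) powr t) * (ennreal (R * (\<beta> ^ m) powr (p0 * t)) * ?I) = ennreal (2 * (K / \<gamma>) powr t * R * (\<beta> ^ m) powr (p0 * t)) * ?I"
      using R by (simp add: ennreal_mult mult.assoc)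
    finally show "(\<integral>\<^sup>+x. w x * epowr (comm_pow m b f x) t \<partial>lebesgue) \<le> \<dots>" by (simp add: mult_left_mono)
  qed
  then show ?case unfolding P_def using R by (intro exI[of _ "2 * (K / \<gamma>) powr t * R"]) auto
qed

end

text \<open>The self-improved reverse Hoelder inequality of W gives the small-set property with
  \<theta> > 1 - 1/u. Its root W^(1/u) is an A_t weight, which gives doubling and the maximal
  bound.\<close>

lemma ap_bound_good_weight:
  assumes t: "1 < t" and u: "1 \<le> u" and K: "1 \<le> K"
  shows "\<exists>\<theta> \<kappa> C D E. 1 - 1/u < \<theta> \<and> 0 < \<theta> \<and> 1 < \<kappa> \<and> 0 \<le> C \<and> 0 \<le> D \<and> 0 \<le> E \<and>
    (\<forall>W :: 'a::euclidean_space \<Rightarrow> real. ap_bound (u * (t - 1) + 1) K W \<longrightarrow> good_weight t \<theta> C D \<kappa> E (\<lambda>x. ennreal (W x powr (1/u))))"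
proof -
  define K' where "K' = K powr (1/u)"
  have K': "1 \<le> K'" using K u by (auto simp: K'_def intro!: ge_one_powr_ge_zero)
  obtain \<theta> C where \<theta>: "1 - 1/u < \<theta>" and C: "0 \<le> C" and small: "\<And>(W :: 'a \<Rightarrow> real) c r A. ap_bound (u * (t - 1) + 1) K W \<Longrightarrow> 0 < r \<Longrightarrow> A \<in> sets lebesgue \<Longrightarrow>
    (\<integral>\<^sup>+y. ennreal (W y powr (1/u)) * indicator A y \<partial>ball_measure c r)
      \<le> ennreal C * epowr (emeasure (ball_measure c r) A) \<theta> * (\<integral>\<^sup>+y. ennreal (W y powr (1/u)) \<partial>ball_measure c r)"
    using ap_bound_small_sets[OF t K u, where 'a = 'a] by blast
  obtain \<kappa> E where \<kappa>: "1 < \<kappa>" and E: "0 \<le> E" and mx: "\<And>(w :: 'a \<Rightarrow> real) g. ap_bound t K' w \<Longrightarrow> g \<in> borel_measurable lebesgue \<Longrightarrow>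
    (\<integral>\<^sup>+x. ennreal (w x) * epowr (hl_max (\<lambda>y. epowr (g y) \<kappa>) x) (t / \<kappa>) \<partial>lebesgue)
      \<le> ennreal E * (\<integral>\<^sup>+x. ennreal (w x) * epowr (g x) t \<partial>lebesgue)"
    using ap_bound_hl_max[OF t K', where 'a = 'a] by blast
  define D where "D = K' * (10 ^ DIM('a)) powr t"
  have "good_weight t \<theta> C D \<kappa> E (\<lambda>x. ennreal (W x powr (1/u)))" if W: "ap_bound (u * (t - 1) + 1) K W" for W :: "'a \<Rightarrow> real"
  proof -
    have w: "ap_bound t K' (\<lambda>x. W x powr (1/u))" unfolding K'_def using K by (intro ap_bound_root(1)[OF W t u]) simp
    obtain N where N: "\<And>x. W x powr (1/u) \<le> N" using ap_bound_obtain[OF w] by blast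
    show ?thesis unfolding good_weight_def
    proof (intro conjI allI impI ballI)
      show "(\<lambda>x. ennreal (W x powr (1/u))) \<in> borel_measurable lebesgue" using ap_boundD(1)[OF w] by measurable
      show "\<exists>N. \<forall>x. ennreal (W x powr (1/u)) \<le> ennreal N" using N by (intro exI[of _ N] allI ennreal_leI)
      show "(\<integral>\<^sup>+y. ennreal (W y powr (1/u)) * indicator (ball c (10 * r)) y \<partial>lebesgue) \<le> ennreal D * (\<integral>\<^sup>+y. ennreal (W y powr (1/u)) * indicator (ball c r) y \<partial>lebesgue)"
        if "0 < r" for c r
        unfolding D_def using K' by (intro ap_bound_doubling(2)[OF w t that]) auto
    qed (use small[OF W] mx[OF w] in auto)
  qed
  moreover have "0 < \<theta>"
  proof -
    have "1 / u \<le> 1" using u by simp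
    then show ?thesis using \<theta> by linarith
  qed
  moreover have "0 \<le> D" using K' by (simp add: D_def)
  ultimately show ?thesis using \<theta> \<kappa> C E by blast
qed

section \<open>Commutators with unbounded b\<close>

text \<open>The John--Nirenberg inequality on a ball containing the support of f makes every power
  of b integrable there.\<close>

lemma osc_bound_power_Lp:
  fixes b f :: "'a::euclidean_space \<Rightarrow> 'k::{real_normed_field, euclidean_space}"
  assumes b: "osc_bound b a \<beta>" and \<beta>: "0 < \<beta>" and f: "f \<in> Linf_c" and p: "0 < p"
  shows "(\<lambda>y. b y ^ j * f y) \<in> Lp_space p"
proof (cases "j = 0")
  case True
  then show ?thesis using Linf_c_subset_Lp_space[OF p f] by simp
next
  case False
  have [measurable]: "b \<in> borel_measurable lebesgue" by (rule osc_boundD[OF b])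
  have [measurable]: "f \<in> borel_measurable lebesgue" by (rule Linf_cD[OF f])
  obtain c R where c: "\<And>x. norm (f x) \<le> c * indicator (ball 0 R) x" "0 < c" "0 < R" using Linf_cD(2)[OF f] by blast
  define s where "s = real j * p"
  have s: "0 < s" using False p by (simp add: s_def)
  define v where "v = a (0::'a) R"
  interpret prob_space "ball_measure (0::'a) R" using c(3) by (rule prob_space_ball_measure)
  have "(\<integral>\<^sup>+y. epowr (ennreal (norm (b y - 0))) s \<partial>ball_measure 0 R)
    \<le> ennreal (2 powr s) * ((\<integral>\<^sup>+y. epowr (ennreal (norm (b y - v))) s \<partial>ball_measure 0 R) + epowr (ennreal (norm (v - 0))) s)"
    using s by (intro nn_integral_epowr_shift) auto
  also have "\<dots> \<le> ennreal (2 powr s) * (ennreal (john_nirenberg_const DIM('a) s * \<beta> powr s) + epowr (ennreal (norm (v - 0))) s)"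
    unfolding v_def by (intro mult_left_mono add_right_mono john_nirenberg[OF b s \<beta> c(3)]) auto
  also have "\<dots> < \<infinity>" using s by (simp add: ennreal_mult_less_top epowr_less_top)
  finally have fin: "(\<integral>\<^sup>+y. epowr (ennreal (norm (b y))) s \<partial>ball_measure 0 R) < \<infinity>" by simp
  have "(\<integral>\<^sup>+x. epowr (ennreal (norm (b x ^ j * f x))) p \<partial>lebesgue) \<le> (\<integral>\<^sup>+x. epowr (ennreal c) p * (epowr (ennreal (norm (b x))) s * indicator (ball 0 R) x) \<partial>lebesgue)"
  proof (intro nn_integral_mono)
    fix x
    have "norm (b x) ^ j = norm (b x) powr real j"
      using False by (cases "norm (b x) = 0") (auto simp: powr_realpow)
    then have 1: "epowr (ennreal (norm (b x) ^ j)) p = epowr (ennreal (norm (b x))) s"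
      using False p s by (simp add: epowr_ennreal powr_powr s_def)
    have "epowr (ennreal (norm (b x ^ j * f x))) p = epowr (ennreal (norm (b x) ^ j)) p * epowr (ennreal (norm (f x))) p"
      using p by (simp add: norm_mult norm_power ennreal_mult epowr_mult)
    also have "\<dots> \<le> epowr (ennreal (norm (b x))) s * epowr (ennreal (c * indicator (ball 0 R) x)) p"
      unfolding 1 using p by (intro mult_left_mono epowr_mono ennreal_leI c) auto
    also have "\<dots> = epowr (ennreal c) p * (epowr (ennreal (norm (b x))) s * indicator (ball 0 R) x)"
      using p by (auto split: split_indicator simp: mult.commute)
    finally show "epowr (ennreal (norm (b x ^ j * f x))) p \<le> \<dots>" .
  qed
  also have "\<dots> = epowr (ennreal c) p * ((\<integral>\<^sup>+y. epowr (ennreal (norm (b y))) s \<partial>ball_measure 0 R) * emeasure lebesgue (ball (0::'a) R))"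
    using c(3) by (simp add: nn_integral_cmult ball_measure_mult)
  also have "\<dots> < \<infinity>" using fin p emeasure_ball_finite[of "0::'a" R] by (simp add: ennreal_mult_less_top epowr_less_top)
  finally show ?thesis using p by (simp add: Lp_space_iff)
qed

lemma norm_power_diff_truncate_le:
  fixes z :: "'k::{real_normed_field, euclidean_space}"
  shows "norm (z ^ j - truncate N z ^ j) \<le> 2 * norm z ^ j"
proof -
  have "norm (z ^ j - truncate N z ^ j) \<le> norm z ^ j + norm (truncate N z) ^ j"
    using norm_triangle_ineq4[of "z ^ j" "truncate N z ^ j"] by (simp add: norm_power)
  also have "norm (truncate N z) ^ j \<le> norm z ^ j" by (intro power_mono truncate_norm_le_norm) simp
  finally show ?thesis by simp
qed

lemma truncation_tendsto_Lp:
  fixes b f :: "'a::euclidean_space \<Rightarrow> 'k::{real_normed_field, euclidean_space}"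
  assumes L: "(\<lambda>y. b y ^ j * f y) \<in> Lp_space p" and p: "0 < p" and [measurable]: "b \<in> borel_measurable lebesgue" "f \<in> borel_measurable lebesgue"
  shows "(\<lambda>N. \<integral>\<^sup>+x. epowr (ennreal (norm ((b x ^ j - truncate N (b x) ^ j) * f x))) p \<partial>lebesgue) \<longlonglongrightarrow> 0"
proof -
  have "(\<lambda>N. \<integral>\<^sup>+x. epowr (ennreal (norm ((b x ^ j - truncate N (b x) ^ j) * f x))) p \<partial>lebesgue) \<longlonglongrightarrow> (\<integral>\<^sup>+x. 0 \<partial>(lebesgue :: 'a measure))"
  proof (rule nn_integral_dominated_convergence[where w = "\<lambda>x. epowr (ennreal (norm (2 * (b x ^ j * f x)))) p"])
    show "(\<integral>\<^sup>+x. epowr (ennreal (norm (2 * (b x ^ j * f x)))) p \<partial>lebesgue) < \<infinity>"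
      using Lp_space_cmult[OF p L, of 2] p by (simp add: Lp_space_iff)
    show "AE x in lebesgue. epowr (ennreal (norm ((b x ^ j - truncate N (b x) ^ j) * f x))) p \<le> epowr (ennreal (norm (2 * (b x ^ j * f x)))) p" for N
    proof (intro always_eventually allI epowr_mono ennreal_leI)
      fix x
      have "norm (b x ^ j - truncate N (b x) ^ j) * norm (f x) \<le> 2 * norm (b x) ^ j * norm (f x)"
        by (intro mult_right_mono norm_power_diff_truncate_le) simp
      then show "norm ((b x ^ j - truncate N (b x) ^ j) * f x) \<le> norm (2 * (b x ^ j * f x))"
        by (simp add: norm_mult norm_power)
    qed (use p in simp)
    show "AE x in lebesgue. (\<lambda>N. epowr (ennreal (norm ((b x ^ j - truncate N (b x) ^ j) * f x))) p) \<longlonglongrightarrow> 0"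
    proof (rule always_eventually, rule allI, rule tendsto_eventually)
      fix x
      obtain M where "norm (b x) \<le> real M" using real_arch_simple by blast
      then have "truncate N (b x) = b x" if "M \<le> N" for N using that by (intro truncate_eq) simp
      then show "\<forall>\<^sub>F N in sequentially. epowr (ennreal (norm ((b x ^ j - truncate N (b x) ^ j) * f x))) p = 0"
        using p by (intro eventually_sequentiallyI[of M]) simp
    qed
  qed measurable
  then show ?thesis by simp
qed

context off_diagonal_operator
begin

lemma T_integral_bound: "\<exists>K<\<infinity>. \<forall>g\<in>Lp_space p0. (\<integral>\<^sup>+x. epowr (ennreal (norm (T g x))) p0 \<partial>lebesgue) \<le> K * (\<integral>\<^sup>+x. epowr (ennreal (norm (g x))) p0 \<partial>lebesgue)"
proof -
  obtain K where K: "\<And>g. g \<in> Lp_space p0 \<Longrightarrow> eLp_norm lebesgue (ennreal p0) (T g) \<le> ennreal K * eLp_norm lebesgue (ennreal p0) g"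
    using bounded unfolding bounded_on_Lp_def by blast
  have "(\<integral>\<^sup>+x. epowr (ennreal (norm (T g x))) p0 \<partial>lebesgue) \<le> epowr (ennreal K) p0 * (\<integral>\<^sup>+x. epowr (ennreal (norm (g x))) p0 \<partial>lebesgue)" if g: "g \<in> Lp_space p0" for g
  proof -
    have "epowr (eLp_norm lebesgue (ennreal p0) (T g)) p0 \<le> epowr (ennreal K * eLp_norm lebesgue (ennreal p0) g) p0"
      using p0_pos by (intro epowr_mono K g) auto
    then show ?thesis using p0_pos by (simp add: eLp_norm_powr epowr_mult)
  qed
  moreover have "epowr (ennreal K) p0 < \<infinity>" using p0_pos by (simp add: epowr_less_top)
  ultimately show ?thesis by blast
qed

text \<open>Geometric decay makes the sum of the p0-th powers of |T g_i| integrable. The sum is then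
  finite almost everywhere, which forces its terms to 0.\<close>

lemma AE_T_tendsto_zero:
  assumes g: "\<And>i. g i \<in> Lp_space p0" and le: "\<And>i. (\<integral>\<^sup>+x. epowr (ennreal (norm (g i x))) p0 \<partial>lebesgue) \<le> ennreal ((1/2) ^ i)"
  shows "AE x in lebesgue. (\<lambda>i. norm (T (g i) x)) \<longlonglongrightarrow> 0"
proof -
  have [measurable]: "T (g i) \<in> borel_measurable lebesgue" for i by (rule T_measurable[OF g])
  obtain K where K: "K < \<infinity>" "\<And>g. g \<in> Lp_space p0 \<Longrightarrow> (\<integral>\<^sup>+x. epowr (ennreal (norm (T g x))) p0 \<partial>lebesgue) \<le> K * (\<integral>\<^sup>+x. epowr (ennreal (norm (g x))) p0 \<partial>lebesgue)"
    using T_integral_bound by blast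
  have "(\<integral>\<^sup>+x. (\<Sum>i. ennreal (norm (T (g i) x) powr p0)) \<partial>lebesgue) = (\<Sum>i. \<integral>\<^sup>+x. epowr (ennreal (norm (T (g i) x))) p0 \<partial>lebesgue)"
    using p0_pos by (subst nn_integral_suminf) (auto simp: epowr_ennreal)
  also have "\<dots> \<le> (\<Sum>i. K * ennreal ((1/2) ^ i))"
  proof (intro suminf_le summableI)
    fix i
    show "(\<integral>\<^sup>+x. epowr (ennreal (norm (T (g i) x))) p0 \<partial>lebesgue) \<le> K * ennreal ((1/2) ^ i)"
      by (rule order_trans[OF K(2)[OF g]]) (intro mult_left_mono le, simp)
  qed
  also have "\<dots> = K * ennreal (\<Sum>i. (1/2) ^ i)"
    by (subst suminf_ennreal2[symmetric]) (auto simp: ennreal_suminf_cmult summable_geometric)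
  also have "\<dots> < \<infinity>" using K(1) by (simp add: ennreal_mult_less_top)
  finally have "AE x in lebesgue. (\<Sum>i. ennreal (norm (T (g i) x) powr p0)) \<noteq> \<infinity>"
    by (intro nn_integral_PInf_AE) auto
  then show ?thesis
  proof eventually_elim
    case (elim x)
    have "summable (\<lambda>i. norm (T (g i) x) powr p0)"
      using elim by (intro summable_suminf_not_top) auto
    then have "(\<lambda>i. norm (T (g i) x) powr p0) \<longlonglongrightarrow> 0" by (rule summable_LIMSEQ_zero)
    then have "(\<lambda>i. (norm (T (g i) x) powr p0) powr (1/p0)) \<longlonglongrightarrow> 0 powr (1/p0)"
      using p0_pos by (intro tendsto_powr2 tendsto_const) auto
    then show ?case using p0_pos by (simp add: powr_powr)
  qed
qed

text \<open>Boundedness of T on L^p0 gives convergence in norm, and pointwise convergence only along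
  a sparse sequence of truncation levels. A finite expansion in powers of b(y) reduces the
  x-dependent argument of T to finitely many fixed functions.\<close>

lemma commutator_truncate_tendsto:
  fixes b f :: "'a \<Rightarrow> 'k"
  assumes osc: "osc_bound b a \<beta>" and \<beta>: "0 < \<beta>" and f: "f \<in> Linf_c"
  shows "\<exists>N. AE x in lebesgue. (\<lambda>i. norm (commutator T k (\<lambda>y. truncate (N i) (b y)) f x)) \<longlonglongrightarrow> norm (commutator T k b f x)"
proof -
  have b[measurable]: "b \<in> borel_measurable lebesgue" by (rule osc_boundD[OF osc])
  have [measurable]: "f \<in> borel_measurable lebesgue" by (rule Linf_cD[OF f])
  have bL: "(\<lambda>y. b y ^ j * f y) \<in> Lp_space p0" for j by (rule osc_bound_power_Lp[OF osc \<beta> f p0_pos])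
  have tL: "(\<lambda>y. truncate N (b y) ^ j * f y) \<in> Lp_space p0" for j N
    by (rule osc_bound_power_Lp[OF osc_bound_truncate[OF osc] \<beta> f p0_pos])
  define g where "g = (\<lambda>N j y. (b y ^ j - truncate N (b y) ^ j) * f y)"
  have gL: "g N j \<in> Lp_space p0" for N j
    using Lp_space_diff[OF p0_pos bL tL] by (simp add: g_def left_diff_distrib)
  \<comment> \<open>One level serves all powers j up to k; N \<ge> i ensures that truncation leaves
    b(x) unchanged for large i.\<close>
  have "\<exists>N\<ge>i. \<forall>j\<le>k. (\<integral>\<^sup>+x. epowr (ennreal (norm (g N j x))) p0 \<partial>lebesgue) \<le> ennreal ((1/2) ^ i)" for i :: nat
  proof -
    have ev: "\<forall>\<^sub>F N in sequentially. (\<integral>\<^sup>+x. epowr (ennreal (norm (g N j x))) p0 \<partial>lebesgue) < ennreal ((1/2) ^ i)" for j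
    proof -
      have "0 < ennreal ((1/2) ^ i)" by (subst ennreal_less_zero_iff) simp
      then show ?thesis unfolding g_def by (intro order_tendstoD(2)[OF truncation_tendsto_Lp[OF bL p0_pos]]) auto
    qed
    have "\<forall>\<^sub>F N in sequentially. \<forall>j\<in>{..k}. (\<integral>\<^sup>+x. epowr (ennreal (norm (g N j x))) p0 \<partial>lebesgue) < ennreal ((1/2) ^ i)"
      using ev by (intro eventually_ball_finite) auto
    then obtain M where M: "\<And>N j. M \<le> N \<Longrightarrow> j \<le> k \<Longrightarrow> (\<integral>\<^sup>+x. epowr (ennreal (norm (g N j x))) p0 \<partial>lebesgue) < ennreal ((1/2) ^ i)"
      by (auto simp: eventually_sequentially)
    show ?thesis
    proof (intro exI[of _ "max i M"] conjI allI impI)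
      fix j assume "j \<le> k"
      then show "(\<integral>\<^sup>+x. epowr (ennreal (norm (g (max i M) j x))) p0 \<partial>lebesgue) \<le> ennreal ((1/2) ^ i)"
        by (intro less_imp_le[OF M]) auto
    qed simp
  qed
  then obtain N where N: "\<And>i. i \<le> N i" "\<And>i j. j \<le> k \<Longrightarrow> (\<integral>\<^sup>+x. epowr (ennreal (norm (g (N i) j x))) p0 \<partial>lebesgue) \<le> ennreal ((1/2) ^ i)"
    by metis
  have "AE x in lebesgue. \<forall>j\<in>{..k}. (\<lambda>i. norm (T (g (N i) j) x)) \<longlonglongrightarrow> 0"
    by (intro AE_finite_allI AE_T_tendsto_zero gL N) auto
  then have "AE x in lebesgue. (\<lambda>i. norm (commutator T k (\<lambda>y. truncate (N i) (b y)) f x)) \<longlonglongrightarrow> norm (commutator T k b f x)"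
    using AE_seminorm
  proof eventually_elim
    case (elim x)
    define c where "c j = of_nat (k choose j) * (b x) ^ (k - j) * (- 1) ^ j" for j
    have exp: "(b x - v) ^ k = (\<Sum>j\<le>k. c j * v ^ j)" for v
    proof -
      have "(b x - v) ^ k = (- v + b x) ^ k" by simp
      also have "\<dots> = (\<Sum>j\<le>k. of_nat (k choose j) * (- v) ^ j * b x ^ (k - j))" by (rule binomial_ring)
      also have "\<dots> = (\<Sum>j\<le>k. c j * v ^ j)"
        by (intro sum.cong) (auto simp: c_def power_minus[of v] ac_simps)
      finally show ?thesis .
    qed
    define F where "F y = (b x - b y) ^ k * f y" for y
    define Fi where "Fi i y = (b x - truncate (N i) (b y)) ^ k * f y" for i y
    have Fs: "F = (\<lambda>y. \<Sum>j\<le>k. c j * (b y ^ j * f y))" "Fi i = (\<lambda>y. \<Sum>j\<le>k. c j * (truncate (N i) (b y) ^ j * f y))" for i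
      by (auto simp: F_def Fi_def exp sum_distrib_right mult.assoc)
    have FL: "F \<in> Lp_space p0" "Fi i \<in> Lp_space p0" for i
      unfolding Fs by (intro Lp_space_sum p0_pos bL tL finite_atMost)+
    obtain M where M: "norm (b x) \<le> real M" using real_arch_simple by blast
    \<comment> \<open>Once b(x) itself is no longer truncated, both commutators expand with the same
      coefficients \<open>c j\<close>.\<close>
    have comm: "commutator T k (\<lambda>y. truncate (N i) (b y)) f x = T (Fi i) x" if "M \<le> i" for i
    proof -
      have "truncate (N i) (b x) = b x" using M that N(1)[of i] by (intro truncate_eq) (meson of_nat_mono order_trans)
      then show ?thesis by (simp add: commutator_def Fi_def[abs_def])
    qed
    have bd: "\<bar>norm (T (Fi i) x) - norm (T F x)\<bar> \<le> (\<Sum>j\<le>k. norm (c j) * norm (T (g (N i) j) x))" for i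
    proof -
      have "\<bar>norm (T F x) - norm (T (Fi i) x)\<bar> \<le> norm (T (\<lambda>y. F y - Fi i y) x)"
        by (intro seminorm_at_diff[OF elim(2) p0_pos] FL)
      also have "(\<lambda>y. F y - Fi i y) = (\<lambda>y. \<Sum>j\<le>k. c j * g (N i) j y)"
        unfolding Fs g_def by (simp add: sum_subtractf[symmetric] algebra_simps)
      also have "norm (T \<dots> x) \<le> (\<Sum>j\<le>k. norm (c j) * norm (T (g (N i) j) x))"
        by (intro seminorm_at_sum[OF elim(2) p0_pos] gL finite_atMost)
      finally show ?thesis by (simp add: abs_minus_commute)
    qed
    have "(\<lambda>i. \<Sum>j\<le>k. norm (c j) * norm (T (g (N i) j) x)) \<longlonglongrightarrow> (\<Sum>j\<le>k. norm (c j) * 0)"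
      using elim(1) by (intro tendsto_sum tendsto_mult tendsto_const) auto
    then have "(\<lambda>i. \<Sum>j\<le>k. norm (c j) * norm (T (g (N i) j) x)) \<longlonglongrightarrow> 0" by simp
    then have "(\<lambda>i. norm (T (Fi i) x) - norm (T F x)) \<longlonglongrightarrow> 0"
      by (rule Lim_null_comparison[rotated]) (simp add: bd)
    then have "(\<lambda>i. norm (T (Fi i) x)) \<longlonglongrightarrow> norm (T F x)" by (simp add: LIM_zero_iff)
    moreover have "\<forall>\<^sub>F i in sequentially. norm (T (Fi i) x) = norm (commutator T k (\<lambda>y. truncate (N i) (b y)) f x)"
      using comm by (intro eventually_sequentiallyI[of M]) simp
    moreover have "T F x = commutator T k b f x" by (simp add: commutator_def F_def[abs_def])
    ultimately show ?case using tendsto_cong by fastforce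
  qed
  then show ?thesis by blast
qed

lemma nn_integral_Fatou_powr:
  fixes w :: "'a \<Rightarrow> ennreal" and g :: "nat \<Rightarrow> 'a \<Rightarrow> real"
  assumes [measurable]: "w \<in> borel_measurable lebesgue" "\<And>i. g i \<in> borel_measurable lebesgue" and fin: "\<And>x. w x < top" and p: "0 < p"
    and nonneg: "\<And>i x. 0 \<le> g i x" "\<And>x. 0 \<le> h x"
    and lim: "AE x in lebesgue. (\<lambda>i. g i x) \<longlonglongrightarrow> h x" and le: "\<And>i. (\<integral>\<^sup>+x. w x * epowr (ennreal (g i x)) p \<partial>lebesgue) \<le> B"
  shows "(\<integral>\<^sup>+x. w x * epowr (ennreal (h x)) p \<partial>lebesgue) \<le> B"
proof -
  have "(\<integral>\<^sup>+x. w x * epowr (ennreal (h x)) p \<partial>lebesgue) \<le> (\<integral>\<^sup>+x. liminf (\<lambda>i. w x * epowr (ennreal (g i x)) p) \<partial>lebesgue)"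
    using lim
  proof (intro nn_integral_mono_AE, eventually_elim)
    case (elim x)
    have "(\<lambda>i. w x * ennreal (g i x powr p)) \<longlonglongrightarrow> w x * ennreal (h x powr p)"
      using elim(2) p nonneg by (intro ennreal_tendsto_cmult fin tendsto_ennrealI tendsto_powr2 tendsto_const) auto
    then have "(\<lambda>i. w x * epowr (ennreal (g i x)) p) \<longlonglongrightarrow> w x * epowr (ennreal (h x)) p"
      using p nonneg by (simp add: epowr_ennreal)
    then show ?case by (simp add: lim_imp_Liminf)
  qed
  also have "\<dots> \<le> liminf (\<lambda>i. \<integral>\<^sup>+x. w x * epowr (ennreal (g i x)) p \<partial>lebesgue)"
    by (intro nn_integral_liminf) measurable
  also have "\<dots> \<le> B" by (intro Liminf_le always_eventually allI le) simp
  finally show ?thesis .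
qed

lemma commutator_measurable_BMO:
  fixes b f :: "'a \<Rightarrow> 'k"
  assumes osc: "osc_bound b a \<beta>" and \<beta>: "0 < \<beta>" and f: "f \<in> Linf_c"
  shows "(\<lambda>x. norm (commutator T k b f x)) \<in> borel_measurable lebesgue"
  by (rule commutator_norm_measurable[OF osc_boundD(1)[OF osc] osc_bound_power_Lp[OF osc \<beta> f p0_pos]])

text \<open>All truncations of b share the bound \<beta>, so the right-hand side is constant along
  the sequence to which Fatou's lemma is applied.\<close>

lemma commutator_weighted_bounded:
  assumes t: "1 < t" and \<theta>: "0 < \<theta>" "t < q0 / p0 * \<theta>" and \<kappa>: "1 < \<kappa>" and nonneg: "0 \<le> C1" "0 \<le> D" "0 \<le> E"
    and sm: "summable (\<lambda>j. \<alpha> j * real (j + 3) ^ k)"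
  shows "\<exists>B\<ge>0. \<forall>w f b a \<beta>. good_weight t \<theta> C1 D \<kappa> E w \<longrightarrow> f \<in> Linf_c \<longrightarrow> osc_bound b a \<beta> \<longrightarrow> 0 < \<beta> \<longrightarrow>
    (\<integral>\<^sup>+x. w x * epowr (ennreal (norm (commutator T k b f x))) (p0 * t) \<partial>lebesgue)
      \<le> ennreal (B * (\<beta> ^ k) powr (p0 * t)) * (\<integral>\<^sup>+x. w x * epowr (ennreal (norm (f x))) (p0 * t) \<partial>lebesgue)"
proof -
  obtain B where B: "0 \<le> B" and bd: "\<And>w f b a \<beta> N. good_weight t \<theta> C1 D \<kappa> E w \<Longrightarrow> f \<in> Linf_c \<Longrightarrow> osc_bound b a \<beta> \<Longrightarrow> 0 < \<beta> \<Longrightarrow> (\<forall>x. norm (b x) \<le> N) \<Longrightarrow>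
    (\<integral>\<^sup>+x. w x * epowr (comm_pow k b f x) t \<partial>lebesgue)
      \<le> ennreal (B * (\<beta> ^ k) powr (p0 * t)) * (\<integral>\<^sup>+x. w x * epowr (epowr (ennreal (norm (f x))) p0) t \<partial>lebesgue)"
    using comm_pow_weighted_bounded[OF t \<theta> \<kappa> nonneg sm order_refl] by blast
  have pt: "0 < p0 * t" using p0_pos t by simp
  have ep: "epowr (epowr z p0) t = epowr z (p0 * t)" for z using p0_pos t by (intro epowr_epowr) auto
  have "(\<integral>\<^sup>+x. w x * epowr (ennreal (norm (commutator T k b f x))) (p0 * t) \<partial>lebesgue)
      \<le> ennreal (B * (\<beta> ^ k) powr (p0 * t)) * (\<integral>\<^sup>+x. w x * epowr (ennreal (norm (f x))) (p0 * t) \<partial>lebesgue)"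
    if w: "good_weight t \<theta> C1 D \<kappa> E w" and f: "f \<in> Linf_c" and osc: "osc_bound b a \<beta>" and \<beta>: "0 < \<beta>" for w f b a \<beta>
  proof -
    obtain N where N: "AE x in lebesgue. (\<lambda>i. norm (commutator T k (\<lambda>y. truncate (N i) (b y)) f x)) \<longlonglongrightarrow> norm (commutator T k b f x)"
      using commutator_truncate_tendsto[OF osc \<beta> f] by blast
    obtain Nw where Nw: "\<And>x. w x \<le> ennreal Nw" using good_weightD(2)[OF w] by blast
    show ?thesis
    proof (rule nn_integral_Fatou_powr[OF good_weightD(1)[OF w] _ _ pt _ _ N])
      show "(\<lambda>x. norm (commutator T k (\<lambda>y. truncate (N i) (b y)) f x)) \<in> borel_measurable lebesgue" for i
        by (rule commutator_measurable_BMO[OF osc_bound_truncate[OF osc] \<beta> f])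
      show "w x < top" for x using Nw[of x] by (rule le_less_trans) simp
      show "(\<integral>\<^sup>+x. w x * epowr (ennreal (norm (commutator T k (\<lambda>y. truncate (N i) (b y)) f x))) (p0 * t) \<partial>lebesgue)
        \<le> ennreal (B * (\<beta> ^ k) powr (p0 * t)) * (\<integral>\<^sup>+x. w x * epowr (ennreal (norm (f x))) (p0 * t) \<partial>lebesgue)" for i
        using bd[OF w f osc_bound_truncate[OF osc, of "N i"] \<beta>, of "real (N i)"]
        by (simp add: truncate_norm_le comm_pow_def ep)
    qed auto
  qed
  then show ?thesis using B by blast
qed

end

section \<open>Truncated weights\<close>

lemma locally_integrable_ball:
  fixes b :: "'a::euclidean_space \<Rightarrow> 'b::{banach, second_countable_topology}"
  assumes "locally_integrable b"
  shows "b \<in> borel_measurable lebesgue" and "(\<integral>\<^sup>+x. ennreal (norm (b x)) * indicator (ball c r) x \<partial>lebesgue) < \<infinity>"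
proof -
  have int: "set_integrable lebesgue (cball c r) b" for c r using assms by (simp add: locally_integrable_def)
  show "b \<in> borel_measurable lebesgue"
  proof (rule borel_measurable_LIMSEQ_metric[where f = "\<lambda>n x. indicator (cball 0 (real n)) x *\<^sub>R b x"])
    show "(\<lambda>x. indicator (cball 0 (real n)) x *\<^sub>R b x) \<in> borel_measurable lebesgue" for n
      using int[of 0 "real n"] unfolding set_integrable_def by (rule borel_measurable_integrable)
    show "(\<lambda>n. indicator (cball 0 (real n)) x *\<^sub>R b x) \<longlonglongrightarrow> b x" for x
    proof (rule tendsto_eventually)
      obtain M where "norm x \<le> real M" using real_arch_simple by blast
      then show "\<forall>\<^sub>F n in sequentially. indicator (cball 0 (real n)) x *\<^sub>R b x = b x"
        by (intro eventually_sequentiallyI[of M]) (auto simp: indicator_def)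
    qed
  qed
  have "(\<integral>\<^sup>+x. ennreal (norm (b x)) * indicator (ball c r) x \<partial>lebesgue) \<le> (\<integral>\<^sup>+x. ennreal (norm (indicator (cball c r) x *\<^sub>R b x)) \<partial>lebesgue)"
    by (intro nn_integral_mono) (auto split: split_indicator)
  also have "\<dots> < \<infinity>" using int[of c r] unfolding set_integrable_def integrable_iff_bounded by simp
  finally show "(\<integral>\<^sup>+x. ennreal (norm (b x)) * indicator (ball c r) x \<partial>lebesgue) < \<infinity>" .
qed

text \<open>Any \<beta> above the BMO seminorm is allowed, because the estimates require \<beta> > 0
  while the seminorm may vanish.\<close>

lemma BMO_osc_bound:
  fixes b :: "'a::euclidean_space \<Rightarrow> 'b::euclidean_space"
  assumes b: "b \<in> BMO" and \<beta>: "BMO_norm b \<le> \<beta>"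
  shows "osc_bound b (ball_average b) \<beta>"
  unfolding osc_bound_def
proof (intro conjI allI impI)
  have li: "locally_integrable b" using b by (simp add: BMO_def)
  show [measurable]: "b \<in> borel_measurable lebesgue" by (rule locally_integrable_ball[OF li])
  fix c :: 'a and r :: real assume r: "0 < r"
  interpret prob_space "ball_measure c r" using r by (rule prob_space_ball_measure)
  have "(\<integral>\<^sup>+x. ennreal (norm (b x)) \<partial>ball_measure c r) < \<infinity>"
    using locally_integrable_ball(2)[OF li, of c r] r by (subst nn_integral_ball_measure) (auto simp: ennreal_divide_eq_top_iff less_top[symmetric])
  then have "integrable (ball_measure c r) b" by (simp add: integrable_iff_bounded)
  then have "integrable (ball_measure c r) (\<lambda>y. norm (b y - ball_average b c r))" by simp
  then have "(\<integral>\<^sup>+y. ennreal (norm (b y - ball_average b c r)) \<partial>ball_measure c r) = ennreal (mean_oscillation b c r)"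
    unfolding mean_oscillation_def by (intro nn_integral_eq_integral) auto
  also have "mean_oscillation b c r \<le> BMO_norm b"
    unfolding BMO_norm_def using b r by (intro cSUP_upper2[where x = "(c, r)"]) (auto simp: BMO_def)
  finally show "(\<integral>\<^sup>+y. ennreal (norm (b y - ball_average b c r)) \<partial>ball_measure c r) \<le> ennreal \<beta>"
    using \<beta> by (auto intro: order_trans ennreal_leI)
qed

lemma BMO_norm_nonneg: "b \<in> BMO \<Longrightarrow> 0 \<le> BMO_norm b"
proof -
  assume b: "b \<in> BMO"
  have "0 \<le> mean_oscillation b 0 1" by (simp add: mean_oscillation_def)
  also have "\<dots> \<le> BMO_norm b"
    unfolding BMO_norm_def using b by (intro cSUP_upper2[where x = "(0, 1)"]) (auto simp: BMO_def)
  finally show ?thesis .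
qed

text \<open>The clamped weights satisfy the \<open>A\<^sub>p\<close> condition uniformly in \<open>N\<close>.\<close>

definition clamp_weight :: "real \<Rightarrow> ('a \<Rightarrow> real) \<Rightarrow> 'a \<Rightarrow> real" where
  "clamp_weight N w x = min (max (w x) (1 / N)) N"

lemma clamp_weight_bounds:
  assumes "1 \<le> N" shows "1 / N \<le> clamp_weight N w x" and "clamp_weight N w x \<le> N"
proof -
  have "1 / N \<le> 1" using assms by simp
  then have "1 / N \<le> N" using assms by linarith
  then show "1 / N \<le> clamp_weight N w x" and "clamp_weight N w x \<le> N" by (auto simp: clamp_weight_def)
qed

text \<open>Clamping increases w^u only where w is raised to 1/N, and increases w^(-s) only where w
  is lowered to N. In both places the clamped power is N^(-u) or N^(-s). At zeros of w the dual
  power is infinite and the second bound is trivial.\<close>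

lemma epowr_clamp_weight_le:
  assumes N: "1 \<le> N" and w: "0 \<le> w x" and u: "0 < u" and s: "0 < s"
  shows "ennreal (clamp_weight N w x powr u) \<le> epowr (ennreal (w x)) u + ennreal (N powr (- u))"
    and "ennreal (clamp_weight N w x powr (- s)) \<le> epowr (ennreal (w x)) (- s) + ennreal (N powr (- s))"
proof -
  let ?c = "clamp_weight N w x"
  have inv: "1 / N \<le> 1" using N by simp
  have c: "1 / N \<le> ?c" "?c \<le> N" by (rule clamp_weight_bounds[OF N])+
  have c0: "0 < ?c" using N c(1) by (smt (verit) zero_less_divide_1_iff)
  have invN: "1 / N \<le> N" using inv N by linarith
  consider "?c \<le> w x" | "?c = 1 / N" using invN by (cases "w x \<le> 1 / N") (auto simp: clamp_weight_def)
  then show "ennreal (?c powr u) \<le> epowr (ennreal (w x)) u + ennreal (N powr (- u))"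
  proof cases
    case 1
    then have "?c powr u \<le> w x powr u" using c0 u by (intro powr_mono2) auto
    then have "ennreal (?c powr u) \<le> epowr (ennreal (w x)) u" using u w by (simp add: epowr_ennreal ennreal_leI)
    then show ?thesis by (rule order_trans) simp
  next
    case 2
    then have "?c powr u = N powr (- u)" using N by (simp add: powr_divide powr_minus_divide)
    then show ?thesis by simp
  qed
  consider "w x \<le> ?c" "0 < w x" | "w x = 0" | "?c = N"
  proof (cases "w x \<le> N")
    case True
    then have "w x \<le> ?c" using invN by (auto simp: clamp_weight_def)
    then show ?thesis using w that(1,2) by (cases "w x = 0") auto
  next
    case False
    then have "?c = N" by (auto simp: clamp_weight_def)
    then show ?thesis by (rule that(3))
  qed
  then show "ennreal (?c powr (- s)) \<le> epowr (ennreal (w x)) (- s) + ennreal (N powr (- s))"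
  proof cases
    case 1
    then have "?c powr (- s) \<le> w x powr (- s)" using s by (intro powr_mono2') auto
    then have "ennreal (?c powr (- s)) \<le> epowr (ennreal (w x)) (- s)" using 1 by (simp add: epowr_ennreal_pos ennreal_leI)
    then show ?thesis by (rule order_trans) simp
  next
    case 2
    then have "epowr (ennreal (w x)) (- s) = top" using s by (simp add: epowr_def)
    then show ?thesis by simp
  qed simp
qed

text \<open>Let X and Y be the averages of w^u and of the dual weight. If X < N^(-u), the clamped
  average is at most 2 N^(-u) and the clamped dual factor at most N^u, which cancel; Y < N^(-s) is
  symmetric. Otherwise clamping at most doubles X and Y, and the bound K applies. The constant adds
  the three cases.\<close>

lemma clamp_weight_ap_bound:
  fixes w :: "'a::euclidean_space \<Rightarrow> real"
  assumes w: "weight w" and t: "1 < t" and u: "1 \<le> u" and K: "0 \<le> K" and N: "1 \<le> N"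
    and Xe: "\<And>c r. 0 < r \<Longrightarrow> (\<integral>\<^sup>+y. epowr (ennreal (w y)) u \<partial>ball_measure c r) *
      epowr (\<integral>\<^sup>+y. epowr (ennreal (w y)) (- (1 / (t - 1))) \<partial>ball_measure c r) (u * (t - 1)) \<le> ennreal K"
  shows "ap_bound (u * (t - 1) + 1) (2 + 2 powr (u * (t - 1)) + 2 * 2 powr (u * (t - 1)) * K) (\<lambda>x. clamp_weight N w x powr u)"
  unfolding ap_bound_def
proof (intro conjI allI impI)
  have [measurable]: "w \<in> borel_measurable lebesgue" using w locally_integrable_ball(1) by (auto simp: weight_def)
  have w0: "0 \<le> w x" for x using w by (simp add: weight_def)
  have [measurable]: "clamp_weight N w \<in> borel_measurable lebesgue" unfolding clamp_weight_def[abs_def] by measurable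
  show "(\<lambda>x. clamp_weight N w x powr u) \<in> borel_measurable lebesgue" by measurable
  have cb: "1 / N \<le> clamp_weight N w x" "clamp_weight N w x \<le> N" for x by (rule clamp_weight_bounds[OF N])+
  have N0: "0 < 1 / N" using N by simp
  have c0: "0 < clamp_weight N w x" for x using N0 cb(1)[of x] by (rule less_le_trans)
  have bd: "(1 / N) powr u \<le> clamp_weight N w x powr u \<and> clamp_weight N w x powr u \<le> N powr u" for x
    using u by (intro conjI powr_mono2 cb less_imp_le[OF c0] less_imp_le[OF N0]) auto
  show "\<exists>m>0. \<exists>M. \<forall>x. m \<le> clamp_weight N w x powr u \<and> clamp_weight N w x powr u \<le> M"
  proof (intro exI conjI allI)
    show "0 < (1 / N) powr u" using N by simp
  qed (use bd in blast)+
  fix c :: 'a and r :: real assume r: "0 < r"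
  interpret prob_space "ball_measure c r" using r by (rule prob_space_ball_measure)
  define e where "e = u * (t - 1)"
  have e: "0 < e" using u t by (simp add: e_def)
  define s where "s = 1 / (t - 1)"
  have s: "0 < s" using t by (simp add: s_def)
  have se: "s * e = u" using t by (simp add: s_def e_def)
  have uu: "0 < u" using u by simp
  define X where "X = (\<integral>\<^sup>+y. epowr (ennreal (w y)) u \<partial>ball_measure c r)"
  define Y where "Y = (\<integral>\<^sup>+y. epowr (ennreal (w y)) (- s) \<partial>ball_measure c r)"
  define A where "A = (\<integral>\<^sup>+y. ennreal (clamp_weight N w y powr u) \<partial>ball_measure c r)"
  define S where "S = (\<integral>\<^sup>+y. ennreal (clamp_weight N w y powr (- s)) \<partial>ball_measure c r)"
  have XY: "X * epowr Y e \<le> ennreal K" using Xe[OF r, of c] by (simp add: X_def Y_def s_def e_def)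
  have AX: "A \<le> X + ennreal (N powr (- u))"
  proof -
    have "A \<le> (\<integral>\<^sup>+y. epowr (ennreal (w y)) u + ennreal (N powr (- u)) \<partial>ball_measure c r)"
      unfolding A_def by (intro nn_integral_mono epowr_clamp_weight_le(1)[where w = w, OF N w0 uu s])
    also have "\<dots> = X + (\<integral>\<^sup>+y. ennreal (N powr (- u)) \<partial>ball_measure c r)" unfolding X_def by (intro nn_integral_add) auto
    finally show ?thesis by (simp only: nn_integral_const emeasure_space_1 mult_1_right)
  qed
  have SY: "S \<le> Y + ennreal (N powr (- s))"
  proof -
    have "S \<le> (\<integral>\<^sup>+y. epowr (ennreal (w y)) (- s) + ennreal (N powr (- s)) \<partial>ball_measure c r)"
      unfolding S_def by (intro nn_integral_mono epowr_clamp_weight_le(2)[where w = w, OF N w0 uu s])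
    also have "\<dots> = Y + (\<integral>\<^sup>+y. ennreal (N powr (- s)) \<partial>ball_measure c r)" unfolding Y_def by (intro nn_integral_add) auto
    finally show ?thesis by (simp only: nn_integral_const emeasure_space_1 mult_1_right)
  qed
  have AN: "A \<le> ennreal (N powr u)"
    unfolding A_def using bd by (intro nn_integral_bounds(2)[of 0] ennreal_leI) auto
  have SN: "S \<le> ennreal (N powr s)"
  proof -
    have "clamp_weight N w x powr (- s) \<le> N powr s" for x
    proof -
      have "clamp_weight N w x powr (- s) \<le> (1 / N) powr (- s)" using cb(1)[of x] N0 s by (intro powr_mono2') auto
      also have "\<dots> = N powr s" using N by (simp add: powr_divide powr_minus_divide)
      finally show ?thesis .
    qed
    then show ?thesis unfolding S_def by (intro nn_integral_bounds(2)[of 0] ennreal_leI) auto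
  qed
  have two: "x + x = 2 * x" for x :: ennreal by (simp add: mult_2)
  have e2: "epowr 2 e = ennreal (2 powr e)" using epowr_ennreal_pos[of 2 e] by simp
  have prod1: "N powr (- u) * N powr u = 1" using N by (simp add: powr_add[symmetric])
  consider "X < ennreal (N powr (- u))" | "Y < ennreal (N powr (- s))" | "ennreal (N powr (- u)) \<le> X" "ennreal (N powr (- s)) \<le> Y" by fastforce
  then have "A * epowr S e \<le> ennreal (2 + 2 powr e + 2 * 2 powr e * K)"
  proof cases
    case 1
    have "A \<le> 2 * ennreal (N powr (- u))" using AX 1 unfolding two[symmetric] by (auto intro: order_trans add_right_mono)
    moreover have "epowr S e \<le> epowr (ennreal (N powr s)) e" using e by (intro epowr_mono SN) auto
    ultimately have "A * epowr S e \<le> 2 * ennreal (N powr (- u)) * epowr (ennreal (N powr s)) e" by (rule mult_mono) auto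
    also have "epowr (ennreal (N powr s)) e = ennreal (N powr u)" using N e se by (simp add: epowr_ennreal powr_powr)
    also have "2 * ennreal (N powr (- u)) * ennreal (N powr u) = 2"
      by (simp only: mult.assoc ennreal_mult[symmetric] powr_ge_zero prod1) simp
    also have "\<dots> = ennreal 2" by simp
    also have "\<dots> \<le> ennreal (2 + 2 powr e + 2 * 2 powr e * K)" using K by (intro ennreal_leI) simp
    finally show ?thesis .
  next
    case 2
    have "S \<le> 2 * ennreal (N powr (- s))" using SY 2 unfolding two[symmetric] by (auto intro: order_trans add_right_mono)
    then have "epowr S e \<le> epowr (2 * ennreal (N powr (- s))) e" using e by (intro epowr_mono) auto
    also have "\<dots> = ennreal (2 powr e) * epowr (ennreal (N powr (- s))) e" using e by (simp add: epowr_mult e2)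
    also have "epowr (ennreal (N powr (- s))) e = ennreal (N powr (- u))" using N e se by (simp add: epowr_ennreal powr_powr)
    finally have "A * epowr S e \<le> ennreal (N powr u) * (ennreal (2 powr e) * ennreal (N powr (- u)))" by (intro mult_mono AN) auto
    also have "\<dots> = ennreal (2 powr e) * ennreal (N powr (- u) * N powr u)" by (simp only: ennreal_mult powr_ge_zero ac_simps)
    also have "\<dots> = ennreal (2 powr e)" by (simp only: prod1) simp
    also have "\<dots> \<le> ennreal (2 + 2 powr e + 2 * 2 powr e * K)" using K by (intro ennreal_leI) simp
    finally show ?thesis .
  next
    case 3
    have "A \<le> 2 * X" using AX 3(1) unfolding two[symmetric] by (auto intro: order_trans add_left_mono)
    moreover have "epowr S e \<le> epowr (2 * Y) e" using SY 3(2) e unfolding two[symmetric] by (intro epowr_mono) (auto intro: order_trans add_left_mono)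
    ultimately have "A * epowr S e \<le> (2 * X) * epowr (2 * Y) e" by (rule mult_mono) auto
    also have "\<dots> = 2 * ennreal (2 powr e) * (X * epowr Y e)" using e by (simp add: epowr_mult e2 ac_simps)
    also have "\<dots> \<le> 2 * ennreal (2 powr e) * ennreal K" by (intro mult_left_mono XY) auto
    also have "\<dots> = ennreal (2 * 2 powr e * K)" using K by (simp add: ennreal_mult)
    also have "\<dots> \<le> ennreal (2 + 2 powr e + 2 * 2 powr e * K)" by (intro ennreal_leI) simp
    finally show ?thesis .
  qed
  moreover have "(clamp_weight N w y powr u) powr (- 1 / (u * (t - 1) + 1 - 1)) = clamp_weight N w y powr (- s)" for y
  proof -
    have "u * (- 1 / (u * (t - 1) + 1 - 1)) = - s" using u t by (simp add: s_def)
    then show ?thesis by (simp only: powr_powr)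
  qed
  ultimately show "(\<integral>\<^sup>+y. ennreal (clamp_weight N w y powr u) \<partial>ball_measure c r) *
    epowr (\<integral>\<^sup>+y. ennreal ((clamp_weight N w y powr u) powr (- 1 / (u * (t - 1) + 1 - 1))) \<partial>ball_measure c r) (u * (t - 1) + 1 - 1)
    \<le> ennreal (2 + 2 powr (u * (t - 1)) + 2 * 2 powr (u * (t - 1)) * K)"
    by (simp only: A_def S_def e_def add_diff_cancel_right')
qed

text \<open>The product is the u-th power of (avg w^u)^(1/u) (avg of the dual weight)^(t-1). Reverse
  Hoelder replaces the first factor by the average of w, and A_t applies. This is the classical fact
  that A_t and RH_u put w^u into A_s with s = u(t-1) + 1.\<close>

lemma muckenhoupt_reverse_hoelder_product:
  fixes w :: "'a::euclidean_space \<Rightarrow> real"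
  assumes t: "1 < t" and u: "1 \<le> u" and A: "muckenhoupt t w" and R: "reverse_hoelder u w"
  shows "\<exists>K\<ge>0. \<forall>c r. 0 < r \<longrightarrow> (\<integral>\<^sup>+y. epowr (ennreal (w y)) u \<partial>ball_measure c r) *
      epowr (\<integral>\<^sup>+y. epowr (ennreal (w y)) (- (1 / (t - 1))) \<partial>ball_measure c r) (u * (t - 1)) \<le> ennreal K"
proof -
  obtain C1 where C1: "\<And>c r. 0 < r \<Longrightarrow> (\<integral>\<^sup>+y. ennreal (w y) \<partial>ball_measure c r) *
       epowr (\<integral>\<^sup>+y. epowr (ennreal (w y)) (1 - conj_exponent t) \<partial>ball_measure c r) (t - 1) \<le> ennreal C1"
    using A unfolding muckenhoupt_def by blast
  have ex: "1 - conj_exponent t = - (1 / (t - 1))" using t by (simp add: conj_exponent_def field_simps)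
  have "\<exists>C2. \<forall>c r. 0 < r \<longrightarrow> epowr (\<integral>\<^sup>+y. epowr (ennreal (w y)) u \<partial>ball_measure c r) (1 / u) \<le> ennreal C2 * (\<integral>\<^sup>+y. ennreal (w y) \<partial>ball_measure c r)"
  proof (cases "u = 1")
    case True
    then show ?thesis by (intro exI[of _ 1]) auto
  next
    case False
    then show ?thesis using R unfolding reverse_hoelder_def by blast
  qed
  then obtain C2 where C2: "\<And>c r. 0 < r \<Longrightarrow> epowr (\<integral>\<^sup>+y. epowr (ennreal (w y)) u \<partial>ball_measure c r) (1 / u) \<le> ennreal C2 * (\<integral>\<^sup>+y. ennreal (w y) \<partial>ball_measure c r)"
    by blast
  \<comment> \<open>\<open>ennreal\<close> sends negative numbers to 0, so replacing the constants
    by their positive parts changes nothing.\<close>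
  define D1 where "D1 = max 0 C1"
  define D2 where "D2 = max 0 C2"
  have D: "ennreal C1 = ennreal D1" "ennreal C2 = ennreal D2" "0 \<le> D1" "0 \<le> D2"
    by (auto simp: D1_def D2_def max_def ennreal_neg)
  have "(\<integral>\<^sup>+y. epowr (ennreal (w y)) u \<partial>ball_measure c r) *
      epowr (\<integral>\<^sup>+y. epowr (ennreal (w y)) (- (1 / (t - 1))) \<partial>ball_measure c r) (u * (t - 1)) \<le> ennreal ((D2 * D1) powr u)"
    if r: "0 < r" for c r
  proof -
    let ?X = "\<integral>\<^sup>+y. epowr (ennreal (w y)) u \<partial>ball_measure c r" and ?Y = "\<integral>\<^sup>+y. epowr (ennreal (w y)) (- (1 / (t - 1))) \<partial>ball_measure c r"
      and ?a = "\<integral>\<^sup>+y. ennreal (w y) \<partial>ball_measure c r"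
    have "?X * epowr ?Y (u * (t - 1)) = epowr (epowr ?X (1/u) * epowr ?Y (t - 1)) u"
      using u t by (simp add: epowr_mult epowr_inv' epowr_epowr mult.commute)
    also have "\<dots> \<le> epowr ((ennreal D2 * ?a) * epowr ?Y (t - 1)) u"
      using u C2[OF r, of c] by (intro epowr_mono mult_right_mono) (auto simp: D)
    also have "\<dots> \<le> epowr (ennreal D2 * ennreal D1) u"
      unfolding mult.assoc using u C1[OF r, of c] by (intro epowr_mono mult_left_mono) (auto simp: D ex)
    also have "\<dots> = ennreal ((D2 * D1) powr u)"
      using D u by (simp add: ennreal_mult[symmetric] epowr_ennreal)
    finally show ?thesis .
  qed
  then show ?thesis by (intro exI[of _ "(D2 * D1) powr u"]) auto
qed

text \<open>On the left the clamped weights eventually dominate w at each point, which suits Fatou's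
  lemma. On the right they exceed w by at most 1/(n+1), and the error vanishes because f is
  integrable for Lebesgue measure.\<close>

lemma clamp_weight_limit:
  fixes w :: "'a::euclidean_space \<Rightarrow> real" and f g :: "'a \<Rightarrow> ennreal"
  assumes [measurable]: "w \<in> borel_measurable lebesgue" "f \<in> borel_measurable lebesgue" "g \<in> borel_measurable lebesgue"
    and w0: "\<And>x. 0 \<le> w x" and B: "0 \<le> B"
    and f: "(\<integral>\<^sup>+x. f x \<partial>lebesgue) < \<infinity>"
    and le: "\<And>n. (\<integral>\<^sup>+x. ennreal (clamp_weight (real (Suc n)) w x) * g x \<partial>lebesgue) \<le> ennreal B * (\<integral>\<^sup>+x. ennreal (clamp_weight (real (Suc n)) w x) * f x \<partial>lebesgue)"
  shows "(\<integral>\<^sup>+x. ennreal (w x) * g x \<partial>lebesgue) \<le> ennreal B * (\<integral>\<^sup>+x. ennreal (w x) * f x \<partial>lebesgue)"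
proof -
  have [measurable]: "clamp_weight N w \<in> borel_measurable lebesgue" for N unfolding clamp_weight_def[abs_def] by measurable
  let ?c = "\<lambda>n. clamp_weight (real (Suc n)) w"
  have ub: "?c n x \<le> w x + 1 / real (Suc n)" for n x
  proof -
    have "0 < 1 / real (Suc n)" by simp
    then show ?thesis using w0[of x] unfolding clamp_weight_def by linarith
  qed
  have lb: "min (w x) (real (Suc n)) \<le> ?c n x" for n x by (auto simp: clamp_weight_def)
  have "(\<integral>\<^sup>+x. ennreal (w x) * g x \<partial>lebesgue) \<le> (\<integral>\<^sup>+x. liminf (\<lambda>n. ennreal (?c n x) * g x) \<partial>lebesgue)"
  proof (intro nn_integral_mono)
    fix x
    obtain M where M: "w x \<le> real M" using real_arch_simple by blast
    have "ennreal (w x) * g x \<le> ennreal (?c n x) * g x" if "M \<le> n" for n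
    proof -
      have "min (w x) (real (Suc n)) = w x" using M that by simp
      then show ?thesis using lb[of x n] by (intro mult_right_mono ennreal_leI) auto
    qed
    then show "ennreal (w x) * g x \<le> liminf (\<lambda>n. ennreal (?c n x) * g x)"
      by (intro Liminf_bounded eventually_sequentiallyI[of M])
  qed
  also have "\<dots> \<le> liminf (\<lambda>n. \<integral>\<^sup>+x. ennreal (?c n x) * g x \<partial>lebesgue)" by (intro nn_integral_liminf) measurable
  also have "\<dots> \<le> liminf (\<lambda>n. ennreal B * ((\<integral>\<^sup>+x. ennreal (w x) * f x \<partial>lebesgue) + ennreal (1 / real (Suc n)) * (\<integral>\<^sup>+x. f x \<partial>lebesgue)))"
  proof (intro Liminf_mono always_eventually allI)
    fix n
    have "(\<integral>\<^sup>+x. ennreal (?c n x) * f x \<partial>lebesgue) \<le> (\<integral>\<^sup>+x. ennreal (w x) * f x + ennreal (1 / real (Suc n)) * f x \<partial>lebesgue)"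
    proof (intro nn_integral_mono)
      fix x
      have "ennreal (?c n x) \<le> ennreal (w x) + ennreal (1 / real (Suc n))"
        using ub[of n x] w0[of x] by (subst ennreal_plus[symmetric]) (auto simp del: ennreal_plus intro!: ennreal_leI)
      then show "ennreal (?c n x) * f x \<le> ennreal (w x) * f x + ennreal (1 / real (Suc n)) * f x"
        unfolding distrib_right[symmetric] by (rule mult_right_mono) simp
    qed
    also have "\<dots> = (\<integral>\<^sup>+x. ennreal (w x) * f x \<partial>lebesgue) + ennreal (1 / real (Suc n)) * (\<integral>\<^sup>+x. f x \<partial>lebesgue)"
      by (simp add: nn_integral_add nn_integral_cmult)
    finally show "(\<integral>\<^sup>+x. ennreal (?c n x) * g x \<partial>lebesgue) \<le> ennreal B * ((\<integral>\<^sup>+x. ennreal (w x) * f x \<partial>lebesgue) + ennreal (1 / real (Suc n)) * (\<integral>\<^sup>+x. f x \<partial>lebesgue))"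
      by (rule order_trans[OF le mult_left_mono]) simp
  qed
  also have "\<dots> = ennreal B * (\<integral>\<^sup>+x. ennreal (w x) * f x \<partial>lebesgue)"
  proof (rule lim_imp_Liminf)
    obtain I where I: "(\<integral>\<^sup>+x. f x \<partial>lebesgue) = ennreal I" "0 \<le> I" using f by (cases "\<integral>\<^sup>+x. f x \<partial>lebesgue") auto
    have "(\<lambda>n. 1 / real (Suc n) * I) \<longlonglongrightarrow> 0 * I" by (intro tendsto_mult tendsto_const LIMSEQ_Suc[OF lim_1_over_n])
    then have "(\<lambda>n. ennreal (1 / real (Suc n) * I)) \<longlonglongrightarrow> ennreal (0 * I)" by (rule tendsto_ennrealI)
    moreover have "ennreal (1 / real (Suc n) * I) = ennreal (1 / real (Suc n)) * ennreal I" for n using I(2) by (intro ennreal_mult) auto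
    ultimately have "(\<lambda>n. ennreal (1 / real (Suc n)) * (\<integral>\<^sup>+x. f x \<partial>lebesgue)) \<longlonglongrightarrow> 0" unfolding I(1) by simp
    then have "(\<lambda>n. ennreal B * ((\<integral>\<^sup>+x. ennreal (w x) * f x \<partial>lebesgue) + ennreal (1 / real (Suc n)) * (\<integral>\<^sup>+x. f x \<partial>lebesgue)))
      \<longlonglongrightarrow> ennreal B * ((\<integral>\<^sup>+x. ennreal (w x) * f x \<partial>lebesgue) + 0)"
      by (intro ennreal_tendsto_cmult tendsto_add tendsto_const) auto
    then show "(\<lambda>n. ennreal B * ((\<integral>\<^sup>+x. ennreal (w x) * f x \<partial>lebesgue) + ennreal (1 / real (Suc n)) * (\<integral>\<^sup>+x. f x \<partial>lebesgue)))
      \<longlonglongrightarrow> ennreal B * (\<integral>\<^sup>+x. ennreal (w x) * f x \<partial>lebesgue)" by simp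
  qed simp
  finally show ?thesis .
qed

text \<open>This is how the on-diagonal hypothesis for q0 = \<infinity> passes to a finite
  exponent.\<close>

lemma (in prob_space) eLp_norm_le_esssup:
  assumes "0 < q" shows "eLp_norm M (ennreal q) g \<le> esssup M (\<lambda>x. ennreal (norm (g x)))"
proof -
  let ?E = "esssup M (\<lambda>x. ennreal (norm (g x)))"
  have "AE x in M. epowr (ennreal (norm (g x))) q \<le> epowr ?E q"
    using esssup_AE[of "\<lambda>x. ennreal (norm (g x))" M]
  proof eventually_elim
    case (elim x)
    then show ?case using assms by (simp add: epowr_mono)
  qed
  then have "(\<integral>\<^sup>+x. epowr (ennreal (norm (g x))) q \<partial>M) \<le> (\<integral>\<^sup>+x. epowr ?E q \<partial>M)"
    by (rule nn_integral_mono_AE)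
  also have "\<dots> = epowr ?E q" by (simp only: nn_integral_const emeasure_space_1 mult_1_right)
  finally have "epowr (\<integral>\<^sup>+x. epowr (ennreal (norm (g x))) q \<partial>M) (1/q) \<le> epowr (epowr ?E q) (1/q)"
    using assms by (intro epowr_mono) auto
  then show ?thesis using assms by (simp add: eLp_norm_ennreal epowr_inv)
qed

lemma conj_quotient_ge_1:
  assumes "0 < p" "ennreal p < q0" shows "1 \<le> conj_quotient q0 p"
proof (cases q0)
  case (real q)
  then have "p < q" using assms by (simp add: ennreal_less_iff)
  then have "1 < q / p" using assms by simp
  then have "1 \<le> conj_exponent (q / p)" unfolding conj_exponent_def by (subst le_divide_eq_1_pos) auto
  then show ?thesis using real by (simp add: conj_quotient_def)
qed (simp add: conj_quotient_def)

lemma nn_integral_weight_Linf_c_finite: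
  fixes w :: "'a::euclidean_space \<Rightarrow> real" and f :: "'a \<Rightarrow> 'k::{real_normed_field, euclidean_space}"
  assumes w: "weight w" and f: "f \<in> Linf_c" and p: "0 < p"
  shows "(\<integral>\<^sup>+x. ennreal (w x) * epowr (ennreal (norm (f x))) p \<partial>lebesgue) < \<infinity>"
proof -
  have li: "locally_integrable w" and w0: "\<And>x. 0 \<le> w x" using w by (auto simp: weight_def)
  have [measurable]: "w \<in> borel_measurable lebesgue" by (rule locally_integrable_ball(1)[OF li])
  obtain c R where c: "0 < c" and R: "0 < R" and b: "\<And>x. norm (f x) \<le> c * indicator (ball 0 R) x"
    using Linf_cD(2)[OF f] by blast
  have "(\<integral>\<^sup>+x. ennreal (w x) * epowr (ennreal (norm (f x))) p \<partial>lebesgue)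
    \<le> (\<integral>\<^sup>+x. epowr (ennreal c) p * (ennreal (norm (w x)) * indicator (ball 0 R) x) \<partial>lebesgue)"
  proof (intro nn_integral_mono)
    fix x
    show "ennreal (w x) * epowr (ennreal (norm (f x))) p \<le> epowr (ennreal c) p * (ennreal (norm (w x)) * indicator (ball 0 R) x)"
    proof (cases "x \<in> ball 0 R")
      case True
      then have "epowr (ennreal (norm (f x))) p \<le> epowr (ennreal c) p" using b[of x] p by (intro epowr_mono ennreal_leI) auto
      then have "ennreal (w x) * epowr (ennreal (norm (f x))) p \<le> ennreal (w x) * epowr (ennreal c) p" by (rule mult_left_mono) simp
      then show ?thesis using True w0[of x] by (simp add: mult.commute)
    next
      case False
      then have "f x = 0" using b[of x] by simp
      then show ?thesis using p by simp
    qed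
  qed
  also have "\<dots> = epowr (ennreal c) p * (\<integral>\<^sup>+x. ennreal (norm (w x)) * indicator (ball 0 R) x \<partial>lebesgue)"
    by (intro nn_integral_cmult) measurable
  also have "\<dots> < \<infinity>"
    using locally_integrable_ball(2)[OF li, of 0 R] p by (simp add: ennreal_mult_less_top epowr_less_top)
  finally show ?thesis .
qed

theorem theorem3p15:
  fixes p0 p :: real and q0 :: ennreal and k :: nat
    and T :: "('a::euclidean_space \<Rightarrow> 'k::{real_normed_field, euclidean_space}) \<Rightarrow> ('a \<Rightarrow> 'k)"
    and A :: "real \<Rightarrow> ('a \<Rightarrow> 'k) \<Rightarrow> ('a \<Rightarrow> 'k)"
    and C :: real and \<alpha> :: "nat \<Rightarrow> real" and w :: "'a \<Rightarrow> real"
  assumes "1 \<le> p0" and "ennreal p0 < q0"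
    and "sublinear_op_on (Lp_space p0) T"
    and "bounded_on_Lp p0 T"
    and "\<And>r f. r > 0 \<Longrightarrow> f \<in> Linf_c \<Longrightarrow> A r f \<in> Lp_space p0"
    and "\<And>j. j \<ge> 1 \<Longrightarrow> \<alpha> j \<ge> 0"
    and "\<And>f x r. f \<in> Linf_c \<Longrightarrow> r > 0 \<Longrightarrow>
      eLp_norm (ball_measure x r) (ennreal p0) (T (\<lambda>y. f y - A r f y))
      \<le> ennreal C * (\<Sum>j. ennreal (\<alpha> (Suc j)) *
            eLp_norm (ball_measure x (2 ^ (Suc j + 1) * r)) (ennreal p0) f)"
    and "\<And>f x r. f \<in> Linf_c \<Longrightarrow> r > 0 \<Longrightarrow>
      eLp_norm (ball_measure x r) q0 (T (A r f))
      \<le> (\<Sum>j. ennreal (\<alpha> (Suc j)) *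
            eLp_norm (ball_measure x (2 ^ (Suc j + 1) * r)) (ennreal p0) (T f))"
    and "p0 < p" and "ennreal p < q0"
    and "muckenhoupt (p / p0) w" and "reverse_hoelder (conj_quotient q0 p) w"
    and "summable (\<lambda>j. \<alpha> j * real j ^ k)"
  shows "\<exists>C'::real. \<forall>f\<in>Linf_c. \<forall>b\<in>BMO.
    (\<lambda>x. norm (commutator T k b f x)) \<in> borel_measurable lebesgue \<and>
    eLp_norm (weighted_measure w) (ennreal p) (commutator T k b f)
      \<le> ennreal (C' * BMO_norm b ^ k) * eLp_norm (weighted_measure w) (ennreal p) f"
proof -
  note p0 = assms(1) and \<alpha>0 = assms(6) and off = assms(7) and on = assms(8) and p0p = assms(9) and pq0 = assms(10)
    and muck = assms(11) and rev = assms(12) and sm = assms(13)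
  have p: "0 < p" using p0 p0p by simp
  have wt: "weight w" and w0: "\<And>x. 0 \<le> w x" using muck by (auto simp: muckenhoupt_def weight_def)
  have [measurable]: "w \<in> borel_measurable lebesgue" using wt locally_integrable_ball(1) by (auto simp: weight_def)
  define t where "t = p / p0"
  have t: "1 < t" using p0 p0p by (simp add: t_def)
  have p0t: "p0 * t = p" using p0 by (simp add: t_def)
  define u where "u = conj_quotient q0 p"
  have u: "1 \<le> u" unfolding u_def by (rule conj_quotient_ge_1[OF p pq0])
  obtain K0 where K0: "0 \<le> K0" and prod: "\<And>c r. 0 < r \<Longrightarrow> (\<integral>\<^sup>+y. epowr (ennreal (w y)) u \<partial>ball_measure c r) *
      epowr (\<integral>\<^sup>+y. epowr (ennreal (w y)) (- (1 / (t - 1))) \<partial>ball_measure c r) (u * (t - 1)) \<le> ennreal K0"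
    using muckenhoupt_reverse_hoelder_product[OF t u muck[folded t_def] rev[folded u_def]] by blast
  \<comment> \<open>The A_s constant that clamping produces from K0, the same for all clamping
    levels.\<close>
  define K where "K = 2 + 2 powr (u * (t - 1)) + 2 * 2 powr (u * (t - 1)) * K0"
  have K: "1 \<le> K" unfolding K_def using K0 by (simp add: add_nonneg_nonneg add_increasing2)
  obtain \<theta> \<kappa> C1 D E where \<theta>: "1 - 1/u < \<theta>" "0 < \<theta>" and \<kappa>: "1 < \<kappa>" and nonneg: "0 \<le> C1" "0 \<le> D" "0 \<le> E"
    and good: "\<And>W :: 'a \<Rightarrow> real. ap_bound (u * (t - 1) + 1) K W \<Longrightarrow> good_weight t \<theta> C1 D \<kappa> E (\<lambda>x. ennreal (W x powr (1/u)))"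
    using ap_bound_good_weight[OF t u K, where 'a = 'a] by blast
  \<comment> \<open>q1 is a finite substitute for q0: equal to it if q0 is finite, and otherwise so
    large that the good-lambda condition holds.\<close>
  have "\<exists>q1. p0 < q1 \<and> t < q1 / p0 * \<theta> \<and>
    (\<forall>x r g. 0 < r \<longrightarrow> eLp_norm (ball_measure x r) (ennreal q1) g \<le> eLp_norm (ball_measure (x :: 'a) r) q0 (g :: 'a \<Rightarrow> 'k))"
  proof (cases q0)
    case (real q)
    then have pq: "p < q" using pq0 p by (simp add: ennreal_less_iff)
    then have "1 < q / p" using p by simp
    \<comment> \<open>Since t = (q/p0)(p/q), the strict gain \<theta> > 1 - 1/u = p/q is exactly the
      good-lambda condition.\<close>
    then have "1 - 1 / u = p / q" using real p pq by (simp add: u_def conj_quotient_def conj_exponent_def field_simps)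
    then have "q / p0 * (p / q) < q / p0 * \<theta>" using \<theta>(1) pq p p0 by (intro mult_strict_left_mono) auto
    then have "t < q / p0 * \<theta>" using pq p by (simp add: t_def)
    then show ?thesis using real pq p0p by (intro exI[of _ q]) auto
  next
    case top
    \<comment> \<open>Here u = 1 and \<theta> may be any positive number; the exponent compensates
      by its size.\<close>
    define q1 where "q1 = max (2 * p0) ((t + 1) * p0 / \<theta>)"
    have "t < (t + 1) * p0 / \<theta> / p0 * \<theta>" using \<theta> p0 by simp
    also have "\<dots> \<le> q1 / p0 * \<theta>" unfolding q1_def using \<theta> p0 by (intro mult_right_mono divide_right_mono) auto
    finally have 1: "t < q1 / p0 * \<theta>" .
    have q1: "p0 < q1" "0 < q1" using p0 by (auto simp: q1_def less_max_iff_disj)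
    have "eLp_norm (ball_measure x r) (ennreal q1) g \<le> eLp_norm (ball_measure x r) q0 g" if "0 < r" for x :: 'a and r and g :: "'a \<Rightarrow> 'k"
      using prob_space.eLp_norm_le_esssup[OF prob_space_ball_measure[OF that] q1(2)] top by (simp add: eLp_norm_def)
    then show ?thesis using 1 q1 by blast
  qed
  then obtain q1 where q1: "p0 < q1" "t < q1 / p0 * \<theta>"
    and le_q0: "\<And>x r g. 0 < r \<Longrightarrow> eLp_norm (ball_measure x r) (ennreal q1) g \<le> eLp_norm (ball_measure (x :: 'a) r) q0 (g :: 'a \<Rightarrow> 'k)"
    by blast
  \<comment> \<open>A negative C becomes 0 under \<open>ennreal\<close>, so \<open>max C 0\<close>
    states the same hypothesis. The sequence \<alpha> is shifted because its indices start at
    1.\<close>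
  interpret off_diagonal_operator T A p0 q1 "max C 0" "\<lambda>j. \<alpha> (Suc j)"
  proof
    show "1 \<le> p0" "p0 < q1" "0 \<le> max C 0" by (use p0 q1 in auto)
    show "sublinear_op_on (Lp_space p0) T" "bounded_on_Lp p0 T" by fact+
    show "A r f \<in> Lp_space p0" if "0 < r" "f \<in> Linf_c" for r f using that by fact
    show "0 \<le> \<alpha> (Suc j)" for j by (rule \<alpha>0) simp
    fix f :: "'a \<Rightarrow> 'k" and x :: 'a and r :: real assume f: "f \<in> Linf_c" and r: "0 < r"
    have "ennreal C = ennreal (max C 0)" by (auto simp: max_def ennreal_neg)
    then show "eLp_norm (ball_measure x r) (ennreal p0) (T (\<lambda>y. f y - A r f y))
      \<le> ennreal (max C 0) * (\<Sum>j. ennreal (\<alpha> (Suc j)) * eLp_norm (ball_measure x (2 ^ (j + 2) * r)) (ennreal p0) f)"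
      using off[OF f r, of x] by simp
    show "eLp_norm (ball_measure x r) (ennreal q1) (T (A r f))
      \<le> (\<Sum>j. ennreal (\<alpha> (Suc j)) * eLp_norm (ball_measure x (2 ^ (j + 2) * r)) (ennreal p0) (T f))"
      using order_trans[OF le_q0[OF r] on[OF f r, of x]] by simp
  qed
  \<comment> \<open>The oscillation factor j + 3 is at most 3 (j + 1), where j + 1 is the original
    index, so 3^k pays for the shift.\<close>
  have "summable (\<lambda>j. \<alpha> (Suc j) * real (j + 3) ^ k)"
  proof (rule summable_comparison_test')
    show "summable (\<lambda>j. 3 ^ k * (\<alpha> (Suc j) * real (Suc j) ^ k))"
      using sm by (intro summable_mult) (simp add: summable_Suc_iff[of "\<lambda>j. \<alpha> j * real j ^ k"] del: of_nat_Suc)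
    show "norm (\<alpha> (Suc j) * real (j + 3) ^ k) \<le> 3 ^ k * (\<alpha> (Suc j) * real (Suc j) ^ k)" if "0 \<le> j" for j
    proof -
      have "real (j + 3) ^ k \<le> (3 * real (Suc j)) ^ k" by (intro power_mono) auto
      then have "\<alpha> (Suc j) * real (j + 3) ^ k \<le> \<alpha> (Suc j) * (3 * real (Suc j)) ^ k" by (rule mult_left_mono) (rule \<alpha>)
      then show ?thesis using \<alpha>[of j] unfolding power_mult_distrib by (simp add: abs_mult mult.left_commute)
    qed
  qed
  then obtain B where B: "0 \<le> B" and bound: "\<And>W f b a \<beta>. good_weight t \<theta> C1 D \<kappa> E W \<Longrightarrow> f \<in> Linf_c \<Longrightarrow> osc_bound b a \<beta> \<Longrightarrow> 0 < \<beta> \<Longrightarrow>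
    (\<integral>\<^sup>+x. W x * epowr (ennreal (norm (commutator T k b f x))) p \<partial>lebesgue)
      \<le> ennreal (B * (\<beta> ^ k) powr p) * (\<integral>\<^sup>+x. W x * epowr (ennreal (norm (f x))) p \<partial>lebesgue)"
    using commutator_weighted_bounded[OF t \<theta>(2) q1(2) \<kappa> nonneg] unfolding p0t by blast
  have clamp_good: "good_weight t \<theta> C1 D \<kappa> E (\<lambda>x. ennreal (clamp_weight (real (Suc n)) w x))" for n
  proof -
    have N: "1 \<le> real (Suc n)" by simp
    have c0: "0 < clamp_weight (real (Suc n)) w x" for x
      using N clamp_weight_bounds(1)[OF N, of w x] by (smt (verit) zero_less_divide_1_iff)
    have "(clamp_weight (real (Suc n)) w x powr u) powr (1/u) = clamp_weight (real (Suc n)) w x" for x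
      using u c0[of x] by (simp add: powr_powr)
    then show ?thesis using good[OF clamp_weight_ap_bound[OF wt t u K0 N prod, folded K_def]] by simp
  qed
  have main: "(\<lambda>x. norm (commutator T k b f x)) \<in> borel_measurable lebesgue \<and>
    eLp_norm (weighted_measure w) (ennreal p) (commutator T k b f)
      \<le> ennreal (B powr (1/p) * BMO_norm b ^ k) * eLp_norm (weighted_measure w) (ennreal p) f"
    if f: "f \<in> Linf_c" and b: "b \<in> BMO" for f b
  proof
    let ?n = "BMO_norm b"
    let ?F = "\<integral>\<^sup>+x. ennreal (w x) * epowr (ennreal (norm (f x))) p \<partial>lebesgue"
      and ?G = "\<integral>\<^sup>+x. ennreal (w x) * epowr (ennreal (norm (commutator T k b f x))) p \<partial>lebesgue"
    have n0: "0 \<le> ?n" by (rule BMO_norm_nonneg[OF b])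
    \<comment> \<open>The added 1/(i+1) keeps \<beta> positive even when the BMO seminorm is 0; it
      is removed by letting i tend to infinity.\<close>
    have osc: "osc_bound b (ball_average b) (?n + 1 / real (Suc i))" and pos: "0 < ?n + 1 / real (Suc i)" for i
      using n0 by (auto intro!: BMO_osc_bound[OF b] add_nonneg_pos)
    show meas[measurable]: "(\<lambda>x. norm (commutator T k b f x)) \<in> borel_measurable lebesgue"
      by (rule commutator_measurable_BMO[OF osc pos f])
    have [measurable]: "f \<in> borel_measurable lebesgue" by (rule Linf_cD(1)[OF f])
    have fin: "(\<integral>\<^sup>+x. epowr (ennreal (norm (f x))) p \<partial>lebesgue) < \<infinity>"
      using Linf_c_subset_Lp_space[OF p f] Lp_space_iff[OF p] by blast
    have "?G \<le> ennreal (B * ((?n + 1 / real (Suc i)) ^ k) powr p) * ?F" for i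
    proof (rule clamp_weight_limit)
      show "(\<lambda>x. epowr (ennreal (norm (commutator T k b f x))) p) \<in> borel_measurable lebesgue"
        "(\<lambda>x. epowr (ennreal (norm (f x))) p) \<in> borel_measurable lebesgue" "w \<in> borel_measurable lebesgue" by measurable
      show "0 \<le> B * ((?n + 1 / real (Suc i)) ^ k) powr p" using B by simp
    qed (rule w0 fin bound[OF clamp_good f osc pos])+
    moreover have "(\<lambda>i. ennreal (B * ((?n + 1 / real (Suc i)) ^ k) powr p) * ?F) \<longlonglongrightarrow> ennreal (B * (?n ^ k) powr p) * ?F"
    proof -
      \<comment> \<open>Finite because w is locally integrable and f is bounded with compact
        support. An infinite value could spoil the limit when the coefficient tends to 0.\<close>
      obtain I where I: "?F = ennreal I" "0 \<le> I" using nn_integral_weight_Linf_c_finite[OF wt f p] by (cases ?F) auto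
      have "(\<lambda>i. ?n + 1 / real (Suc i)) \<longlonglongrightarrow> ?n + 0" by (intro tendsto_add tendsto_const LIMSEQ_Suc[OF lim_1_over_n])
      then have "(\<lambda>i. (?n + 1 / real (Suc i)) ^ k) \<longlonglongrightarrow> ?n ^ k" by (intro tendsto_power) simp
      then have "(\<lambda>i. ((?n + 1 / real (Suc i)) ^ k) powr p) \<longlonglongrightarrow> (?n ^ k) powr p"
        using p pos by (intro tendsto_powr2 tendsto_const always_eventually allI zero_le_power less_imp_le[OF pos])
      then have "(\<lambda>i. ennreal (B * ((?n + 1 / real (Suc i)) ^ k) powr p * I)) \<longlonglongrightarrow> ennreal (B * (?n ^ k) powr p * I)"
        by (intro tendsto_ennrealI tendsto_mult tendsto_const)
      then show ?thesis using I B by (simp add: ennreal_mult)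
    qed
    ultimately have "?G \<le> ennreal (B * (?n ^ k) powr p) * ?F" by (intro LIMSEQ_le_const) auto
    then have "epowr ?G (1/p) \<le> epowr (ennreal (B * (?n ^ k) powr p) * ?F) (1/p)" using p by (intro epowr_mono) auto
    also have "\<dots> = epowr (ennreal (B * (?n ^ k) powr p)) (1/p) * epowr ?F (1/p)" using p by (intro epowr_mult) auto
    also have "epowr (ennreal (B * (?n ^ k) powr p)) (1/p) = ennreal (B powr (1/p) * ?n ^ k)"
      using p B n0 by (simp add: epowr_ennreal powr_mult powr_powr)
    finally show "eLp_norm (weighted_measure w) (ennreal p) (commutator T k b f)
      \<le> ennreal (B powr (1/p) * ?n ^ k) * eLp_norm (weighted_measure w) (ennreal p) f"
      using p by (simp add: eLp_norm_ennreal weighted_measure_def nn_integral_density)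
  qed
  then show ?thesis by blast
qed

end
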